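(* Let $\delta>0$ and consider the system $$r_1' = v+2\delta r_1 l^3,\qquad v' = -\frac{r_1-1}{r_1^3}-2\delta v l^3,\qquad l' = -\delta l^4$$ on $\{(r_1,v,l): r_1>0,\ v\in\mathbb R,\ l\ge 0\}$. Let $q_1:\ (r_1,v,l)=(1,0,0)$ and, for $h\in(0,\frac12)$, let $\Gamma_1(h)=\{(r_1,v,0): r_1>0,\ \frac12v^2+\frac{(r_1-1)^2}{2r_1^2}=h\}$. The global stable manifolds $W^s(q_1)$ and $W^s(\Gamma_1(h))$, $h\in(0,\frac12)$, of $q_1$ and $\Gamma_1(h)$, respectively, are each $C^\infty$. The dependency of $W^s(\Gamma_1(h))$ on $h$ is also $C^\infty$.
   Context: The system is the Kepler problem with linear drag $\ddot u+\delta\dot u+u/|u|^3=0$, $u=re^{i\theta}\in\mathbb C\setminus\{0\}$, written in the variables $l=r^2\dot\theta$ (angular momentum magnitude), $r_1=l^{-2}r$, $v=l\dot r$, after multiplying the vector field by $l^3$; the prime denotes differentiation with respect to the new time. For $h\in(0,\frac12)$ the set $\Gamma_1(h)$ is a periodic orbit in the invariant plane $l=0$. The global stable manifold $W^s(S)$ of $S=\{q_1\}$ or $S=\Gamma_1(h)$ is the set of points of the phase space $\{r_1>0,\ l\ge0\}$ whose forward orbits converge to $S$ (distance to $S$ tends to $0$); equivalently it is obtained from the local stable manifold near $S$ (one-dimensional for $q_1$, two-dimensional for $\Gamma_1(h)$) by applying the backward flow. Smoothness is understood up to and including the boundary $l=0$. Smooth dependency on $h$ means that, locally, the manifolds admit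 parametrizations that are $C^\infty$ jointly in $h$ and the parameters of the manifold. *)

theory Defs
  imports "HOL-Analysis.Analysis"
begin

text \<open>
  Phase-space points are triples \<open>(r\<^sub>1, v, l)\<close>; \<open>r\<^sub>1 = l\<^sup>-\<^sup>2 r\<close> is written \<open>r\<close>.
\<close>

definition phase_space :: "(real \<times> real \<times> real) set" where
  "phase_space = {(r, v, l). 0 < r \<and> 0 \<le> l}"

definition phase_boundary :: "(real \<times> real \<times> real) set" where
  "phase_boundary = {(r, v, l). 0 < r \<and> l = 0}"

definition kepler_drag :: "real \<Rightarrow> real \<times> real \<times> real \<Rightarrow> real \<times> real \<times> real" where
  "kepler_drag \<delta> = (\<lambda>(r, v, l).
     (v + 2 * \<delta> * r * l ^ 3,
      - ((r - 1) / r ^ 3) - 2 * \<delta> * v * l ^ 3,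
      - \<delta> * l ^ 4))"

definition q\<^sub>1 :: "real \<times> real \<times> real" where
  "q\<^sub>1 = (1, 0, 0)"

definition \<Gamma>\<^sub>1 :: "real \<Rightarrow> (real \<times> real \<times> real) set" where
  "\<Gamma>\<^sub>1 h = {(r, v, l). 0 < r \<and> l = 0 \<and> v ^ 2 / 2 + (r - 1) ^ 2 / (2 * r ^ 2) = h}"

text \<open>
  Because \<open>infdist _ {} = 0\<close>, the following is meaningful only for nonempty \<open>S\<close>.
\<close>

definition stable_set :: "real \<Rightarrow> (real \<times> real \<times> real) set \<Rightarrow> (real \<times> real \<times> real) set" where
  "stable_set \<delta> S = {p. \<exists>x.
     x 0 = p \<and>
     (\<forall>t\<ge>0. x t \<in> phase_space \<and>
        (x has_vector_derivative kepler_drag \<delta> (x t)) (at t within {0..})) \<and>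
     ((\<lambda>t. infdist (x t) S) \<longlongrightarrow> 0) at_top}"

text \<open>
  Differentiability is taken within \<open>S\<close>, so that at boundary points the derivatives are
  one-sided. The notion is intended for finite-dimensional spaces and for sets \<open>S\<close> that are
  relatively open in a closed half-space: for these the derivative within \<open>S\<close> is unique,
  and it is continuous as an operator as soon as all \<open>\<lambda>x. f' x w\<close> are.
\<close>

primrec Ck_on :: "nat \<Rightarrow> 'a::euclidean_space set \<Rightarrow> ('a \<Rightarrow> 'b::euclidean_space) \<Rightarrow> bool" where
  "Ck_on 0 S f \<longleftrightarrow> continuous_on S f"
| "Ck_on (Suc k) S f \<longleftrightarrow>
     (\<exists>f'. (\<forall>x\<in>S. (f has_derivative f' x) (at x within S)) \<and>
           (\<forall>w. Ck_on k S (\<lambda>x. f' x w)))"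

definition smooth_on :: "'a::euclidean_space set \<Rightarrow> ('a \<Rightarrow> 'b::euclidean_space) \<Rightarrow> bool" where
  "smooth_on S f \<longleftrightarrow> (\<forall>k. Ck_on k S f)"

definition halfspace :: "'a::euclidean_space \<Rightarrow> 'a set" where
  "halfspace b = {x. 0 \<le> x \<bullet> b}"

text \<open>
  \<open>\<phi>\<close> is a smooth embedding of the relatively open part \<open>V \<inter> halfspace b\<close> of a half-space
  onto \<open>T\<close>, under which the boundary hyperplane corresponds to \<open>T \<inter> B\<close>. If \<open>V\<close> misses the
  hyperplane, this is an ordinary interior parametrization.
\<close>

definition smooth_parametrization ::
    "'b::euclidean_space set \<Rightarrow> 'b set \<Rightarrow> 'a::euclidean_space \<Rightarrow> 'a set \<Rightarrow> ('a \<Rightarrow> 'b) \<Rightarrow> bool" where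
  "smooth_parametrization B T b V \<phi> \<longleftrightarrow>
     b \<in> Basis \<and> open V \<and>
     smooth_on (V \<inter> halfspace b) \<phi> \<and>
     (\<forall>x \<in> V \<inter> halfspace b. \<exists>D. (\<phi> has_derivative D) (at x within V \<inter> halfspace b) \<and> inj D) \<and>
     (\<exists>\<psi>. homeomorphism (V \<inter> halfspace b) T \<phi> \<psi>) \<and>
     (\<forall>x \<in> V \<inter> halfspace b. \<phi> x \<in> B \<longleftrightarrow> x \<bullet> b = 0)"

text \<open>
  \<open>M\<close> is an embedded smooth submanifold with boundary \<open>M \<inter> B\<close>, whose dimension is that of the
  parameter space \<open>'a\<close>.
\<close>

definition smooth_submanifold ::
    "'a::euclidean_space itself \<Rightarrow> 'b::euclidean_space set \<Rightarrow> 'b set \<Rightarrow> bool" where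
  "smooth_submanifold _ B M \<longleftrightarrow>
     (\<forall>p\<in>M. \<exists>U b V (\<phi> :: 'a \<Rightarrow> 'b).
        open U \<and> p \<in> U \<and> smooth_parametrization B (M \<inter> U) b V \<phi>)"

definition smooth_family ::
    "'a::euclidean_space itself \<Rightarrow> 'b::euclidean_space set \<Rightarrow> real set \<Rightarrow> (real \<Rightarrow> 'b set) \<Rightarrow> bool" where
  "smooth_family _ B J M \<longleftrightarrow>
     (\<forall>h\<^sub>0\<in>J. \<forall>p\<in>M h\<^sub>0. \<exists>I U b V (\<Phi> :: real \<times> 'a \<Rightarrow> 'b).
        open I \<and> h\<^sub>0 \<in> I \<and> I \<subseteq> J \<and> open U \<and> p \<in> U \<and>
        smooth_on (I \<times> (V \<inter> halfspace b)) \<Phi> \<and>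
        (\<forall>h\<in>I. smooth_parametrization B (M h \<inter> U) b V (\<lambda>x. \<Phi> (h, x))))"

end

theory Submission imports Defs "HOL-Analysis.Analysis"
begin

text \<open>
  In the coordinates \<open>(x, y, l) = (1/r - 1, -v, l)\<close> and after dividing the field by \<open>(1 + x)\<^sup>2\<close>,
  the limit system \<open>l = 0\<close> is a rotation of the plane with energy \<open>E = (x\<^sup>2 + y\<^sup>2)/2\<close>, and the drag
  is of order \<open>l\<^sup>3\<close>. Every solution starting in \<open>x\<^sup>2 + y\<^sup>2 < 1\<close> with small \<open>l\<close> has a limit energy, and
  the stable sets of \<open>\<Gamma>\<^sub>1 h\<close> and \<open>q\<^sub>1\<close> are the level sets of this limit. Averaging over the
  rotation to order \<open>n\<close> gives a smooth function whose derivative along the flow is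
  \<open>O(l\<^bsup>3n\<^esup>)\<close>. Derivatives of the flow of any fixed order grow at most like a power of \<open>1/l\<close>, so the
  difference between this function and the limit energy, an integral along the solution, vanishes
  to high order at \<open>l = 0\<close>. As \<open>n\<close> is arbitrary, the limit energy is smooth up to \<open>l = 0\<close>.

  For \<open>h > 0\<close> the limit energy is a submersion near \<open>\<Gamma>\<^sub>1 h\<close>. At \<open>q\<^sub>1\<close> it is a minimum in the
  \<open>(x, y)\<close>-direction and nondegenerate there, so the stable set is the curve of critical points of its restrictions
  to the planes of constant \<open>l\<close>. Points away from \<open>l = 0\<close> are reached by the backward flow.
\<close>

section \<open>Smooth functions on sets with boundary\<close>

text \<open>Near \<open>q\<^sub>1\<close> the plane l = 0 is filled with periodic orbits and
  attraction in l is only algebraic, l' ~ - l^4, so no hyperbolicity is available for a stable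
  manifold theorem up to l = 0. Since l^4 dt is comparable with - dl, powers of l decide everything.
  An effect of order l^3 integrates like dl / l and diverges logarithmically; order l^6 integrates
  like l^2 dl. Existence of a limit energy therefore rests on a cancellation: the work of the drag
  at order l^3 is a derivative along the rotation (\<open>inner_drag\<close>) and can be removed by
  a coordinate change. The same logarithm, exponentiated by Gronwall, is why derivatives of the flow
  grow no faster than a power of 1/l. At higher orders the mean over the rotation need not vanish;
  it is absorbed by a rotation invariant term l^m a, because the decay of l^m contributes - m *
  \<open>decay\<close> * a and \<open>decay\<close> has positive mean. The power of 1/l lost depends
  on the order k of differentiation, so n is chosen after k. The bound h < 1/2 corresponds to the
  unit disc in (x, y), which keeps 1 + x = 1/r positive.\<close>

lemma Ck_on_imp_continuous_on: "Ck_on k S f \<Longrightarrow> continuous_on S f"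
proof (cases k)
  case (Suc j)
  assume "Ck_on k S f"
  with Suc obtain f' where "\<And>x. x \<in> S \<Longrightarrow> (f has_derivative f' x) (at x within S)"
    by auto
  then show ?thesis by (meson has_derivative_continuous_on)
qed simp

lemma Ck_on_SucI:
  assumes "\<And>x. x \<in> S \<Longrightarrow> (f has_derivative f' x) (at x within S)"
    and "\<And>w. Ck_on k S (\<lambda>x. f' x w)"
  shows "Ck_on (Suc k) S f"
  using assms by auto

lemma Ck_on_SucE:
  assumes "Ck_on (Suc k) S f"
  obtains f' where "\<And>x. x \<in> S \<Longrightarrow> (f has_derivative f' x) (at x within S)"
    and "\<And>w. Ck_on k S (\<lambda>x. f' x w)"
  using assms by auto

lemma Ck_on_SucD: "Ck_on (Suc k) S f \<Longrightarrow> Ck_on k S f"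
proof (induction k arbitrary: f)
  case 0
  then show ?case using Ck_on_imp_continuous_on by fastforce
next
  case (Suc k)
  from Suc.prems obtain f' where f': "\<And>x. x \<in> S \<Longrightarrow> (f has_derivative f' x) (at x within S)"
    "\<And>w. Ck_on (Suc k) S (\<lambda>x. f' x w)" by (rule Ck_on_SucE) blast
  show ?case by (rule Ck_on_SucI [OF f'(1) Suc.IH [OF f'(2)]])
qed

lemma Ck_on_subset: "Ck_on k S f \<Longrightarrow> T \<subseteq> S \<Longrightarrow> Ck_on k T f"
proof (induction k arbitrary: f)
  case 0
  then show ?case by (auto intro: continuous_on_subset)
next
  case (Suc k)
  from Suc.prems(1) obtain f' where f': "\<And>x. x \<in> S \<Longrightarrow> (f has_derivative f' x) (at x within S)"
    "\<And>w. Ck_on k S (\<lambda>x. f' x w)" by (rule Ck_on_SucE) blast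
  show ?case
  proof (rule Ck_on_SucI)
    show "(f has_derivative f' x) (at x within T)" if "x \<in> T" for x
      using that Suc.prems(2) by (intro has_derivative_subset [OF f'(1)]) auto
    show "Ck_on k T (\<lambda>x. f' x w)" for w by (rule Suc.IH [OF f'(2) Suc.prems(2)])
  qed
qed

lemma Ck_on_cong: "(\<And>x. x \<in> S \<Longrightarrow> f x = g x) \<Longrightarrow> Ck_on k S f \<longleftrightarrow> Ck_on k S g"
proof (cases k)
  case 0
  assume "\<And>x. x \<in> S \<Longrightarrow> f x = g x"
  with 0 show ?thesis by (auto cong: continuous_on_cong)
next
  case (Suc j)
  assume eq: "\<And>x. x \<in> S \<Longrightarrow> f x = g x"
  have "(f has_derivative D) (at x within S) \<longleftrightarrow> (g has_derivative D) (at x within S)"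
    if "x \<in> S" for x D
    using has_derivative_transform [OF that, of f g] has_derivative_transform [OF that, of g f] eq
    by auto
  then have "(\<forall>x\<in>S. (f has_derivative F x) (at x within S)) \<longleftrightarrow> (\<forall>x\<in>S. (g has_derivative F x) (at x within S))" for F
    by simp
  with Suc show ?thesis by (simp only: Ck_on.simps)
qed

lemma Ck_on_const: "Ck_on k S (\<lambda>x. c)"
proof (induction k arbitrary: c)
  case (Suc k)
  show ?case by (rule Ck_on_SucI [of _ _ "\<lambda>x w. 0"]) (auto intro: Suc)
qed simp

lemma Ck_on_linear: "bounded_linear f \<Longrightarrow> Ck_on k S f"
proof (cases k)
  case 0
  assume "bounded_linear f"
  with 0 show ?thesis by (auto intro: linear_continuous_on)
next
  case (Suc j)
  assume "bounded_linear f"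
  then show ?thesis unfolding Suc
    by (intro Ck_on_SucI [of _ _ "\<lambda>x. f"] bounded_linear_imp_has_derivative Ck_on_const)
qed

lemma Ck_on_add: "Ck_on k S f \<Longrightarrow> Ck_on k S g \<Longrightarrow> Ck_on k S (\<lambda>x. f x + g x)"
proof (induction k arbitrary: f g)
  case 0
  then show ?case by (simp add: continuous_on_add)
next
  case (Suc k)
  from Suc.prems(1) obtain f' where f': "\<And>x. x \<in> S \<Longrightarrow> (f has_derivative f' x) (at x within S)"
    "\<And>w. Ck_on k S (\<lambda>x. f' x w)" by (rule Ck_on_SucE) blast
  from Suc.prems(2) obtain g' where g': "\<And>x. x \<in> S \<Longrightarrow> (g has_derivative g' x) (at x within S)"
    "\<And>w. Ck_on k S (\<lambda>x. g' x w)" by (rule Ck_on_SucE) blast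
  show ?case
    by (rule Ck_on_SucI [of _ _ "\<lambda>x w. f' x w + g' x w"])
      (auto intro: f' g' Suc.IH has_derivative_add)
qed

lemma Ck_on_sum: "(\<And>i. i \<in> I \<Longrightarrow> Ck_on k S (f i)) \<Longrightarrow> Ck_on k S (\<lambda>x. \<Sum>i\<in>I. f i x)"
proof (induction I rule: infinite_finite_induct)
  case (insert i I)
  then show ?case using Ck_on_add [of k S "f i" "\<lambda>x. \<Sum>i\<in>I. f i x"] by simp
qed (simp_all add: Ck_on_const)

lemma Ck_on_bilinear:
  assumes "bounded_bilinear h"
  shows "Ck_on k S f \<Longrightarrow> Ck_on k S g \<Longrightarrow> Ck_on k S (\<lambda>x. h (f x) (g x))"
proof (induction k arbitrary: f g)
  case 0
  then show ?case using bounded_bilinear.continuous_on [OF assms] by auto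
next
  case (Suc k)
  from Suc.prems(1) obtain f' where f': "\<And>x. x \<in> S \<Longrightarrow> (f has_derivative f' x) (at x within S)"
    "\<And>w. Ck_on k S (\<lambda>x. f' x w)" by (rule Ck_on_SucE) blast
  from Suc.prems(2) obtain g' where g': "\<And>x. x \<in> S \<Longrightarrow> (g has_derivative g' x) (at x within S)"
    "\<And>w. Ck_on k S (\<lambda>x. g' x w)" by (rule Ck_on_SucE) blast
  have fg: "Ck_on k S f" "Ck_on k S g" using Suc.prems by (auto intro: Ck_on_SucD simp del: Ck_on.simps)
  show ?case
    by (rule Ck_on_SucI [of _ _ "\<lambda>x w. h (f x) (g' x w) + h (f' x w) (g x)"])
      (intro bounded_bilinear.FDERIV [OF assms] f' g' Ck_on_add Suc.IH fg; assumption)+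
qed

lemmas Ck_on_scaleR = Ck_on_bilinear [OF bounded_bilinear_scaleR]
lemmas Ck_on_mult = Ck_on_bilinear [OF bounded_bilinear_mult]
lemmas Ck_on_inner = Ck_on_bilinear [OF bounded_bilinear_inner]

lemma Ck_on_compose:
  "Ck_on k S f \<Longrightarrow> Ck_on k T g \<Longrightarrow> f ` S \<subseteq> T \<Longrightarrow> Ck_on k S (\<lambda>x. g (f x))"
proof (induction k arbitrary: f g)
  case 0
  then show ?case by (auto intro: continuous_on_compose2)
next
  case (Suc k)
  from Suc.prems(1) obtain f' where f': "\<And>x. x \<in> S \<Longrightarrow> (f has_derivative f' x) (at x within S)"
    "\<And>w. Ck_on k S (\<lambda>x. f' x w)" by (rule Ck_on_SucE) blast
  from Suc.prems(2) obtain g' where g': "\<And>x. x \<in> T \<Longrightarrow> (g has_derivative g' x) (at x within T)"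
    "\<And>w. Ck_on k T (\<lambda>x. g' x w)" by (rule Ck_on_SucE) blast
  have f: "Ck_on k S f" using Suc.prems(1) by (rule Ck_on_SucD)
  \<comment> \<open>The induction hypothesis controls \<open>g'\<close> only in fixed directions,
    whereas the direction \<open>f' x w\<close> moves with x. Expanding it in the basis leaves
    products of functions that are covered.\<close>
  have rep: "g' (f x) (f' x w) = (\<Sum>b\<in>Basis. (f' x w \<bullet> b) *\<^sub>R g' (f x) b)" if "x \<in> S" for x w
  proof -
    have "f x \<in> T" using that Suc.prems(3) by auto
    then have "linear (g' (f x))" using g'(1) has_derivative_linear by blast
    then have "g' (f x) (\<Sum>b\<in>Basis. (f' x w \<bullet> b) *\<^sub>R b) = (\<Sum>b\<in>Basis. (f' x w \<bullet> b) *\<^sub>R g' (f x) b)"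
      by (simp add: linear_sum linear_scale)
    then show ?thesis by (simp add: euclidean_representation)
  qed
  show ?case
  proof (rule Ck_on_SucI [of _ _ "\<lambda>x w. g' (f x) (f' x w)"])
    fix x assume x: "x \<in> S"
    then have "(g has_derivative g' (f x)) (at (f x) within f ` S)"
      using g'(1) Suc.prems(3) by (blast intro: has_derivative_subset)
    then show "((\<lambda>x. g (f x)) has_derivative (\<lambda>w. g' (f x) (f' x w))) (at x within S)"
      by (rule has_derivative_in_compose [OF f'(1) [OF x]])
  next
    fix w
    have "Ck_on k S (\<lambda>x. \<Sum>b\<in>Basis. (f' x w \<bullet> b) *\<^sub>R g' (f x) b)"
      by (intro Ck_on_sum Ck_on_scaleR Ck_on_inner f' Ck_on_const Suc.IH [OF f g'(2) Suc.prems(3)])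
    then show "Ck_on k S (\<lambda>x. g' (f x) (f' x w))"
      by (subst Ck_on_cong [OF rep])
  qed
qed

lemma Ck_on_linear_compose:
  "bounded_linear h \<Longrightarrow> Ck_on k S f \<Longrightarrow> Ck_on k S (\<lambda>x. h (f x))"
  by (rule Ck_on_compose [OF _ Ck_on_linear, of k S f h UNIV]) auto

lemma Ck_on_Pair:
  assumes "Ck_on k S f" "Ck_on k S g"
  shows "Ck_on k S (\<lambda>x. (f x, g x))"
proof -
  have "bounded_linear (\<lambda>a. (a, 0))" "bounded_linear (\<lambda>b. (0, b))"
    by (intro bounded_linear_Pair bounded_linear_ident bounded_linear_zero)+
  from Ck_on_add [OF this(1) [THEN Ck_on_linear_compose, OF assms(1)]
      this(2) [THEN Ck_on_linear_compose, OF assms(2)]]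
  show ?thesis by simp
qed

lemma Ck_on_inverse:
  fixes f :: "'a::euclidean_space \<Rightarrow> real"
  assumes "\<And>x. x \<in> S \<Longrightarrow> f x \<noteq> 0"
  shows "Ck_on k S f \<Longrightarrow> Ck_on k S (\<lambda>x. inverse (f x))"
proof (induction k)
  case 0
  then show ?case using assms by (simp add: continuous_on_inverse)
next
  case (Suc k)
  from Suc.prems obtain f' where f': "\<And>x. x \<in> S \<Longrightarrow> (f has_derivative f' x) (at x within S)"
    "\<And>w. Ck_on k S (\<lambda>x. f' x w)" by (rule Ck_on_SucE) blast
  have inv: "Ck_on k S (\<lambda>x. inverse (f x))" by (rule Suc.IH [OF Ck_on_SucD [OF Suc.prems]])
  show ?case
  proof (rule Ck_on_SucI [of _ _ "\<lambda>x w. (-1) * (inverse (f x) * f' x w * inverse (f x))"])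
    show "((\<lambda>x. inverse (f x)) has_derivative (\<lambda>w. (-1) * (inverse (f x) * f' x w * inverse (f x)))) (at x within S)"
      if "x \<in> S" for x
      using Deriv.has_derivative_inverse [OF assms [OF that] f'(1) [OF that]] by simp
    show "Ck_on k S (\<lambda>x. (-1) * (inverse (f x) * f' x w * inverse (f x)))" for w
      by (rule Ck_on_mult [OF Ck_on_const Ck_on_mult [OF Ck_on_mult [OF inv f'(2)] inv]])
  qed
qed

section \<open>Closure properties of smooth functions\<close>

named_theorems smooth_intros

lemma smooth_on_imp_continuous_on: "smooth_on S f \<Longrightarrow> continuous_on S f"
  unfolding smooth_on_def by (auto dest: spec [of _ 0])

lemma smooth_on_subset: "smooth_on S f \<Longrightarrow> T \<subseteq> S \<Longrightarrow> smooth_on T f"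
  unfolding smooth_on_def using Ck_on_subset by metis

lemma smooth_on_cong: "(\<And>x. x \<in> S \<Longrightarrow> f x = g x) \<Longrightarrow> smooth_on S f \<longleftrightarrow> smooth_on S g"
  unfolding smooth_on_def using Ck_on_cong [of S f g] by simp

lemma smooth_on_const [smooth_intros]: "smooth_on S (\<lambda>x. c)"
  by (simp add: smooth_on_def Ck_on_const)

lemma smooth_on_linear: "bounded_linear f \<Longrightarrow> smooth_on S f"
  by (simp add: smooth_on_def Ck_on_linear)

lemma smooth_on_id [smooth_intros]: "smooth_on S (\<lambda>x. x)"
  by (simp add: smooth_on_linear)

lemma smooth_on_linear_compose: "bounded_linear h \<Longrightarrow> smooth_on S f \<Longrightarrow> smooth_on S (\<lambda>x. h (f x))"
  by (simp add: smooth_on_def Ck_on_linear_compose)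

lemmas smooth_on_fst [smooth_intros] = smooth_on_linear_compose [OF bounded_linear_fst]
lemmas smooth_on_snd [smooth_intros] = smooth_on_linear_compose [OF bounded_linear_snd]
lemmas smooth_on_uminus [smooth_intros] =
  smooth_on_linear_compose [OF bounded_linear_minus [OF bounded_linear_ident]]

lemma smooth_on_add [smooth_intros]:
  "smooth_on S f \<Longrightarrow> smooth_on S g \<Longrightarrow> smooth_on S (\<lambda>x. f x + g x)"
  by (simp add: smooth_on_def Ck_on_add)

lemma smooth_on_diff [smooth_intros]:
  "smooth_on S f \<Longrightarrow> smooth_on S g \<Longrightarrow> smooth_on S (\<lambda>x. f x - g x)"
  using smooth_on_add [OF _ smooth_on_uminus] by fastforce

lemma smooth_on_sum [smooth_intros]:
  "(\<And>i. i \<in> I \<Longrightarrow> smooth_on S (f i)) \<Longrightarrow> smooth_on S (\<lambda>x. \<Sum>i\<in>I. f i x)"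
  by (simp add: smooth_on_def Ck_on_sum)

lemma smooth_on_scaleR [smooth_intros]:
  "smooth_on S f \<Longrightarrow> smooth_on S g \<Longrightarrow> smooth_on S (\<lambda>x. f x *\<^sub>R g x)"
  by (simp add: smooth_on_def Ck_on_scaleR)

lemma smooth_on_mult [smooth_intros]:
  fixes f g :: "'a::euclidean_space \<Rightarrow> real"
  shows "smooth_on S f \<Longrightarrow> smooth_on S g \<Longrightarrow> smooth_on S (\<lambda>x. f x * g x)"
  by (simp add: smooth_on_def Ck_on_mult)

lemma smooth_on_inner [smooth_intros]:
  "smooth_on S f \<Longrightarrow> smooth_on S g \<Longrightarrow> smooth_on S (\<lambda>x. f x \<bullet> g x)"
  by (simp add: smooth_on_def Ck_on_inner)

lemma smooth_on_Pair [smooth_intros]: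
  "smooth_on S f \<Longrightarrow> smooth_on S g \<Longrightarrow> smooth_on S (\<lambda>x. (f x, g x))"
  by (simp add: smooth_on_def Ck_on_Pair)

lemma smooth_on_inverse [smooth_intros]:
  fixes f :: "'a::euclidean_space \<Rightarrow> real"
  shows "smooth_on S f \<Longrightarrow> (\<And>x. x \<in> S \<Longrightarrow> f x \<noteq> 0) \<Longrightarrow> smooth_on S (\<lambda>x. inverse (f x))"
  by (simp add: smooth_on_def Ck_on_inverse)

lemma smooth_on_divide [smooth_intros]:
  fixes f g :: "'a::euclidean_space \<Rightarrow> real"
  shows "smooth_on S f \<Longrightarrow> smooth_on S g \<Longrightarrow> (\<And>x. x \<in> S \<Longrightarrow> g x \<noteq> 0) \<Longrightarrow> smooth_on S (\<lambda>x. f x / g x)"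
  by (simp add: divide_inverse smooth_on_mult smooth_on_inverse)

lemma smooth_on_power [smooth_intros]:
  fixes f :: "'a::euclidean_space \<Rightarrow> real"
  shows "smooth_on S f \<Longrightarrow> smooth_on S (\<lambda>x. f x ^ n)"
  by (induction n) (simp_all add: smooth_on_const smooth_on_mult)

lemma smooth_on_compose:
  "smooth_on S f \<Longrightarrow> smooth_on T g \<Longrightarrow> f ` S \<subseteq> T \<Longrightarrow> smooth_on S (\<lambda>x. g (f x))"
  unfolding smooth_on_def using Ck_on_compose [of _ S f T g] by simp

text \<open>The derivative fields witnessing \<open>Ck_on\<close> for different \<open>k\<close> agree in the interior, hence on
  all of \<open>S\<close> by continuity.\<close>

lemma smooth_onE:
  assumes f: "smooth_on S f" and S: "S \<subseteq> closure (interior S)"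
  obtains f' where "\<And>x. x \<in> S \<Longrightarrow> (f has_derivative f' x) (at x within S)"
    and "\<And>w. smooth_on S (\<lambda>x. f' x w)"
proof -
  have "\<forall>k. \<exists>f'. (\<forall>x\<in>S. (f has_derivative f' x) (at x within S)) \<and> (\<forall>w. Ck_on k S (\<lambda>x. f' x w))"
  proof
    fix k
    have "Ck_on (Suc k) S f" using f unfolding smooth_on_def ..
    then show "\<exists>f'. (\<forall>x\<in>S. (f has_derivative f' x) (at x within S)) \<and> (\<forall>w. Ck_on k S (\<lambda>x. f' x w))"
      by simp
  qed
  from choice [OF this] obtain D where
    "\<forall>k. (\<forall>x\<in>S. (f has_derivative D k x) (at x within S)) \<and> (\<forall>w. Ck_on k S (\<lambda>x. D k x w))" ..
  then have D: "\<And>k x. x \<in> S \<Longrightarrow> (f has_derivative D k x) (at x within S)"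
      "\<And>k w. Ck_on k S (\<lambda>x. D k x w)"
    by simp_all
  have int: "D k x = D 0 x" if "x \<in> interior S" for k x
  proof -
    have "x \<in> S" "at x within S = at x" using that interior_subset at_within_interior by auto
    then show ?thesis using D(1) [of x k] D(1) [of x 0] has_derivative_unique [of f "D k x" x "D 0 x"] by simp
  qed
  have eq: "D k x w = D 0 x w" if x: "x \<in> S" for k x w
  proof -
    have cont: "continuous_on S (\<lambda>x. D k x w - D 0 x w)"
      by (intro continuous_on_diff Ck_on_imp_continuous_on [OF D(2) [of k]] Ck_on_imp_continuous_on [OF D(2) [of 0]])
    have "x \<in> closure (interior S)" using x S by auto
    then obtain X where X: "\<And>n. X n \<in> interior S" "X \<longlonglongrightarrow> x"
      unfolding closure_sequential by auto
    have "X n \<in> S" for n using X(1) [of n] interior_subset by auto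
    then have "(\<lambda>n. D k (X n) w - D 0 (X n) w) \<longlonglongrightarrow> D k x w - D 0 x w"
      using continuous_on_tendsto_compose [OF cont X(2) x] by simp
    moreover have "D k (X n) w = D 0 (X n) w" for n by (rule fun_cong [OF int [OF X(1)]])
    ultimately have "(\<lambda>n. 0 :: 'b) \<longlonglongrightarrow> D k x w - D 0 x w"
      by simp
    then show ?thesis by (simp add: LIMSEQ_const_iff)
  qed
  have "smooth_on S (\<lambda>x. D 0 x w)" for w
    unfolding smooth_on_def
  proof
    fix k
    show "Ck_on k S (\<lambda>x. D 0 x w)" by (rule Ck_on_cong [OF eq, THEN iffD1, OF _ D(2)])
  qed
  with D(1) show thesis by (rule that)
qed

section \<open>Differential equations on a half-line\<close>

definition ode_sol :: "(real \<Rightarrow> 'a::euclidean_space \<Rightarrow> 'a) \<Rightarrow> (real \<Rightarrow> 'a) \<Rightarrow> bool" where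
  "ode_sol f x \<longleftrightarrow> (\<forall>t\<ge>0. (x has_vector_derivative f t (x t)) (at t within {0..}))"

lemma ode_solD: "ode_sol f x \<Longrightarrow> 0 \<le> t \<Longrightarrow> (x has_vector_derivative f t (x t)) (at t within {0..})"
  by (simp add: ode_sol_def)

lemma ode_sol_continuous_on: "ode_sol f x \<Longrightarrow> continuous_on {0..} x"
  unfolding ode_sol_def
  by (rule continuous_on_vector_derivative [where f' = "\<lambda>t. f t (x t)"]) auto

text \<open>All barrier arguments below reduce to this. The derivative is one-sided at 0, so its
  sign is used only at interior times and the end points follow by continuity.\<close>

lemma halfline_nonincreasing:
  fixes g :: "real \<Rightarrow> real"
  assumes d: "\<And>t. 0 \<le> t \<Longrightarrow> t \<le> T \<Longrightarrow> (g has_real_derivative g' t) (at t within {0..})"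
    and le: "\<And>t. 0 < t \<Longrightarrow> t < T \<Longrightarrow> g' t \<le> 0"
    and st: "0 \<le> s" "s \<le> t" "t \<le> T"
  shows "g t \<le> g s"
proof (cases "s = t")
  case False
  show ?thesis
  proof (rule DERIV_nonpos_imp_decreasing_open [OF st(2)])
    fix u assume u: "s < u" "u < t"
    then have "at u within {0..} = at u"
      using st by (intro at_within_interior) (simp add: interior_real_atLeast)
    then show "\<exists>y. DERIV g u :> y \<and> y \<le> 0" using d [of u] le [of u] u st by auto
  next
    have "continuous_on {0..T} g"
      unfolding continuous_on_eq_continuous_within
    proof
      fix u assume "u \<in> {0..T}"
      then have "continuous (at u within {0..}) g" using DERIV_continuous [OF d [of u]] by simp
      then show "continuous (at u within {0..T}) g" by (rule continuous_within_subset) auto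
    qed
    then show "continuous_on {s..t} g" by (rule continuous_on_subset) (use st in auto)
  qed
qed simp

text \<open>The integrating factor \<open>exp (- (c * t))\<close> removes the linear term, and being
  at most 1 it leaves a derivative of at most e.\<close>

lemma gronwall_real:
  fixes q :: "real \<Rightarrow> real"
  assumes d: "\<And>t. 0 \<le> t \<Longrightarrow> t \<le> T \<Longrightarrow> (q has_real_derivative q' t) (at t within {0..})"
    and le: "\<And>t. 0 \<le> t \<Longrightarrow> t \<le> T \<Longrightarrow> q' t \<le> c * q t + e"
    and c: "0 \<le> c" "0 \<le> e" and t: "0 \<le> t" "t \<le> T"
  shows "q t \<le> (q 0 + e * t) * exp (c * t)"
proof -
  let ?g = "\<lambda>t. exp (- (c * t)) * q t - e * t"
  have "?g t \<le> ?g 0"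
  proof (rule halfline_nonincreasing [of T ?g "\<lambda>t. exp (- (c * t)) * (q' t - c * q t) - e"])
    show "(?g has_real_derivative exp (- (c * t)) * (q' t - c * q t) - e) (at t within {0..})"
      if "0 \<le> t" "t \<le> T" for t
      using d [OF that] by (auto intro!: derivative_eq_intros simp: algebra_simps)
    show "exp (- (c * t)) * (q' t - c * q t) - e \<le> 0" if "0 < t" "t < T" for t
    proof -
      have "exp (- (c * t)) * (q' t - c * q t) \<le> exp (- (c * t)) * e"
        using le [of t] that by (intro mult_left_mono) auto
      also have "\<dots> \<le> 1 * e" using c that by (intro mult_right_mono) auto
      finally show ?thesis by simp
    qed
  qed (use t in auto)
  then have "exp (- (c * t)) * q t \<le> q 0 + e * t" by simp
  then have "exp (c * t) * (exp (- (c * t)) * q t) \<le> exp (c * t) * (q 0 + e * t)"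
    by (intro mult_left_mono) auto
  moreover have "exp (c * t) * (exp (- (c * t)) * q t) = q t" by (simp add: exp_minus)
  ultimately show ?thesis by (metis mult.commute)
qed

text \<open>The square of the norm is differentiable even where u vanishes. The cross term 2 * norm
  u * e is split into the square of norm u and the square of e, which accounts for the extra 1 in
  the exponent.\<close>

lemma gronwall_norm:
  fixes u :: "real \<Rightarrow> 'a::euclidean_space"
  assumes d: "\<And>t. 0 \<le> t \<Longrightarrow> t \<le> T \<Longrightarrow> (u has_vector_derivative u' t) (at t within {0..})"
    and le: "\<And>t. 0 \<le> t \<Longrightarrow> t \<le> T \<Longrightarrow> norm (u' t) \<le> L * norm (u t) + e"
    and L: "0 \<le> L" "0 \<le> e" and t: "0 \<le> t" "t \<le> T"
  shows "(norm (u t))\<^sup>2 \<le> ((norm (u 0))\<^sup>2 + e\<^sup>2 * t) * exp ((2 * L + 1) * t)"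
proof (rule gronwall_real [of T _ "\<lambda>t. 2 * (u t \<bullet> u' t)"])
  fix t assume t: "0 \<le> t" "t \<le> T"
  have "((\<lambda>t. u t \<bullet> u t) has_real_derivative u t \<bullet> u' t + u' t \<bullet> u t) (at t within {0..})"
    using d [OF t] d [OF t] unfolding has_real_derivative_iff_has_vector_derivative has_vector_derivative_def
    by (auto intro!: derivative_eq_intros simp: algebra_simps inner_simps)
  then show "((\<lambda>t. (norm (u t))\<^sup>2) has_real_derivative 2 * (u t \<bullet> u' t)) (at t within {0..})"
    by (simp add: power2_norm_eq_inner inner_commute)
  have "2 * (u t \<bullet> u' t) \<le> 2 * (norm (u t) * norm (u' t))"
    using norm_cauchy_schwarz by simp
  also have "\<dots> \<le> 2 * (norm (u t) * (L * norm (u t) + e))"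
    using le [OF t] by (simp add: mult_left_mono)
  also have "\<dots> = 2 * L * (norm (u t))\<^sup>2 + 2 * norm (u t) * e"
    by (simp add: algebra_simps power2_eq_square)
  also have "\<dots> \<le> (2 * L + 1) * (norm (u t))\<^sup>2 + e\<^sup>2"
    using sum_squares_bound [of "norm (u t)" e] by (simp add: algebra_simps)
  finally show "2 * (u t \<bullet> u' t) \<le> (2 * L + 1) * (norm (u t))\<^sup>2 + e\<^sup>2" .
qed (use L t in auto)

section \<open>Global existence and uniqueness by Picard iteration\<close>

lemma has_vector_derivative_atLeast:
  fixes x :: "real \<Rightarrow> 'a::real_normed_vector"
  assumes "(x has_vector_derivative x') (at t within {0..T})" "0 \<le> t" "t < T"
  shows "(x has_vector_derivative x') (at t within {0..})"
proof -
  have "at t within {0..} = at t within {0..T}"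
    using assms(2,3) by (intro at_within_nhd [of t "{..<T}"]) auto
  with assms(1) show ?thesis by simp
qed

text \<open>The iteration runs on u with x t = exp (M * t) *R u t. In this weighted supremum norm
  the integral operator contracts by L / M, which is at most 1/2 on all of [0, T], so T need not be
  small.\<close>

lemma picard_interval:
  fixes f :: "real \<Rightarrow> 'a::euclidean_space \<Rightarrow> 'a"
  assumes cont: "continuous_on ({0..} \<times> UNIV) (\<lambda>(t, x). f t x)"
    and lip: "\<And>t x y. 0 \<le> t \<Longrightarrow> t \<le> T \<Longrightarrow> norm (f t x - f t y) \<le> L * norm (x - y)"
    and L: "0 \<le> L" and T: "0 < T"
  shows "\<exists>x. x 0 = x0 \<and> (\<forall>t\<in>{0..T}. (x has_vector_derivative f t (x t)) (at t within {0..T}))"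
proof -
  define M where "M = 2 * L + 1"
  have M: "M > 0" "2 * L \<le> M" using L by (auto simp: M_def)
  \<comment> \<open>Clamping time to [0, T] turns functions on the interval into bounded continuous
    functions on the whole line, a complete metric space given as a type.\<close>
  define c where "c t = max 0 (min T t)" for t :: real
  have c: "0 \<le> c t" "c t \<le> T" for t using T by (auto simp: c_def)
  have c_id: "c t = t" if "0 \<le> t" "t \<le> T" for t using that by (auto simp: c_def)
  have cont_c: "continuous_on UNIV c" unfolding c_def by (intro continuous_intros)
  define G where "G u t = exp (- (M * t)) *\<^sub>R (x0 + integral {0..t} (\<lambda>s. f s (exp (M * s) *\<^sub>R apply_bcontfun u s)))"
    for u :: "real \<Rightarrow>\<^sub>C 'a" and t
  have cont_f: "continuous_on {0..T} (\<lambda>s. f s (exp (M * s) *\<^sub>R apply_bcontfun u s))" for u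
  proof -
    have "continuous_on {0..T} (\<lambda>s. (s, exp (M * s) *\<^sub>R apply_bcontfun u s))"
      by (intro continuous_intros continuous_on_subset [OF continuous_on_apply_bcontfun]) auto
    from continuous_on_compose2 [OF cont this] show ?thesis by (simp add: image_subset_iff)
  qed
  have cont_G: "continuous_on {0..T} (G u)" for u
    unfolding G_def
    by (intro continuous_intros indefinite_integral_continuous_1 integrable_continuous_interval cont_f)
  have bcf: "(\<lambda>t. G u (c t)) \<in> bcontfun" for u
  proof -
    have "bounded (G u ` {0..T})"
      by (intro compact_imp_bounded compact_continuous_image cont_G) simp
    then obtain B where "\<forall>y\<in>G u ` {0..T}. norm y \<le> B" unfolding bounded_iff by blast
    then have "norm (G u (c t)) \<le> B" for t using c by auto
    moreover have "continuous_on UNIV (\<lambda>t. G u (c t))"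
      using c by (intro continuous_on_compose2 [OF cont_G cont_c]) auto
    ultimately show ?thesis by (intro bcontfun_normI)
  qed
  define P where "P u = Bcontfun (\<lambda>t. G u (c t))" for u
  have P: "apply_bcontfun (P u) t = G u (c t)" for u t
    unfolding P_def by (simp add: Bcontfun_inverse [OF bcf])
  have contr: "dist (P u) (P v) \<le> (1/2) * dist u v" for u v
  proof (rule dist_bound)
    fix t
    let ?c = "c t"
    have ct: "{0..?c} \<subseteq> {0..T}" using c [of t] by auto
    have "norm (integral {0..?c} (\<lambda>s. f s (exp (M * s) *\<^sub>R apply_bcontfun u s) - f s (exp (M * s) *\<^sub>R apply_bcontfun v s)))
      \<le> integral {0..?c} (\<lambda>s. L * dist u v * exp (M * s))"
    proof (rule integral_norm_bound_integral)
      fix s assume s: "s \<in> {0..?c}"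
      have "norm (f s (exp (M * s) *\<^sub>R apply_bcontfun u s) - f s (exp (M * s) *\<^sub>R apply_bcontfun v s))
        \<le> L * norm (exp (M * s) *\<^sub>R apply_bcontfun u s - exp (M * s) *\<^sub>R apply_bcontfun v s)"
        using s ct by (intro lip) auto
      also have "\<dots> = L * (exp (M * s) * dist (apply_bcontfun u s) (apply_bcontfun v s))"
        by (simp add: scaleR_diff_right [symmetric] dist_norm)
      also have "\<dots> \<le> L * (exp (M * s) * dist u v)"
        using dist_bounded [of u s v] L by (intro mult_left_mono) auto
      finally show "norm (f s (exp (M * s) *\<^sub>R apply_bcontfun u s) - f s (exp (M * s) *\<^sub>R apply_bcontfun v s))
        \<le> L * dist u v * exp (M * s)" by (simp add: mult_ac)
    qed (intro integrable_continuous_interval continuous_intros continuous_on_subset [OF cont_f ct])+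
    also have "\<dots> = L * dist u v * ((exp (M * ?c) - exp (M * 0)) / M)"
    proof -
      have "((\<lambda>s. exp (M * s)) has_integral (exp (M * ?c) / M - exp (M * 0) / M)) {0..?c}"
        using M c by (intro fundamental_theorem_of_calculus)
          (auto intro!: derivative_eq_intros simp: has_real_derivative_iff_has_vector_derivative [symmetric])
      then show ?thesis by (simp add: integral_unique diff_divide_distrib)
    qed
    also have "\<dots> \<le> L * dist u v * (exp (M * ?c) / M)"
      using M L by (intro mult_left_mono divide_right_mono) auto
    also have "\<dots> = (L / M) * (dist u v * exp (M * ?c))" by simp
    also have "\<dots> \<le> (1/2) * (dist u v * exp (M * ?c))"
      using M by (intro mult_right_mono) (auto simp: field_simps)
    finally have *: "norm (integral {0..?c} (\<lambda>s. f s (exp (M * s) *\<^sub>R apply_bcontfun u s) - f s (exp (M * s) *\<^sub>R apply_bcontfun v s)))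
      \<le> (1/2) * dist u v * exp (M * ?c)" by simp
    have "G u ?c - G v ?c = exp (- (M * ?c)) *\<^sub>R integral {0..?c} (\<lambda>s. f s (exp (M * s) *\<^sub>R apply_bcontfun u s) - f s (exp (M * s) *\<^sub>R apply_bcontfun v s))"
      unfolding G_def
      by (subst integral_diff)
        (auto intro!: integrable_continuous_interval continuous_on_subset [OF cont_f ct] simp: scaleR_diff_right [symmetric])
    then have "dist (G u ?c) (G v ?c) \<le> exp (- (M * ?c)) * ((1/2) * dist u v * exp (M * ?c))"
      using * by (simp add: dist_norm)
    also have "\<dots> = (1/2) * dist u v" by (simp add: exp_minus field_simps)
    finally show "dist (apply_bcontfun (P u) t) (apply_bcontfun (P v) t) \<le> (1/2) * dist u v"
      by (simp add: P)
  qed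
  have "\<exists>!u. P u = u" by (rule banach_fix_type [of "1/2"]) (use contr in auto)
  then obtain u where u: "P u = u" by auto
  define x where "x t = x0 + integral {0..t} (\<lambda>s. f s (exp (M * s) *\<^sub>R apply_bcontfun u s))" for t
  have x: "x t = exp (M * t) *\<^sub>R apply_bcontfun u t" if "0 \<le> t" "t \<le> T" for t
  proof -
    have "apply_bcontfun u t = exp (- (M * t)) *\<^sub>R x t"
      using P [of u t] u c_id [OF that] by (simp add: G_def x_def)
    then show ?thesis by (simp add: exp_minus)
  qed
  have "(x has_vector_derivative f t (x t)) (at t within {0..T})" if "t \<in> {0..T}" for t
  proof -
    have "((\<lambda>t. integral {0..t} (\<lambda>s. f s (exp (M * s) *\<^sub>R apply_bcontfun u s))) has_vector_derivative
       f t (exp (M * t) *\<^sub>R apply_bcontfun u t)) (at t within {0..T})"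
      by (rule integral_has_vector_derivative [OF cont_f that])
    then have "(x has_vector_derivative f t (exp (M * t) *\<^sub>R apply_bcontfun u t)) (at t within {0..T})"
      unfolding x_def by (auto intro!: derivative_eq_intros)
    then show ?thesis using x that by simp
  qed
  moreover have "x 0 = x0" by (simp add: x_def)
  ultimately show ?thesis by blast
qed

lemma ode_unique_interval:
  fixes x y :: "real \<Rightarrow> 'a::euclidean_space"
  assumes x: "\<And>t. 0 \<le> t \<Longrightarrow> t < T \<Longrightarrow> (x has_vector_derivative f t (x t)) (at t within {0..})"
    and y: "\<And>t. 0 \<le> t \<Longrightarrow> t < T \<Longrightarrow> (y has_vector_derivative f t (y t)) (at t within {0..})"
    and lip: "\<And>t. 0 \<le> t \<Longrightarrow> t < T \<Longrightarrow> norm (f t (x t) - f t (y t)) \<le> L * norm (x t - y t)"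
    and L: "0 \<le> L" and 0: "x 0 = y 0" and t: "0 \<le> t" "t < T"
  shows "x t = y t"
proof -
  have "(norm (x t - y t))\<^sup>2 \<le> ((norm (x 0 - y 0))\<^sup>2 + 0\<^sup>2 * t) * exp ((2 * L + 1) * t)"
  proof (rule gronwall_norm [where u' = "\<lambda>t. f t (x t) - f t (y t)" and T = t])
    show "((\<lambda>t. x t - y t) has_vector_derivative f s (x s) - f s (y s)) (at s within {0..})"
      if "0 \<le> s" "s \<le> t" for s
      using that t by (intro has_vector_derivative_diff x y) auto
    show "norm (f s (x s) - f s (y s)) \<le> L * norm (x s - y s) + 0" if "0 \<le> s" "s \<le> t" for s
      using lip [of s] that t by simp
  qed (use L t in auto)
  then show ?thesis using 0 by simp
qed

text \<open>The Lipschitz constant may grow with the time horizon, so the solutions on [0, n + 1]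
  are built separately and glued by uniqueness.\<close>

lemma picard_halfline:
  fixes f :: "real \<Rightarrow> 'a::euclidean_space \<Rightarrow> 'a"
  assumes cont: "continuous_on ({0..} \<times> UNIV) (\<lambda>(t, x). f t x)"
    and lip: "\<And>T. 0 \<le> T \<Longrightarrow> \<exists>L. \<forall>t x y. 0 \<le> t \<and> t \<le> T \<longrightarrow> norm (f t x - f t y) \<le> L * norm (x - y)"
  shows "\<exists>x. x 0 = x0 \<and> ode_sol f x"
proof -
  have lip': "\<exists>L\<ge>0. \<forall>t x y. 0 \<le> t \<and> t \<le> T \<longrightarrow> norm (f t x - f t y) \<le> L * norm (x - y)"
    if "0 \<le> T" for T
  proof -
    obtain L where L: "\<forall>t x y. 0 \<le> t \<and> t \<le> T \<longrightarrow> norm (f t x - f t y) \<le> L * norm (x - y)"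
      using lip [OF \<open>0 \<le> T\<close>] by blast
    have "norm (f t x - f t y) \<le> max 0 L * norm (x - y)" if "0 \<le> t \<and> t \<le> T" for t x y
    proof -
      have "L * norm (x - y) \<le> max 0 L * norm (x - y)" by (intro mult_right_mono) auto
      then show ?thesis using L that order_trans by blast
    qed
    then show ?thesis by (intro exI [of _ "max 0 L"]) auto
  qed
  have "\<forall>n. \<exists>x. x 0 = x0 \<and> (\<forall>t\<in>{0..real n + 1}. (x has_vector_derivative f t (x t)) (at t within {0..real n + 1}))"
  proof
    fix n
    obtain L where "L \<ge> 0" "\<forall>t x y. 0 \<le> t \<and> t \<le> real n + 1 \<longrightarrow> norm (f t x - f t y) \<le> L * norm (x - y)"
      using lip' [of "real n + 1"] by auto
    then show "\<exists>x. x 0 = x0 \<and> (\<forall>t\<in>{0..real n + 1}. (x has_vector_derivative f t (x t)) (at t within {0..real n + 1}))"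
      by (intro picard_interval [OF cont, of _ L]) auto
  qed
  from choice [OF this] obtain X where X: "\<And>n. X n 0 = x0"
    "\<And>n t. t \<in> {0..real n + 1} \<Longrightarrow> (X n has_vector_derivative f t (X n t)) (at t within {0..real n + 1})"
    by blast
  \<comment> \<open>At the right end of its interval \<open>X n\<close> has only a derivative from
    the left; the strict inequality avoids that point, and the floor used as index below satisfies
    it.\<close>
  have X': "(X n has_vector_derivative f t (X n t)) (at t within {0..})" if "0 \<le> t" "t < real n + 1" for n t
    by (rule has_vector_derivative_atLeast [OF X(2)]) (use that in auto)
  have eq: "X m t = X n t" if "0 \<le> t" "t < real m + 1" "t < real n + 1" for m n t
  proof -
    let ?T = "min (real m + 1) (real n + 1)"
    obtain L where L: "L \<ge> 0" "\<forall>t x y. 0 \<le> t \<and> t \<le> ?T \<longrightarrow> norm (f t x - f t y) \<le> L * norm (x - y)"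
      using lip' [of ?T] by auto
    show ?thesis
      by (rule ode_unique_interval [of ?T _ f _ L]) (use that X' X(1) L in auto)
  qed
  define x where "x t = X (nat \<lfloor>t\<rfloor>) t" for t
  have x: "x t = X n t" if "0 \<le> t" "t < real n + 1" for n t
  proof -
    have "t < real (nat \<lfloor>t\<rfloor>) + 1" using that by linarith
    then show ?thesis unfolding x_def by (rule eq [OF that(1) _ that(2)])
  qed
  have "(x has_vector_derivative f t (x t)) (at t within {0..})" if t: "0 \<le> t" for t
  proof -
    let ?n = "nat \<lfloor>t\<rfloor>"
    have tn: "t < real ?n + 1" using t by linarith
    have "(X ?n has_vector_derivative f t (X ?n t)) (at t within {0..})" by (rule X' [OF t tn])
    then have "(x has_vector_derivative f t (X ?n t)) (at t within {0..})"
    proof (rule has_vector_derivative_transform_within)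
      show "0 < real ?n + 1 - t" using tn by simp
      show "X ?n s = x s" if "s \<in> {0..}" "dist s t < real ?n + 1 - t" for s
        using that by (intro x [symmetric]) (auto simp: dist_real_def)
    qed (use t in auto)
    then show ?thesis using x [OF t tn] by simp
  qed
  moreover have "x 0 = x0" using X(1) by (simp add: x_def)
  ultimately show ?thesis unfolding ode_sol_def by blast
qed

text \<open>Continuation principle: the times spent outside form a closed set, so a first exit time
  would be attained, and \<open>step\<close> at that time is a contradiction.\<close>

lemma continuous_stays_in_open:
  fixes c :: "real \<Rightarrow> 'a::topological_space"
  assumes cont: "continuous_on {0..} c" and \<Omega>: "open \<Omega>" "c 0 \<in> \<Omega>"
    and step: "\<And>t. 0 < t \<Longrightarrow> (\<And>s. 0 \<le> s \<Longrightarrow> s < t \<Longrightarrow> c s \<in> \<Omega>) \<Longrightarrow> c t \<in> \<Omega>"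
    and t: "0 \<le> t"
  shows "c t \<in> \<Omega>"
proof (rule ccontr)
  assume "c t \<notin> \<Omega>"
  define B where "B = {s \<in> {0..}. c s \<in> - \<Omega>}"
  have "closed B"
    unfolding B_def using \<Omega> by (intro continuous_closed_preimage [OF cont, unfolded vimage_def Int_def mem_Collect_eq]) auto
  moreover have B: "B \<noteq> {}" "bdd_below B"
    using \<open>c t \<notin> \<Omega>\<close> t unfolding B_def by (auto intro!: bdd_belowI [of _ 0])
  ultimately have i: "Inf B \<in> B" by (intro closed_contains_Inf)
  then have "Inf B \<noteq> 0" using \<Omega>(2) by (auto simp: B_def)
  with i have "0 < Inf B" by (auto simp: B_def)
  moreover have "c s \<in> \<Omega>" if "0 \<le> s" "s < Inf B" for s
    using cInf_lower [OF _ B(2), of s] that by (auto simp: B_def)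
  ultimately show False using step [of "Inf B"] i by (auto simp: B_def)
qed

section \<open>Functions with weighted derivative bounds\<close>

text \<open>The weight will be the last coordinate along the flow, which tends to 0. A negative
  exponent thus permits growth in time, a positive one forces decay.\<close>

definition weighted_bound :: "'p::euclidean_space set \<Rightarrow> (real \<Rightarrow> 'p \<Rightarrow> real) \<Rightarrow> real \<Rightarrow> (real \<Rightarrow> 'p \<Rightarrow> 'b::euclidean_space) \<Rightarrow> bool" where
  "weighted_bound S l a g \<longleftrightarrow> continuous_on ({0..} \<times> S) (\<lambda>(t, p). g t p) \<and>
     (\<exists>C. \<forall>t\<ge>0. \<forall>p\<in>S. norm (g t p) \<le> C * l t p powr a)"

text \<open>All derivatives in \<open>p\<close> of order at most \<open>k\<close> are \<open>O(l\<^sup>a)\<close>, uniformly in time and on \<open>S\<close>.\<close>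

primrec weighted_Ck :: "'p::euclidean_space set \<Rightarrow> (real \<Rightarrow> 'p \<Rightarrow> real) \<Rightarrow> real \<Rightarrow> nat \<Rightarrow> (real \<Rightarrow> 'p \<Rightarrow> 'b::euclidean_space) \<Rightarrow> bool" where
  "weighted_Ck S l a 0 g \<longleftrightarrow> weighted_bound S l a g"
| "weighted_Ck S l a (Suc k) g \<longleftrightarrow> weighted_bound S l a g \<and>
     (\<exists>g'. (\<forall>t\<ge>0. \<forall>p\<in>S. (g t has_derivative g' t p) (at p)) \<and> (\<forall>w. weighted_Ck S l a k (\<lambda>t p. g' t p w)))"

text \<open>At most polynomial growth in 1/l, the exponent being left open. This class is stable
  under products and compositions, so exponents need tracking only where decay is claimed.\<close>

definition tempered_Ck :: "'p::euclidean_space set \<Rightarrow> (real \<Rightarrow> 'p \<Rightarrow> real) \<Rightarrow> nat \<Rightarrow> (real \<Rightarrow> 'p \<Rightarrow> 'b::euclidean_space) \<Rightarrow> bool" where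
  "tempered_Ck S l k g \<longleftrightarrow> (\<exists>a. weighted_Ck S l a k g)"

lemma weighted_boundI:
  assumes "continuous_on ({0..} \<times> S) (\<lambda>(t, p). g t p)"
    and "\<And>t p. 0 \<le> t \<Longrightarrow> p \<in> S \<Longrightarrow> norm (g t p) \<le> C * l t p powr a"
  shows "weighted_bound S l a g"
  using assms unfolding weighted_bound_def by blast

lemma weighted_Ck_bound: "weighted_Ck S l a k g \<Longrightarrow> weighted_bound S l a g"
  by (cases k) auto

lemma weighted_boundE:
  assumes "weighted_bound S l a g"
  obtains C where "0 \<le> C" "\<And>t p. 0 \<le> t \<Longrightarrow> p \<in> S \<Longrightarrow> norm (g t p) \<le> C * l t p powr a"
proof -
  obtain C where C: "\<forall>t\<ge>0. \<forall>p\<in>S. norm (g t p) \<le> C * l t p powr a"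
    using assms unfolding weighted_bound_def by blast
  have "norm (g t p) \<le> max 0 C * l t p powr a" if "0 \<le> t" "p \<in> S" for t p
  proof -
    have "C * l t p powr a \<le> max 0 C * l t p powr a" by (intro mult_right_mono) auto
    then show ?thesis using C that order_trans by blast
  qed
  then show thesis using that [of "max 0 C"] by simp
qed

lemma weighted_Ck_SucE:
  assumes "weighted_Ck S l a (Suc k) g"
  obtains g' where "\<And>t p. 0 \<le> t \<Longrightarrow> p \<in> S \<Longrightarrow> (g t has_derivative g' t p) (at p)"
    and "\<And>w. weighted_Ck S l a k (\<lambda>t p. g' t p w)"
  using assms by auto

lemma weighted_Ck_SucI:
  assumes "weighted_bound S l a g" "\<And>t p. 0 \<le> t \<Longrightarrow> p \<in> S \<Longrightarrow> (g t has_derivative g' t p) (at p)"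
    and "\<And>w. weighted_Ck S l a k (\<lambda>t p. g' t p w)"
  shows "weighted_Ck S l a (Suc k) g"
  using assms by auto

lemma weighted_Ck_SucD: "weighted_Ck S l a (Suc k) g \<Longrightarrow> weighted_Ck S l a k g"
proof (induction k arbitrary: g)
  case (Suc k)
  from Suc.prems obtain g' where g': "\<And>t p. 0 \<le> t \<Longrightarrow> p \<in> S \<Longrightarrow> (g t has_derivative g' t p) (at p)"
    "\<And>w. weighted_Ck S l a (Suc k) (\<lambda>t p. g' t p w)" by (rule weighted_Ck_SucE) blast
  show ?case
    by (rule weighted_Ck_SucI [OF weighted_Ck_bound [OF Suc.prems] g'(1) Suc.IH [OF g'(2)]])
qed simp

lemma has_derivative_cong_on_open:
  assumes "open S" "p \<in> S" "\<And>q. q \<in> S \<Longrightarrow> f q = g q" "(f has_derivative D) (at p)"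
  shows "(g has_derivative D) (at p)"
  by (rule has_derivative_transform_within_open [OF assms(4,1,2)]) (rule assms(3))

locale weighted_family =
  fixes S :: "'p::euclidean_space set" and l :: "real \<Rightarrow> 'p \<Rightarrow> real" and Lm :: real
  assumes open_S: "open S" and l_pos: "\<And>t p. 0 \<le> t \<Longrightarrow> p \<in> S \<Longrightarrow> 0 < l t p"
    and l_le: "\<And>t p. 0 \<le> t \<Longrightarrow> p \<in> S \<Longrightarrow> l t p \<le> Lm"
begin

text \<open>The weight is bounded by \<open>Lm\<close>, hence so is its power with the nonnegative
  exponent b - a.\<close>

lemma weighted_bound_mono:
  assumes "a \<le> b" "weighted_bound S l b g"
  shows "weighted_bound S l a g"
proof -
  obtain C where C: "0 \<le> C" "\<And>t p. 0 \<le> t \<Longrightarrow> p \<in> S \<Longrightarrow> norm (g t p) \<le> C * l t p powr b"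
    by (rule weighted_boundE [OF assms(2)]) blast
  show ?thesis
  proof (rule weighted_boundI)
    show "continuous_on ({0..} \<times> S) (\<lambda>(t, p). g t p)" using assms(2) by (simp add: weighted_bound_def)
    fix t :: real and p assume tp: "0 \<le> t" "p \<in> S"
    have "l t p powr b = l t p powr (b - a) * l t p powr a" by (simp add: powr_add [symmetric])
    also have "\<dots> \<le> Lm powr (b - a) * l t p powr a"
      using l_pos [OF tp] l_le [OF tp] assms(1) by (intro mult_right_mono powr_mono2) auto
    finally have "C * l t p powr b \<le> C * (Lm powr (b - a) * l t p powr a)"
      using C(1) by (intro mult_left_mono)
    then show "norm (g t p) \<le> (C * Lm powr (b - a)) * l t p powr a"
      using C(2) [OF tp] by (simp add: mult_ac)
  qed
qed

lemma weighted_Ck_mono: "a \<le> b \<Longrightarrow> weighted_Ck S l b k g \<Longrightarrow> weighted_Ck S l a k g"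
proof (induction k arbitrary: g)
  case 0
  then show ?case using weighted_bound_mono by auto
next
  case (Suc k)
  from Suc.prems(2) obtain g' where g': "\<And>t p. 0 \<le> t \<Longrightarrow> p \<in> S \<Longrightarrow> (g t has_derivative g' t p) (at p)"
    "\<And>w. weighted_Ck S l b k (\<lambda>t p. g' t p w)" by (rule weighted_Ck_SucE) blast
  show ?case
    by (rule weighted_Ck_SucI [OF weighted_bound_mono [OF Suc.prems(1) weighted_Ck_bound [OF Suc.prems(2)]]
      g'(1) Suc.IH [OF Suc.prems(1) g'(2)]])
qed

lemma weighted_Ck_const: "weighted_Ck S l 0 k (\<lambda>t p. c)"
proof (induction k arbitrary: c)
  case 0
  have "weighted_bound S l 0 (\<lambda>t p. c)"
    by (rule weighted_boundI [where C = "norm c"]) (auto simp: less_imp_neq [OF l_pos, symmetric])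
  then show ?case by simp
next
  case (Suc k)
  have "weighted_bound S l 0 (\<lambda>t p. c)"
    by (rule weighted_boundI [where C = "norm c"]) (auto simp: less_imp_neq [OF l_pos, symmetric])
  then show ?case by (rule weighted_Ck_SucI [where g' = "\<lambda>t p w. 0"]) (auto intro: Suc)
qed

lemma weighted_bound_add:
  assumes "weighted_bound S l a f" "weighted_bound S l a g"
  shows "weighted_bound S l a (\<lambda>t p. f t p + g t p)"
proof -
  obtain C where C: "\<And>t p. 0 \<le> t \<Longrightarrow> p \<in> S \<Longrightarrow> norm (f t p) \<le> C * l t p powr a"
    by (rule weighted_boundE [OF assms(1)]) blast
  obtain D where D: "\<And>t p. 0 \<le> t \<Longrightarrow> p \<in> S \<Longrightarrow> norm (g t p) \<le> D * l t p powr a"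
    by (rule weighted_boundE [OF assms(2)]) blast
  show ?thesis
  proof (rule weighted_boundI)
    show "continuous_on ({0..} \<times> S) (\<lambda>(t, p). f t p + g t p)"
      using assms by (simp add: weighted_bound_def split_def continuous_on_add)
    show "norm (f t p + g t p) \<le> (C + D) * l t p powr a" if "0 \<le> t" "p \<in> S" for t p
      using norm_triangle_mono [OF C [OF that] D [OF that]] by (simp add: distrib_right)
  qed
qed

lemma weighted_Ck_add:
  "weighted_Ck S l a k f \<Longrightarrow> weighted_Ck S l a k g \<Longrightarrow> weighted_Ck S l a k (\<lambda>t p. f t p + g t p)"
proof (induction k arbitrary: f g)
  case 0
  then show ?case using weighted_bound_add by simp
next
  case (Suc k)
  from Suc.prems(1) obtain f' where f': "\<And>t p. 0 \<le> t \<Longrightarrow> p \<in> S \<Longrightarrow> (f t has_derivative f' t p) (at p)"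
    "\<And>w. weighted_Ck S l a k (\<lambda>t p. f' t p w)" by (rule weighted_Ck_SucE) blast
  from Suc.prems(2) obtain g' where g': "\<And>t p. 0 \<le> t \<Longrightarrow> p \<in> S \<Longrightarrow> (g t has_derivative g' t p) (at p)"
    "\<And>w. weighted_Ck S l a k (\<lambda>t p. g' t p w)" by (rule weighted_Ck_SucE) blast
  show ?case
    by (rule weighted_Ck_SucI [OF weighted_bound_add [OF weighted_Ck_bound [OF Suc.prems(1)] weighted_Ck_bound [OF Suc.prems(2)]]
      has_derivative_add [OF f'(1) g'(1)] Suc.IH [OF f'(2) g'(2)]])
qed

lemma weighted_Ck_sum:
  assumes "finite I" "I \<noteq> {}" "\<And>i. i \<in> I \<Longrightarrow> weighted_Ck S l a k (f i)"
  shows "weighted_Ck S l a k (\<lambda>t p. \<Sum>i\<in>I. f i t p)"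
  using assms
proof (induction I rule: finite_ne_induct)
  case (insert i I)
  then show ?case using weighted_Ck_add [of a k "f i" "\<lambda>t p. \<Sum>i\<in>I. f i t p"] by simp
qed simp

lemma weighted_bound_bilinear:
  assumes h: "bounded_bilinear h" and f: "weighted_bound S l a f" and g: "weighted_bound S l b g"
  shows "weighted_bound S l (a + b) (\<lambda>t p. h (f t p) (g t p))"
proof -
  obtain C where C: "0 \<le> C" "\<And>t p. 0 \<le> t \<Longrightarrow> p \<in> S \<Longrightarrow> norm (f t p) \<le> C * l t p powr a"
    by (rule weighted_boundE [OF f]) blast
  obtain D where D: "0 \<le> D" "\<And>t p. 0 \<le> t \<Longrightarrow> p \<in> S \<Longrightarrow> norm (g t p) \<le> D * l t p powr b"
    by (rule weighted_boundE [OF g]) blast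
  obtain K where K: "0 \<le> K" "\<And>x y. norm (h x y) \<le> norm x * norm y * K"
    using bounded_bilinear.nonneg_bounded [OF h] by blast
  show ?thesis
  proof (rule weighted_boundI)
    show "continuous_on ({0..} \<times> S) (\<lambda>(t, p). h (f t p) (g t p))"
      using f g by (simp add: weighted_bound_def split_def bounded_bilinear.continuous_on [OF h])
    fix t :: real and p assume tp: "0 \<le> t" "p \<in> S"
    have "norm (h (f t p) (g t p)) \<le> norm (f t p) * norm (g t p) * K" by (rule K(2))
    also have "\<dots> \<le> (C * l t p powr a) * (D * l t p powr b) * K"
      using C D K tp by (intro mult_right_mono mult_mono) auto
    also have "\<dots> = (C * D * K) * l t p powr (a + b)" by (simp add: powr_add)
    finally show "norm (h (f t p) (g t p)) \<le> (C * D * K) * l t p powr (a + b)" .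
  qed
qed

lemma weighted_Ck_bilinear:
  assumes h: "bounded_bilinear h"
  shows "weighted_Ck S l a k f \<Longrightarrow> weighted_Ck S l b k g \<Longrightarrow> weighted_Ck S l (a + b) k (\<lambda>t p. h (f t p) (g t p))"
proof (induction k arbitrary: f g)
  case 0
  then show ?case using weighted_bound_bilinear [OF h] by simp
next
  case (Suc k)
  from Suc.prems(1) obtain f' where f': "\<And>t p. 0 \<le> t \<Longrightarrow> p \<in> S \<Longrightarrow> (f t has_derivative f' t p) (at p)"
    "\<And>w. weighted_Ck S l a k (\<lambda>t p. f' t p w)" by (rule weighted_Ck_SucE) blast
  from Suc.prems(2) obtain g' where g': "\<And>t p. 0 \<le> t \<Longrightarrow> p \<in> S \<Longrightarrow> (g t has_derivative g' t p) (at p)"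
    "\<And>w. weighted_Ck S l b k (\<lambda>t p. g' t p w)" by (rule weighted_Ck_SucE) blast
  note fg = weighted_Ck_SucD [OF Suc.prems(1)] weighted_Ck_SucD [OF Suc.prems(2)]
  show ?case
    by (rule weighted_Ck_SucI [OF weighted_bound_bilinear [OF h weighted_Ck_bound [OF Suc.prems(1)] weighted_Ck_bound [OF Suc.prems(2)]]
      bounded_bilinear.FDERIV [OF h f'(1) g'(1)] weighted_Ck_add [OF Suc.IH [OF fg(1) g'(2)] Suc.IH [OF f'(2) fg(2)]]])
qed

lemma weighted_bound_compose:
  assumes G: "continuous_on U G" and K: "compact K" "K \<subseteq> U"
    and \<xi>: "continuous_on ({0..} \<times> S) (\<lambda>(t, p). \<xi> t p)" "\<And>t p. 0 \<le> t \<Longrightarrow> p \<in> S \<Longrightarrow> \<xi> t p \<in> K"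
  shows "weighted_bound S l 0 (\<lambda>t p. G (\<xi> t p))"
proof -
  have "bounded (G ` K)"
    by (intro compact_imp_bounded compact_continuous_image continuous_on_subset [OF G] K)
  then obtain B where B: "\<And>y. y \<in> K \<Longrightarrow> norm (G y) \<le> B" unfolding bounded_iff by blast
  show ?thesis
  proof (rule weighted_boundI)
    have "continuous_on ({0..} \<times> S) (\<lambda>z. G ((\<lambda>(t, p). \<xi> t p) z))"
      by (rule continuous_on_compose2 [OF G \<xi>(1)]) (use \<xi>(2) K(2) in auto)
    then show "continuous_on ({0..} \<times> S) (\<lambda>(t, p). G (\<xi> t p))" by (simp add: split_def)
    show "norm (G (\<xi> t p)) \<le> B * l t p powr 0" if "0 \<le> t" "p \<in> S" for t p
      using B [OF \<xi>(2) [OF that]] l_pos [OF that] by simp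
  qed
qed

text \<open>G and its derivatives stay bounded on the compact K; each differentiation produces one
  factor \<open>\<xi>'\<close> of weight a. Order k therefore costs k * a, and a \<le> 0 lets the
  same exponent serve the lower orders.\<close>

lemma weighted_Ck_compose:
  assumes U: "open U" and K: "compact K" "K \<subseteq> U" and a: "a \<le> 0"
    and \<xi>K: "\<And>t p. 0 \<le> t \<Longrightarrow> p \<in> S \<Longrightarrow> \<xi> t p \<in> K"
  shows "Ck_on k U G \<Longrightarrow> weighted_Ck S l a k \<xi> \<Longrightarrow> weighted_Ck S l (real k * a) k (\<lambda>t p. G (\<xi> t p))"
proof (induction k arbitrary: G)
  case 0
  then have "weighted_bound S l 0 (\<lambda>t p. G (\<xi> t p))"
    by (intro weighted_bound_compose [OF _ K _ \<xi>K]) (auto simp: weighted_bound_def)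
  then show ?case by simp
next
  case (Suc k)
  from Suc.prems(1) obtain G' where G': "\<And>u. u \<in> U \<Longrightarrow> (G has_derivative G' u) (at u within U)"
    "\<And>w. Ck_on k U (\<lambda>u. G' u w)" by (rule Ck_on_SucE) blast
  from Suc.prems(2) obtain \<xi>' where \<xi>': "\<And>t p. 0 \<le> t \<Longrightarrow> p \<in> S \<Longrightarrow> (\<xi> t has_derivative \<xi>' t p) (at p)"
    "\<And>w. weighted_Ck S l a k (\<lambda>t p. \<xi>' t p w)" by (rule weighted_Ck_SucE) blast
  have G'at: "(G has_derivative G' (\<xi> t p)) (at (\<xi> t p))" if "0 \<le> t" "p \<in> S" for t p
    using G'(1) [of "\<xi> t p"] \<xi>K [OF that] K(2) at_within_open [OF _ U] by (metis subsetD)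
  have rep: "G' (\<xi> t p) (\<xi>' t p w) = (\<Sum>b\<in>Basis. (\<xi>' t p w \<bullet> b) *\<^sub>R G' (\<xi> t p) b)"
    if "0 \<le> t" "p \<in> S" for t p w
  proof -
    have "linear (G' (\<xi> t p))" using G'at [OF that] has_derivative_linear by blast
    then have "G' (\<xi> t p) (\<Sum>b\<in>Basis. (\<xi>' t p w \<bullet> b) *\<^sub>R b) = (\<Sum>b\<in>Basis. (\<xi>' t p w \<bullet> b) *\<^sub>R G' (\<xi> t p) b)"
      by (simp add: linear_sum linear_scale)
    then show ?thesis by (simp add: euclidean_representation)
  qed
  note \<xi>k = weighted_Ck_SucD [OF Suc.prems(2)]
  have exp: "real (Suc k) * a = (a + 0) + real k * a" by (simp add: algebra_simps)
  show ?case
  proof (rule weighted_Ck_SucI)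
    have "weighted_bound S l 0 (\<lambda>t p. G (\<xi> t p))"
      using Ck_on_imp_continuous_on [OF Suc.prems(1)] weighted_Ck_bound [OF Suc.prems(2)] \<xi>K
      by (intro weighted_bound_compose [OF _ K]) (auto simp: weighted_bound_def)
    then show "weighted_bound S l (real (Suc k) * a) (\<lambda>t p. G (\<xi> t p))"
      by (rule weighted_bound_mono [rotated]) (use a in \<open>simp add: mult_nonneg_nonpos\<close>)
  next
    fix t :: real and p assume tp: "0 \<le> t" "p \<in> S"
    show "((\<lambda>p. G (\<xi> t p)) has_derivative (\<lambda>w. \<Sum>b\<in>Basis. (\<xi>' t p w \<bullet> b) *\<^sub>R G' (\<xi> t p) b)) (at p)"
      using has_derivative_compose [OF \<xi>'(1) [OF tp] G'at [OF tp]] by (simp add: rep [OF tp])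
  next
    fix w
    have "weighted_Ck S l ((a + 0) + real k * a) k (\<lambda>t p. (\<xi>' t p w \<bullet> b) *\<^sub>R G' (\<xi> t p) b)" for b
      by (intro weighted_Ck_bilinear [OF bounded_bilinear_scaleR] weighted_Ck_bilinear [OF bounded_bilinear_inner]
          \<xi>'(2) weighted_Ck_const Suc.IH G'(2) \<xi>k)
    then show "weighted_Ck S l (real (Suc k) * a) k (\<lambda>t p. \<Sum>b\<in>Basis. (\<xi>' t p w \<bullet> b) *\<^sub>R G' (\<xi> t p) b)"
      unfolding exp by (intro weighted_Ck_sum) auto
  qed
qed

section \<open>Closure properties of tempered functions\<close>

lemma tempered_Ck_bound: "tempered_Ck S l k g \<Longrightarrow> \<exists>a. weighted_bound S l a g"
  unfolding tempered_Ck_def using weighted_Ck_bound by blast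

lemma tempered_Ck_continuous: "tempered_Ck S l k g \<Longrightarrow> continuous_on ({0..} \<times> S) (\<lambda>(t, p). g t p)"
  using tempered_Ck_bound unfolding weighted_bound_def by blast

lemma tempered_Ck_SucD: "tempered_Ck S l (Suc k) g \<Longrightarrow> tempered_Ck S l k g"
  unfolding tempered_Ck_def using weighted_Ck_SucD by blast

lemma tempered_Ck_0: "tempered_Ck S l 0 g \<longleftrightarrow> (\<exists>a. weighted_bound S l a g)"
  by (simp add: tempered_Ck_def)

lemma tempered_Ck_const: "tempered_Ck S l k (\<lambda>t p. c)"
  unfolding tempered_Ck_def using weighted_Ck_const by blast

lemma tempered_Ck_add:
  assumes "tempered_Ck S l k f" "tempered_Ck S l k g"
  shows "tempered_Ck S l k (\<lambda>t p. f t p + g t p)"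
proof -
  obtain a b where "weighted_Ck S l a k f" "weighted_Ck S l b k g" using assms unfolding tempered_Ck_def by blast
  then have "weighted_Ck S l (min a b) k f" "weighted_Ck S l (min a b) k g"
    by (auto intro: weighted_Ck_mono [rotated])
  then show ?thesis unfolding tempered_Ck_def using weighted_Ck_add by blast
qed

lemma tempered_Ck_sum:
  "(\<And>i. i \<in> I \<Longrightarrow> tempered_Ck S l k (f i)) \<Longrightarrow> tempered_Ck S l k (\<lambda>t p. \<Sum>i\<in>I. f i t p)"
proof (induction I rule: infinite_finite_induct)
  case (insert i I)
  then show ?case using tempered_Ck_add [of k "f i" "\<lambda>t p. \<Sum>i\<in>I. f i t p"] by simp
qed (simp_all add: tempered_Ck_const)

lemma tempered_Ck_bilinear:
  "bounded_bilinear h \<Longrightarrow> tempered_Ck S l k f \<Longrightarrow> tempered_Ck S l k g \<Longrightarrow> tempered_Ck S l k (\<lambda>t p. h (f t p) (g t p))"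
  unfolding tempered_Ck_def using weighted_Ck_bilinear by blast

lemma tempered_Ck_compose:
  assumes "open U" "compact K" "K \<subseteq> U" "\<And>t p. 0 \<le> t \<Longrightarrow> p \<in> S \<Longrightarrow> \<xi> t p \<in> K"
    and "Ck_on k U G" "tempered_Ck S l k \<xi>"
  shows "tempered_Ck S l k (\<lambda>t p. G (\<xi> t p))"
proof -
  obtain a where "weighted_Ck S l a k \<xi>" using assms(6) unfolding tempered_Ck_def by blast
  then have "weighted_Ck S l (min a 0) k \<xi>" by (rule weighted_Ck_mono [rotated]) simp
  then show ?thesis unfolding tempered_Ck_def
    using weighted_Ck_compose [OF assms(1-3) _ assms(4,5)] by (meson min.cobounded2)
qed

text \<open>The exponent provided for \<open>g' t p w\<close> may depend on w. Only the finitely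
  many basis directions matter by linearity, and the least of their exponents works for every
  w.\<close>

lemma tempered_Ck_SucI:
  assumes "tempered_Ck S l 0 g" and d: "\<And>t p. 0 \<le> t \<Longrightarrow> p \<in> S \<Longrightarrow> (g t has_derivative g' t p) (at p)"
    and g': "\<And>w. tempered_Ck S l k (\<lambda>t p. g' t p w)"
  shows "tempered_Ck S l (Suc k) g"
proof -
  obtain a where a: "weighted_bound S l a g" using assms(1) tempered_Ck_0 by blast
  have "\<forall>b. \<exists>c. weighted_Ck S l c k (\<lambda>t p. g' t p b)" using g' unfolding tempered_Ck_def by blast
  then obtain c where c: "\<And>b. weighted_Ck S l (c b) k (\<lambda>t p. g' t p b)" by metis
  define m where "m = Min (insert a (c ` Basis))"
  have m: "m \<le> a" "\<And>b. b \<in> Basis \<Longrightarrow> m \<le> c b" unfolding m_def by (auto intro!: Min_le simp del: Min_insert)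
  show ?thesis unfolding tempered_Ck_def
  proof (intro exI weighted_Ck_SucI)
    show "weighted_bound S l m g" by (rule weighted_bound_mono [OF m(1) a])
    fix t :: real and p assume tp: "0 \<le> t" "p \<in> S"
    have "g' t p w = (\<Sum>b\<in>Basis. (w \<bullet> b) *\<^sub>R g' t p b)" for w
    proof -
      have "linear (g' t p)" using d [OF tp] has_derivative_linear by blast
      then have "g' t p (\<Sum>b\<in>Basis. (w \<bullet> b) *\<^sub>R b) = (\<Sum>b\<in>Basis. (w \<bullet> b) *\<^sub>R g' t p b)"
        by (simp add: linear_sum linear_scale)
      then show ?thesis by (simp add: euclidean_representation)
    qed
    then have "g' t p = (\<lambda>w. \<Sum>b\<in>Basis. (w \<bullet> b) *\<^sub>R g' t p b)" by blast
    with d [OF tp] show "(g t has_derivative (\<lambda>w. \<Sum>b\<in>Basis. (w \<bullet> b) *\<^sub>R g' t p b)) (at p)" by simp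
  next
    fix w
    have "weighted_Ck S l m k (\<lambda>t p. (w \<bullet> b) *\<^sub>R g' t p b)" if "b \<in> Basis" for b
      using weighted_Ck_bilinear [OF bounded_bilinear_scaleR weighted_Ck_const weighted_Ck_mono [OF m(2) [OF that] c]]
      by simp
    then show "weighted_Ck S l m k (\<lambda>t p. \<Sum>b\<in>Basis. (w \<bullet> b) *\<^sub>R g' t p b)"
      by (intro weighted_Ck_sum) auto
  qed
qed

lemma tempered_Ck_SucE:
  assumes "tempered_Ck S l (Suc k) g"
  obtains g' where "\<And>t p. 0 \<le> t \<Longrightarrow> p \<in> S \<Longrightarrow> (g t has_derivative g' t p) (at p)"
    and "\<And>w. tempered_Ck S l k (\<lambda>t p. g' t p w)"
proof -
  obtain a where "weighted_Ck S l a (Suc k) g" using assms unfolding tempered_Ck_def by blast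
  then obtain g' where "\<And>t p. 0 \<le> t \<Longrightarrow> p \<in> S \<Longrightarrow> (g t has_derivative g' t p) (at p)"
    "\<And>w. weighted_Ck S l a k (\<lambda>t p. g' t p w)" by (rule weighted_Ck_SucE) blast
  then show thesis using that unfolding tempered_Ck_def by blast
qed

end

section \<open>Estimates uniform over compact time intervals\<close>

lemma joint_continuous_uniform:
  fixes g :: "real \<Rightarrow> 'p::euclidean_space \<Rightarrow> 'b::euclidean_space"
  assumes g: "continuous_on ({0..} \<times> S) (\<lambda>(t, p). g t p)" and S: "open S" "p \<in> S" and e: "0 < e"
  shows "\<exists>d>0. ball p d \<subseteq> S \<and> (\<forall>t q. 0 \<le> t \<and> t \<le> T \<and> q \<in> ball p d \<longrightarrow> norm (g t q - g t p) < e)"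
proof -
  obtain r where r: "0 < r" "cball p r \<subseteq> S" using S open_contains_cball by blast
  have "uniformly_continuous_on ({0..T} \<times> cball p r) (\<lambda>(t, p). g t p)"
    using r by (intro compact_uniformly_continuous continuous_on_subset [OF g] compact_Times) auto
  then obtain d where d: "0 < d" "\<And>z z'. z \<in> {0..T} \<times> cball p r \<Longrightarrow> z' \<in> {0..T} \<times> cball p r \<Longrightarrow>
      dist z' z < d \<Longrightarrow> dist ((\<lambda>(t, p). g t p) z') ((\<lambda>(t, p). g t p) z) < e"
    using e unfolding uniformly_continuous_on_def by blast
  have "norm (g t q - g t p) < e" if "0 \<le> t" "t \<le> T" "q \<in> ball p (min d r)" for t q
  proof -
    have "dist (t, q) (t, p) < d" using that by (simp add: dist_Pair_Pair dist_commute)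
    then show ?thesis using d(2) [of "(t, p)" "(t, q)"] that r by (auto simp: dist_norm)
  qed
  moreover have "ball p (min d r) \<subseteq> S" using r by auto
  ultimately show ?thesis using d(1) r(1) by (intro exI [of _ "min d r"]) auto
qed

lemma linear_norm_le_Basis:
  fixes A :: "'a::euclidean_space \<Rightarrow> 'b::real_normed_vector"
  assumes "linear A"
  shows "norm (A v) \<le> (\<Sum>b\<in>Basis. norm (A b)) * norm v"
proof -
  have "A v = A (\<Sum>b\<in>Basis. (v \<bullet> b) *\<^sub>R b)" by (simp add: euclidean_representation)
  also have "\<dots> = (\<Sum>b\<in>Basis. (v \<bullet> b) *\<^sub>R A b)" using assms by (simp add: linear_sum linear_scale)
  also have "norm \<dots> \<le> (\<Sum>b\<in>Basis. norm (A b) * norm v)"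
  proof (rule sum_norm_le)
    fix b :: 'a assume "b \<in> Basis"
    then show "norm ((v \<bullet> b) *\<^sub>R A b) \<le> norm (A b) * norm v"
      using mult_right_mono [OF Basis_le_norm [of b v] norm_ge_zero [of "A b"]] by (simp add: mult.commute)
  qed
  finally show ?thesis by (simp add: sum_distrib_right)
qed

text \<open>Mean value inequality for q \<mapsto> g t q - g' t p q: its derivative g' t q - g' t p
  is small near p, uniformly for t in [0, T], because it is so in each basis direction.\<close>

lemma joint_derivative_uniform:
  fixes g :: "real \<Rightarrow> 'p::euclidean_space \<Rightarrow> 'b::euclidean_space"
  assumes d: "\<And>t p. 0 \<le> t \<Longrightarrow> p \<in> S \<Longrightarrow> (g t has_derivative g' t p) (at p)"
    and g': "\<And>w. continuous_on ({0..} \<times> S) (\<lambda>(t, p). g' t p w)" and S: "open S" "p \<in> S" and e: "0 < e"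
  shows "\<exists>r>0. ball p r \<subseteq> S \<and> (\<forall>t q. 0 \<le> t \<and> t \<le> T \<and> q \<in> ball p r \<longrightarrow>
      norm (g t q - g t p - g' t p (q - p)) \<le> e * norm (q - p))"
proof -
  let ?n = "real DIM('p)"
  have "\<forall>w. \<exists>r>0. ball p r \<subseteq> S \<and> (\<forall>t q. 0 \<le> t \<and> t \<le> T \<and> q \<in> ball p r \<longrightarrow> norm (g' t q w - g' t p w) < e / ?n)"
    using joint_continuous_uniform [OF g' S] e by (simp add: divide_pos_pos)
  then obtain R where R: "\<And>w. 0 < R w" "\<And>w. ball p (R w) \<subseteq> S"
    "\<And>w t q. 0 \<le> t \<Longrightarrow> t \<le> T \<Longrightarrow> q \<in> ball p (R w) \<Longrightarrow> norm (g' t q w - g' t p w) < e / ?n"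
    by metis
  define r where "r = Min (R ` Basis)"
  have r: "0 < r" "\<And>b. b \<in> Basis \<Longrightarrow> r \<le> R b" unfolding r_def using R(1) by auto
  obtain b0 :: 'p where b0: "b0 \<in> Basis" using nonempty_Basis by blast
  have rS: "ball p r \<subseteq> S" using R(2) [of b0] r(2) [OF b0] by auto
  have "norm (g t q - g t p - g' t p (q - p)) \<le> e * norm (q - p)" if t: "0 \<le> t" "t \<le> T" and q: "q \<in> ball p r" for t q
  proof -
    have lin: "linear (g' t u)" if "u \<in> ball p r" for u
      using d [OF t(1)] that rS has_derivative_linear by blast
    have p: "p \<in> ball p r" using r by simp
    have "norm ((g t q - g' t p q) - (g t p - g' t p p)) \<le> e * norm (q - p)"
    proof (rule differentiable_bound [where f' = "\<lambda>u w. g' t u w - g' t p w" and S = "ball p r"])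
      fix u assume u: "u \<in> ball p r"
      have "(g t has_derivative g' t u) (at u within ball p r)"
        using d [OF t(1), of u] u rS has_derivative_at_withinI by blast
      moreover have "(g' t p has_derivative g' t p) (at u within ball p r)"
        using lin [OF p] by (simp add: linear_imp_has_derivative)
      ultimately show "((\<lambda>u. g t u - g' t p u) has_derivative (\<lambda>w. g' t u w - g' t p w)) (at u within ball p r)"
        by (rule has_derivative_diff)
      show "onorm (\<lambda>w. g' t u w - g' t p w) \<le> e"
      proof (rule onorm_bound)
        fix w
        have "linear (\<lambda>w. g' t u w - g' t p w)" using lin [OF u] lin [OF p] by (intro linear_compose_sub)
        then have "norm (g' t u w - g' t p w) \<le> (\<Sum>b\<in>Basis. norm (g' t u b - g' t p b)) * norm w"
          by (rule linear_norm_le_Basis)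
        also have "\<dots> \<le> (\<Sum>b\<in>(Basis::'p set). e / ?n) * norm w"
        proof (intro mult_right_mono sum_mono)
          fix b :: 'p assume "b \<in> Basis"
          then have "u \<in> ball p (R b)" using u r(2) by fastforce
          then show "norm (g' t u b - g' t p b) \<le> e / ?n" using R(3) [OF t] less_imp_le by blast
        qed simp
        finally show "norm (g' t u w - g' t p w) \<le> e * norm w" by simp
      qed (use e in simp)
    qed (use p q in auto)
    moreover have "g' t p (q - p) = g' t p q - g' t p p" using lin [OF p] by (rule linear_diff)
    moreover have "g t q - g t p - (g' t p q - g' t p p) = (g t q - g' t p q) - (g t p - g' t p p)" by simp
    ultimately show ?thesis by metis
  qed
  then show ?thesis using r(1) rS by blast
qed

lemma joint_continuous_bounded:
  fixes g :: "real \<Rightarrow> 'p::euclidean_space \<Rightarrow> 'b::euclidean_space"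
  assumes g: "continuous_on ({0..} \<times> S) (\<lambda>(t, p). g t p)" and p: "p \<in> S"
  shows "\<exists>B\<ge>0. \<forall>t. 0 \<le> t \<and> t \<le> T \<longrightarrow> norm (g t p) \<le> B"
proof -
  have "continuous_on {0..T} (\<lambda>t. (\<lambda>(t, p). g t p) (t, p))"
    using p by (intro continuous_on_compose2 [OF g] continuous_intros) auto
  then have "bounded ((\<lambda>t. g t p) ` {0..T})"
    by (intro compact_imp_bounded compact_continuous_image) auto
  then obtain B where "\<forall>y\<in>(\<lambda>t. g t p) ` {0..T}. norm y \<le> B" unfolding bounded_iff by blast
  then show ?thesis by (intro exI [of _ "max 0 B"]) (auto simp: le_max_iff_disj)
qed

lemma joint_lipschitz:
  fixes g :: "real \<Rightarrow> 'p::euclidean_space \<Rightarrow> 'b::euclidean_space"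
  assumes d: "\<And>t p. 0 \<le> t \<Longrightarrow> p \<in> S \<Longrightarrow> (g t has_derivative g' t p) (at p)"
    and g': "\<And>w. continuous_on ({0..} \<times> S) (\<lambda>(t, p). g' t p w)" and S: "open S" "p \<in> S"
  shows "\<exists>r>0. \<exists>L\<ge>0. ball p r \<subseteq> S \<and> (\<forall>t q. 0 \<le> t \<and> t \<le> T \<and> q \<in> ball p r \<longrightarrow>
      norm (g t q - g t p) \<le> L * norm (q - p))"
proof -
  obtain r where r: "0 < r" "ball p r \<subseteq> S" "\<And>t q. 0 \<le> t \<Longrightarrow> t \<le> T \<Longrightarrow> q \<in> ball p r \<Longrightarrow>
      norm (g t q - g t p - g' t p (q - p)) \<le> 1 * norm (q - p)"
    using joint_derivative_uniform [OF d g' S, of 1 T] by auto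
  have "\<forall>w. \<exists>B\<ge>0. \<forall>t. 0 \<le> t \<and> t \<le> T \<longrightarrow> norm (g' t p w) \<le> B"
    using joint_continuous_bounded [OF g' S(2)] by blast
  then obtain B where B: "\<And>w. B w \<ge> 0" "\<And>w t. 0 \<le> t \<Longrightarrow> t \<le> T \<Longrightarrow> norm (g' t p w) \<le> B w" by metis
  define L where "L = (\<Sum>b\<in>Basis. B b) + 1"
  have "norm (g t q - g t p) \<le> L * norm (q - p)" if t: "0 \<le> t" "t \<le> T" and q: "q \<in> ball p r" for t q
  proof -
    have "linear (g' t p)" using d [OF t(1) S(2)] has_derivative_linear by blast
    then have "norm (g' t p (q - p)) \<le> (\<Sum>b\<in>Basis. norm (g' t p b)) * norm (q - p)"
      by (rule linear_norm_le_Basis)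
    also have "\<dots> \<le> (\<Sum>b\<in>Basis. B b) * norm (q - p)"
      using B(2) [OF t] by (intro mult_right_mono sum_mono) auto
    finally show ?thesis
      using r(3) [OF t q] norm_triangle_sub [of "g t q - g t p" "g' t p (q - p)"]
      by (simp add: L_def algebra_simps)
  qed
  moreover have "L \<ge> 0" unfolding L_def using B(1) by (simp add: add_nonneg_nonneg sum_nonneg)
  ultimately show ?thesis using r(1,2) by blast
qed

section \<open>Smooth dependence on initial values\<close>

lemma ode_sol_diff:
  assumes "ode_sol f x" "ode_sol g y" "0 \<le> t"
  shows "((\<lambda>t. x t - y t) has_vector_derivative f t (x t) - g t (y t)) (at t within {0..})"
  using assms by (intro has_vector_derivative_diff ode_solD)

lemma linear_ode_exists:
  fixes A :: "real \<Rightarrow> 'u::euclidean_space \<Rightarrow> 'u"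
  assumes lin: "\<And>t. 0 \<le> t \<Longrightarrow> linear (A t)" and A: "\<And>v. continuous_on {0..} (\<lambda>t. A t v)"
    and b: "continuous_on {0..} b"
  shows "\<exists>x. x 0 = x0 \<and> ode_sol (\<lambda>t u. A t u + b t) x"
proof (rule picard_halfline)
  have "continuous_on ({0..} \<times> UNIV) (\<lambda>z. (\<Sum>i\<in>Basis. (snd z \<bullet> i) *\<^sub>R A (fst z) i) + b (fst z))"
    by (intro continuous_intros continuous_on_compose2 [OF A] continuous_on_compose2 [OF b]) auto
  moreover have "(\<Sum>i\<in>Basis. (snd z \<bullet> i) *\<^sub>R A (fst z) i) + b (fst z) = (\<lambda>(t, u). A t u + b t) z"
    if "z \<in> {0..} \<times> UNIV" for z :: "real \<times> 'u"
  proof -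
    obtain t u where "z = (t, u)" by (cases z)
    with that have z: "z = (t, u)" "0 \<le> t" by auto
    have "A t (\<Sum>i\<in>Basis. (u \<bullet> i) *\<^sub>R i) = (\<Sum>i\<in>Basis. (u \<bullet> i) *\<^sub>R A t i)"
      using lin [OF z(2)] by (simp add: linear_sum linear_scale)
    then show ?thesis using z by (simp add: euclidean_representation)
  qed
  ultimately show "continuous_on ({0..} \<times> UNIV) (\<lambda>(t, u). A t u + b t)"
    by (rule continuous_on_eq)
next
  fix T :: real assume "0 \<le> T"
  have "\<exists>B. \<forall>t\<in>{0..T}. norm (A t i) \<le> B" for i
  proof -
    have "bounded ((\<lambda>t. A t i) ` {0..T})"
      by (intro compact_imp_bounded compact_continuous_image continuous_on_subset [OF A]) auto
    then show ?thesis unfolding bounded_iff by blast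
  qed
  then obtain B where B: "\<And>i t. t \<in> {0..T} \<Longrightarrow> norm (A t i) \<le> B i" by metis
  show "\<exists>L. \<forall>t x y. 0 \<le> t \<and> t \<le> T \<longrightarrow> norm ((A t x + b t) - (A t y + b t)) \<le> L * norm (x - y)"
  proof (intro exI allI impI)
    fix t :: real and x y assume t: "0 \<le> t \<and> t \<le> T"
    have "norm ((A t x + b t) - (A t y + b t)) = norm (A t (x - y))"
      using lin [of t] t by (simp add: linear_diff)
    also have "\<dots> \<le> (\<Sum>i\<in>Basis. norm (A t i)) * norm (x - y)"
      using lin [of t] t by (intro linear_norm_le_Basis) auto
    also have "\<dots> \<le> (\<Sum>i\<in>Basis. B i) * norm (x - y)"
      using B t by (intro mult_right_mono sum_mono) auto
    finally show "norm ((A t x + b t) - (A t y + b t)) \<le> (\<Sum>i\<in>Basis. B i) * norm (x - y)" .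
  qed
qed

lemma continuous_jointI:
  fixes y :: "real \<Rightarrow> 'p::euclidean_space \<Rightarrow> 'b::real_normed_vector"
  assumes t: "\<And>p. p \<in> S \<Longrightarrow> continuous_on {0..} (\<lambda>t. y t p)"
    and p: "\<And>p T e. p \<in> S \<Longrightarrow> 0 \<le> T \<Longrightarrow> 0 < e \<Longrightarrow>
      \<exists>d>0. \<forall>t q. 0 \<le> t \<and> t \<le> T \<and> q \<in> ball p d \<inter> S \<longrightarrow> norm (y t q - y t p) < e"
  shows "continuous_on ({0..} \<times> S) (\<lambda>(t, p). y t p)"
  unfolding continuous_on_iff
proof (intro ballI allI impI)
  fix z :: "real \<times> 'p" and e :: real assume z: "z \<in> {0..} \<times> S" and e: "0 < e"
  obtain t p where tp: "z = (t, p)" "0 \<le> t" "p \<in> S" using z by auto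
  obtain d where d: "0 < d" "\<And>s q. 0 \<le> s \<Longrightarrow> s \<le> t + 1 \<Longrightarrow> q \<in> ball p d \<inter> S \<Longrightarrow> norm (y s q - y s p) < e / 2"
    using p [OF tp(3), of "t + 1" "e / 2"] tp e by auto
  obtain d' where d': "0 < d'" "\<And>s. 0 \<le> s \<Longrightarrow> dist s t < d' \<Longrightarrow> dist (y s p) (y t p) < e / 2"
    using t [OF tp(3)] tp(2) e unfolding continuous_on_iff by (metis atLeast_iff half_gt_zero)
  show "\<exists>d>0. \<forall>z'\<in>{0..} \<times> S. dist z' z < d \<longrightarrow> dist ((\<lambda>(t, p). y t p) z') ((\<lambda>(t, p). y t p) z) < e"
  proof (intro exI [of _ "min 1 (min d d')"] conjI ballI impI)
    fix z' assume z': "z' \<in> {0..} \<times> S" "dist z' z < min 1 (min d d')"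
    obtain s q where sq: "z' = (s, q)" "0 \<le> s" "q \<in> S" using z'(1) by auto
    have ds: "dist s t < min 1 (min d d')" "dist q p < min 1 (min d d')"
      using z'(2) dist_fst_le [of z' z] dist_snd_le [of z' z] unfolding sq tp by auto
    have "dist (y s q) (y s p) < e / 2"
    proof -
      have "dist s t < 1" using ds(1) by simp
      then have "s \<le> t + 1" unfolding dist_real_def by linarith
      moreover have "q \<in> ball p d \<inter> S" using ds(2) sq by (simp add: dist_commute)
      ultimately show ?thesis using d(2) sq(2) by (simp add: dist_norm)
    qed
    moreover have "dist (y s p) (y t p) < e / 2" using d'(2) [of s] ds sq by simp
    ultimately show "dist ((\<lambda>(t, p). y t p) z') ((\<lambda>(t, p). y t p) z) < e"
      unfolding sq tp using dist_triangle_half_l [of "y s q" "y s p" e "y t p"]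
      by (simp add: dist_commute)
  qed (use d d' in auto)
qed

text \<open>Continuity is asked for each fixed vector v, the form in which derivative fields arrive.
  In finite dimension this already gives closeness in operator norm, see
  \<open>operator_close\<close>.\<close>

locale linear_family =
  fixes S :: "'p::euclidean_space set" and A :: "real \<Rightarrow> 'p \<Rightarrow> 'u::euclidean_space \<Rightarrow> 'u"
  assumes S_open: "open S" and linear_A: "\<And>t p. 0 \<le> t \<Longrightarrow> p \<in> S \<Longrightarrow> linear (A t p)"
    and cont_A: "\<And>v. continuous_on ({0..} \<times> S) (\<lambda>(t, p). A t p v)"
begin

lemma operator_close:
  assumes p: "p \<in> S" and e: "0 < e"
  shows "\<exists>d>0. ball p d \<subseteq> S \<and> (\<forall>t q v. 0 \<le> t \<and> t \<le> T \<and> q \<in> ball p d \<longrightarrow> norm (A t q v - A t p v) \<le> e * norm v)"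
proof -
  let ?n = "real DIM('u)"
  have "\<forall>v. \<exists>d>0. ball p d \<subseteq> S \<and> (\<forall>t q. 0 \<le> t \<and> t \<le> T \<and> q \<in> ball p d \<longrightarrow> norm (A t q v - A t p v) < e / ?n)"
    using joint_continuous_uniform [OF cont_A S_open p, of "e / ?n" T] e by auto
  then obtain R where R: "\<And>v. 0 < R v" "\<And>v. ball p (R v) \<subseteq> S"
    "\<And>v t q. 0 \<le> t \<Longrightarrow> t \<le> T \<Longrightarrow> q \<in> ball p (R v) \<Longrightarrow> norm (A t q v - A t p v) < e / ?n"
    by metis
  define r where "r = Min (R ` Basis)"
  have r: "0 < r" "\<And>b. b \<in> Basis \<Longrightarrow> r \<le> R b" unfolding r_def using R(1) by auto
  obtain b0 :: 'u where b0: "b0 \<in> Basis" using nonempty_Basis by blast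
  have rS: "ball p r \<subseteq> S" using R(2) [of b0] r(2) [OF b0] by auto
  have "norm (A t q v - A t p v) \<le> e * norm v" if t: "0 \<le> t" "t \<le> T" and q: "q \<in> ball p r" for t q v
  proof -
    have "linear (\<lambda>v. A t q v - A t p v)"
      using linear_A [OF t(1), of q] linear_A [OF t(1) p] q rS by (intro linear_compose_sub) auto
    then have "norm (A t q v - A t p v) \<le> (\<Sum>b\<in>Basis. norm (A t q b - A t p b)) * norm v"
      by (rule linear_norm_le_Basis)
    also have "\<dots> \<le> (\<Sum>b\<in>(Basis::'u set). e / ?n) * norm v"
    proof (intro mult_right_mono sum_mono)
      fix b :: 'u assume "b \<in> Basis"
      then have "q \<in> ball p (R b)" using q r(2) by fastforce
      then show "norm (A t q b - A t p b) \<le> e / ?n" using R(3) [OF t] less_imp_le by blast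
    qed simp
    finally show ?thesis by simp
  qed
  then show ?thesis using r(1) rS by blast
qed

lemma operator_bounded:
  assumes p: "p \<in> S"
  shows "\<exists>K\<ge>0. \<forall>t v. 0 \<le> t \<and> t \<le> T \<longrightarrow> norm (A t p v) \<le> K * norm v"
proof -
  have "\<forall>v. \<exists>B\<ge>0. \<forall>t. 0 \<le> t \<and> t \<le> T \<longrightarrow> norm (A t p v) \<le> B"
    using joint_continuous_bounded [OF cont_A p] by blast
  then obtain B where B: "\<And>v. B v \<ge> 0" "\<And>v t. 0 \<le> t \<Longrightarrow> t \<le> T \<Longrightarrow> norm (A t p v) \<le> B v" by metis
  have "norm (A t p v) \<le> (\<Sum>b\<in>Basis. B b) * norm v" if t: "0 \<le> t" "t \<le> T" for t v
  proof -
    have "norm (A t p v) \<le> (\<Sum>b\<in>Basis. norm (A t p b)) * norm v"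
      by (rule linear_norm_le_Basis [OF linear_A [OF t(1) p]])
    also have "\<dots> \<le> (\<Sum>b\<in>Basis. B b) * norm v" using B(2) [OF t] by (intro mult_right_mono sum_mono) auto
    finally show ?thesis .
  qed
  then show ?thesis using B(1) by (intro exI [of _ "\<Sum>b\<in>Basis. B b"]) (auto simp: sum_nonneg)
qed

text \<open>A Duhamel bound whose constant M is the same for all q near p. Uniqueness, continuity,
  Lipschitz dependence and differentiability all follow from it by identifying the residual
  r.\<close>

lemma difference_estimate:
  assumes p: "p \<in> S" and T: "0 \<le> T"
  obtains M d where "0 \<le> M" "0 < d" "ball p d \<subseteq> S"
    "\<And>q e r \<eta> t. q \<in> ball p d \<Longrightarrow> e 0 = 0 \<Longrightarrow> 0 \<le> \<eta> \<Longrightarrow>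
      (\<And>t. 0 \<le> t \<Longrightarrow> t \<le> T \<Longrightarrow> (e has_vector_derivative A t q (e t) + r t) (at t within {0..})) \<Longrightarrow>
      (\<And>t. 0 \<le> t \<Longrightarrow> t \<le> T \<Longrightarrow> norm (r t) \<le> \<eta>) \<Longrightarrow> 0 \<le> t \<Longrightarrow> t \<le> T \<Longrightarrow> norm (e t) \<le> \<eta> * M"
proof -
  obtain d where d: "0 < d" "ball p d \<subseteq> S"
    "\<And>t q v. 0 \<le> t \<Longrightarrow> t \<le> T \<Longrightarrow> q \<in> ball p d \<Longrightarrow> norm (A t q v - A t p v) \<le> 1 * norm v"
    using operator_close [OF p, of 1 T] by auto
  obtain K where K: "0 \<le> K" "\<And>t v. 0 \<le> t \<Longrightarrow> t \<le> T \<Longrightarrow> norm (A t p v) \<le> K * norm v"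
    using operator_bounded [OF p, of T] by auto
  \<comment> \<open>Gronwall with growth rate K + 1: the operator at p has bound K, and the choice
    of d lets the one at q exceed it by at most 1.\<close>
  define N where "N = T * exp ((2 * (K + 1) + 1) * T)"
  have N: "0 \<le> N" using T by (simp add: N_def)
  have est: "norm (e t) \<le> \<eta> * sqrt N"
    if q: "q \<in> ball p d" and e0: "e 0 = 0" and \<eta>: "0 \<le> \<eta>"
      and e: "\<And>t. 0 \<le> t \<Longrightarrow> t \<le> T \<Longrightarrow> (e has_vector_derivative A t q (e t) + r t) (at t within {0..})"
      and r: "\<And>t. 0 \<le> t \<Longrightarrow> t \<le> T \<Longrightarrow> norm (r t) \<le> \<eta>" and t: "0 \<le> t" "t \<le> T"
    for q and e :: "real \<Rightarrow> 'u" and r \<eta> t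
  proof -
    have "norm (A t q v) \<le> (K + 1) * norm v" if t: "0 \<le> t" "t \<le> T" for t v
    proof -
      have "norm (A t q v) \<le> norm (A t p v) + norm (A t q v - A t p v)"
        using norm_triangle_ineq [of "A t p v" "A t q v - A t p v"] by simp
      then show ?thesis using K(2) [OF t, of v] d(3) [OF t q, of v] by (simp add: algebra_simps)
    qed
    then have "norm (A t q (e t) + r t) \<le> (K + 1) * norm (e t) + \<eta>" if "0 \<le> t" "t \<le> T" for t
      using that r [OF that] norm_triangle_mono by blast
    then have "(norm (e t))\<^sup>2 \<le> ((norm (e 0))\<^sup>2 + \<eta>\<^sup>2 * t) * exp ((2 * (K + 1) + 1) * t)"
      using e t \<eta> K(1) by (intro gronwall_norm [of T]) auto
    also have "\<dots> \<le> (\<eta>\<^sup>2 * T) * exp ((2 * (K + 1) + 1) * T)"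
      using e0 t K(1) T by (intro mult_mono) (auto intro: mult_left_mono)
    also have "\<dots> = (\<eta> * sqrt N)\<^sup>2" using N by (simp add: N_def power_mult_distrib)
    finally show ?thesis by (rule power2_le_imp_le) (use \<eta> N in simp)
  qed
  show thesis
  proof (rule that [OF _ d(1,2)])
    show "0 \<le> sqrt N" using N by simp
    fix q and e r :: "real \<Rightarrow> 'u" and \<eta> t :: real
    assume "q \<in> ball p d" "e 0 = 0" "0 \<le> \<eta>"
      "\<And>t. 0 \<le> t \<Longrightarrow> t \<le> T \<Longrightarrow> (e has_vector_derivative A t q (e t) + r t) (at t within {0..})"
      "\<And>t. 0 \<le> t \<Longrightarrow> t \<le> T \<Longrightarrow> norm (r t) \<le> \<eta>" "0 \<le> t" "t \<le> T"
    then show "norm (e t) \<le> \<eta> * sqrt N" by (rule est [where q = q and e = e and r = r])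
  qed
qed

lemma unique_zero:
  assumes "p \<in> S" "e 0 = 0" "ode_sol (\<lambda>t u. A t p u) e" "0 \<le> t"
  shows "e t = 0"
proof -
  obtain M d where "0 \<le> M" "0 < d" "ball p d \<subseteq> S" and *:
    "\<And>q e r \<eta> s. q \<in> ball p d \<Longrightarrow> e 0 = 0 \<Longrightarrow> 0 \<le> \<eta> \<Longrightarrow>
      (\<And>s. 0 \<le> s \<Longrightarrow> s \<le> t \<Longrightarrow> (e has_vector_derivative A s q (e s) + r s) (at s within {0..})) \<Longrightarrow>
      (\<And>s. 0 \<le> s \<Longrightarrow> s \<le> t \<Longrightarrow> norm (r s) \<le> \<eta>) \<Longrightarrow> 0 \<le> s \<Longrightarrow> s \<le> t \<Longrightarrow> norm (e s) \<le> \<eta> * M"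
    using difference_estimate [OF assms(1,4)] by blast
  have "norm (e t) \<le> 0 * M"
    by (rule * [where q = p and r = "\<lambda>s. 0"])
      (use assms ode_solD [OF assms(3)] \<open>0 < d\<close> in auto)
  then show ?thesis by simp
qed

text \<open>The difference y t q - y t p solves the linear equation at q with residual (A t q - A t
  p) (y t p) + b t q - b t p, which is small uniformly on [0, T].\<close>

lemma linear_solution_continuous:
  assumes b: "continuous_on ({0..} \<times> S) (\<lambda>(t, p). b t p)"
    and y: "\<And>p. p \<in> S \<Longrightarrow> y 0 p = c" "\<And>p. p \<in> S \<Longrightarrow> ode_sol (\<lambda>t u. A t p u + b t p) (\<lambda>t. y t p)"
  shows "continuous_on ({0..} \<times> S) (\<lambda>(t, p). y t p)"
proof (rule continuous_jointI)
  show "continuous_on {0..} (\<lambda>t. y t p)" if "p \<in> S" for p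
    by (rule ode_sol_continuous_on [OF y(2) [OF that]])
  fix p and T \<epsilon> :: real assume p: "p \<in> S" and T: "0 \<le> T" and \<epsilon>: "0 < \<epsilon>"
  obtain M d where M: "0 \<le> M" "0 < d" "ball p d \<subseteq> S" and *:
    "\<And>q e r \<eta> t. q \<in> ball p d \<Longrightarrow> e 0 = 0 \<Longrightarrow> 0 \<le> \<eta> \<Longrightarrow>
      (\<And>t. 0 \<le> t \<Longrightarrow> t \<le> T \<Longrightarrow> (e has_vector_derivative A t q (e t) + r t) (at t within {0..})) \<Longrightarrow>
      (\<And>t. 0 \<le> t \<Longrightarrow> t \<le> T \<Longrightarrow> norm (r t) \<le> \<eta>) \<Longrightarrow> 0 \<le> t \<Longrightarrow> t \<le> T \<Longrightarrow> norm (e t) \<le> \<eta> * M"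
    using difference_estimate [OF p T] by blast
  have "bounded ((\<lambda>t. y t p) ` {0..T})"
    by (intro compact_imp_bounded compact_continuous_image continuous_on_subset [OF ode_sol_continuous_on [OF y(2) [OF p]]]) auto
  then obtain Y where Y: "0 < Y" "\<And>t. 0 \<le> t \<Longrightarrow> t \<le> T \<Longrightarrow> norm (y t p) \<le> Y"
    unfolding bounded_pos by auto
  \<comment> \<open>The residual is at most \<eta> (Y + 1) and M amplifies it. Adding 1 to M avoids
    division by 0, and the half makes the final inequality strict.\<close>
  define \<eta> where "\<eta> = \<epsilon> / 2 / ((Y + 1) * (M + 1))"
  have \<eta>: "0 < \<eta>" using Y M \<epsilon> by (simp add: \<eta>_def)
  obtain d1 where d1: "0 < d1" "\<And>t q v. 0 \<le> t \<Longrightarrow> t \<le> T \<Longrightarrow> q \<in> ball p d1 \<Longrightarrow> norm (A t q v - A t p v) \<le> \<eta> * norm v"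
    using operator_close [OF p \<eta>, of T] by auto
  obtain d2 where d2: "0 < d2" "\<And>t q. 0 \<le> t \<Longrightarrow> t \<le> T \<Longrightarrow> q \<in> ball p d2 \<Longrightarrow> norm (b t q - b t p) < \<eta>"
    using joint_continuous_uniform [OF b S_open p \<eta>, of T] by auto
  have "norm (y t q - y t p) < \<epsilon>" if t: "0 \<le> t" "t \<le> T" and q: "q \<in> ball p (min d (min d1 d2)) \<inter> S" for t q
  proof -
    have "norm (y t q - y t p) \<le> (\<eta> * (Y + 1)) * M"
    proof (rule * [where q = q and r = "\<lambda>t. (A t q (y t p) - A t p (y t p)) + (b t q - b t p)"])
      fix t :: real assume t: "0 \<le> t" "t \<le> T"
      have "((\<lambda>t. y t q - y t p) has_vector_derivative (A t q (y t q) + b t q) - (A t p (y t p) + b t p)) (at t within {0..})"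
        using q p t(1) by (intro ode_sol_diff y(2)) auto
      moreover have "A t q (y t q - y t p) = A t q (y t q) - A t q (y t p)"
        using q t(1) linear_A by (intro linear_diff) auto
      ultimately show "((\<lambda>t. y t q - y t p) has_vector_derivative A t q (y t q - y t p) +
          ((A t q (y t p) - A t p (y t p)) + (b t q - b t p))) (at t within {0..})"
        by (simp add: algebra_simps)
      have "norm ((A t q (y t p) - A t p (y t p)) + (b t q - b t p)) \<le> \<eta> * norm (y t p) + \<eta>"
        using q by (intro norm_triangle_mono d1 t less_imp_le [OF d2(2)]) auto
      also have "\<dots> \<le> \<eta> * (Y + 1)" using Y(2) [OF t] \<eta> by (simp add: algebra_simps)
      finally show "norm ((A t q (y t p) - A t p (y t p)) + (b t q - b t p)) \<le> \<eta> * (Y + 1)" .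
    qed (use q p y(1) \<eta> Y t in auto)
    also have "\<dots> \<le> \<eta> * (Y + 1) * (M + 1)" using \<eta> Y by (intro mult_left_mono) auto
    also have "\<dots> = \<eta> * ((Y + 1) * (M + 1))" by simp
    also have "\<dots> = \<epsilon> / 2"
    proof -
      have "0 < (Y + 1) * (M + 1)" using Y M by simp
      then show ?thesis unfolding \<eta>_def by (metis less_irrefl nonzero_eq_divide_eq)
    qed
    finally show ?thesis using \<epsilon> by simp
  qed
  then show "\<exists>d>0. \<forall>t q. 0 \<le> t \<and> t \<le> T \<and> q \<in> ball p d \<inter> S \<longrightarrow> norm (y t q - y t p) < \<epsilon>"
    using M d1(1) d2(1) by (intro exI [of _ "min d (min d1 d2)"]) auto
qed

text \<open>Differentiating y' = A y + b in p gives an equation of the same type for Y, with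
  inhomogeneity (dA/dp) y + db/dp. The remainder y t q - y t p - Y t (q - p) solves the linear
  equation at p with three residuals, each small compared with q - p.\<close>

lemma linear_solution_derivative:
  assumes A': "\<And>v t p. 0 \<le> t \<Longrightarrow> p \<in> S \<Longrightarrow> ((\<lambda>p. A t p v) has_derivative A' v t p) (at p)"
      "\<And>v w. continuous_on ({0..} \<times> S) (\<lambda>(t, p). A' v t p w)"
    and b': "\<And>t p. 0 \<le> t \<Longrightarrow> p \<in> S \<Longrightarrow> (b t has_derivative b' t p) (at p)"
      "\<And>w. continuous_on ({0..} \<times> S) (\<lambda>(t, p). b' t p w)"
    and y: "\<And>p. p \<in> S \<Longrightarrow> y 0 p = c" "\<And>p. p \<in> S \<Longrightarrow> ode_sol (\<lambda>t u. A t p u + b t p) (\<lambda>t. y t p)"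
    and Y: "\<And>w. Y 0 w = 0"
      "\<And>w. ode_sol (\<lambda>t u. A t p u + ((\<Sum>i\<in>Basis. (y t p \<bullet> i) *\<^sub>R A' i t p w) + b' t p w)) (\<lambda>t. Y t w)"
    and p: "p \<in> S" and t0: "0 \<le> t0"
  shows "(y t0 has_derivative Y t0) (at p)"
proof -
  define T where "T = t0"
  have T: "0 \<le> T" using t0 T_def by simp
  define B where "B t w = (\<Sum>i\<in>Basis. (y t p \<bullet> i) *\<^sub>R A' i t p w) + b' t p w" for t w
  have linB: "linear (B t)" if "0 \<le> t" for t
  proof -
    have "linear (A' i t p)" "linear (b' t p)" for i
      using A'(1) [OF that p] b'(1) [OF that p] has_derivative_linear by blast+
    then show ?thesis unfolding B_def
      by (intro linear_compose_add linear_compose_sum ballI linear_compose_scale_right)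
  qed
  have Yd: "((\<lambda>t. Y t w) has_vector_derivative A t p (Y t w) + B t w) (at t within {0..})" if "0 \<le> t" for t w
    using ode_solD [OF Y(2) that, of w] by (simp add: B_def)
  \<comment> \<open>Y is given separately for each w. Its linearity in w is uniqueness of solutions,
    since the inhomogeneity B is linear in w.\<close>
  have lin: "linear (Y t0)"
  proof (rule linearI)
    fix w w'
    have "(\<lambda>t. Y t (w + w') - (Y t w + Y t w')) t0 = 0"
    proof (rule unique_zero [OF p _ _ t0])
      show "ode_sol (\<lambda>t. A t p) (\<lambda>t. Y t (w + w') - (Y t w + Y t w'))"
        unfolding ode_sol_def
      proof (intro allI impI)
        fix t :: real assume t: "0 \<le> t"
        have "((\<lambda>t. Y t (w + w') - (Y t w + Y t w')) has_vector_derivative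
            (A t p (Y t (w + w')) + B t (w + w')) - ((A t p (Y t w) + B t w) + (A t p (Y t w') + B t w'))) (at t within {0..})"
          by (intro has_vector_derivative_diff has_vector_derivative_add Yd t)
        then show "((\<lambda>t. Y t (w + w') - (Y t w + Y t w')) has_vector_derivative
            A t p (Y t (w + w') - (Y t w + Y t w'))) (at t within {0..})"
          by (simp add: linear_diff [OF linear_A [OF t p]] linear_add [OF linear_A [OF t p]]
              linear_add [OF linB [OF t]] algebra_simps)
      qed
    qed (simp add: Y(1))
    then show "Y t0 (w + w') = Y t0 w + Y t0 w'" by simp
  next
    fix w and c :: real
    have "(\<lambda>t. Y t (c *\<^sub>R w) - c *\<^sub>R Y t w) t0 = 0"
    proof (rule unique_zero [OF p _ _ t0])
      show "ode_sol (\<lambda>t. A t p) (\<lambda>t. Y t (c *\<^sub>R w) - c *\<^sub>R Y t w)"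
        unfolding ode_sol_def
      proof (intro allI impI)
        fix t :: real assume t: "0 \<le> t"
        have "((\<lambda>t. Y t (c *\<^sub>R w) - c *\<^sub>R Y t w) has_vector_derivative
            (A t p (Y t (c *\<^sub>R w)) + B t (c *\<^sub>R w)) - c *\<^sub>R (A t p (Y t w) + B t w)) (at t within {0..})"
          by (intro has_vector_derivative_diff Yd t
              bounded_linear.has_vector_derivative [OF bounded_linear_scaleR_right])
        then show "((\<lambda>t. Y t (c *\<^sub>R w) - c *\<^sub>R Y t w) has_vector_derivative
            A t p (Y t (c *\<^sub>R w) - c *\<^sub>R Y t w)) (at t within {0..})"
          by (simp add: linear_diff [OF linear_A [OF t p]] linear_scale [OF linear_A [OF t p]]
              linear_scale [OF linB [OF t]] algebra_simps)
      qed
    qed (simp add: Y(1))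
    then show "Y t0 (c *\<^sub>R w) = c *\<^sub>R Y t0 w" by simp
  qed
  obtain M d where M: "0 \<le> M" "0 < d" "ball p d \<subseteq> S" and *:
    "\<And>q e r \<eta> t. q \<in> ball p d \<Longrightarrow> e 0 = 0 \<Longrightarrow> 0 \<le> \<eta> \<Longrightarrow>
      (\<And>t. 0 \<le> t \<Longrightarrow> t \<le> T \<Longrightarrow> (e has_vector_derivative A t q (e t) + r t) (at t within {0..})) \<Longrightarrow>
      (\<And>t. 0 \<le> t \<Longrightarrow> t \<le> T \<Longrightarrow> norm (r t) \<le> \<eta>) \<Longrightarrow> 0 \<le> t \<Longrightarrow> t \<le> T \<Longrightarrow> norm (e t) \<le> \<eta> * M"
    using difference_estimate [OF p T] by blast
  have "bounded ((\<lambda>t. y t p) ` {0..T})"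
    by (intro compact_imp_bounded compact_continuous_image continuous_on_subset [OF ode_sol_continuous_on [OF y(2) [OF p]]]) auto
  then obtain N where N: "0 < N" "\<And>t. 0 \<le> t \<Longrightarrow> t \<le> T \<Longrightarrow> norm (y t p) \<le> N"
    unfolding bounded_pos by auto
  define n where "n = real DIM('u)"
  have n: "0 < n" by (simp add: n_def)
  obtain rb Lb where rb: "0 < rb" "0 \<le> Lb" "\<And>t q. 0 \<le> t \<Longrightarrow> t \<le> T \<Longrightarrow> q \<in> ball p rb \<Longrightarrow> norm (b t q - b t p) \<le> Lb * norm (q - p)"
    using joint_lipschitz [OF b' S_open p, of T] by auto
  have "\<forall>v. \<exists>r>0. \<exists>L\<ge>0. ball p r \<subseteq> S \<and> (\<forall>t q. 0 \<le> t \<and> t \<le> T \<and> q \<in> ball p r \<longrightarrow> norm (A t q v - A t p v) \<le> L * norm (q - p))"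
    using joint_lipschitz [OF A' S_open p] by blast
  then obtain rA LA where rA: "\<And>v. 0 < rA v" "\<And>v. 0 \<le> LA v"
    "\<And>v t q. 0 \<le> t \<Longrightarrow> t \<le> T \<Longrightarrow> q \<in> ball p (rA v) \<Longrightarrow> norm (A t q v - A t p v) \<le> LA v * norm (q - p)"
    by metis
  define r1 where "r1 = Min (insert d (insert rb (rA ` Basis)))"
  have r1: "0 < r1" "r1 \<le> d" "r1 \<le> rb" "\<And>i. i \<in> Basis \<Longrightarrow> r1 \<le> rA i"
    unfolding r1_def using M rb(1) rA(1) by (auto intro!: Min_le simp del: Min_insert simp: Min_gr_iff)
  define L where "L = (\<Sum>i\<in>Basis. LA i)"
  have L: "0 \<le> L" using rA(2) by (simp add: L_def sum_nonneg)
  have A_lip: "norm (A t q v - A t p v) \<le> (L * norm (q - p)) * norm v"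
    if t: "0 \<le> t" "t \<le> T" and q: "q \<in> ball p r1" for t q v
  proof -
    have "q \<in> S" using q r1 M by auto
    then have "linear (\<lambda>v. A t q v - A t p v)"
      by (intro linear_compose_sub linear_A t(1) p)
    then have "norm (A t q v - A t p v) \<le> (\<Sum>i\<in>Basis. norm (A t q i - A t p i)) * norm v"
      by (rule linear_norm_le_Basis)
    also have "\<dots> \<le> (\<Sum>i\<in>Basis. LA i * norm (q - p)) * norm v"
      using q r1(4) by (intro mult_right_mono sum_mono rA(3) t) fastforce+
    finally show ?thesis by (simp add: L_def sum_distrib_right)
  qed
  define Ly where "Ly = (L * N + Lb) * M"
  have Ly: "0 \<le> Ly" using L N M rb by (simp add: Ly_def)
  have y_lip: "norm (y t q - y t p) \<le> Ly * norm (q - p)"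
    if t: "0 \<le> t" "t \<le> T" and q: "q \<in> ball p r1" for t q
  proof -
    have qd: "q \<in> ball p d" "q \<in> S" using q r1 M by auto
    have "norm (y t q - y t p) \<le> ((L * N + Lb) * norm (q - p)) * M"
    proof (rule * [where q = q and r = "\<lambda>t. (A t q (y t p) - A t p (y t p)) + (b t q - b t p)"])
      fix t :: real assume t: "0 \<le> t" "t \<le> T"
      have "((\<lambda>t. y t q - y t p) has_vector_derivative (A t q (y t q) + b t q) - (A t p (y t p) + b t p)) (at t within {0..})"
        using qd p t(1) by (intro ode_sol_diff y(2)) auto
      moreover have "A t q (y t q - y t p) = A t q (y t q) - A t q (y t p)"
        using qd t(1) linear_A by (intro linear_diff) auto
      ultimately show "((\<lambda>t. y t q - y t p) has_vector_derivative A t q (y t q - y t p) +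
          ((A t q (y t p) - A t p (y t p)) + (b t q - b t p))) (at t within {0..})"
        by (simp add: algebra_simps)
      have "norm ((A t q (y t p) - A t p (y t p)) + (b t q - b t p)) \<le> (L * norm (q - p)) * norm (y t p) + Lb * norm (q - p)"
        using q r1(3) by (intro norm_triangle_mono A_lip rb(3) t) auto
      also have "\<dots> \<le> (L * norm (q - p)) * N + Lb * norm (q - p)"
        using N(2) [OF t] L by (intro add_right_mono mult_left_mono) auto
      finally show "norm ((A t q (y t p) - A t p (y t p)) + (b t q - b t p)) \<le> (L * N + Lb) * norm (q - p)"
        by (simp add: algebra_simps)
    qed (use qd p y(1) L N rb t in auto)
    then show ?thesis by (simp add: Ly_def mult_ac)
  qed
  show ?thesis
    unfolding has_derivative_at_alt
  proof (intro conjI allI impI)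
    show "bounded_linear (Y t0)" using lin linear_conv_bounded_linear by blast
    fix \<epsilon> :: real assume \<epsilon>: "0 < \<epsilon>"
    \<comment> \<open>The summands 1, n * N and 1 belong to the residuals \<open>t1\<close>,
      \<open>t2\<close> and \<open>t3\<close> below.\<close>
    define \<eta> where "\<eta> = \<epsilon> / ((1 + n * N + 1) * (M + 1))"
    have \<eta>: "0 < \<eta>" using \<epsilon> N M n by (simp add: \<eta>_def add_pos_nonneg)
    obtain db where db: "0 < db" "\<And>t q. 0 \<le> t \<Longrightarrow> t \<le> T \<Longrightarrow> q \<in> ball p db \<Longrightarrow> norm (b t q - b t p - b' t p (q - p)) \<le> \<eta> * norm (q - p)"
      using joint_derivative_uniform [OF b' S_open p \<eta>, of T] by auto
    have "\<forall>v. \<exists>r>0. ball p r \<subseteq> S \<and> (\<forall>t q. 0 \<le> t \<and> t \<le> T \<and> q \<in> ball p r \<longrightarrow> norm (A t q v - A t p v - A' v t p (q - p)) \<le> \<eta> * norm (q - p))"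
      using joint_derivative_uniform [OF A' S_open p \<eta>] by blast
    then obtain dA where dA: "\<And>v. 0 < dA v"
      "\<And>v t q. 0 \<le> t \<Longrightarrow> t \<le> T \<Longrightarrow> q \<in> ball p (dA v) \<Longrightarrow> norm (A t q v - A t p v - A' v t p (q - p)) \<le> \<eta> * norm (q - p)"
      by metis
    \<comment> \<open>The residual \<open>t1\<close> is quadratic, at most L * Ly times the square
      of norm w. The radius \<eta> / (L * Ly + 1) makes it at most \<eta> * norm w.\<close>
    define r2 where "r2 = Min (insert r1 (insert db (insert (\<eta> / (L * Ly + 1)) (dA ` Basis))))"
    have "0 < \<eta> / (L * Ly + 1)" using \<eta> L Ly by (simp add: add_nonneg_pos)
    then have r2: "0 < r2" "r2 \<le> r1" "r2 \<le> db" "r2 \<le> \<eta> / (L * Ly + 1)" "\<And>i. i \<in> Basis \<Longrightarrow> r2 \<le> dA i"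
      unfolding r2_def using r1(1) db(1) dA(1) by (auto intro!: Min_le simp del: Min_insert simp: Min_gr_iff)
    have "norm (y t0 q - y t0 p - Y t0 (q - p)) \<le> \<epsilon> * norm (q - p)" if q: "norm (q - p) < r2" for q
    proof -
      define w where "w = q - p"
      have qb: "q \<in> ball p r1" "q \<in> ball p d" "q \<in> ball p db" "\<And>i. i \<in> Basis \<Longrightarrow> q \<in> ball p (dA i)" "q \<in> S"
        using q r2 r1 M(3) by (force simp: dist_norm norm_minus_commute)+
      have "norm (y t0 q - y t0 p - Y t0 w) \<le> (\<eta> * (1 + n * N + 1) * norm w) * M"
      proof (rule * [where q = p and t = t0 and e = "\<lambda>t. y t q - y t p - Y t w" and r = "\<lambda>t. (A t q (y t q - y t p) - A t p (y t q - y t p)) +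
          ((A t q (y t p) - A t p (y t p) - (\<Sum>i\<in>Basis. (y t p \<bullet> i) *\<^sub>R A' i t p w)) + (b t q - b t p - b' t p w))"])
        fix t :: real assume t: "0 \<le> t" "t \<le> T"
        have "((\<lambda>t. y t q - y t p - Y t w) has_vector_derivative
           ((A t q (y t q) + b t q) - (A t p (y t p) + b t p)) - (A t p (Y t w) + B t w)) (at t within {0..})"
          using qb(5) p t(1) by (intro has_vector_derivative_diff [OF ode_sol_diff [OF y(2) y(2)]] Yd) auto
        then show "((\<lambda>t. y t q - y t p - Y t w) has_vector_derivative
            A t p (y t q - y t p - Y t w) + ((A t q (y t q - y t p) - A t p (y t q - y t p)) +
          ((A t q (y t p) - A t p (y t p) - (\<Sum>i\<in>Basis. (y t p \<bullet> i) *\<^sub>R A' i t p w)) + (b t q - b t p - b' t p w)))) (at t within {0..})"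
          by (simp add: linear_diff [OF linear_A [OF t(1) p]] linear_diff [OF linear_A [OF t(1) qb(5)]]
              linear_add [OF linear_A [OF t(1) p]] B_def algebra_simps)
        have t1: "norm (A t q (y t q - y t p) - A t p (y t q - y t p)) \<le> \<eta> * norm w"
        proof -
          have "norm (A t q (y t q - y t p) - A t p (y t q - y t p)) \<le> (L * norm w) * norm (y t q - y t p)"
            unfolding w_def by (rule A_lip [OF t qb(1)])
          also have "\<dots> \<le> (L * norm w) * (Ly * norm w)"
            using y_lip [OF t qb(1)] L unfolding w_def by (intro mult_left_mono) auto
          also have "\<dots> = (L * Ly * norm w) * norm w" by simp
          also have "\<dots> \<le> \<eta> * norm w"
          proof (intro mult_right_mono)
            have "norm w \<le> \<eta> / (L * Ly + 1)" using q r2 unfolding w_def by simp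
            moreover have "0 < L * Ly + 1" using L Ly by (simp add: add_nonneg_pos)
            ultimately have "norm w * (L * Ly + 1) \<le> \<eta>" by (simp add: pos_le_divide_eq)
            moreover have "norm w * (L * Ly + 1) = L * Ly * norm w + norm w" by (simp add: algebra_simps)
            ultimately show "L * Ly * norm w \<le> \<eta>" using norm_ge_zero [of w] by linarith
          qed simp
          finally show ?thesis .
        qed
        have t2: "norm (A t q (y t p) - A t p (y t p) - (\<Sum>i\<in>Basis. (y t p \<bullet> i) *\<^sub>R A' i t p w)) \<le> \<eta> * (n * N) * norm w"
        proof -
          have rep: "A t x (y t p) = (\<Sum>i\<in>Basis. (y t p \<bullet> i) *\<^sub>R A t x i)" if "x \<in> S" for x
          proof -
            have "A t x (\<Sum>i\<in>Basis. (y t p \<bullet> i) *\<^sub>R i) = (\<Sum>i\<in>Basis. (y t p \<bullet> i) *\<^sub>R A t x i)"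
              using linear_A [OF t(1) that] by (simp add: linear_sum linear_scale)
            then show ?thesis by (simp add: euclidean_representation)
          qed
          have "A t q (y t p) - A t p (y t p) - (\<Sum>i\<in>Basis. (y t p \<bullet> i) *\<^sub>R A' i t p w)
            = (\<Sum>i\<in>Basis. (y t p \<bullet> i) *\<^sub>R (A t q i - A t p i - A' i t p w))"
            by (simp add: rep [OF qb(5)] rep [OF p] sum_subtractf scaleR_diff_right)
          also have "norm \<dots> \<le> (\<Sum>i\<in>(Basis::'u set). N * (\<eta> * norm w))"
          proof (rule sum_norm_le)
            fix i :: 'u assume i: "i \<in> Basis"
            have "\<bar>y t p \<bullet> i\<bar> \<le> N" using Basis_le_norm [OF i] N(2) [OF t] order_trans by blast
            then show "norm ((y t p \<bullet> i) *\<^sub>R (A t q i - A t p i - A' i t p w)) \<le> N * (\<eta> * norm w)"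
              using dA(2) [OF t qb(4) [OF i]] N(1) unfolding w_def
              by (simp add: mult_mono)
          qed
          finally show ?thesis by (simp add: n_def mult_ac)
        qed
        have t3: "norm (b t q - b t p - b' t p w) \<le> \<eta> * norm w"
          unfolding w_def by (rule db(2) [OF t qb(3)])
        show "norm ((A t q (y t q - y t p) - A t p (y t q - y t p)) +
          ((A t q (y t p) - A t p (y t p) - (\<Sum>i\<in>Basis. (y t p \<bullet> i) *\<^sub>R A' i t p w)) + (b t q - b t p - b' t p w)))
           \<le> \<eta> * (1 + n * N + 1) * norm w"
          using norm_triangle_mono [OF t1 norm_triangle_mono [OF t2 t3]] by (simp add: algebra_simps)
      qed (use p y(1) qb M \<eta> n N Y(1) t0 T_def in auto)
      also have "\<dots> \<le> (\<eta> * (1 + n * N + 1) * norm w) * (M + 1)"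
        using \<eta> n N by (intro mult_left_mono) auto
      also have "\<dots> = (\<eta> * ((1 + n * N + 1) * (M + 1))) * norm w" by simp
      also have "\<eta> * ((1 + n * N + 1) * (M + 1)) = \<epsilon>"
      proof -
        have "0 < n * N" using n N by simp
        then have "0 < (1 + n * N + 1) * (M + 1)" using M by (intro mult_pos_pos) auto
        then show ?thesis unfolding \<eta>_def by (metis less_irrefl nonzero_eq_divide_eq)
      qed
      finally show ?thesis by (simp add: w_def)
    qed
    then show "\<exists>d>0. \<forall>q. norm (q - p) < d \<longrightarrow> norm (y t0 q - y t0 p - Y t0 (q - p)) \<le> \<epsilon> * norm (q - p)"
      using r2(1) by blast
  qed
qed

end

section \<open>Flows confined to a compact convex set\<close>

lemma lipschitz_on_compact_convex:
  fixes F :: "'u::euclidean_space \<Rightarrow> 'v::euclidean_space"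
  assumes F: "\<And>u. u \<in> K \<Longrightarrow> (F has_derivative F' u) (at u within K)"
    and F': "\<And>v. continuous_on K (\<lambda>u. F' u v)" and K: "compact K" "convex K"
  shows "\<exists>L\<ge>0. \<forall>u\<in>K. \<forall>v\<in>K. norm (F u - F v) \<le> L * norm (u - v)"
proof -
  have "\<exists>B\<ge>0. \<forall>u\<in>K. norm (F' u i) \<le> B" for i
  proof -
    have "bounded ((\<lambda>u. F' u i) ` K)" by (intro compact_imp_bounded compact_continuous_image F' K)
    then obtain B where "\<forall>y\<in>(\<lambda>u. F' u i) ` K. norm y \<le> B" unfolding bounded_iff by blast
    then show ?thesis by (intro exI [of _ "max 0 B"]) (auto simp: le_max_iff_disj)
  qed
  then obtain B where B: "\<And>i. 0 \<le> B i" "\<And>i u. u \<in> K \<Longrightarrow> norm (F' u i) \<le> B i" by metis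
  let ?L = "\<Sum>i\<in>Basis. B i"
  have "norm (F u - F v) \<le> ?L * norm (u - v)" if uv: "u \<in> K" "v \<in> K" for u v
  proof (rule differentiable_bound [OF K(2) F _ uv])
    fix x assume x: "x \<in> K"
    show "onorm (F' x) \<le> ?L"
    proof (rule onorm_bound)
      fix w
      have "norm (F' x w) \<le> (\<Sum>i\<in>Basis. norm (F' x i)) * norm w"
        using F [OF x] has_derivative_linear by (intro linear_norm_le_Basis) blast
      also have "\<dots> \<le> ?L * norm w" using B(2) [OF x] by (intro mult_right_mono sum_mono) auto
      finally show "norm (F' x w) \<le> ?L * norm w" .
    qed (use B in \<open>auto intro: sum_nonneg\<close>)
  qed
  moreover have "0 \<le> ?L" using B(1) by (intro sum_nonneg)
  ultimately show ?thesis by blast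
qed

text \<open>Confinement of all trajectories to one compact convex K makes F Lipschitz along them
  with a single constant, while the open U leaves room for Taylor expansion around points of
  K.\<close>

locale flow_family =
  fixes U K S :: "'u::euclidean_space set" and F :: "'u \<Rightarrow> 'u" and F' :: "'u \<Rightarrow> 'u \<Rightarrow> 'u"
    and \<xi> :: "real \<Rightarrow> 'u \<Rightarrow> 'u"
  assumes U_open: "open U" and K: "compact K" "convex K" "K \<subseteq> U" and openS: "open S"
    and F_deriv: "\<And>u. u \<in> U \<Longrightarrow> (F has_derivative F' u) (at u)"
    and F'_cont: "\<And>v. continuous_on U (\<lambda>u. F' u v)"
    and \<xi>0: "\<And>p. p \<in> S \<Longrightarrow> \<xi> 0 p = p"
    and \<xi>_sol: "\<And>p. p \<in> S \<Longrightarrow> ode_sol (\<lambda>t. F) (\<lambda>t. \<xi> t p)"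
    and \<xi>_in: "\<And>t p. 0 \<le> t \<Longrightarrow> p \<in> S \<Longrightarrow> \<xi> t p \<in> K"
begin

lemma flow_lipschitz:
  obtains L where "0 \<le> L" "\<And>t p q. 0 \<le> t \<Longrightarrow> t \<le> T \<Longrightarrow> p \<in> S \<Longrightarrow> q \<in> S \<Longrightarrow> norm (\<xi> t q - \<xi> t p) \<le> L * norm (q - p)"
proof -
  obtain L where L: "0 \<le> L" "\<And>u v. u \<in> K \<Longrightarrow> v \<in> K \<Longrightarrow> norm (F u - F v) \<le> L * norm (u - v)"
    using lipschitz_on_compact_convex [of K F F'] F_deriv F'_cont K
    by (meson continuous_on_subset has_derivative_at_withinI subsetD)
  have "norm (\<xi> t q - \<xi> t p) \<le> sqrt (exp ((2 * L + 1) * T)) * norm (q - p)"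
    if t: "0 \<le> t" "t \<le> T" and pq: "p \<in> S" "q \<in> S" for t p q
  proof -
    have "(norm (\<xi> t q - \<xi> t p))\<^sup>2 \<le> ((norm (\<xi> 0 q - \<xi> 0 p))\<^sup>2 + 0\<^sup>2 * t) * exp ((2 * L + 1) * t)"
    proof (rule gronwall_norm [of T "\<lambda>t. \<xi> t q - \<xi> t p" "\<lambda>t. F (\<xi> t q) - F (\<xi> t p)"])
      show "((\<lambda>t. \<xi> t q - \<xi> t p) has_vector_derivative F (\<xi> t q) - F (\<xi> t p)) (at t within {0..})"
        if "0 \<le> t" for t by (rule ode_sol_diff [OF \<xi>_sol \<xi>_sol that]) (rule pq)+
      show "norm (F (\<xi> t q) - F (\<xi> t p)) \<le> L * norm (\<xi> t q - \<xi> t p) + 0" if "0 \<le> t" for t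
        using L(2) [OF \<xi>_in [OF that pq(2)] \<xi>_in [OF that pq(1)]] by simp
    qed (use L(1) t in auto)
    also have "\<dots> \<le> (norm (q - p))\<^sup>2 * exp ((2 * L + 1) * T)"
      using t L(1) pq by (auto simp: \<xi>0 intro!: mult_left_mono)
    also have "\<dots> = (sqrt (exp ((2 * L + 1) * T)) * norm (q - p))\<^sup>2" by (simp add: power_mult_distrib)
    finally show ?thesis by (rule power2_le_imp_le) simp
  qed
  then show thesis by (intro that [of "sqrt (exp ((2 * L + 1) * T))"]) auto
qed

lemma flow_continuous: "continuous_on ({0..} \<times> S) (\<lambda>(t, p). \<xi> t p)"
proof (rule continuous_jointI)
  show "continuous_on {0..} (\<lambda>t. \<xi> t p)" if "p \<in> S" for p
    by (rule ode_sol_continuous_on [OF \<xi>_sol [OF that]])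
  fix p and T e :: real assume p: "p \<in> S" and T: "0 \<le> T" and e: "0 < e"
  obtain L where L: "0 \<le> L" "\<And>t p q. 0 \<le> t \<Longrightarrow> t \<le> T \<Longrightarrow> p \<in> S \<Longrightarrow> q \<in> S \<Longrightarrow> norm (\<xi> t q - \<xi> t p) \<le> L * norm (q - p)"
    by (rule flow_lipschitz [of T]) blast
  have "norm (\<xi> t q - \<xi> t p) < e" if t: "0 \<le> t" "t \<le> T" and q: "q \<in> ball p (e / (L + 1)) \<inter> S" for t q
  proof -
    have "norm (\<xi> t q - \<xi> t p) \<le> L * norm (q - p)" using L(2) [OF t p] q by simp
    also have "\<dots> \<le> (L + 1) * norm (q - p)" by (intro mult_right_mono) auto
    also have "\<dots> < e" using q L(1) by (simp add: dist_norm norm_minus_commute pos_less_divide_eq mult.commute)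
    finally show ?thesis .
  qed
  then show "\<exists>d>0. \<forall>t q. 0 \<le> t \<and> t \<le> T \<and> q \<in> ball p d \<inter> S \<longrightarrow> norm (\<xi> t q - \<xi> t p) < e"
    using e L(1) by (intro exI [of _ "e / (L + 1)"]) auto
qed

lemma flow_linear_family: "linear_family S (\<lambda>t p. F' (\<xi> t p))"
proof (rule linear_family.intro)
  show "linear (F' (\<xi> t p))" if "0 \<le> t" "p \<in> S" for t p
    using F_deriv \<xi>_in [OF that] K(3) has_derivative_linear by blast
  show "continuous_on ({0..} \<times> S) (\<lambda>(t, p). F' (\<xi> t p) v)" for v
  proof -
    have "continuous_on ({0..} \<times> S) (\<lambda>z. F' ((\<lambda>(t, p). \<xi> t p) z) v)"
      by (rule continuous_on_compose2 [OF F'_cont flow_continuous]) (use \<xi>_in K(3) in auto)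
    then show ?thesis by (simp add: split_def)
  qed
qed (rule openS)

text \<open>The remainder \<xi> t q - \<xi> t p - Y t (q - p) solves the linearization along \<xi> t
  p, with the Taylor remainder of F as residual. Lipschitz dependence makes that residual small
  compared with q - p.\<close>

lemma flow_derivative:
  assumes Y: "\<And>w. Y 0 w = w" "\<And>w. ode_sol (\<lambda>t. F' (\<xi> t p)) (\<lambda>t. Y t w)"
    and p: "p \<in> S" and t0: "0 \<le> t0"
  shows "(\<xi> t0 has_derivative Y t0) (at p)"
proof -
  interpret A: linear_family S "\<lambda>t p. F' (\<xi> t p)" by (rule flow_linear_family)
  note Yd = ode_solD [OF Y(2)]
  have linF: "linear (F' (\<xi> t p))" if "0 \<le> t" for t using A.linear_A [OF that p] .
  have lin: "linear (Y t0)"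
  proof (rule linearI)
    fix w w'
    have "(\<lambda>t. Y t (w + w') - (Y t w + Y t w')) t0 = 0"
    proof (rule A.unique_zero [OF p _ _ t0])
      show "ode_sol (\<lambda>t. F' (\<xi> t p)) (\<lambda>t. Y t (w + w') - (Y t w + Y t w'))"
        unfolding ode_sol_def
      proof (intro allI impI)
        fix t :: real assume t: "0 \<le> t"
        have "((\<lambda>t. Y t (w + w') - (Y t w + Y t w')) has_vector_derivative
            F' (\<xi> t p) (Y t (w + w')) - (F' (\<xi> t p) (Y t w) + F' (\<xi> t p) (Y t w'))) (at t within {0..})"
          by (intro has_vector_derivative_diff has_vector_derivative_add Yd t)
        then show "((\<lambda>t. Y t (w + w') - (Y t w + Y t w')) has_vector_derivative
            F' (\<xi> t p) (Y t (w + w') - (Y t w + Y t w'))) (at t within {0..})"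
          by (simp add: linear_diff [OF linF [OF t]] linear_add [OF linF [OF t]])
      qed
    qed (simp add: Y(1))
    then show "Y t0 (w + w') = Y t0 w + Y t0 w'" by simp
  next
    fix w and c :: real
    have "(\<lambda>t. Y t (c *\<^sub>R w) - c *\<^sub>R Y t w) t0 = 0"
    proof (rule A.unique_zero [OF p _ _ t0])
      show "ode_sol (\<lambda>t. F' (\<xi> t p)) (\<lambda>t. Y t (c *\<^sub>R w) - c *\<^sub>R Y t w)"
        unfolding ode_sol_def
      proof (intro allI impI)
        fix t :: real assume t: "0 \<le> t"
        have "((\<lambda>t. Y t (c *\<^sub>R w) - c *\<^sub>R Y t w) has_vector_derivative
            F' (\<xi> t p) (Y t (c *\<^sub>R w)) - c *\<^sub>R F' (\<xi> t p) (Y t w)) (at t within {0..})"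
          by (intro has_vector_derivative_diff Yd t
              bounded_linear.has_vector_derivative [OF bounded_linear_scaleR_right])
        then show "((\<lambda>t. Y t (c *\<^sub>R w) - c *\<^sub>R Y t w) has_vector_derivative
            F' (\<xi> t p) (Y t (c *\<^sub>R w) - c *\<^sub>R Y t w)) (at t within {0..})"
          by (simp add: linear_diff [OF linF [OF t]] linear_scale [OF linF [OF t]])
      qed
    qed (simp add: Y(1))
    then show "Y t0 (c *\<^sub>R w) = c *\<^sub>R Y t0 w" by simp
  qed
  obtain M d where M: "0 \<le> M" "0 < d" "ball p d \<subseteq> S" and *:
    "\<And>q e r \<eta> t. q \<in> ball p d \<Longrightarrow> e 0 = 0 \<Longrightarrow> 0 \<le> \<eta> \<Longrightarrow>
      (\<And>t. 0 \<le> t \<Longrightarrow> t \<le> t0 \<Longrightarrow> (e has_vector_derivative F' (\<xi> t q) (e t) + r t) (at t within {0..})) \<Longrightarrow>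
      (\<And>t. 0 \<le> t \<Longrightarrow> t \<le> t0 \<Longrightarrow> norm (r t) \<le> \<eta>) \<Longrightarrow> 0 \<le> t \<Longrightarrow> t \<le> t0 \<Longrightarrow> norm (e t) \<le> \<eta> * M"
    using A.difference_estimate [OF p t0] by blast
  obtain L where L: "0 \<le> L" "\<And>t p q. 0 \<le> t \<Longrightarrow> t \<le> t0 \<Longrightarrow> p \<in> S \<Longrightarrow> q \<in> S \<Longrightarrow> norm (\<xi> t q - \<xi> t p) \<le> L * norm (q - p)"
    by (rule flow_lipschitz [of t0]) blast
  obtain \<rho> where \<rho>: "0 < \<rho>" "(\<Union>x\<in>K. ball x \<rho>) \<subseteq> U"
    using compact_subset_open_imp_ball_epsilon_subset [OF K(1) U_open K(3)] by blast
  have inU: "\<xi> t p + u \<in> U" if "0 \<le> t" "u \<in> ball 0 \<rho>" for t u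
    using \<rho>(2) \<xi>_in [OF that(1) p] that(2) by (force simp: dist_norm)
  show ?thesis
    unfolding has_derivative_at_alt
  proof (intro conjI allI impI)
    show "bounded_linear (Y t0)" using lin linear_conv_bounded_linear by blast
    fix \<epsilon> :: real assume \<epsilon>: "0 < \<epsilon>"
    define \<eta> where "\<eta> = \<epsilon> / ((L + 1) * (M + 1))"
    have LM: "0 < (L + 1) * (M + 1)" using L M by simp
    have \<eta>: "0 < \<eta>" using \<epsilon> LM by (simp add: \<eta>_def)
    \<comment> \<open>Taylor expansion of F uniformly along a moving base point: F is viewed as a
      time-dependent family around u = 0, so that \<open>joint_derivative_uniform\<close>
      applies.\<close>
    define g where "g t u = F (\<xi> t p + u)" for t u
    define g' where "g' t u = F' (\<xi> t p + u)" for t u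
    have "\<exists>r>0. ball 0 r \<subseteq> ball (0 :: 'u) \<rho> \<and> (\<forall>t u. 0 \<le> t \<and> t \<le> t0 \<and> u \<in> ball 0 r \<longrightarrow>
      norm (g t u - g t 0 - g' t 0 (u - 0)) \<le> \<eta> * norm (u - 0))"
    proof (rule joint_derivative_uniform)
      fix t :: real and u :: 'u assume tu: "0 \<le> t" "u \<in> ball 0 \<rho>"
      have "((\<lambda>u. \<xi> t p + u) has_derivative (\<lambda>w. w)) (at u)" by (auto intro!: derivative_eq_intros)
      from has_derivative_compose [OF this F_deriv [OF inU [OF tu]]]
      show "(g t has_derivative g' t u) (at u)" by (simp add: g_def [abs_def] g'_def)
    next
      fix w
      have "continuous_on ({0..} \<times> ball 0 \<rho>) (\<lambda>z. \<xi> (fst z) p + snd z)"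
        by (intro continuous_intros continuous_on_compose2 [OF ode_sol_continuous_on [OF \<xi>_sol [OF p]]]) auto
      then have "continuous_on ({0..} \<times> ball 0 \<rho>) (\<lambda>z. F' (\<xi> (fst z) p + snd z) w)"
        by (rule continuous_on_compose2 [OF F'_cont]) (use inU in auto)
      then show "continuous_on ({0..} \<times> ball 0 \<rho>) (\<lambda>(t, u). g' t u w)" by (simp add: split_def g'_def)
    qed (use \<rho> \<eta> in auto)
    then obtain r where r: "0 < r" "\<And>t u. 0 \<le> t \<Longrightarrow> t \<le> t0 \<Longrightarrow> norm u < r \<Longrightarrow>
        norm (F (\<xi> t p + u) - F (\<xi> t p) - F' (\<xi> t p) u) \<le> \<eta> * norm u" by (auto simp: g_def g'_def)
    define r2 where "r2 = min d (r / (L + 1))"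
    have r2: "0 < r2" using M(2) r(1) L(1) by (simp add: r2_def)
    have "norm (\<xi> t0 q - \<xi> t0 p - Y t0 (q - p)) \<le> \<epsilon> * norm (q - p)" if q: "norm (q - p) < r2" for q
    proof -
      define w where "w = q - p"
      have qS: "q \<in> S" using q M(3) by (auto simp: r2_def dist_norm norm_minus_commute)
      have close: "norm (\<xi> t q - \<xi> t p) \<le> L * norm w" "norm (\<xi> t q - \<xi> t p) < r" if "0 \<le> t" "t \<le> t0" for t
      proof -
        show 1: "norm (\<xi> t q - \<xi> t p) \<le> L * norm w" unfolding w_def by (rule L(2) [OF that p qS])
        also have "\<dots> \<le> (L + 1) * norm w" by (intro mult_right_mono) auto
        also have "\<dots> < r" using q L(1) by (simp add: w_def r2_def pos_less_divide_eq mult.commute)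
        finally show "norm (\<xi> t q - \<xi> t p) < r" .
      qed
      have "norm (\<xi> t0 q - \<xi> t0 p - Y t0 w) \<le> (\<eta> * (L * norm w)) * M"
      proof (rule * [where q = p and t = t0 and e = "\<lambda>t. \<xi> t q - \<xi> t p - Y t w" and
            r = "\<lambda>t. F (\<xi> t q) - F (\<xi> t p) - F' (\<xi> t p) (\<xi> t q - \<xi> t p)"])
        fix t :: real assume t: "0 \<le> t" "t \<le> t0"
        have "((\<lambda>t. \<xi> t q - \<xi> t p - Y t w) has_vector_derivative
           (F (\<xi> t q) - F (\<xi> t p)) - F' (\<xi> t p) (Y t w)) (at t within {0..})"
          by (intro has_vector_derivative_diff ode_sol_diff [OF \<xi>_sol \<xi>_sol] Yd t p qS)
        then show "((\<lambda>t. \<xi> t q - \<xi> t p - Y t w) has_vector_derivative F' (\<xi> t p) (\<xi> t q - \<xi> t p - Y t w) +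
           (F (\<xi> t q) - F (\<xi> t p) - F' (\<xi> t p) (\<xi> t q - \<xi> t p))) (at t within {0..})"
          by (simp add: linear_diff [OF linF [OF t(1)]])
        have "norm (F (\<xi> t p + (\<xi> t q - \<xi> t p)) - F (\<xi> t p) - F' (\<xi> t p) (\<xi> t q - \<xi> t p)) \<le> \<eta> * norm (\<xi> t q - \<xi> t p)"
          by (rule r(2) [OF t close(2) [OF t]])
        also have "\<dots> \<le> \<eta> * (L * norm w)" using close(1) [OF t] \<eta> by (intro mult_left_mono) auto
        finally show "norm (F (\<xi> t q) - F (\<xi> t p) - F' (\<xi> t p) (\<xi> t q - \<xi> t p)) \<le> \<eta> * (L * norm w)" by simp
      qed (use p M qS \<xi>0 \<eta> L(1) t0 in \<open>auto simp: Y(1) w_def\<close>)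
      also have "\<dots> = (\<eta> * norm w) * (L * M)" by simp
      also have "\<dots> \<le> (\<eta> * norm w) * ((L + 1) * (M + 1))"
        using L(1) M(1) \<eta> by (intro mult_left_mono mult_mono) auto
      also have "\<dots> = (\<eta> * ((L + 1) * (M + 1))) * norm w" by simp
      also have "\<eta> * ((L + 1) * (M + 1)) = \<epsilon>"
        using LM unfolding \<eta>_def by (metis less_irrefl nonzero_eq_divide_eq)
      finally show ?thesis by (simp add: w_def)
    qed
    then show "\<exists>d>0. \<forall>q. norm (q - p) < d \<longrightarrow> norm (\<xi> t0 q - \<xi> t0 p - Y t0 (q - p)) \<le> \<epsilon> * norm (q - p)"
      using r2 by blast
  qed
qed

end

text \<open>The last assumption says that the linear system has polynomially bounded growth in \<open>1/l\<close>.\<close>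

locale tempered_linear = weighted_family S l Lm + linear_family S A
  for S :: "'p::euclidean_space set" and l Lm and A :: "real \<Rightarrow> 'p \<Rightarrow> 'u::euclidean_space \<Rightarrow> 'u" +
  assumes growth: "\<And>a c C. \<exists>C' a'. \<forall>p\<in>S. \<forall>\<beta> y. ode_sol (\<lambda>t u. A t p u + \<beta> t) y \<and> norm (y 0) \<le> c \<and>
      (\<forall>t\<ge>0. norm (\<beta> t) \<le> C * l t p powr a) \<longrightarrow> (\<forall>t\<ge>0. norm (y t) \<le> C' * l t p powr a')"
begin

text \<open>The derivative in p solves the same linear system with initial value 0 and another
  inhomogeneity, built from y and the derivatives of A and b and hence tempered. This is why b, y
  and c vary in the induction; \<open>growth\<close> supplies the bound itself.\<close>

lemma tempered_linear_solution:
  fixes y :: "real \<Rightarrow> 'p \<Rightarrow> 'u"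
  assumes "\<And>v. tempered_Ck S l k (\<lambda>t p. A t p v)" "tempered_Ck S l k b"
    and "\<And>p. p \<in> S \<Longrightarrow> y 0 p = c" "\<And>p. p \<in> S \<Longrightarrow> ode_sol (\<lambda>t u. A t p u + b t p) (\<lambda>t. y t p)"
  shows "tempered_Ck S l k y"
proof -
  have base: "tempered_Ck S l 0 y"
    if b: "tempered_Ck S l 0 b" and y: "\<And>p. p \<in> S \<Longrightarrow> y 0 p = c"
      "\<And>p. p \<in> S \<Longrightarrow> ode_sol (\<lambda>t u. A t p u + b t p) (\<lambda>t. y t p)"
    for b y :: "real \<Rightarrow> 'p \<Rightarrow> 'u" and c
  proof -
    obtain a where a: "weighted_bound S l a b" using b tempered_Ck_0 by blast
    obtain C where C: "0 \<le> C" "\<And>t p. 0 \<le> t \<Longrightarrow> p \<in> S \<Longrightarrow> norm (b t p) \<le> C * l t p powr a"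
      by (rule weighted_boundE [OF a]) blast
    obtain C' a' where C': "\<forall>p\<in>S. \<forall>\<beta> y. ode_sol (\<lambda>t u. A t p u + \<beta> t) y \<and> norm (y 0) \<le> norm c \<and>
      (\<forall>t\<ge>0. norm (\<beta> t) \<le> C * l t p powr a) \<longrightarrow> (\<forall>t\<ge>0. norm (y t) \<le> C' * l t p powr a')"
      using growth [of "norm c" C a] by blast
    have "weighted_bound S l a' y"
    proof (rule weighted_boundI [OF linear_solution_continuous [OF tempered_Ck_continuous [OF b] y]])
      show "norm (y t p) \<le> C' * l t p powr a'" if "0 \<le> t" "p \<in> S" for t p
        using C' [rule_format, OF that(2), of "\<lambda>t. b t p" "\<lambda>t. y t p" t] y [OF that(2)] C(2) that by simp
    qed
    then show ?thesis using tempered_Ck_0 by blast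
  qed
  show ?thesis using assms
  proof (induction k arbitrary: b y c)
    case 0
    show ?case by (rule base [OF 0(2-4)])
  next
    case (Suc k)
    have "\<exists>A'. (\<forall>t\<ge>0. \<forall>p\<in>S. ((\<lambda>p. A t p v) has_derivative A' t p) (at p)) \<and> (\<forall>w. tempered_Ck S l k (\<lambda>t p. A' t p w))" for v
      by (rule tempered_Ck_SucE [OF Suc.prems(1) [of v]]) blast
    then obtain A' where A': "\<And>v t p. 0 \<le> t \<Longrightarrow> p \<in> S \<Longrightarrow> ((\<lambda>p. A t p v) has_derivative A' v t p) (at p)"
      "\<And>v w. tempered_Ck S l k (\<lambda>t p. A' v t p w)" by metis
    obtain b' where b': "\<And>t p. 0 \<le> t \<Longrightarrow> p \<in> S \<Longrightarrow> (b t has_derivative b' t p) (at p)"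
      "\<And>w. tempered_Ck S l k (\<lambda>t p. b' t p w)" by (rule tempered_Ck_SucE [OF Suc.prems(2)]) blast
    have Ak: "tempered_Ck S l k (\<lambda>t p. A t p v)" for v by (rule tempered_Ck_SucD [OF Suc.prems(1)])
    have yk: "tempered_Ck S l k y"
      by (rule Suc.IH [OF Ak tempered_Ck_SucD [OF Suc.prems(2)] Suc.prems(3,4)])
    define B where "B w t p = (\<Sum>i\<in>Basis. (y t p \<bullet> i) *\<^sub>R A' i t p w) + b' t p w" for w t p
    have B: "tempered_Ck S l k (B w)" for w
      unfolding B_def
      by (intro tempered_Ck_add tempered_Ck_sum tempered_Ck_bilinear [OF bounded_bilinear_scaleR]
          tempered_Ck_bilinear [OF bounded_bilinear_inner] yk tempered_Ck_const A'(2) b'(2))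
    have "\<exists>Y. Y 0 = 0 \<and> ode_sol (\<lambda>t u. A t p u + B w t p) Y" if "p \<in> S" for p w
    proof (rule linear_ode_exists)
      show "linear (A t p)" if "0 \<le> t" for t by (rule linear_A [OF that \<open>p \<in> S\<close>])
      have *: "continuous_on {0..} (\<lambda>t. g t p)" if "continuous_on ({0..} \<times> S) (\<lambda>(t, p). g t p)" for g :: "real \<Rightarrow> 'p \<Rightarrow> 'u"
      proof -
        have "continuous_on {0..} (\<lambda>t. (\<lambda>(t, p). g t p) (t, p))"
          using \<open>p \<in> S\<close> by (intro continuous_on_compose2 [OF that] continuous_intros) auto
        then show ?thesis by simp
      qed
      show "continuous_on {0..} (\<lambda>t. A t p v)" for v by (rule * [OF cont_A])
      show "continuous_on {0..} (\<lambda>t. B w t p)" by (rule * [OF tempered_Ck_continuous [OF B]])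
    qed
    then obtain Y0 where Y0: "\<And>p w. p \<in> S \<Longrightarrow> Y0 p w 0 = 0" "\<And>p w. p \<in> S \<Longrightarrow> ode_sol (\<lambda>t u. A t p u + B w t p) (Y0 p w)"
      by metis
    define Y where "Y t p w = Y0 p w t" for t p w
    have Yk: "tempered_Ck S l k (\<lambda>t p. Y t p w)" for w
      by (rule Suc.IH [OF Ak B, of _ 0]) (use Y0 in \<open>auto simp: Y_def\<close>)
    show ?case
    proof (rule tempered_Ck_SucI [OF _ _ Yk])
      have "tempered_Ck S l 0 b"
        using tempered_Ck_bound [OF Suc.prems(2)] tempered_Ck_0 by blast
      then show "tempered_Ck S l 0 y" by (rule base [OF _ Suc.prems(3,4)])
      fix t :: real and p assume tp: "0 \<le> t" "p \<in> S"
      show "(y t has_derivative Y t p) (at p)"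
      proof (rule linear_solution_derivative [OF A'(1) tempered_Ck_continuous [OF A'(2)] b'(1) tempered_Ck_continuous [OF b'(2)] Suc.prems(3,4) _ _ tp(2,1)])
        show "Y 0 p w = 0" for w using Y0(1) [OF tp(2)] by (simp add: Y_def)
        show "ode_sol (\<lambda>t u. A t p u + ((\<Sum>i\<in>Basis. (y t p \<bullet> i) *\<^sub>R A' i t p w) + b' t p w)) (\<lambda>t. Y t p w)" for w
          using Y0(2) [OF tp(2), of w] by (simp add: Y_def B_def)
      qed
    qed
  qed
qed

end

text \<open>A bootstrap: if \<xi> is tempered of order k, so are the coefficients
  \<open>F' (\<xi> t p)\<close> of the variational equation, hence its solutions, which are the
  first derivatives of \<xi>.\<close>

theorem (in flow_family) tempered_flow:
  assumes T: "tempered_linear S l Lm (\<lambda>t p. F' (\<xi> t p))" and F'_smooth: "\<And>v. smooth_on U (\<lambda>u. F' u v)"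
  shows "tempered_Ck S l k \<xi>"
proof -
  interpret T: tempered_linear S l Lm "\<lambda>t p. F' (\<xi> t p)" by (rule T)
  show ?thesis
  proof (induction k)
    case 0
    have "weighted_bound S l 0 (\<lambda>t p. (\<lambda>u. u) (\<xi> t p))"
      by (rule T.weighted_bound_compose [OF continuous_on_id K(1) subset_UNIV flow_continuous \<xi>_in])
    then show ?case using T.tempered_Ck_0 by auto
  next
    case (Suc k)
    have Ak: "tempered_Ck S l k (\<lambda>t p. F' (\<xi> t p) v)" for v
    proof -
      have "Ck_on k U (\<lambda>u. F' u v)" using F'_smooth [of v] unfolding smooth_on_def by blast
      then show ?thesis by (intro T.tempered_Ck_compose [where G = "\<lambda>u. F' u v", OF U_open K(1,3) \<xi>_in _ Suc])
    qed
    have "\<exists>Y. Y 0 = w \<and> ode_sol (\<lambda>t u. F' (\<xi> t p) u + 0) Y" if "p \<in> S" for p w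
    proof (rule linear_ode_exists)
      show "linear (F' (\<xi> t p))" if "0 \<le> t" for t by (rule T.linear_A [OF that \<open>p \<in> S\<close>])
      show "continuous_on {0..} (\<lambda>t. F' (\<xi> t p) v)" for v
      proof -
        have "continuous_on {0..} (\<lambda>t. (\<lambda>(t, p). F' (\<xi> t p) v) (t, p))"
          using \<open>p \<in> S\<close> by (intro continuous_on_compose2 [OF T.cont_A] continuous_intros) auto
        then show ?thesis by simp
      qed
    qed simp
    then obtain Y0 where Y0: "\<And>p w. p \<in> S \<Longrightarrow> Y0 p w 0 = w" "\<And>p w. p \<in> S \<Longrightarrow> ode_sol (\<lambda>t u. F' (\<xi> t p) u + 0) (Y0 p w)"
      by metis
    define Y where "Y t p w = Y0 p w t" for t p w
    show ?case
    proof (rule T.tempered_Ck_SucI)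
      show "tempered_Ck S l 0 \<xi>" using T.tempered_Ck_bound [OF Suc] T.tempered_Ck_0 by blast
      show "(\<xi> t has_derivative Y t p) (at p)" if "0 \<le> t" "p \<in> S" for t p
        by (rule flow_derivative [OF _ _ that(2,1)]) (use Y0 that in \<open>auto simp: Y_def\<close>)
      show "tempered_Ck S l k (\<lambda>t p. Y t p w)" for w
        by (rule T.tempered_linear_solution [OF Ak T.tempered_Ck_const [of k 0], of _ w]) (use Y0 in \<open>auto simp: Y_def\<close>)
    qed
  qed
qed

section \<open>Normal forms for the drag near the circular flow\<close>

abbreviation deriv_at :: "('a::real_normed_vector \<Rightarrow> 'b::real_normed_vector) \<Rightarrow> 'a \<Rightarrow> 'a \<Rightarrow> 'b" where
  "deriv_at f z \<equiv> frechet_derivative f (at z)"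

lemma smooth_on_open_has_derivative:
  assumes "open S" "smooth_on S f" "z \<in> S"
  shows "(f has_derivative deriv_at f z) (at z)"
proof -
  have "S \<subseteq> closure (interior S)" using assms(1) by (simp add: closure_subset interior_open)
  from smooth_onE [OF assms(2) this] obtain f' where "(f has_derivative f' z) (at z within S)"
    using assms(3) by metis
  then have "(f has_derivative f' z) (at z)" using assms(1,3) at_within_open by metis
  from frechet_derivative_at [OF this] this show ?thesis by simp
qed

lemma smooth_on_deriv_at_const:
  assumes "open S" "smooth_on S f"
  shows "smooth_on S (\<lambda>z. deriv_at f z w)"
proof -
  have "S \<subseteq> closure (interior S)" using assms(1) by (simp add: closure_subset interior_open)
  from smooth_onE [OF assms(2) this] obtain f' where
    f': "\<And>z. z \<in> S \<Longrightarrow> (f has_derivative f' z) (at z within S)" "\<And>w. smooth_on S (\<lambda>z. f' z w)" by metis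
  have "f' z w = deriv_at f z w" if "z \<in> S" for z
    using f'(1) [OF that] assms(1) that at_within_open frechet_derivative_at by metis
  then show ?thesis using f'(2) smooth_on_cong [of S "\<lambda>z. f' z w" "\<lambda>z. deriv_at f z w"] by simp
qed

lemma smooth_on_deriv_at:
  assumes S: "open S" and f: "smooth_on S f" and v: "smooth_on S v"
  shows "smooth_on S (\<lambda>z. deriv_at f z (v z))"
proof -
  have "smooth_on S (\<lambda>z. \<Sum>b\<in>Basis. (v z \<bullet> b) *\<^sub>R deriv_at f z b)"
    by (intro smooth_intros smooth_on_deriv_at_const S f v)
  moreover have "(\<Sum>b\<in>Basis. (v z \<bullet> b) *\<^sub>R deriv_at f z b) = deriv_at f z (v z)" if "z \<in> S" for z
  proof -
    have "linear (deriv_at f z)"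
      using smooth_on_open_has_derivative [OF S f that] has_derivative_linear by blast
    then have "deriv_at f z (\<Sum>b\<in>Basis. (v z \<bullet> b) *\<^sub>R b) = (\<Sum>b\<in>Basis. (v z \<bullet> b) *\<^sub>R deriv_at f z b)"
      by (simp add: linear_sum linear_scale)
    then show ?thesis by (simp add: euclidean_representation)
  qed
  ultimately show ?thesis using smooth_on_cong by (metis (no_types, lifting))
qed

text \<open>Differentiation under the integral sign for derivatives given as plain functions,
  continuous direction by direction. They are packed into bounded linear maps, and evaluation at w
  is moved through the integral.\<close>

lemma has_derivative_integral_param:
  fixes f :: "'p::euclidean_space \<Rightarrow> real \<Rightarrow> 'b::euclidean_space"
  assumes d: "\<And>x t. x \<in> U \<Longrightarrow> t \<in> {a..b} \<Longrightarrow> ((\<lambda>x. f x t) has_derivative f' x t) (at x)"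
    and f: "\<And>x. x \<in> U \<Longrightarrow> continuous_on {a..b} (f x)"
    and f': "\<And>w. continuous_on (U \<times> {a..b}) (\<lambda>(x, t). f' x t w)"
    and U: "open U" "convex U" "x0 \<in> U"
  shows "((\<lambda>x. integral {a..b} (f x)) has_derivative (\<lambda>w. integral {a..b} (\<lambda>t. f' x0 t w))) (at x0)"
proof -
  have bl: "bounded_linear (f' x t)" if "x \<in> U" "t \<in> {a..b}" for x t
    using d [OF that] has_derivative_bounded_linear by blast
  define B where "B x t = Blinfun (f' x t)" for x t
  have B: "blinfun_apply (B x t) = f' x t" if "x \<in> U" "t \<in> {a..b}" for x t
    unfolding B_def using bl [OF that] by (rule bounded_linear_Blinfun_apply)
  have cont: "continuous_on (U \<times> cbox a b) (\<lambda>(x, t). B x t)"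
  proof (rule continuous_on_blinfun_componentwise)
    fix i :: 'p
    have "continuous_on (U \<times> {a..b}) (\<lambda>z. blinfun_apply ((\<lambda>(x, t). B x t) z) i)"
      by (rule continuous_on_eq [OF f' [of i]]) (auto simp: B)
    then show "continuous_on (U \<times> cbox a b) (\<lambda>z. blinfun_apply ((\<lambda>(x, t). B x t) z) i)" by simp
  qed
  have "((\<lambda>x. integral (cbox a b) (f x)) has_derivative blinfun_apply (integral (cbox a b) (B x0))) (at x0 within U)"
  proof (rule leibniz_rule [OF _ _ cont U(3,2)])
    show "((\<lambda>x. f x t) has_derivative blinfun_apply (B x t)) (at x within U)" if "x \<in> U" "t \<in> cbox a b" for x t
      using d [of x t] that B [of x t] by (simp add: has_derivative_at_withinI)
    show "f x integrable_on cbox a b" if "x \<in> U" for x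
      using f [OF that] integrable_continuous_interval by simp
  qed
  moreover have "blinfun_apply (integral (cbox a b) (B x0)) = (\<lambda>w. integral {a..b} (\<lambda>t. f' x0 t w))"
  proof
    fix w
    have "continuous_on {a..b} (\<lambda>t. (\<lambda>(x, t). B x t) (x0, t))"
      using U(3) by (intro continuous_on_compose2 [OF cont] continuous_intros) auto
    then have "B x0 integrable_on {a..b}" by (simp add: integrable_continuous_interval)
    then have "integral {a..b} ((\<lambda>b. blinfun_apply b w) \<circ> B x0) = blinfun_apply (integral {a..b} (B x0)) w"
      by (rule integral_linear) (rule blinfun.bounded_linear_left)
    moreover have "integral {a..b} ((\<lambda>b. blinfun_apply b w) \<circ> B x0) = integral {a..b} (\<lambda>t. f' x0 t w)"
      by (rule integral_cong) (simp add: B [OF U(3)])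
    ultimately show "blinfun_apply (integral (cbox a b) (B x0)) w = integral {a..b} (\<lambda>t. f' x0 t w)" by simp
  qed
  ultimately show ?thesis using at_within_open [OF U(3,1)] by simp
qed

section \<open>Rotations and circle averages\<close>

definition rot :: "real \<Rightarrow> real \<times> real \<Rightarrow> real \<times> real" where
  "rot s z = (fst z * cos s + snd z * sin s, snd z * cos s - fst z * sin s)"

text \<open>Generator of \<open>rot\<close>, which is the flow of x' = y, y' = - x, the limit system
  at l = 0.\<close>

definition rot' :: "real \<times> real \<Rightarrow> real \<times> real" where
  "rot' z = (snd z, - fst z)"

lemma norm_rot [simp]: "norm (rot s z) = norm z"
proof -
  have "(fst z * cos s + snd z * sin s)\<^sup>2 + (snd z * cos s - fst z * sin s)\<^sup>2
    = ((fst z)\<^sup>2 + (snd z)\<^sup>2) * ((sin s)\<^sup>2 + (cos s)\<^sup>2)"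
    by (simp add: power2_eq_square algebra_simps del: sin_cos_squared_add sin_cos_squared_add2 sin_cos_squared_add3)
  then show ?thesis unfolding rot_def by (cases z) (simp add: norm_Pair)
qed

lemma linear_rot: "linear (rot s)"
  by (rule linearI) (auto simp: rot_def algebra_simps)

lemma bounded_linear_rot: "bounded_linear (rot s)"
  by (simp add: linear_rot linear_conv_bounded_linear [symmetric])

lemma rot_rot': "rot s (rot' z) = rot' (rot s z)"
  by (simp add: rot_def rot'_def)

lemma rot_0 [simp]: "rot 0 z = z" and rot_2pi [simp]: "rot (2 * pi) z = z" and rot_pi [simp]: "rot pi z = - z"
  by (simp_all add: rot_def prod_eq_iff)

lemma has_vector_derivative_rot: "((\<lambda>s. rot s z) has_vector_derivative rot' (rot s z)) (at s within S)"
  unfolding rot_def rot'_def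
  by (auto intro!: derivative_eq_intros has_vector_derivative_Pair
      simp: has_real_derivative_iff_has_vector_derivative [symmetric])

lemma continuous_on_rot: "continuous_on S (\<lambda>(z, s). rot s z)"
  unfolding rot_def split_def by (intro continuous_intros)

abbreviation disc :: "(real \<times> real) set" where "disc \<equiv> ball 0 1"

text \<open>Weight 1 gives the mean over the circle up to the factor 2 pi. Weight s gives the
  function that inverts differentiation along the rotation on functions of mean zero.\<close>

definition circle_integral :: "(real \<Rightarrow> real) \<Rightarrow> (real \<times> real \<Rightarrow> real) \<Rightarrow> real \<times> real \<Rightarrow> real" where
  "circle_integral c f z = integral {0..2 * pi} (\<lambda>s. c s * f (rot s z))"

lemma circle_integrand_continuous:
  fixes c :: "real \<Rightarrow> real" and f :: "real \<times> real \<Rightarrow> real"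
  assumes "continuous_on {0..2 * pi} c" "continuous_on disc f"
  shows "continuous_on (disc \<times> {0..2 * pi}) (\<lambda>(z, s). c s * f (rot s z))"
proof -
  have "continuous_on (disc \<times> {0..2 * pi}) (\<lambda>z. f ((\<lambda>(z, s). rot s z) z))"
    by (rule continuous_on_compose2 [OF assms(2) continuous_on_rot]) auto
  moreover have "continuous_on (disc \<times> {0..2 * pi}) (\<lambda>z. c (snd z))"
    by (rule continuous_on_compose2 [OF assms(1)]) (auto intro: continuous_intros)
  ultimately show ?thesis unfolding split_def by (intro continuous_on_mult)
qed

lemma circle_integrand_continuous':
  fixes c :: "real \<Rightarrow> real" and f :: "real \<times> real \<Rightarrow> real"
  assumes "continuous_on {0..2 * pi} c" "continuous_on disc f" "z \<in> disc"
  shows "continuous_on {0..2 * pi} (\<lambda>s. c s * f (rot s z))"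
proof -
  have "continuous_on {0..2 * pi} (\<lambda>s. (\<lambda>(z, s). c s * f (rot s z)) (z, s))"
    using assms(3)
    by (intro continuous_on_compose2 [OF circle_integrand_continuous [OF assms(1,2)]] continuous_intros) auto
  then show ?thesis by simp
qed

lemma circle_integral_has_derivative:
  assumes c: "continuous_on {0..2 * pi} c"
    and f: "\<And>z. z \<in> disc \<Longrightarrow> (f has_derivative f' z) (at z)" "\<And>w. continuous_on disc (\<lambda>z. f' z w)"
    and z: "z \<in> disc"
  shows "(circle_integral c f has_derivative (\<lambda>w. integral {0..2 * pi} (\<lambda>s. c s * f' (rot s z) (rot s w)))) (at z)"
    and "integral {0..2 * pi} (\<lambda>s. c s * f' (rot s z) (rot s w)) =
      (\<Sum>b\<in>Basis. circle_integral (\<lambda>s. c s * (rot s w \<bullet> b)) (\<lambda>z. f' z b) z)"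
proof -
  have rep: "c s * f' (rot s z) (rot s w) = (\<Sum>b\<in>Basis. (c s * (rot s w \<bullet> b)) * f' (rot s z) b)"
    if "z \<in> disc" for z w s
  proof -
    have "linear (f' (rot s z))" using f(1) [of "rot s z"] that has_derivative_linear by force
    then have "f' (rot s z) (\<Sum>b\<in>Basis. (rot s w \<bullet> b) *\<^sub>R b) = (\<Sum>b\<in>Basis. (rot s w \<bullet> b) *\<^sub>R f' (rot s z) b)"
      by (simp add: linear_sum linear_scale)
    then show ?thesis by (simp add: euclidean_representation sum_distrib_left mult.assoc)
  qed
  have cc: "continuous_on {0..2 * pi} (\<lambda>s. c s * (rot s w \<bullet> b))" for w b
  proof -
    have "continuous_on {0..2 * pi} (\<lambda>s. rot s w)"
      unfolding rot_def by (intro continuous_intros)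
    then show ?thesis by (intro continuous_intros c)
  qed
  have fc: "continuous_on disc f"
    using f(1) has_derivative_continuous continuous_at_imp_continuous_on by blast
  show "integral {0..2 * pi} (\<lambda>s. c s * f' (rot s z) (rot s w)) =
      (\<Sum>b\<in>Basis. circle_integral (\<lambda>s. c s * (rot s w \<bullet> b)) (\<lambda>z. f' z b) z)"
    unfolding circle_integral_def rep [OF z]
    by (intro integral_sum finite_Basis integrable_continuous_interval circle_integrand_continuous' [OF cc f(2) z])
  show "(circle_integral c f has_derivative (\<lambda>w. integral {0..2 * pi} (\<lambda>s. c s * f' (rot s z) (rot s w)))) (at z)"
    unfolding circle_integral_def [abs_def]
  proof (rule has_derivative_integral_param [where U = disc])
    fix x s assume x: "x \<in> disc"
    have "(f has_derivative f' (rot s x)) (at (rot s x))" using f(1) x by simp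
    from has_derivative_compose [OF bounded_linear_imp_has_derivative [OF bounded_linear_rot] this]
    show "((\<lambda>x. c s * f (rot s x)) has_derivative (\<lambda>w. c s * f' (rot s x) (rot s w))) (at x)"
      by (rule has_derivative_mult_right)
  next
    show "continuous_on {0..2 * pi} (\<lambda>s. c s * f (rot s x))" if "x \<in> disc" for x
      by (rule circle_integrand_continuous' [OF c fc that])
    have "continuous_on (disc \<times> {0..2 * pi}) (\<lambda>z. \<Sum>b\<in>Basis. (\<lambda>(z, s). (c s * (rot s w \<bullet> b)) * f' (rot s z) b) z)" for w
      by (intro continuous_on_sum circle_integrand_continuous [OF cc f(2)])
    then show "continuous_on (disc \<times> {0..2 * pi}) (\<lambda>(x, s). c s * f' (rot s x) (rot s w))" for w
      by (rule continuous_on_eq) (auto simp: rep split_def)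
  qed (use z in auto)
qed

text \<open>A directional derivative of a circle integral is a sum of circle integrals of first
  derivatives of f with new weights, so the induction must run over all weights c.\<close>

lemma smooth_on_circle_integral:
  assumes c: "continuous_on {0..2 * pi} c" and f: "smooth_on disc f"
  shows "smooth_on disc (circle_integral c f)"
proof -
  have "Ck_on k disc (circle_integral c f)" for k
    using c f
  proof (induction k arbitrary: c f)
    case 0
    have "continuous_on disc (\<lambda>z. integral (cbox 0 (2 * pi)) (\<lambda>s. c s * f (rot s z)))"
      by (rule integral_continuous_on_param)
        (use circle_integrand_continuous [OF 0(1) smooth_on_imp_continuous_on [OF 0(2)]] in simp)
    then show ?case by (simp add: circle_integral_def [abs_def])
  next
    case (Suc k)
    let ?f' = "deriv_at f"
    have f': "\<And>z. z \<in> disc \<Longrightarrow> (f has_derivative ?f' z) (at z)" "\<And>w. continuous_on disc (\<lambda>z. ?f' z w)"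
      using Suc.prems(2) by (auto intro: smooth_on_open_has_derivative smooth_on_imp_continuous_on smooth_on_deriv_at_const)
    show ?case
    proof (rule Ck_on_SucI)
      show "(circle_integral c f has_derivative (\<lambda>w. \<Sum>b\<in>Basis. circle_integral (\<lambda>s. c s * (rot s w \<bullet> b)) (\<lambda>z. ?f' z b) z)) (at z within disc)"
        if "z \<in> disc" for z
        using circle_integral_has_derivative [OF Suc.prems(1) f' that] has_derivative_at_withinI by (metis (no_types, lifting) ext)
      fix w
      have "continuous_on {0..2 * pi} (\<lambda>s. rot s w)"
        unfolding rot_def by (intro continuous_intros)
      then show "Ck_on k disc (\<lambda>z. \<Sum>b\<in>Basis. circle_integral (\<lambda>s. c s * (rot s w \<bullet> b)) (\<lambda>z. ?f' z b) z)"
        by (intro Ck_on_sum Suc.IH continuous_intros Suc.prems smooth_on_deriv_at_const open_ball)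
    qed
  qed
  then show ?thesis by (simp add: smooth_on_def)
qed

lemma has_vector_derivative_along_rot:
  assumes "smooth_on disc f" "z \<in> disc"
  shows "((\<lambda>s. f (rot s z)) has_vector_derivative deriv_at f (rot s z) (rot' (rot s z))) (at s within S)"
proof -
  have "(f has_derivative deriv_at f (rot s z)) (at (rot s z))"
    using assms by (intro smooth_on_open_has_derivative [OF open_ball]) auto
  then have "(f has_derivative deriv_at f (rot s z)) (at (rot s z) within (\<lambda>s. rot s z) ` S)"
    by (rule has_derivative_at_withinI)
  then show ?thesis
    using vector_derivative_diff_chain_within [OF has_vector_derivative_rot] by (simp add: comp_def)
qed

text \<open>Integration by parts in s: differentiating f (rot s z) along the rotation in z is
  differentiating it in s. The boundary terms combine because rot has period 2 pi.\<close>

lemma circle_integral_rot':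
  assumes f: "smooth_on disc f" and z: "z \<in> disc"
    and c: "\<And>s. (c has_real_derivative c' s) (at s)" "continuous_on {0..2 * pi} c'"
  shows "deriv_at (circle_integral c f) z (rot' z) = (c (2 * pi) - c 0) * f z - circle_integral c' f z"
proof -
  have cc: "continuous_on {0..2 * pi} c"
    using c(1) by (meson DERIV_isCont continuous_at_imp_continuous_on)
  let ?f' = "deriv_at f"
  have f': "\<And>z. z \<in> disc \<Longrightarrow> (f has_derivative ?f' z) (at z)" "\<And>w. continuous_on disc (\<lambda>z. ?f' z w)"
    using f by (auto intro: smooth_on_open_has_derivative smooth_on_imp_continuous_on smooth_on_deriv_at_const)
  have "deriv_at (circle_integral c f) z = (\<lambda>w. integral {0..2 * pi} (\<lambda>s. c s * ?f' (rot s z) (rot s w)))"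
    using frechet_derivative_at [OF circle_integral_has_derivative(1) [OF cc f' z]] by simp
  then have 1: "deriv_at (circle_integral c f) z (rot' z) = integral {0..2 * pi} (\<lambda>s. c s * ?f' (rot s z) (rot' (rot s z)))"
    by (simp add: rot_rot')
  have "((\<lambda>s. c s * f (rot s z)) has_vector_derivative (c s * ?f' (rot s z) (rot' (rot s z)) + c' s * f (rot s z))) (at s within {0..2 * pi})" for s
    using DERIV_mult [OF has_field_derivative_at_within [OF c(1)] has_vector_derivative_along_rot [OF f z, unfolded has_real_derivative_iff_has_vector_derivative [symmetric]]]
    by (simp add: has_real_derivative_iff_has_vector_derivative [symmetric] add.commute mult.commute)
  then have i1: "((\<lambda>s. c s * ?f' (rot s z) (rot' (rot s z)) + c' s * f (rot s z)) has_integral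
      (c (2 * pi) * f (rot (2 * pi) z) - c 0 * f (rot 0 z))) {0..2 * pi}"
    by (intro fundamental_theorem_of_calculus) auto
  have i2: "((\<lambda>s. c' s * f (rot s z)) has_integral circle_integral c' f z) {0..2 * pi}"
    unfolding circle_integral_def
    by (intro integrable_integral integrable_continuous_interval circle_integrand_continuous' c(2) z smooth_on_imp_continuous_on f)
  have "((\<lambda>s. c s * ?f' (rot s z) (rot' (rot s z))) has_integral
      (c (2 * pi) * f (rot (2 * pi) z) - c 0 * f (rot 0 z)) - circle_integral c' f z) {0..2 * pi}"
    using has_integral_diff [OF i1 i2] by simp
  from this [unfolded rot_2pi rot_0] show ?thesis unfolding 1 by (simp add: integral_unique algebra_simps)
qed

abbreviation circle_mean :: "(real \<times> real \<Rightarrow> real) \<Rightarrow> real \<times> real \<Rightarrow> real" where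
  "circle_mean \<equiv> circle_integral (\<lambda>s. 1)"

lemma smooth_on_circle_mean: "smooth_on disc f \<Longrightarrow> smooth_on disc (circle_mean f)"
  by (intro smooth_on_circle_integral continuous_intros)

lemma circle_mean_rot': "smooth_on disc f \<Longrightarrow> z \<in> disc \<Longrightarrow> deriv_at (circle_mean f) z (rot' z) = 0"
  using circle_integral_rot' [of f z "\<lambda>s. 1" "\<lambda>s. 0"] by (simp add: circle_integral_def)

lemma circle_mean_deriv_rot':
  assumes f: "smooth_on disc f" and z: "z \<in> disc"
  shows "circle_mean (\<lambda>z. deriv_at f z (rot' z)) z = 0"
proof -
  have "((\<lambda>s. deriv_at f (rot s z) (rot' (rot s z))) has_integral (f (rot (2 * pi) z) - f (rot 0 z))) {0..2 * pi}"
    by (intro fundamental_theorem_of_calculus has_vector_derivative_along_rot f z) auto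
  then show ?thesis by (simp add: circle_integral_def integral_unique)
qed

lemma rot_invariant:
  assumes a: "smooth_on disc a" "\<And>z. z \<in> disc \<Longrightarrow> deriv_at a z (rot' z) = 0" and z: "z \<in> disc"
  shows "a (rot s z) = a z"
proof -
  have "((\<lambda>s. a (rot s z)) has_vector_derivative 0) (at s within UNIV)" for s
    using has_vector_derivative_along_rot [OF a(1) z, of s UNIV] a(2) [of "rot s z"] z by simp
  then obtain k where "\<And>s. s \<in> UNIV \<Longrightarrow> a (rot s z) = k"
    using has_vector_derivative_zero_constant [OF convex_UNIV, of "\<lambda>s. a (rot s z)"] by auto
  from this [of s] this [of 0] show ?thesis by simp
qed

lemma circle_mean_invariant_mult:
  assumes "\<And>s. a (rot s z) = a z"
  shows "circle_mean (\<lambda>z. a z * f z) z = a z * circle_mean f z"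
  by (simp add: circle_integral_def assms)

section \<open>Averaging the drag\<close>

definition drag :: "real \<Rightarrow> real \<times> real \<Rightarrow> real \<times> real" where
  "drag \<delta> z = (- 2 * \<delta> / (1 + fst z), - 2 * \<delta> * snd z / (1 + fst z) ^ 2)"

text \<open>With z = (x, y), the field \<open>fld\<close> below splits as z' = rot' z + l^3 * drag z
  and l' = - l^4 * decay z.\<close>

definition decay :: "real \<Rightarrow> real \<times> real \<Rightarrow> real" where
  "decay \<delta> z = \<delta> / (1 + fst z) ^ 2"

lemma disc_fst: "z \<in> disc \<Longrightarrow> 0 < 1 + fst z"
  using norm_fst_le [of "fst z" "snd z"] by (auto simp: abs_if split: if_splits)

lemma smooth_on_drag: "smooth_on disc (drag \<delta>)"
  unfolding drag_def [abs_def] using disc_fst by (intro smooth_intros) force+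

lemma smooth_on_decay: "smooth_on disc (decay \<delta>)"
  unfolding decay_def [abs_def] using disc_fst by (intro smooth_intros) force+

text \<open>The cancellation on which the proof rests: the drag changes the energy at order l^3 only
  by a derivative along the rotation, so its net effect over one revolution vanishes at that
  order.\<close>

lemma inner_drag:
  assumes "z \<in> disc"
  shows "z \<bullet> drag \<delta> z = deriv_at (\<lambda>z. 2 * \<delta> * snd z / (1 + fst z)) z (rot' z)"
proof -
  have "((\<lambda>z. 2 * \<delta> * snd z / (1 + fst z)) has_derivative
    (\<lambda>w. (2 * \<delta> * snd w * (1 + fst z) - 2 * \<delta> * snd z * fst w) / ((1 + fst z) * (1 + fst z)))) (at z)"
    using disc_fst [OF assms] by (auto intro!: derivative_eq_intros simp: field_simps)
  from fun_cong [OF frechet_derivative_at [OF this], of "rot' z", symmetric] show ?thesis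
  proof (rule trans [rotated, OF sym])
    obtain a b w where z: "z = (a, b)" and w: "w = 1 + a" by (cases z) auto
    have "0 < w" using disc_fst [OF assms] z w by simp
    then have "a * (- 2 * \<delta> / w) + b * (- 2 * \<delta> * b / w ^ 2) = (2 * \<delta> * (- a) * w - 2 * \<delta> * b * b) / (w * w)"
      by (simp add: field_simps power2_eq_square)
    then show "z \<bullet> drag \<delta> z = (2 * \<delta> * snd (rot' z) * (1 + fst z) - 2 * \<delta> * snd z * fst (rot' z)) / ((1 + fst z) * (1 + fst z))"
      by (simp add: z drag_def rot'_def w)
  qed
qed

text \<open>A rotation invariant function has radial gradient, so its drag derivative is proportional
  to \<open>z \<bullet> drag z\<close>, a rotational derivative.\<close>

lemma circle_mean_drag:
  assumes a: "smooth_on disc a" "\<And>z. z \<in> disc \<Longrightarrow> deriv_at a z (rot' z) = 0" and z: "z \<in> disc"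
  shows "circle_mean (\<lambda>z. deriv_at a z (drag \<delta> z)) z = 0"
proof -
  note ad = smooth_on_open_has_derivative [OF open_ball a(1)]
  \<comment> \<open>Differentiating the identity a (rot s z) = a z: the derivative of an invariant
    function is carried along by the rotation.\<close>
  have equiv: "deriv_at a (rot s z) (rot s w) = deriv_at a z w" for s w
  proof -
    have "(a has_derivative deriv_at a (rot s z)) (at (rot s z))" using ad z by simp
    from has_derivative_compose [OF bounded_linear_imp_has_derivative [OF bounded_linear_rot] this]
    have "((\<lambda>z. a (rot s z)) has_derivative (\<lambda>w. deriv_at a (rot s z) (rot s w))) (at z)" .
    then have "(a has_derivative (\<lambda>w. deriv_at a (rot s z) (rot s w))) (at z)"
      by (rule has_derivative_cong_on_open [OF open_ball z, rotated]) (rule rot_invariant [OF a])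
    from has_derivative_unique [OF this ad [OF z]] show ?thesis by metis
  qed
  have lin: "linear (deriv_at a x)" if "x \<in> disc" for x using ad [OF that] has_derivative_linear by blast
  show ?thesis
  proof (cases "z = 0")
    case True
    \<comment> \<open>At the centre there is no radial direction. Invariance under the half turn
      makes the derivative even, and an even linear map is 0.\<close>
    have "deriv_at a 0 w = 0" for w
    proof -
      have "deriv_at a 0 (- w) = deriv_at a 0 w" using equiv [of pi w] True by simp
      then show ?thesis using lin [of 0] by (simp add: linear_neg)
    qed
    moreover have "rot s 0 = 0" for s by (simp add: rot_def prod_eq_iff)
    ultimately show ?thesis using True by (simp add: circle_integral_def)
  next
    case False
    \<comment> \<open>In the orthogonal frame x, rot' x only the component along x contributes,
      because a is constant along the rotation.\<close>
    have rad: "(norm x)\<^sup>2 * deriv_at a x v = (x \<bullet> v) * deriv_at a x x" if x: "x \<in> disc" for x v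
    proof -
      have "(norm x)\<^sup>2 *\<^sub>R v = (x \<bullet> v) *\<^sub>R x + (rot' x \<bullet> v) *\<^sub>R rot' x"
        unfolding power2_norm_eq_inner
        by (cases x; cases v) (simp add: rot'_def algebra_simps)
      then have "deriv_at a x ((norm x)\<^sup>2 *\<^sub>R v) = deriv_at a x ((x \<bullet> v) *\<^sub>R x + (rot' x \<bullet> v) *\<^sub>R rot' x)" by simp
      then show ?thesis using lin [OF x] a(2) [OF x] by (simp add: linear_add linear_scale)
    qed
    have "(norm z)\<^sup>2 * circle_mean (\<lambda>z. deriv_at a z (drag \<delta> z)) z
      = integral {0..2 * pi} (\<lambda>s. (norm (rot s z))\<^sup>2 * deriv_at a (rot s z) (drag \<delta> (rot s z)))"
      by (simp add: circle_integral_def)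
    also have "\<dots> = integral {0..2 * pi} (\<lambda>s. (rot s z \<bullet> drag \<delta> (rot s z)) * deriv_at a z z)"
    proof (rule integral_cong)
      fix s
      have "rot s z \<in> disc" using z by simp
      from rad [OF this] show "(norm (rot s z))\<^sup>2 * deriv_at a (rot s z) (drag \<delta> (rot s z)) =
          (rot s z \<bullet> drag \<delta> (rot s z)) * deriv_at a z z"
        by (simp only: equiv)
    qed
    also have "\<dots> = integral {0..2 * pi} (\<lambda>s. (rot s z \<bullet> drag \<delta> (rot s z))) * deriv_at a z z"
      by simp
    also have "integral {0..2 * pi} (\<lambda>s. (rot s z \<bullet> drag \<delta> (rot s z))) =
        circle_mean (\<lambda>z. deriv_at (\<lambda>z. 2 * \<delta> * snd z / (1 + fst z)) z (rot' z)) z"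
      unfolding circle_integral_def using inner_drag z by (intro integral_cong) simp
    also have "\<dots> = 0"
    proof (rule circle_mean_deriv_rot' [OF _ z])
      show "smooth_on disc (\<lambda>z. 2 * \<delta> * snd z / (1 + fst z))" using disc_fst by (intro smooth_intros) force+
    qed
    finally show ?thesis using False by simp
  qed
qed

text \<open>Two unknowns remove two parts of f. The invariant a fixes the mean: its drag derivative
  has mean zero (\<open>circle_mean_drag\<close>), so only m * decay * a counts, and its mean can be
  prescribed because m > 0 and decay is positive. What is left has mean zero and is a derivative
  along the rotation.\<close>

lemma homological_step:
  assumes f: "smooth_on disc f" and \<delta>: "\<delta> > 0" and m: "m > 0"
  obtains a g where "smooth_on disc a" "smooth_on disc g" "\<And>z. z \<in> disc \<Longrightarrow> deriv_at a z (rot' z) = 0"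
    "\<And>z. z \<in> disc \<Longrightarrow> f z + deriv_at a z (drag \<delta> z) - m * decay \<delta> z * a z + deriv_at g z (rot' z) = 0"
proof -
  define Q where "Q = circle_mean (decay \<delta>)"
  have Qs: "smooth_on disc Q" unfolding Q_def by (intro smooth_on_circle_mean smooth_on_decay)
  have Qpos: "0 < Q z" if z: "z \<in> disc" for z
  proof -
    have cont: "continuous_on {0..2 * pi} (\<lambda>s. 1 * decay \<delta> (rot s z))"
      by (intro circle_integrand_continuous' z smooth_on_imp_continuous_on smooth_on_decay continuous_intros)
    have pos: "0 < decay \<delta> (rot s z)" for s
      using disc_fst [of "rot s z"] z \<delta> by (simp add: decay_def)
    have "0 < integral (cbox 0 (2 * pi)) (\<lambda>s. 1 * decay \<delta> (rot s z))"
    proof (rule ccontr)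
      assume "\<not> ?thesis"
      moreover have "0 \<le> integral (cbox 0 (2 * pi)) (\<lambda>s. 1 * decay \<delta> (rot s z))"
        using pos by (intro integral_nonneg) (auto simp: less_imp_le intro: integrable_continuous_interval [OF cont, simplified])
      ultimately have "integral {0..2 * pi} (\<lambda>s. 1 * decay \<delta> (rot s z)) = 0" by simp
      then have "\<forall>s\<in>{0..2 * pi}. 1 * decay \<delta> (rot s z) = 0"
        using integral_eq_0_iff [OF cont] pos by (auto simp: less_imp_le)
      from bspec [OF this, of 0] show False using pos [of 0] by simp
    qed
    then show ?thesis by (simp add: Q_def circle_integral_def)
  qed
  \<comment> \<open>Obtained by averaging the required equation: mean f - m * Q * a = 0.\<close>
  define a where "a z = circle_mean f z / (m * Q z)" for z
  have as: "smooth_on disc a"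
    unfolding a_def [abs_def] using Qpos m by (intro smooth_intros smooth_on_circle_mean f Qs) force
  have inv: "a (rot s z) = a z" if z: "z \<in> disc" for s z
  proof -
    have "circle_mean h (rot s z) = circle_mean h z" if "smooth_on disc h" for h
      by (rule rot_invariant [OF smooth_on_circle_mean circle_mean_rot' z]) (use that in auto)
    from this [OF f] this [OF smooth_on_decay] show ?thesis by (simp add: a_def Q_def)
  qed
  have aR: "deriv_at a z (rot' z) = 0" if z: "z \<in> disc" for z
  proof -
    have "((\<lambda>s. a (rot s z)) has_vector_derivative deriv_at a (rot 0 z) (rot' (rot 0 z))) (at 0)"
      using has_vector_derivative_along_rot [OF as z, of 0 UNIV] by simp
    moreover have "((\<lambda>s. a (rot s z)) has_vector_derivative 0) (at 0)" by (simp add: inv [OF z])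
    ultimately show ?thesis using vector_derivative_unique_at by fastforce
  qed
  define \<phi> where "\<phi> z = f z + deriv_at a z (drag \<delta> z) - m * decay \<delta> z * a z" for z
  have ps: "smooth_on disc (\<lambda>z. deriv_at a z (drag \<delta> z))"
    by (intro smooth_on_deriv_at open_ball as smooth_on_drag)
  have \<phi>s: "smooth_on disc \<phi>"
    unfolding \<phi>_def [abs_def] by (intro smooth_intros f ps smooth_on_decay as)
  have mean: "circle_mean \<phi> z = 0" if z: "z \<in> disc" for z
  proof -
    have "circle_mean \<phi> z = circle_mean f z + circle_mean (\<lambda>z. deriv_at a z (drag \<delta> z)) z - circle_mean (\<lambda>z. a z * (m * decay \<delta> z)) z"
    proof -
      have "h \<in> {f, \<lambda>z. deriv_at a z (drag \<delta> z), \<lambda>z. a z * (m * decay \<delta> z)} \<Longrightarrow> (\<lambda>s. 1 * h (rot s z)) integrable_on {0..2 * pi}" for h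
        by (intro integrable_continuous_interval circle_integrand_continuous' continuous_intros z smooth_on_imp_continuous_on)
          (auto intro!: smooth_intros f ps smooth_on_decay as)
      then have "(\<lambda>s. f (rot s z)) integrable_on {0..2 * pi}" "(\<lambda>s. deriv_at a (rot s z) (drag \<delta> (rot s z))) integrable_on {0..2 * pi}"
         "(\<lambda>s. a (rot s z) * (m * decay \<delta> (rot s z))) integrable_on {0..2 * pi}" by force+
      then show ?thesis
        unfolding circle_integral_def \<phi>_def
        by (simp add: integral_diff integral_add integrable_add mult_ac)
    qed
    also have "\<dots> = circle_mean f z - a z * (m * Q z)"
    proof -
      have "circle_mean (\<lambda>z. a z * (m * decay \<delta> z)) z = a z * circle_mean (\<lambda>z. m * decay \<delta> z) z"
        by (rule circle_mean_invariant_mult) (rule inv [OF z])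
      moreover have "circle_mean (\<lambda>z. m * decay \<delta> z) z = m * Q z" by (simp add: Q_def circle_integral_def)
      ultimately show ?thesis using circle_mean_drag [OF as aR z] by simp
    qed
    also have "\<dots> = 0" using Qpos [OF z] m by (simp add: a_def)
    finally show ?thesis .
  qed
  \<comment> \<open>By \<open>circle_integral_rot'\<close> with weight s, the derivative of G along
    the rotation is 2 pi \<phi> minus the mean of \<phi>, which is 0.\<close>
  define G where "G = circle_integral (\<lambda>s. s) \<phi>"
  have Gs: "smooth_on disc G" unfolding G_def by (intro smooth_on_circle_integral \<phi>s continuous_intros)
  have GR: "deriv_at G z (rot' z) = 2 * pi * \<phi> z" if z: "z \<in> disc" for z
    unfolding G_def using circle_integral_rot' [OF \<phi>s z, of "\<lambda>s. s" "\<lambda>s. 1"] mean [OF z] by simp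
  define g where "g z = (- 1 / (2 * pi)) * G z" for z
  have gs: "smooth_on disc g" unfolding g_def [abs_def] by (intro smooth_intros Gs)
  have gR: "deriv_at g z (rot' z) = - \<phi> z" if z: "z \<in> disc" for z
  proof -
    have "(g has_derivative (\<lambda>w. (- 1 / (2 * pi)) * deriv_at G z w)) (at z)"
      unfolding g_def [abs_def]
      by (intro has_derivative_mult_right smooth_on_open_has_derivative [OF open_ball Gs z])
    from frechet_derivative_at [OF this, symmetric] show ?thesis using GR [OF z] by simp
  qed
  show thesis by (rule that [OF as gs aR]) (simp_all add: gR \<phi>_def)
qed

section \<open>Normal form of the energy to arbitrary order in l\<close>

definition fld :: "real \<Rightarrow> real \<times> real \<times> real \<Rightarrow> real \<times> real \<times> real" where
  "fld \<delta> = (\<lambda>(x, y, l). (y - 2 * \<delta> * l ^ 3 / (1 + x), - x - 2 * \<delta> * y * l ^ 3 / (1 + x) ^ 2, - \<delta> * l ^ 4 / (1 + x) ^ 2))"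

definition energy :: "real \<times> real \<times> real \<Rightarrow> real" where
  "energy = (\<lambda>(x, y, l). (x ^ 2 + y ^ 2) / 2)"

definition cylinder :: "(real \<times> real \<times> real) set" where
  "cylinder = {(x, y, l). (x, y) \<in> disc}"

abbreviation plane :: "real \<times> real \<times> real \<Rightarrow> real \<times> real" where
  "plane p \<equiv> (fst p, fst (snd p))"

abbreviation lev :: "real \<times> real \<times> real \<Rightarrow> real" where
  "lev p \<equiv> snd (snd p)"

lemma mem_cylinder: "p \<in> cylinder \<longleftrightarrow> plane p \<in> disc"
  by (cases p) (simp add: cylinder_def)

lemma open_cylinder: "open cylinder"
proof -
  have "cylinder = plane -` disc" using mem_cylinder by auto
  moreover have "open (plane -` disc)"
    by (intro open_vimage open_ball continuous_intros)
  ultimately show ?thesis by simp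
qed

lemma smooth_on_plane_compose: "smooth_on disc g \<Longrightarrow> smooth_on cylinder (\<lambda>p. g (plane p))"
  by (rule smooth_on_compose [where T = disc]) (auto intro!: smooth_intros simp: mem_cylinder)

text \<open>Order bookkeeping: a term l^m g contributes at order m through the rotation, and at
  order m + 3 through the drag and the decay of l^m. Corrections therefore advance in steps of
  three.\<close>

lemma deriv_power_mult:
  assumes g: "smooth_on disc g" and p: "p \<in> cylinder"
  shows "\<exists>D. ((\<lambda>p. lev p ^ m * g (plane p)) has_derivative D) (at p) \<and>
    D (fld \<delta> p) = lev p ^ m * deriv_at g (plane p) (rot' (plane p))
      + lev p ^ (m + 3) * (deriv_at g (plane p) (drag \<delta> (plane p)) - real m * decay \<delta> (plane p) * g (plane p))"
proof -
  have z: "plane p \<in> disc" using p by (simp add: mem_cylinder)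
  have gd: "(g has_derivative deriv_at g (plane p)) (at (plane p))"
    by (rule smooth_on_open_has_derivative [OF open_ball g z])
  have "((\<lambda>p. plane p) has_derivative (\<lambda>w. plane w)) (at p)"
    by (auto intro!: derivative_eq_intros)
  from has_derivative_compose [OF this gd]
  have 1: "((\<lambda>p. g (plane p)) has_derivative (\<lambda>w. deriv_at g (plane p) (plane w))) (at p)" .
  have 2: "((\<lambda>p. lev p ^ m) has_derivative (\<lambda>w. of_nat m * lev w * lev p ^ (m - 1))) (at p)"
    by (auto intro!: derivative_eq_intros)
  have dec: "plane (fld \<delta> p) = rot' (plane p) + lev p ^ 3 *\<^sub>R drag \<delta> (plane p)"
    by (cases p) (simp add: fld_def rot'_def drag_def)
  have lin: "linear (deriv_at g (plane p))" using gd has_derivative_linear by blast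
  have "real m * lev (fld \<delta> p) * lev p ^ (m - 1) = - (lev p ^ (m + 3) * (real m * decay \<delta> (plane p)))"
  proof (cases m)
    case (Suc k)
    have "lev p ^ 4 * lev p ^ k = lev p ^ (m + 3)" by (simp add: Suc power_add [symmetric] eval_nat_numeral)
    then show ?thesis unfolding Suc by (cases p) (simp add: fld_def decay_def field_simps)
  qed simp
  then have "lev p ^ m * deriv_at g (plane p) (plane (fld \<delta> p)) + real m * lev (fld \<delta> p) * lev p ^ (m - 1) * g (plane p)
    = lev p ^ m * deriv_at g (plane p) (rot' (plane p))
      + lev p ^ (m + 3) * (deriv_at g (plane p) (drag \<delta> (plane p)) - real m * decay \<delta> (plane p) * g (plane p))"
    unfolding dec using lin by (simp add: linear_add linear_scale power_add algebra_simps)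
  then show ?thesis using has_derivative_mult [OF 2 1]
    by (intro exI [of _ "\<lambda>w. lev p ^ m * deriv_at g (plane p) (plane w) + of_nat m * lev w * lev p ^ (m - 1) * g (plane p)"] conjI)
      simp_all
qed

text \<open>The invariant term a enters at order 3n - 3, where the rotation annihilates it, so that
  it acts at order 3n together with the rotational derivative of l^(3n) g. The induction starts at n
  = 2: at order 3 the invariant term would carry l^0 and have no decay to work with, and the mean
  vanishes there only by \<open>inner_drag\<close>.\<close>

theorem normal_form:
  assumes \<delta>: "\<delta> > 0" and n: "n \<ge> 2"
  shows "\<exists>e f. smooth_on cylinder e \<and> smooth_on disc f \<and>
    (\<forall>p\<in>cylinder. \<exists>D. ((\<lambda>p. energy p + lev p ^ 3 * e p) has_derivative D) (at p) \<and>
      D (fld \<delta> p) = lev p ^ (3 * n) * f (plane p))"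
  using n
proof (induction n rule: dec_induct)
  case base
  \<comment> \<open>Minus the function from \<open>inner_drag\<close>, so that l^3 g cancels the
    change of energy at order l^3.\<close>
  define g where "g z = - (2 * \<delta> * snd z / (1 + fst z))" for z :: "real \<times> real"
  have g0: "smooth_on disc (\<lambda>z. 2 * \<delta> * snd z / (1 + fst z))" using disc_fst by (intro smooth_intros) force+
  then have g: "smooth_on disc g" unfolding g_def [abs_def] by (rule smooth_on_uminus)
  define f where "f z = deriv_at g z (drag \<delta> z) - 3 * decay \<delta> z * g z" for z
  have f: "smooth_on disc f"
    unfolding f_def [abs_def] by (intro smooth_intros smooth_on_deriv_at open_ball g smooth_on_drag smooth_on_decay)
  have "\<exists>D. ((\<lambda>p. energy p + lev p ^ 3 * g (plane p)) has_derivative D) (at p) \<and> D (fld \<delta> p) = lev p ^ (3 * 2) * f (plane p)"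
    if p: "p \<in> cylinder" for p
  proof -
    have z: "plane p \<in> disc" using p by (simp add: mem_cylinder)
    obtain D where D: "((\<lambda>p. lev p ^ 3 * g (plane p)) has_derivative D) (at p)"
      "D (fld \<delta> p) = lev p ^ 3 * deriv_at g (plane p) (rot' (plane p)) + lev p ^ 6 * f (plane p)"
      using deriv_power_mult [OF g p, of 3 \<delta>] unfolding f_def by auto
    have "deriv_at g (plane p) (rot' (plane p)) = - (plane p \<bullet> drag \<delta> (plane p))"
    proof -
      have "(g has_derivative (\<lambda>w. - deriv_at (\<lambda>z. 2 * \<delta> * snd z / (1 + fst z)) (plane p) w)) (at (plane p))"
        unfolding g_def [abs_def] by (intro has_derivative_minus smooth_on_open_has_derivative [OF open_ball g0 z])
      from frechet_derivative_at [OF this, symmetric] show ?thesis using inner_drag [OF z] by simp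
    qed
    moreover have "(energy has_derivative (\<lambda>w. plane p \<bullet> plane w)) (at p)"
      unfolding energy_def split_def by (auto intro!: derivative_eq_intros)
    moreover have "plane p \<bullet> plane (fld \<delta> p) = lev p ^ 3 * (plane p \<bullet> drag \<delta> (plane p))"
      by (cases p) (simp add: fld_def drag_def algebra_simps)
    ultimately show ?thesis
      using D by (intro exI [of _ "\<lambda>w. plane p \<bullet> plane w + D w"] conjI has_derivative_add) simp_all
  qed
  then show ?case using smooth_on_plane_compose [OF g] f by blast
next
  case (step n)
  then obtain e f where e: "smooth_on cylinder e" and f: "smooth_on disc f" and
    ef: "\<And>p. p \<in> cylinder \<Longrightarrow> \<exists>D. ((\<lambda>p. energy p + lev p ^ 3 * e p) has_derivative D) (at p) \<and>
      D (fld \<delta> p) = lev p ^ (3 * n) * f (plane p)" by blast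
  obtain k where k: "n = Suc (Suc k)" using le_Suc_ex [OF step(1)] by auto
  \<comment> \<open>This is 3n - 3, positive because n is at least 2.\<close>
  let ?m = "3 * Suc k"
  have m: "0 < real ?m" by simp
  obtain a g where a: "smooth_on disc a" and g: "smooth_on disc g"
    and aR: "\<And>z. z \<in> disc \<Longrightarrow> deriv_at a z (rot' z) = 0"
    and eq: "\<And>z. z \<in> disc \<Longrightarrow> f z + deriv_at a z (drag \<delta> z) - real ?m * decay \<delta> z * a z + deriv_at g z (rot' z) = 0"
    by (rule homological_step [OF f \<delta> m]) blast
  define f1 where "f1 z = deriv_at g z (drag \<delta> z) - real (3 * n) * decay \<delta> z * g z" for z
  have f1: "smooth_on disc f1"
    unfolding f1_def [abs_def] by (intro smooth_intros smooth_on_deriv_at open_ball g smooth_on_drag smooth_on_decay)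
  define e1 where "e1 p = e p + lev p ^ (3 * k) * a (plane p) + lev p ^ (?m) * g (plane p)" for p
  have e1: "smooth_on cylinder e1"
    unfolding e1_def [abs_def] by (intro smooth_intros e smooth_on_plane_compose a g)
  have "\<exists>D. ((\<lambda>p. energy p + lev p ^ 3 * e1 p) has_derivative D) (at p) \<and> D (fld \<delta> p) = lev p ^ (3 * Suc n) * f1 (plane p)"
    if p: "p \<in> cylinder" for p
  proof -
    have z: "plane p \<in> disc" using p by (simp add: mem_cylinder)
    obtain D0 where D0: "((\<lambda>p. energy p + lev p ^ 3 * e p) has_derivative D0) (at p)"
      "D0 (fld \<delta> p) = lev p ^ (3 * n) * f (plane p)" using ef [OF p] by blast
    obtain D1 where D1: "((\<lambda>p. lev p ^ ?m * a (plane p)) has_derivative D1) (at p)"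
      "D1 (fld \<delta> p) = lev p ^ ?m * deriv_at a (plane p) (rot' (plane p))
      + lev p ^ (?m + 3) * (deriv_at a (plane p) (drag \<delta> (plane p)) - real ?m * decay \<delta> (plane p) * a (plane p))"
      using deriv_power_mult [OF a p] by blast
    obtain D2 where D2: "((\<lambda>p. lev p ^ (3 * n) * g (plane p)) has_derivative D2) (at p)"
      "D2 (fld \<delta> p) = lev p ^ (3 * n) * deriv_at g (plane p) (rot' (plane p))
      + lev p ^ (3 * n + 3) * (deriv_at g (plane p) (drag \<delta> (plane p)) - real (3 * n) * decay \<delta> (plane p) * g (plane p))"
      using deriv_power_mult [OF g p] by blast
    have "(\<lambda>p. energy p + lev p ^ 3 * e1 p) =
      (\<lambda>p. (energy p + lev p ^ 3 * e p) + lev p ^ ?m * a (plane p) + lev p ^ (3 * n) * g (plane p))"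
      by (simp add: e1_def k fun_eq_iff power_add algebra_simps eval_nat_numeral)
    then have "((\<lambda>p. energy p + lev p ^ 3 * e1 p) has_derivative (\<lambda>w. D0 w + D1 w + D2 w)) (at p)"
      using has_derivative_add [OF has_derivative_add [OF D0(1) D1(1)] D2(1)] by simp
    moreover have "D0 (fld \<delta> p) + D1 (fld \<delta> p) + D2 (fld \<delta> p) = lev p ^ (3 * Suc n) * f1 (plane p)"
    proof -
      have e: "?m + 3 = 3 * n" "3 * Suc n = 3 * n + 3" by (simp_all add: k)
      have "D0 (fld \<delta> p) + D1 (fld \<delta> p) + D2 (fld \<delta> p) =
        lev p ^ (3 * n) * (f (plane p) + deriv_at a (plane p) (drag \<delta> (plane p)) - real ?m * decay \<delta> (plane p) * a (plane p)
          + deriv_at g (plane p) (rot' (plane p))) + lev p ^ (3 * Suc n) * f1 (plane p)"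
        unfolding D0(2) D1(2) D2(2) aR [OF z] f1_def e by (simp add: distrib_left right_diff_distrib)
      then show ?thesis unfolding eq [OF z] by simp
    qed
    ultimately show ?thesis by (intro exI [of _ "\<lambda>w. D0 w + D1 w + D2 w"]) simp
  qed
  then show ?case using e1 f1 by blast
qed

section \<open>The field in Binet coordinates\<close>

definition fld' :: "real \<Rightarrow> real \<times> real \<times> real \<Rightarrow> real \<times> real \<times> real \<Rightarrow> real \<times> real \<times> real" where
  "fld' \<delta> = (\<lambda>(x, y, l) (a, b, c). let u = inverse (1 + x) in
     (b - 6 * \<delta> * l ^ 2 * c * u + 2 * \<delta> * l ^ 3 * u ^ 2 * a,
      - a - 2 * \<delta> * b * l ^ 3 * u ^ 2 - 6 * \<delta> * y * l ^ 2 * c * u ^ 2 + 4 * \<delta> * y * l ^ 3 * u ^ 3 * a,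
      - 4 * \<delta> * l ^ 3 * c * u ^ 2 + 2 * \<delta> * l ^ 4 * u ^ 3 * a))"

text \<open>The condition r > 0 in terms of x = 1/r - 1.\<close>

definition binet_dom :: "(real \<times> real \<times> real) set" where
  "binet_dom = {p. 0 < 1 + fst p}"

lemma open_binet_dom: "open binet_dom"
  unfolding binet_dom_def by (intro open_Collect_less continuous_intros)

lemma fld_alt: "fld \<delta> p = (fst (snd p) - 2 * \<delta> * lev p ^ 3 * inverse (1 + fst p),
    - fst p - 2 * \<delta> * fst (snd p) * lev p ^ 3 * inverse (1 + fst p) ^ 2, - \<delta> * lev p ^ 4 * inverse (1 + fst p) ^ 2)"
  by (cases p) (simp add: fld_def divide_inverse power_inverse)

lemma fld'_alt: "fld' \<delta> p w =
     (fst (snd w) - 6 * \<delta> * lev p ^ 2 * lev w * inverse (1 + fst p) + 2 * \<delta> * lev p ^ 3 * inverse (1 + fst p) ^ 2 * fst w,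
      - fst w - 2 * \<delta> * fst (snd w) * lev p ^ 3 * inverse (1 + fst p) ^ 2 - 6 * \<delta> * fst (snd p) * lev p ^ 2 * lev w * inverse (1 + fst p) ^ 2
        + 4 * \<delta> * fst (snd p) * lev p ^ 3 * inverse (1 + fst p) ^ 3 * fst w,
      - 4 * \<delta> * lev p ^ 3 * lev w * inverse (1 + fst p) ^ 2 + 2 * \<delta> * lev p ^ 4 * inverse (1 + fst p) ^ 3 * fst w)"
  by (cases p; cases w) (simp add: fld'_def Let_def)

lemma fld_has_derivative:
  assumes "p \<in> binet_dom"
  shows "(fld \<delta> has_derivative fld' \<delta> p) (at p)"
proof -
  have nz: "1 + fst p \<noteq> 0" using assms by (simp add: binet_dom_def)
  let ?u = "inverse (1 + fst p)"
  have u: "((\<lambda>p. inverse (1 + fst p)) has_derivative (\<lambda>w. - (?u ^ 2 * fst w))) (at p)"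
    using nz by (auto intro!: derivative_eq_intros simp: power2_eq_square)
  have u2: "((\<lambda>p. inverse (1 + fst p) ^ 2) has_derivative (\<lambda>w. - (2 * ?u ^ 3 * fst w))) (at p)"
    using has_derivative_mult [OF u u] by (simp add: power2_eq_square power3_eq_cube algebra_simps)
  have x: "(fst has_derivative fst) (at p)" and y: "((\<lambda>p. fst (snd p)) has_derivative (\<lambda>w. fst (snd w))) (at p)"
    by (auto intro!: derivative_eq_intros)
  have l3: "((\<lambda>p. lev p ^ 3) has_derivative (\<lambda>w. 3 * lev p ^ 2 * lev w)) (at p)"
    and l4: "((\<lambda>p. lev p ^ 4) has_derivative (\<lambda>w. 4 * lev p ^ 3 * lev w)) (at p)"
    by (auto intro!: derivative_eq_intros)
  have 1: "((\<lambda>p. fst (snd p) - 2 * \<delta> * lev p ^ 3 * inverse (1 + fst p)) has_derivative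
      (\<lambda>w. fst (fld' \<delta> p w))) (at p)"
    by (rule has_derivative_eq_rhs [OF has_derivative_diff [OF y has_derivative_mult [OF has_derivative_mult_right [OF l3, of "2 * \<delta>"] u]]])
      (simp add: fld'_alt fun_eq_iff algebra_simps)
  have 2: "((\<lambda>p. - fst p - 2 * \<delta> * fst (snd p) * lev p ^ 3 * inverse (1 + fst p) ^ 2) has_derivative
      (\<lambda>w. fst (snd (fld' \<delta> p w)))) (at p)"
    by (rule has_derivative_eq_rhs [OF has_derivative_diff [OF has_derivative_minus [OF x]
        has_derivative_mult [OF has_derivative_mult [OF has_derivative_mult_right [OF y, of "2 * \<delta>"] l3] u2]]])
      (simp add: fld'_alt fun_eq_iff algebra_simps)
  have 3: "((\<lambda>p. - \<delta> * lev p ^ 4 * inverse (1 + fst p) ^ 2) has_derivative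
      (\<lambda>w. lev (fld' \<delta> p w))) (at p)"
    by (rule has_derivative_eq_rhs [OF has_derivative_mult [OF has_derivative_mult_right [OF l4, of "- \<delta>"] u2]])
      (simp add: fld'_alt fun_eq_iff algebra_simps)
  have "fld \<delta> = (\<lambda>p. (fst (snd p) - 2 * \<delta> * lev p ^ 3 * inverse (1 + fst p),
    - fst p - 2 * \<delta> * fst (snd p) * lev p ^ 3 * inverse (1 + fst p) ^ 2, - \<delta> * lev p ^ 4 * inverse (1 + fst p) ^ 2))"
    by (rule ext) (rule fld_alt)
  then show ?thesis using has_derivative_Pair [OF 1 has_derivative_Pair [OF 2 3]] by simp
qed

lemma smooth_on_fld': "smooth_on binet_dom (\<lambda>p. fld' \<delta> p w)"
  unfolding fld'_alt by (intro smooth_intros) (auto simp: binet_dom_def)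

text \<open>Compact convex sets exhausting the part of \<open>binet_dom\<close> with l \<ge> 0. The
  single constant C bounds all coordinates and also keeps 1 + x at least 1/C.\<close>

definition Box :: "real \<Rightarrow> (real \<times> real \<times> real) set" where
  "Box C = {1 / C - 1 .. C} \<times> {-C..C} \<times> {0..C}"

lemma Box: "compact (Box C)" "convex (Box C)"
  unfolding Box_def by (auto intro!: compact_Times convex_Times)

lemma Box_subset_binet_dom: "0 < C \<Longrightarrow> Box C \<subseteq> binet_dom"
  by (force simp: Box_def binet_dom_def intro: less_le_trans [of 0 "1 / C"])

lemma Box_mono:
  assumes "0 < C" "C \<le> D" shows "Box C \<subseteq> Box D"
proof -
  have "1 / D \<le> 1 / C" using assms by (simp add: frac_le)
  then show ?thesis using assms unfolding Box_def by auto
qed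

lemma Box_D:
  assumes "p \<in> Box C" "1 \<le> C"
  shows "0 < inverse (1 + fst p)" "inverse (1 + fst p) \<le> C" "1 / (C + 1) ^ 2 \<le> inverse (1 + fst p) ^ 2"
    "\<bar>fst (snd p)\<bar> \<le> C" "0 \<le> lev p" "lev p \<le> C"
proof -
  have C: "0 < 1 / C" using assms(2) by simp
  have p: "1 / C \<le> 1 + fst p" "1 + fst p \<le> C + 1" using assms(1) by (auto simp: Box_def)
  then have pos: "0 < 1 + fst p" using C by linarith
  then show "0 < inverse (1 + fst p)" by simp
  have "inverse (1 + fst p) \<le> inverse (1 / C)" using p C by (intro le_imp_inverse_le)
  then show "inverse (1 + fst p) \<le> C" by simp
  have "inverse (C + 1) \<le> inverse (1 + fst p)" using p pos by (intro le_imp_inverse_le)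
  then have "inverse (C + 1) ^ 2 \<le> inverse (1 + fst p) ^ 2" using assms(2) by (intro power_mono) auto
  then show "1 / (C + 1) ^ 2 \<le> inverse (1 + fst p) ^ 2" by (simp add: power_inverse divide_inverse)
qed (use assms in \<open>auto simp: Box_def\<close>)

section \<open>Growth of the linearized system\<close>

lemma mult_le_of_abs_le:
  fixes k p c q :: real
  assumes "\<bar>k\<bar> \<le> c" "\<bar>p\<bar> \<le> q" shows "k * p \<le> c * q"
proof -
  have "k * p \<le> \<bar>k\<bar> * \<bar>p\<bar>" by (simp add: abs_mult [symmetric])
  also have "\<dots> \<le> c * q" using assms by (intro mult_mono) auto
  finally show ?thesis .
qed

lemma abs_mult_le_square_sum:
  fixes a b :: real shows "\<bar>a * b\<bar> \<le> a\<^sup>2 + b\<^sup>2"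
proof -
  have "0 \<le> \<bar>a\<bar> * \<bar>b\<bar>" by simp
  moreover have "2 * (\<bar>a\<bar> * \<bar>b\<bar>) \<le> a\<^sup>2 + b\<^sup>2" using sum_squares_bound [of "\<bar>a\<bar>" "\<bar>b\<bar>"] by simp
  ultimately show ?thesis unfolding abs_mult by linarith
qed

text \<open>In the norm \<open>y\<^sub>1\<^sup>2 + y\<^sub>2\<^sup>2 + (y\<^sub>3/l)\<^sup>2\<close> the linearized system is a rotation up to \<open>O(l\<^sup>3)\<close>,
  while \<open>l\<close> itself decays like \<open>l' = - O(l\<^sup>3) l\<close>; hence the growth is at most a power of \<open>1/l\<close>.\<close>

lemma linearized_growth_rate:
  fixes A B E u y l \<delta> C b1 b2 b3 :: real
  assumes \<delta>: "\<delta> > 0" and C: "C \<ge> 1" and u: "0 < u" "u \<le> C" and y: "\<bar>y\<bar> \<le> C" and l: "0 < l"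
  defines "q \<equiv> A\<^sup>2 + B\<^sup>2 + E\<^sup>2"
  shows "2 * A * (B - 6 * \<delta> * l ^ 2 * (l * E) * u + 2 * \<delta> * l ^ 3 * u ^ 2 * A + b1)
     + 2 * B * (- A - 2 * \<delta> * B * l ^ 3 * u ^ 2 - 6 * \<delta> * y * l ^ 2 * (l * E) * u ^ 2 + 4 * \<delta> * y * l ^ 3 * u ^ 3 * A + b2)
     + 2 * E * ((- 4 * \<delta> * l ^ 3 * (l * E) * u ^ 2 + 2 * \<delta> * l ^ 4 * u ^ 3 * A + b3) / l + E * (\<delta> * l ^ 3 * u ^ 2))
    \<le> (2 * \<delta> * (6 * C + 4 * C ^ 2 + 6 * C ^ 3 + 4 * C ^ 4 + 3 * C ^ 2 + 2 * C ^ 3) + 1) * l ^ 3 * q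
      + (b1\<^sup>2 + b2\<^sup>2 + (b3 / l)\<^sup>2) / l ^ 3"
proof -
  have q: "\<bar>E * A\<bar> \<le> q" "\<bar>A * B\<bar> \<le> q" "\<bar>E * B\<bar> \<le> q" "\<bar>A * A\<bar> \<le> q" "\<bar>B * B\<bar> \<le> q" "\<bar>E * E\<bar> \<le> q"
    unfolding q_def using abs_mult_le_square_sum [of E A] abs_mult_le_square_sum [of A B] abs_mult_le_square_sum [of E B]
    by (auto simp: power2_eq_square [symmetric] intro: order_trans)
  have up: "\<bar>u\<bar> \<le> C" "\<bar>u ^ k\<bar> \<le> C ^ k" for k using u by (auto intro: power_mono)
  have yu: "\<bar>y * u ^ k\<bar> \<le> C ^ Suc k" for k
    using mult_mono [OF y up(2) [of k]] C by (simp add: abs_mult)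
  have t: "(- 6 * u) * (E * A) \<le> (6 * C) * q" "(2 * u ^ 2) * (A * A) \<le> (2 * C ^ 2) * q"
    "(- 2 * u ^ 2) * (B * B) \<le> (2 * C ^ 2) * q" "(- 6 * (y * u ^ 2)) * (E * B) \<le> (6 * C ^ 3) * q"
    "(4 * (y * u ^ 3)) * (A * B) \<le> (4 * C ^ 4) * q" "(- 3 * u ^ 2) * (E * E) \<le> (3 * C ^ 2) * q"
    "(2 * u ^ 3) * (E * A) \<le> (2 * C ^ 3) * q"
    using up(1) up(2) [of 2] up(2) [of 3] yu [of 2] yu [of 3]
    by (intro mult_le_of_abs_le q; simp add: abs_mult eval_nat_numeral)+
  \<comment> \<open>The rotation drops out since 2 A B - 2 B A = 0. The coefficient - 3 of E E is -
    4 from the field plus 1 from differentiating the factor 1/l in E.\<close>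
  define br where "br = (- 6 * u) * (E * A) + (2 * u ^ 2) * (A * A) + (- 2 * u ^ 2) * (B * B) + (- 6 * (y * u ^ 2)) * (E * B)
    + (4 * (y * u ^ 3)) * (A * B) + (- 3 * u ^ 2) * (E * E) + (2 * u ^ 3) * (E * A)"
  have br: "br \<le> (6 * C + 4 * C ^ 2 + 6 * C ^ 3 + 4 * C ^ 4 + 3 * C ^ 2 + 2 * C ^ 3) * q"
  proof -
    have "(6 * C + 4 * C ^ 2 + 6 * C ^ 3 + 4 * C ^ 4 + 3 * C ^ 2 + 2 * C ^ 3) * q =
      (6 * C) * q + (2 * C ^ 2) * q + (2 * C ^ 2) * q + (6 * C ^ 3) * q + (4 * C ^ 4) * q + (3 * C ^ 2) * q + (2 * C ^ 3) * q"
      by (simp add: distrib_right)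
    then show ?thesis unfolding br_def using t by linarith
  qed
  \<comment> \<open>Young's inequality with weight l^3, so that the forcing adds to the quadratic
    part nothing larger than the drag already does.\<close>
  have pt: "2 * a * b \<le> l ^ 3 * a\<^sup>2 + b\<^sup>2 / l ^ 3" for a b :: real
  proof -
    have "0 \<le> (l ^ 3 * a - b)\<^sup>2 / l ^ 3" using l by simp
    also have "\<dots> = l ^ 3 * a\<^sup>2 + b\<^sup>2 / l ^ 3 - 2 * a * b"
      using l by (simp add: field_simps power2_eq_square)
    finally show ?thesis by simp
  qed
  have "2 * A * (B - 6 * \<delta> * l ^ 2 * (l * E) * u + 2 * \<delta> * l ^ 3 * u ^ 2 * A + b1)
     + 2 * B * (- A - 2 * \<delta> * B * l ^ 3 * u ^ 2 - 6 * \<delta> * y * l ^ 2 * (l * E) * u ^ 2 + 4 * \<delta> * y * l ^ 3 * u ^ 3 * A + b2)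
     + 2 * E * ((- 4 * \<delta> * l ^ 3 * (l * E) * u ^ 2 + 2 * \<delta> * l ^ 4 * u ^ 3 * A + b3) / l + E * (\<delta> * l ^ 3 * u ^ 2))
    = (2 * \<delta> * l ^ 3) * br + (2 * A * b1 + 2 * B * b2 + 2 * E * (b3 / l))"
    unfolding br_def using l by (simp add: field_simps power2_eq_square power3_eq_cube power4_eq_xxxx)
  also have "\<dots> \<le> (2 * \<delta> * l ^ 3) * ((6 * C + 4 * C ^ 2 + 6 * C ^ 3 + 4 * C ^ 4 + 3 * C ^ 2 + 2 * C ^ 3) * q)
    + ((l ^ 3 * A\<^sup>2 + b1\<^sup>2 / l ^ 3) + (l ^ 3 * B\<^sup>2 + b2\<^sup>2 / l ^ 3) + (l ^ 3 * E\<^sup>2 + (b3 / l)\<^sup>2 / l ^ 3))"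
    using \<delta> l by (intro add_mono mult_left_mono br pt) auto
  also have "\<dots> = (2 * \<delta> * (6 * C + 4 * C ^ 2 + 6 * C ^ 3 + 4 * C ^ 4 + 3 * C ^ 2 + 2 * C ^ 3) + 1) * l ^ 3 * q
      + (b1\<^sup>2 + b2\<^sup>2 + (b3 / l)\<^sup>2) / l ^ 3"
    unfolding q_def by (simp add: algebra_simps add_divide_distrib)
  finally show ?thesis .
qed

lemma component_derivatives:
  fixes y :: "real \<Rightarrow> real \<times> real \<times> real"
  assumes "(y has_vector_derivative d) (at t within S)"
  shows "((\<lambda>t. fst (y t)) has_real_derivative fst d) (at t within S)"
    "((\<lambda>t. fst (snd (y t))) has_real_derivative fst (snd d)) (at t within S)"
    "((\<lambda>t. lev (y t)) has_real_derivative lev d) (at t within S)"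
proof -
  note fst' = bounded_linear.has_vector_derivative [OF bounded_linear_fst]
  note snd' = bounded_linear.has_vector_derivative [OF bounded_linear_snd]
  show "((\<lambda>t. fst (y t)) has_real_derivative fst d) (at t within S)"
    "((\<lambda>t. fst (snd (y t))) has_real_derivative fst (snd d)) (at t within S)"
    "((\<lambda>t. lev (y t)) has_real_derivative lev d) (at t within S)"
    using fst' [OF assms] fst' [OF snd' [OF assms]] snd' [OF snd' [OF assms]]
    by (simp_all add: has_real_derivative_iff_has_vector_derivative)
qed

lemma norm_triple: "(norm (p :: real \<times> real \<times> real))\<^sup>2 = (fst p)\<^sup>2 + (fst (snd p))\<^sup>2 + (lev p)\<^sup>2"
  by (cases p) (simp add: norm_Pair)

lemma rescaled_norm_le:
  fixes a b c l :: real
  shows "a\<^sup>2 + b\<^sup>2 + (c / l)\<^sup>2 \<le> (a\<^sup>2 + b\<^sup>2 + c\<^sup>2) * (1 + 1 / l\<^sup>2)"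
proof -
  have "(a\<^sup>2 + b\<^sup>2 + c\<^sup>2) * (1 + 1 / l\<^sup>2) = a\<^sup>2 + b\<^sup>2 + (c / l)\<^sup>2 + (c\<^sup>2 + (a\<^sup>2 + b\<^sup>2) / l\<^sup>2)"
    by (simp add: power_divide algebra_simps add_divide_distrib)
  then show ?thesis by simp
qed

text \<open>A factor X^4 is kept aside to be compared with - l', which has that order. The exponents
  lose 3 from the division, 4 for this factor, and 2 more in the term with 1/X^2.\<close>

lemma powr_split:
  fixes X b :: real
  assumes X: "0 < X"
  shows "X powr b * (1 + 1 / X\<^sup>2) / X ^ 3 * X ^ m = X powr (b + real m - 7) * X ^ 4 + X powr (b + real m - 9) * X ^ 4"
proof -
  have e: "X powr (b + real m - 7) = X powr b * X ^ m / X ^ 7" "X powr (b + real m - 9) = X powr b * X ^ m / X ^ 9"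
    using X by (simp_all add: powr_diff powr_add powr_realpow)
  define P where "P = X powr b * X ^ m"
  have "X powr b * (1 + 1 / X\<^sup>2) / X ^ 3 * X ^ m = P * (1 + 1 / X\<^sup>2) / X ^ 3" by (simp add: P_def)
  also have "\<dots> = P / X ^ 7 * X ^ 4 + P / X ^ 9 * X ^ 4"
    using X by (simp add: field_simps flip: power_add)
  finally show ?thesis unfolding e P_def .
qed

text \<open>The weighted square norm q of y grows at rate at most K l^3, and l decays at relative
  rate at least \<delta> l^3 / (C + 1)^2. Hence q l^m stops growing once m is large, and adding a
  multiple of l absorbs the forcing. The bound depends only on the constants, not on the
  trajectory.\<close>

lemma linearized_growth:
  assumes \<delta>: "\<delta> > 0" and C: "C \<ge> 1"
  shows "\<exists>C' a'. \<forall>\<xi> \<beta> y. ode_sol (\<lambda>t. fld \<delta>) \<xi> \<and> (\<forall>t\<ge>0. \<xi> t \<in> Box C \<and> 0 < lev (\<xi> t)) \<and>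
    ode_sol (\<lambda>t u. fld' \<delta> (\<xi> t) u + \<beta> t) y \<and> norm (y 0) \<le> c \<and> (\<forall>t\<ge>0. norm (\<beta> t) \<le> Cb * lev (\<xi> t) powr a)
    \<longrightarrow> (\<forall>t\<ge>0. norm (y t) \<le> C' * lev (\<xi> t) powr a')"
proof -
  define K where "K = 2 * \<delta> * (6 * C + 4 * C ^ 2 + 6 * C ^ 3 + 4 * C ^ 4 + 3 * C ^ 2 + 2 * C ^ 3) + 1"
  have K: "K \<ge> 0" using \<delta> C by (simp add: K_def)
  \<comment> \<open>The first condition lets the decay of l^m beat the growth K. The next two make
    the exponents from \<open>powr_split\<close> nonnegative, so that powers of l are bounded by
    powers of C; m at least 2 serves the initial value, where E contains 1/l.\<close>
  obtain m :: nat where m: "real m \<ge> K * (C + 1) ^ 2 / \<delta>" "real m \<ge> 9 - 2 * a" "real m \<ge> 7 - 2 * a" "m \<ge> 2"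
  proof -
    obtain m :: nat where "real m \<ge> max (max (K * (C + 1) ^ 2 / \<delta>) (9 - 2 * a)) 2" using real_arch_simple by blast
    then show thesis by (intro that [of m]) auto
  qed
  define D where "D = Cb\<^sup>2 * (C powr (2 * a + real m - 7) + C powr (2 * a + real m - 9))"
  have D: "0 \<le> D" by (simp add: D_def)
  \<comment> \<open>Since the squared inverse of 1 + x is at least 1 / (C + 1)^2, the multiple D' *
    l decreases at least at rate D l^4, the size of the forcing.\<close>
  define D' where "D' = D * (C + 1) ^ 2 / \<delta>"
  have D': "0 \<le> D'" using D \<delta> by (simp add: D'_def)
  define V where "V = c\<^sup>2 * (C ^ m + C ^ (m - 2)) + D' * C"
  have V: "0 \<le> V" using D' C by (simp add: V_def)
  show ?thesis
  proof (rule exI [of _ "sqrt ((1 + C\<^sup>2) * V)"], rule exI [of _ "- real m / 2"], intro allI impI)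
    fix \<xi> \<beta> y and t0 :: real
    assume "ode_sol (\<lambda>t. fld \<delta>) \<xi> \<and> (\<forall>t\<ge>0. \<xi> t \<in> Box C \<and> 0 < lev (\<xi> t)) \<and>
      ode_sol (\<lambda>t u. fld' \<delta> (\<xi> t) u + \<beta> t) y \<and> norm (y 0) \<le> c \<and> (\<forall>t\<ge>0. norm (\<beta> t) \<le> Cb * lev (\<xi> t) powr a)"
    then have \<xi>: "ode_sol (\<lambda>t. fld \<delta>) \<xi>" and in_box: "\<And>t. 0 \<le> t \<Longrightarrow> \<xi> t \<in> Box C" and
      pos: "\<And>t. 0 \<le> t \<Longrightarrow> 0 < lev (\<xi> t)" and y: "ode_sol (\<lambda>t u. fld' \<delta> (\<xi> t) u + \<beta> t) y" and
      y0: "norm (y 0) \<le> c" and \<beta>: "\<And>t. 0 \<le> t \<Longrightarrow> norm (\<beta> t) \<le> Cb * lev (\<xi> t) powr a" by auto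
    assume t0: "0 \<le> t0"
    define l where "l t = lev (\<xi> t)" for t
    define u where "u t = inverse (1 + fst (\<xi> t))" for t
    define A where "A t = fst (y t)" for t
    define B where "B t = fst (snd (y t))" for t
    define E where "E t = lev (y t) / l t" for t
    define q where "q t = (A t)\<^sup>2 + (B t)\<^sup>2 + (E t)\<^sup>2" for t
    have lp: "0 < l t" "l t \<le> C" if "0 \<le> t" for t using pos [OF that] Box_D(6) [OF in_box [OF that] C] by (auto simp: l_def)
    have dl: "(l has_real_derivative - (\<delta> * l t ^ 4 * u t ^ 2)) (at t within {0..})" if "0 \<le> t" for t
      using component_derivatives(3) [OF ode_solD [OF \<xi> that]] unfolding fld_alt l_def [abs_def] u_def by simp
    note dy = component_derivatives [OF ode_solD [OF y]]
    define dA where "dA t = B t - 6 * \<delta> * l t ^ 2 * (l t * E t) * u t + 2 * \<delta> * l t ^ 3 * u t ^ 2 * A t + fst (\<beta> t)" for t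
    define dB where "dB t = - A t - 2 * \<delta> * B t * l t ^ 3 * u t ^ 2 - 6 * \<delta> * fst (snd (\<xi> t)) * l t ^ 2 * (l t * E t) * u t ^ 2
        + 4 * \<delta> * fst (snd (\<xi> t)) * l t ^ 3 * u t ^ 3 * A t + fst (snd (\<beta> t))" for t
    define dL where "dL t = - 4 * \<delta> * l t ^ 3 * (l t * E t) * u t ^ 2 + 2 * \<delta> * l t ^ 4 * u t ^ 3 * A t + lev (\<beta> t)" for t
    have lE: "lev (y t) = l t * E t" if "0 \<le> t" for t using lp [OF that] by (simp add: E_def)
    have ddA: "(A has_real_derivative dA t) (at t within {0..})" if "0 \<le> t" for t
      using dy(1) [OF that] lE [OF that] by (simp add: fld'_alt A_def [abs_def] dA_def B_def l_def u_def)
    have ddB: "(B has_real_derivative dB t) (at t within {0..})" if "0 \<le> t" for t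
      using dy(2) [OF that] lE [OF that] by (simp add: fld'_alt A_def dB_def B_def [abs_def] l_def u_def)
    have ddE: "(E has_real_derivative dL t / l t + E t * (\<delta> * l t ^ 3 * u t ^ 2)) (at t within {0..})" if "0 \<le> t" for t
    proof -
      have "((\<lambda>t. lev (y t)) has_real_derivative dL t) (at t within {0..})"
        using dy(3) [OF that] lE [OF that] by (simp add: fld'_alt A_def dL_def l_def u_def)
      from DERIV_divide [OF this dl [OF that]] lp [OF that]
      have "(E has_real_derivative (dL t * l t - lev (y t) * - (\<delta> * l t ^ 4 * u t ^ 2)) / (l t * l t)) (at t within {0..})"
        unfolding E_def [abs_def] by simp
      moreover have "(dL t * l t - lev (y t) * - (\<delta> * l t ^ 4 * u t ^ 2)) / (l t * l t) = dL t / l t + E t * (\<delta> * l t ^ 3 * u t ^ 2)"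
        unfolding lE [OF that] using lp [OF that] by (simp add: field_simps eval_nat_numeral)
      ultimately show ?thesis by simp
    qed
    define dq where "dq t = 2 * A t * dA t + 2 * B t * dB t + 2 * E t * (dL t / l t + E t * (\<delta> * l t ^ 3 * u t ^ 2))" for t
    have ddq: "(q has_real_derivative dq t) (at t within {0..})" if "0 \<le> t" for t
      unfolding q_def [abs_def] dq_def by (auto intro!: derivative_eq_intros ddA ddB ddE that)
    have q_nonneg: "0 \<le> q t" for t by (simp add: q_def)
    have dq_le: "dq t \<le> K * l t ^ 3 * q t + Cb\<^sup>2 * l t powr (2 * a) * (1 + 1 / (l t)\<^sup>2) / l t ^ 3" if t: "0 \<le> t" for t
    proof -
      have "dq t \<le> K * l t ^ 3 * q t + ((fst (\<beta> t))\<^sup>2 + (fst (snd (\<beta> t)))\<^sup>2 + (lev (\<beta> t) / l t)\<^sup>2) / l t ^ 3"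
        unfolding dq_def dA_def dB_def dL_def K_def q_def
        by (rule linearized_growth_rate [OF \<delta> C]) (use Box_D [OF in_box [OF t] C] lp [OF t] in \<open>auto simp: u_def\<close>)
      also have "((fst (\<beta> t))\<^sup>2 + (fst (snd (\<beta> t)))\<^sup>2 + (lev (\<beta> t) / l t)\<^sup>2) \<le> (norm (\<beta> t))\<^sup>2 * (1 + 1 / (l t)\<^sup>2)"
        unfolding norm_triple by (rule rescaled_norm_le)
      also have "(norm (\<beta> t))\<^sup>2 \<le> (Cb * l t powr a)\<^sup>2"
        using \<beta> [OF t] by (intro power_mono) (auto simp: l_def)
      also have "(Cb * l t powr a)\<^sup>2 = Cb\<^sup>2 * l t powr (2 * a)"
        by (simp add: power_mult_distrib power2_eq_square powr_add [symmetric])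
      finally show ?thesis using lp [OF t] by (simp add: divide_right_mono mult_right_mono)
    qed
    \<comment> \<open>The Lyapunov function: the power of l pays for the homogeneous growth, the
      linear term for \<beta>.\<close>
    define v where "v t = q t * l t ^ m + D' * l t" for t
    have "v t0 \<le> v 0"
    proof (rule halfline_nonincreasing [of t0 v "\<lambda>t. dq t * l t ^ m - q t * (real m * (\<delta> * u t ^ 2) * (l t ^ 3 * l t ^ m)) - D' * (\<delta> * l t ^ 4 * u t ^ 2)"])
      fix t :: real assume t: "0 \<le> t"
      have "l t ^ (m - Suc 0) * l t ^ 4 = l t ^ 3 * l t ^ m" using m(4) by (simp add: power_add [symmetric])
      then have e: "(real m * (l t ^ (m - Suc 0) * (- (\<delta> * l t ^ 4 * u t ^ 2)))) * q t = - (q t * (real m * (\<delta> * u t ^ 2) * (l t ^ 3 * l t ^ m)))"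
        by (simp add: mult_ac)
      have "((\<lambda>t. l t ^ m) has_real_derivative real m * (l t ^ (m - Suc 0) * (- (\<delta> * l t ^ 4 * u t ^ 2)))) (at t within {0..})"
        by (rule DERIV_cong [OF DERIV_power [OF dl [OF t]]]) simp
      from DERIV_add [OF DERIV_mult [OF ddq [OF t] this] DERIV_cmult [OF dl [OF t], of D']]
      show "(v has_real_derivative dq t * l t ^ m - q t * (real m * (\<delta> * u t ^ 2) * (l t ^ 3 * l t ^ m)) - D' * (\<delta> * l t ^ 4 * u t ^ 2)) (at t within {0..})"
        unfolding v_def [abs_def] by (rule DERIV_cong) (unfold e, simp)
    next
      fix t :: real assume "0 < t"
      then have t: "0 \<le> t" by simp
      note lpt = lp [OF t]
      have u2: "1 / (C + 1) ^ 2 \<le> u t ^ 2" using Box_D(3) [OF in_box [OF t] C] by (simp add: u_def)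
      have "K \<le> real m * (\<delta> * (1 / (C + 1) ^ 2))"
        using m(1) \<delta> C by (simp add: field_simps)
      also have "\<dots> \<le> real m * (\<delta> * u t ^ 2)" using u2 \<delta> by (intro mult_left_mono) auto
      finally have "q t * (K * (l t ^ 3 * l t ^ m)) \<le> q t * (real m * (\<delta> * u t ^ 2) * (l t ^ 3 * l t ^ m))"
        using lpt q_nonneg by (intro mult_left_mono mult_right_mono) auto
      moreover have "dq t * l t ^ m \<le> (K * l t ^ 3 * q t + Cb\<^sup>2 * l t powr (2 * a) * (1 + 1 / (l t)\<^sup>2) / l t ^ 3) * l t ^ m"
        using lpt by (intro mult_right_mono dq_le [OF t]) auto
      moreover have "Cb\<^sup>2 * l t powr (2 * a) * (1 + 1 / (l t)\<^sup>2) / l t ^ 3 * l t ^ m \<le> D' * (\<delta> * l t ^ 4 * u t ^ 2)"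
      proof -
        have "l t powr (2 * a) * (1 + 1 / (l t)\<^sup>2) / l t ^ 3 * l t ^ m
          = l t powr (2 * a + real m - 7) * l t ^ 4 + l t powr (2 * a + real m - 9) * l t ^ 4"
          using lpt by (intro powr_split)
        also have "\<dots> \<le> C powr (2 * a + real m - 7) * l t ^ 4 + C powr (2 * a + real m - 9) * l t ^ 4"
          using lpt m by (intro add_mono mult_right_mono powr_mono2) auto
        also have "\<dots> = (C powr (2 * a + real m - 7) + C powr (2 * a + real m - 9)) * l t ^ 4" by (simp add: distrib_right)
        finally have "Cb\<^sup>2 * (l t powr (2 * a) * (1 + 1 / (l t)\<^sup>2) / l t ^ 3 * l t ^ m) \<le>
            Cb\<^sup>2 * ((C powr (2 * a + real m - 7) + C powr (2 * a + real m - 9)) * l t ^ 4)"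
          by (rule mult_left_mono) simp
        also have "\<dots> = D * l t ^ 4" by (simp add: D_def)
        also have "D * l t ^ 4 = D' * (\<delta> * l t ^ 4 * (1 / (C + 1) ^ 2))"
          unfolding D'_def using \<delta> C by (simp add: field_simps)
        also have "\<dots> \<le> D' * (\<delta> * l t ^ 4 * u t ^ 2)" using u2 D' \<delta> by (intro mult_left_mono) auto
        finally show ?thesis by (simp add: mult_ac)
      qed
      ultimately show "dq t * l t ^ m - q t * (real m * (\<delta> * u t ^ 2) * (l t ^ 3 * l t ^ m)) - D' * (\<delta> * l t ^ 4 * u t ^ 2) \<le> 0"
        by (simp add: algebra_simps)
    qed (use t0 in auto)
    also have "v 0 \<le> V"
    proof -
      note l0 = lp [of 0, simplified]
      have q0: "q 0 \<le> c\<^sup>2 * (1 + 1 / (l 0)\<^sup>2)"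
      proof -
        have "q 0 \<le> (norm (y 0))\<^sup>2 * (1 + 1 / (l 0)\<^sup>2)"
          unfolding norm_triple q_def A_def B_def E_def by (rule rescaled_norm_le)
        also have "\<dots> \<le> c\<^sup>2 * (1 + 1 / (l 0)\<^sup>2)" using y0 by (intro mult_right_mono power_mono) auto
        finally show ?thesis .
      qed
      have "q 0 * l 0 ^ m \<le> c\<^sup>2 * (1 + 1 / (l 0)\<^sup>2) * l 0 ^ m" using l0 q0 by (intro mult_right_mono) auto
      also have "\<dots> = c\<^sup>2 * (l 0 ^ m + l 0 ^ (m - 2))" using l0 m(4) by (simp add: field_simps power_diff)
      also have "\<dots> \<le> c\<^sup>2 * (C ^ m + C ^ (m - 2))" using l0 by (intro mult_left_mono add_mono power_mono) auto
      finally show ?thesis unfolding v_def V_def using l0 D' by (intro add_mono mult_left_mono) auto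
    qed
    finally have "q t0 * l t0 ^ m \<le> V" using lp [OF t0] D' by (simp add: v_def) (smt (verit) mult_nonneg_nonneg)
    then have qV: "q t0 \<le> V * l t0 powr (- real m)"
      using lp [OF t0] by (simp add: powr_minus powr_realpow field_simps)
    have "(norm (y t0))\<^sup>2 = (A t0)\<^sup>2 + (B t0)\<^sup>2 + (l t0)\<^sup>2 * (E t0)\<^sup>2"
      unfolding norm_triple lE [OF t0] by (simp add: A_def B_def power_mult_distrib)
    also have "\<dots> \<le> (1 + C\<^sup>2) * q t0"
    proof -
      have "(l t0)\<^sup>2 * (E t0)\<^sup>2 \<le> C\<^sup>2 * q t0"
        using lp [OF t0] by (intro mult_mono power_mono) (auto simp: q_def)
      moreover have "(A t0)\<^sup>2 + (B t0)\<^sup>2 \<le> q t0" by (simp add: q_def)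
      ultimately have "(A t0)\<^sup>2 + (B t0)\<^sup>2 + (l t0)\<^sup>2 * (E t0)\<^sup>2 \<le> q t0 + C\<^sup>2 * q t0" by linarith
      then show ?thesis by (simp add: distrib_right)
    qed
    also have "\<dots> \<le> (1 + C\<^sup>2) * (V * l t0 powr (- real m))" using qV by (intro mult_left_mono) auto
    also have "\<dots> = (sqrt ((1 + C\<^sup>2) * V) * l t0 powr (- real m / 2))\<^sup>2"
    proof -
      have "(sqrt ((1 + C\<^sup>2) * V))\<^sup>2 = (1 + C\<^sup>2) * V" using V by (intro real_sqrt_pow2) simp
      moreover have "(l t0 powr (- real m / 2))\<^sup>2 = l t0 powr (- real m)"
        by (simp add: power2_eq_square powr_add [symmetric])
      ultimately show ?thesis by (simp add: power_mult_distrib)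
    qed
    finally have "norm (y t0) \<le> sqrt ((1 + C\<^sup>2) * V) * l t0 powr (- real m / 2)"
      by (rule power2_le_imp_le) (use V in simp)
    then show "norm (y t0) \<le> sqrt ((1 + C\<^sup>2) * V) * lev (\<xi> t0) powr (- real m / 2)" by (simp add: l_def)
  qed
qed

section \<open>Weighted bounds for the flow\<close>

definition box_sol :: "real \<Rightarrow> real \<Rightarrow> (real \<Rightarrow> real \<times> real \<times> real) \<Rightarrow> bool" where
  "box_sol \<delta> C \<xi> \<longleftrightarrow> ode_sol (\<lambda>t. fld \<delta>) \<xi> \<and> (\<forall>t\<ge>0. \<xi> t \<in> Box C)"

lemma box_solD: "box_sol \<delta> C \<xi> \<Longrightarrow> ode_sol (\<lambda>t. fld \<delta>) \<xi>" "box_sol \<delta> C \<xi> \<Longrightarrow> 0 \<le> t \<Longrightarrow> \<xi> t \<in> Box C"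
  by (auto simp: box_sol_def)

lemma lev_deriv:
  assumes "ode_sol (\<lambda>t. fld \<delta>) \<xi>" "0 \<le> t"
  shows "((\<lambda>t. lev (\<xi> t)) has_real_derivative - (\<delta> * lev (\<xi> t) ^ 4 * inverse (1 + fst (\<xi> t)) ^ 2)) (at t within {0..})"
  using component_derivatives(3) [OF ode_solD [OF assms]] unfolding fld_alt by simp

lemma lev_antimono:
  assumes \<xi>: "box_sol \<delta> C \<xi>" and \<delta>: "\<delta> > 0" and st: "0 \<le> s" "s \<le> t"
  shows "lev (\<xi> t) \<le> lev (\<xi> s)"
  by (rule halfline_nonincreasing [OF lev_deriv [OF box_solD(1) [OF \<xi>]] _ st order_refl]) (use \<delta> in auto)

text \<open>While l is at least e it falls at rate at least \<delta> e^4 / (C + 1)^2, and it starts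
  at most at C. The time is explicit and so common to all solutions in the box, which later yields
  uniform limits.\<close>

lemma lev_vanish:
  assumes \<xi>: "box_sol \<delta> C \<xi>" and \<delta>: "\<delta> > 0" and C: "C \<ge> 1" and e: "e > 0"
    and T: "T \<ge> C / (\<delta> / (C + 1) ^ 2 * e ^ 4)"
  shows "lev (\<xi> T) < e"
proof (rule ccontr)
  define c where "c = \<delta> / (C + 1) ^ 2"
  have c: "c > 0" using \<delta> C by (simp add: c_def)
  have ce: "0 < c * e ^ 4" using c e by simp
  have T0: "0 \<le> T" using T C ce unfolding c_def [symmetric] by (meson divide_nonneg_pos order_trans zero_le_one)
  assume "\<not> lev (\<xi> T) < e"
  then have ge: "e \<le> lev (\<xi> t)" if "0 \<le> t" "t \<le> T" for t
    using lev_antimono [OF \<xi> \<delta> that] by simp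
  have "lev (\<xi> T) + c * e ^ 4 * T \<le> lev (\<xi> 0) + c * e ^ 4 * 0"
  proof (rule halfline_nonincreasing [of T "\<lambda>t. lev (\<xi> t) + c * e ^ 4 * t"])
    show "((\<lambda>t. lev (\<xi> t) + c * e ^ 4 * t) has_real_derivative
        - (\<delta> * lev (\<xi> t) ^ 4 * inverse (1 + fst (\<xi> t)) ^ 2) + c * e ^ 4) (at t within {0..})" if "0 \<le> t" for t
      by (rule DERIV_add [OF lev_deriv [OF box_solD(1) [OF \<xi>] that]]) (auto intro!: derivative_eq_intros)
    fix t assume t: "0 < t" "t < T"
    have b: "1 / (C + 1) ^ 2 \<le> inverse (1 + fst (\<xi> t)) ^ 2"
      using Box_D(3) [OF box_solD(2) [OF \<xi>] C] t by simp
    have "\<delta> * e ^ 4 * (1 / (C + 1) ^ 2) \<le> \<delta> * lev (\<xi> t) ^ 4 * inverse (1 + fst (\<xi> t)) ^ 2"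
      using ge [of t] t \<delta> e b by (intro mult_mono power_mono) auto
    then show "- (\<delta> * lev (\<xi> t) ^ 4 * inverse (1 + fst (\<xi> t)) ^ 2) + c * e ^ 4 \<le> 0"
      by (simp add: c_def)
  qed (use T0 in auto)
  moreover have "lev (\<xi> 0) \<le> C" using Box_D(6) [OF box_solD(2) [OF \<xi>] C] by simp
  moreover have "C \<le> c * e ^ 4 * T" using T ce unfolding c_def [symmetric] by (simp add: pos_divide_le_eq mult.commute)
  ultimately show False using ge [of T] T0 e by simp
qed

lemma lev_tendsto_0:
  assumes \<xi>: "box_sol \<delta> C \<xi>" and \<delta>: "\<delta> > 0" and C: "C \<ge> 1"
  shows "((\<lambda>t. lev (\<xi> t)) \<longlongrightarrow> 0) at_top"
proof (rule tendstoI)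
  fix e :: real assume e: "0 < e"
  have "dist (lev (\<xi> t)) 0 < e" if "t \<ge> max 0 (C / (\<delta> / (C + 1) ^ 2 * e ^ 4))" for t
    using lev_vanish [OF \<xi> \<delta> C e, of t] Box_D(5) [OF box_solD(2) [OF \<xi>, of t] C] that by simp
  then show "\<forall>\<^sub>F t in at_top. dist (lev (\<xi> t)) 0 < e"
    unfolding eventually_at_top_linorder by blast
qed

locale box_flow =
  fixes \<delta> C :: real and S :: "(real \<times> real \<times> real) set" and \<xi> :: "real \<Rightarrow> real \<times> real \<times> real \<Rightarrow> real \<times> real \<times> real"
  assumes \<delta>: "\<delta> > 0" and C: "C \<ge> 1" and S_open: "open S" and \<xi>_0: "\<And>p. p \<in> S \<Longrightarrow> \<xi> 0 p = p"
    and sol: "\<And>p. p \<in> S \<Longrightarrow> box_sol \<delta> C (\<lambda>t. \<xi> t p)"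
    and lev_pos: "\<And>t p. 0 \<le> t \<Longrightarrow> p \<in> S \<Longrightarrow> 0 < lev (\<xi> t p)"
begin

abbreviation l :: "real \<Rightarrow> real \<times> real \<times> real \<Rightarrow> real" where "l t p \<equiv> lev (\<xi> t p)"

lemma \<xi>_in_Box: "0 \<le> t \<Longrightarrow> p \<in> S \<Longrightarrow> \<xi> t p \<in> Box C"
  by (rule box_solD(2) [OF sol])

lemma l_le: "0 \<le> t \<Longrightarrow> p \<in> S \<Longrightarrow> l t p \<le> C"
  using Box_D(6) [OF \<xi>_in_Box C] .

lemma weighted: "weighted_family S l C"
  by unfold_locales (use S_open lev_pos l_le in auto)

lemma flow: "flow_family binet_dom (Box C) S (fld \<delta>) (fld' \<delta>) \<xi>"
  by (rule flow_family.intro)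
    (use open_binet_dom Box Box_subset_binet_dom [of C] C S_open fld_has_derivative smooth_on_imp_continuous_on [OF smooth_on_fld']
      \<xi>_0 sol in \<open>auto simp: box_sol_def\<close>)

lemma tempered_lin: "tempered_linear S l C (\<lambda>t p. fld' \<delta> (\<xi> t p))"
proof (rule tempered_linear.intro [OF weighted flow_family.flow_linear_family [OF flow]], rule tempered_linear_axioms.intro)
  fix a c Cb :: real
  obtain C' a' where *: "\<forall>\<xi> \<beta> y. ode_sol (\<lambda>t. fld \<delta>) \<xi> \<and> (\<forall>t\<ge>0. \<xi> t \<in> Box C \<and> 0 < lev (\<xi> t)) \<and>
    ode_sol (\<lambda>t u. fld' \<delta> (\<xi> t) u + \<beta> t) y \<and> norm (y 0) \<le> c \<and> (\<forall>t\<ge>0. norm (\<beta> t) \<le> Cb * lev (\<xi> t) powr a)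
    \<longrightarrow> (\<forall>t\<ge>0. norm (y t) \<le> C' * lev (\<xi> t) powr a')"
    using linearized_growth [OF \<delta> C, of c Cb a] by (elim exE)
  show "\<exists>C' a'. \<forall>p\<in>S. \<forall>\<beta> y. ode_sol (\<lambda>t u. fld' \<delta> (\<xi> t p) u + \<beta> t) y \<and> norm (y 0) \<le> c \<and>
      (\<forall>t\<ge>0. norm (\<beta> t) \<le> Cb * l t p powr a) \<longrightarrow> (\<forall>t\<ge>0. norm (y t) \<le> C' * l t p powr a')"
  proof (rule exI [of _ C'], rule exI [of _ a'], intro ballI allI impI)
    fix p \<beta> y and t :: real
    assume "p \<in> S" "ode_sol (\<lambda>t u. fld' \<delta> (\<xi> t p) u + \<beta> t) y \<and> norm (y 0) \<le> c \<and>
      (\<forall>t\<ge>0. norm (\<beta> t) \<le> Cb * l t p powr a)" "0 \<le> t"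
    then show "norm (y t) \<le> C' * l t p powr a'"
      using *[rule_format, of "\<lambda>t. \<xi> t p" \<beta> y t] sol [OF \<open>p \<in> S\<close>] lev_pos [OF _ \<open>p \<in> S\<close>]
      by (simp add: box_sol_def)
  qed
qed

lemma tempered: "tempered_Ck S l k \<xi>"
  by (rule flow_family.tempered_flow [OF flow tempered_lin smooth_on_fld'])

text \<open>Each differentiation lowers the power of l by one and brings in a derivative of l of
  weight - M, a loss of M + 1 per order. A large N outweighs the total loss.\<close>

lemma lev_power_weighted:
  assumes "weighted_Ck S l (- M) k l" "0 \<le> M"
  shows "weighted_Ck S l (real N - real k * (M + 1)) k (\<lambda>t p. l t p ^ N)"
proof -
  interpret weighted_family S l C by (rule weighted)
  have cont: "continuous_on ({0..} \<times> S) (\<lambda>(t, p). l t p)"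
    using weighted_Ck_bound [OF assms(1)] by (simp add: weighted_bound_def)
  have base: "weighted_bound S l (real N) (\<lambda>t p. l t p ^ N)" for N
  proof (rule weighted_boundI [where C = 1])
    show "continuous_on ({0..} \<times> S) (\<lambda>(t, p). l t p ^ N)"
      using continuous_on_power [OF cont] by (simp add: split_def)
    show "norm (l t p ^ N) \<le> 1 * l t p powr real N" if "0 \<le> t" "p \<in> S" for t p
      using lev_pos [OF that] by (simp add: powr_realpow)
  qed
  show ?thesis using assms(1)
  proof (induction k arbitrary: N)
    case 0
    show ?case using base [of N] by simp
  next
    case (Suc k)
    obtain l' where l': "\<And>t p. 0 \<le> t \<Longrightarrow> p \<in> S \<Longrightarrow> (l t has_derivative l' t p) (at p)"
      "\<And>w. weighted_Ck S l (- M) k (\<lambda>t p. l' t p w)" by (rule weighted_Ck_SucE [OF Suc.prems]) blast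
    have lk: "weighted_Ck S l (- M) k l" by (rule weighted_Ck_SucD [OF Suc.prems])
    show ?case
    proof (rule weighted_Ck_SucI)
      show "weighted_bound S l (real N - real (Suc k) * (M + 1)) (\<lambda>t p. l t p ^ N)"
        by (rule weighted_bound_mono [OF _ base]) (use assms(2) in simp)
      show "((\<lambda>p. l t p ^ N) has_derivative (\<lambda>w. (real N * l t p ^ (N - 1)) * l' t p w)) (at p)"
        if "0 \<le> t" "p \<in> S" for t p
        using has_derivative_power [OF l'(1) [OF that], of N] by (simp add: mult_ac)
      fix w
      show "weighted_Ck S l (real N - real (Suc k) * (M + 1)) k (\<lambda>t p. (real N * l t p ^ (N - 1)) * l' t p w)"
      proof (cases N)
        case 0
        have "weighted_Ck S l (real N - real (Suc k) * (M + 1)) k (\<lambda>t p. 0 :: real)"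
          by (rule weighted_Ck_mono [OF _ weighted_Ck_const]) (use 0 assms(2) in \<open>simp add: mult_nonneg_nonneg\<close>)
        then show ?thesis using 0 by simp
      next
        case (Suc N')
        have X: "weighted_Ck S l (0 + (real N' - real k * (M + 1)) + - M) k (\<lambda>t p. (real N * l t p ^ N') * l' t p w)"
          by (intro weighted_Ck_bilinear [OF bounded_bilinear_mult] weighted_Ck_const Suc.IH lk l'(2))
        have "0 + (real N' - real k * (M + 1)) + - M = real N - real (Suc k) * (M + 1)"
          by (simp add: Suc algebra_simps)
        from X [unfolded this] show ?thesis by (simp only: Suc diff_Suc_1)
      qed
    qed
  qed
qed

text \<open>l serves as a clock: on a box l^4 dt is comparable with - dl, which turns time integrals
  of powers of l into powers of l.\<close>

lemma lev_integral:
  assumes p: "p \<in> S" and st: "0 \<le> s" "s \<le> t"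
  shows "((\<lambda>r. \<delta> * l r p ^ 4 * inverse (1 + fst (\<xi> r p)) ^ 2) has_integral (l s p - l t p)) {s..t}"
proof -
  have "((\<lambda>r. - l r p) has_vector_derivative \<delta> * l r p ^ 4 * inverse (1 + fst (\<xi> r p)) ^ 2) (at r within {s..t})"
    if "r \<in> {s..t}" for r
  proof -
    have "((\<lambda>t. - l t p) has_real_derivative - (- (\<delta> * l r p ^ 4 * inverse (1 + fst (\<xi> r p)) ^ 2))) (at r within {0..})"
      using that st by (intro DERIV_minus lev_deriv box_solD(1) [OF sol [OF p]]) auto
    then have "((\<lambda>t. - l t p) has_real_derivative \<delta> * l r p ^ 4 * inverse (1 + fst (\<xi> r p)) ^ 2) (at r within {s..t})"
      by (rule DERIV_subset [THEN DERIV_cong]) (use st in auto)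
    then show ?thesis by (simp add: has_real_derivative_iff_has_vector_derivative)
  qed
  then have "((\<lambda>r. \<delta> * l r p ^ 4 * inverse (1 + fst (\<xi> r p)) ^ 2) has_integral (- l t p - - l s p)) {s..t}"
    using st by (intro fundamental_theorem_of_calculus) auto
  then show ?thesis by simp
qed

lemma u_integrable:
  assumes "weighted_bound S l a u" "p \<in> S" "0 \<le> s"
  shows "(\<lambda>r. u r p) integrable_on {s..t}"
proof -
  have c: "continuous_on ({0..} \<times> S) (\<lambda>(t, p). u t p)" using assms(1) by (simp add: weighted_bound_def)
  have "continuous_on {s..t} (\<lambda>r. (\<lambda>(t, p). u t p) (r, p))"
    by (rule continuous_on_compose2 [OF c continuous_on_Pair [OF continuous_on_id continuous_on_const]])
      (use assms(2,3) in auto)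
  then show ?thesis by (simp add: integrable_continuous_interval)
qed

text \<open>Split l^6 = l^2 * l^4 along the trajectory. The first factor is at most its value at
  time s, and the integral of the second is at most l(s) / c, giving the third power.\<close>

lemma tail_estimate:
  fixes u :: "real \<Rightarrow> real \<times> real \<times> real \<Rightarrow> 'b::euclidean_space"
  assumes u: "weighted_bound S l 6 u"
  shows "\<exists>K\<ge>0. \<forall>p\<in>S. \<forall>s t. 0 \<le> s \<and> s \<le> t \<longrightarrow> norm (integral {s..t} (\<lambda>r. u r p)) \<le> K * l s p ^ 3"
proof -
  define c where "c = \<delta> / (C + 1) ^ 2"
  have c: "c > 0" using \<delta> C by (simp add: c_def)
  obtain K where K: "0 \<le> K" "\<And>t p. 0 \<le> t \<Longrightarrow> p \<in> S \<Longrightarrow> norm (u t p) \<le> K * l t p powr 6"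
    by (rule weighted_boundE [OF u]) blast
  have "norm (integral {s..t} (\<lambda>r. u r p)) \<le> (K / c) * l s p ^ 3" if p: "p \<in> S" and st: "0 \<le> s" "s \<le> t" for p s t
  proof -
    let ?g = "\<lambda>r. \<delta> * l r p ^ 4 * inverse (1 + fst (\<xi> r p)) ^ 2"
    note int = lev_integral [OF p st]
    have "norm (integral {s..t} (\<lambda>r. u r p)) \<le> integral {s..t} (\<lambda>r. (K * l s p ^ 2 / c) * ?g r)"
    proof (rule integral_norm_bound_integral)
      show "(\<lambda>r. u r p) integrable_on {s..t}" by (rule u_integrable [OF u p st(1)])
      show "(\<lambda>r. (K * l s p ^ 2 / c) * ?g r) integrable_on {s..t}"
        using has_integral_mult_right [OF int, of "K * l s p ^ 2 / c"] by (rule has_integral_integrable)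
      fix r assume r: "r \<in> {s..t}"
      then have r0: "0 \<le> r" using st by simp
      have lr: "0 < l r p" "l r p \<le> l s p"
        using lev_pos [OF r0 p] lev_antimono [OF sol [OF p] \<delta> st(1)] r by auto
      have "norm (u r p) \<le> K * l r p powr 6" by (rule K(2) [OF r0 p])
      also have "l r p powr 6 = l r p ^ 2 * l r p ^ 4" using powr_realpow [of "l r p" 6] lr by (simp flip: power_add)
      also have "K * (l r p ^ 2 * l r p ^ 4) \<le> K * (l s p ^ 2 * (?g r / c))"
      proof (intro mult_left_mono mult_mono power_mono)
        have "1 / (C + 1) ^ 2 \<le> inverse (1 + fst (\<xi> r p)) ^ 2" by (rule Box_D(3) [OF \<xi>_in_Box [OF r0 p] C])
        then have "\<delta> * l r p ^ 4 * (1 / (C + 1) ^ 2) \<le> ?g r" using \<delta> by (intro mult_left_mono) auto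
        then have "c * l r p ^ 4 \<le> ?g r" by (simp add: c_def)
        then show "l r p ^ 4 \<le> ?g r / c" using c by (simp add: pos_le_divide_eq mult.commute)
      qed (use lr K in auto)
      finally show "norm (u r p) \<le> (K * l s p ^ 2 / c) * ?g r" by simp
    qed
    also have "\<dots> = (K * l s p ^ 2 / c) * (l s p - l t p)"
      using int by (simp add: integral_unique)
    also have "\<dots> \<le> (K * l s p ^ 2 / c) * l s p"
      using K(1) c lev_pos [of t p] st p by (intro mult_left_mono) auto
    also have "\<dots> = (K / c) * l s p ^ 3" by (simp add: eval_nat_numeral)
    finally show ?thesis .
  qed
  then show ?thesis using K(1) c by (intro exI [of _ "K / c"]) auto
qed

lemma l_tendsto_0: "p \<in> S \<Longrightarrow> ((\<lambda>t. l t p) \<longlongrightarrow> 0) at_top"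
  by (rule lev_tendsto_0 [OF sol \<delta> C])

lemma l_uniform: "0 < e \<Longrightarrow> \<exists>T\<ge>0. \<forall>t\<ge>T. \<forall>p\<in>S. l t p < e"
  using lev_vanish [OF sol \<delta> C] C \<delta>
  by (intro exI [of _ "max 0 (C / (\<delta> / (C + 1) ^ 2 * e ^ 4))"]) auto

lemma limit_exists:
  fixes u :: "real \<Rightarrow> real \<times> real \<times> real \<Rightarrow> 'b::euclidean_space"
  assumes u: "weighted_bound S l 6 u"
  shows "\<exists>G. \<exists>K\<ge>0. \<forall>p\<in>S. \<forall>t\<ge>0. norm (integral {0..t} (\<lambda>r. u r p) - G p) \<le> K * l t p ^ 3"
proof -
  obtain K where K: "0 \<le> K" "\<And>p s t. p \<in> S \<Longrightarrow> 0 \<le> s \<Longrightarrow> s \<le> t \<Longrightarrow> norm (integral {s..t} (\<lambda>r. u r p)) \<le> K * l s p ^ 3"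
    using tail_estimate [OF u] by (elim exE conjE) blast
  define I where "I t p = integral {0..t} (\<lambda>r. u r p)" for t p
  have I: "norm (I t p - I s p) \<le> K * l s p ^ 3" if "p \<in> S" "0 \<le> s" "s \<le> t" for p s t
  proof -
    have "I s p + integral {s..t} (\<lambda>r. u r p) = I t p"
      unfolding I_def using that by (intro Henstock_Kurzweil_Integration.integral_combine u_integrable [OF u]) auto
    then have "I t p - I s p = integral {s..t} (\<lambda>r. u r p)" by (simp add: algebra_simps)
    then show ?thesis using K(2) [OF that] by simp
  qed
  have "\<exists>L. (\<lambda>n. I (real n) p) \<longlonglongrightarrow> L" if p: "p \<in> S" for p
  proof -
    have "Cauchy (\<lambda>n. I (real n) p)"
    proof (rule metric_CauchyI)
      fix e :: real assume e: "0 < e"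
      have "((\<lambda>t. K * l t p ^ 3) \<longlongrightarrow> K * 0 ^ 3) at_top"
        by (intro tendsto_intros l_tendsto_0 p)
      then have "((\<lambda>t. K * l t p ^ 3) \<longlongrightarrow> 0) at_top" by simp
      then have "\<forall>\<^sub>F t in at_top. K * l t p ^ 3 < e / 2" using e by (intro order_tendstoD) auto
      then obtain T where T: "\<And>t. t \<ge> T \<Longrightarrow> K * l t p ^ 3 < e / 2" unfolding eventually_at_top_linorder by blast
      obtain N :: nat where N: "real N \<ge> T" using real_arch_simple by blast
      have "dist (I (real n) p) (I (real N) p) < e / 2" if "n \<ge> N" for n
        using I [OF p, of "real N" "real n"] that T [OF N] by (simp add: dist_norm)
      then show "\<exists>M. \<forall>m\<ge>M. \<forall>n\<ge>M. dist (I (real m) p) (I (real n) p) < e"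
        using dist_triangle_half_l by blast
    qed
    then show ?thesis using Cauchy_convergent convergent_def by blast
  qed
  then obtain G where G: "\<And>p. p \<in> S \<Longrightarrow> (\<lambda>n. I (real n) p) \<longlonglongrightarrow> G p" by metis
  have "norm (I t p - G p) \<le> K * l t p ^ 3" if "p \<in> S" "0 \<le> t" for p t
  proof (rule LIMSEQ_le_const2)
    show "(\<lambda>n. norm (I t p - I (real n) p)) \<longlonglongrightarrow> norm (I t p - G p)"
      by (intro tendsto_intros G that)
    obtain N :: nat where N: "real N \<ge> t" using real_arch_simple by blast
    have "norm (I t p - I (real n) p) \<le> K * l t p ^ 3" if "n \<ge> N" for n
      using I [OF \<open>p \<in> S\<close> \<open>0 \<le> t\<close>, of "real n"] that N by (simp add: norm_minus_commute)
    then show "\<exists>N. \<forall>n\<ge>N. norm (I t p - I (real n) p) \<le> K * l t p ^ 3" by blast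
  qed
  then show ?thesis using K(1) unfolding I_def by blast
qed

end

text \<open>All derivatives of order at most \<open>k\<close> vanish to second order at \<open>d = 0\<close>.\<close>

primrec flat_Ck :: "'a::euclidean_space set \<Rightarrow> ('a \<Rightarrow> real) \<Rightarrow> nat \<Rightarrow> ('a \<Rightarrow> 'b::euclidean_space) \<Rightarrow> bool" where
  "flat_Ck S d 0 g \<longleftrightarrow> continuous_on S g \<and> (\<exists>K. \<forall>p\<in>S. norm (g p) \<le> K * d p ^ 2)"
| "flat_Ck S d (Suc k) g \<longleftrightarrow> (\<exists>K. \<forall>p\<in>S. norm (g p) \<le> K * d p ^ 2) \<and>
     (\<exists>g'. (\<forall>p\<in>S. (g has_derivative g' p) (at p)) \<and> (\<forall>w. flat_Ck S d k (\<lambda>p. g' p w)))"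

lemma abs_lev_le_norm: "\<bar>lev z\<bar> \<le> norm z"
  using norm_snd_le [of "snd (snd z)" "fst (snd z)"] norm_snd_le [of "snd z" "fst z"]
  unfolding prod.collapse by simp

text \<open>A quadratic bound in l makes the extension by 0 differentiable at l = 0 with derivative
  0; the same bound on the derivatives lets the argument repeat. Away from the boundary nothing
  changes.\<close>

lemma flat_Ck_extend:
  fixes g :: "real \<times> real \<times> real \<Rightarrow> 'b::euclidean_space"
  assumes T: "open T"
  shows "flat_Ck (T \<inter> {p. 0 < lev p}) lev k g \<Longrightarrow> Ck_on k (T \<inter> {p. 0 \<le> lev p}) (\<lambda>p. if 0 < lev p then g p else 0)"
proof (induction k arbitrary: g)
  case 0
  then obtain K where K: "\<And>p. p \<in> T \<Longrightarrow> 0 < lev p \<Longrightarrow> norm (g p) \<le> K * lev p ^ 2" and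
    g: "continuous_on (T \<inter> {p. 0 < lev p}) g" by auto
  let ?f = "\<lambda>p. if 0 < lev p then g p else 0"
  have op: "open (T \<inter> {p :: real \<times> real \<times> real. 0 < lev p})"
    by (intro open_Int T open_Collect_less continuous_intros)
  have "continuous (at p within T \<inter> {p. 0 \<le> lev p}) ?f" if p: "p \<in> T" "0 \<le> lev p" for p
  proof (cases "0 < lev p")
    case True
    have "isCont g p" using g op True p by (auto simp: continuous_on_eq_continuous_at)
    moreover have ev: "\<forall>\<^sub>F q in nhds p. ?f q = g q"
      using eventually_nhds_in_open [OF op, of p] True p by (auto elim!: eventually_mono)
    ultimately have "isCont ?f p" using isCont_cong [OF ev] by blast
    then show ?thesis using continuous_at_imp_continuous_at_within by blast
  next
    case False
    then have z: "lev p = 0" using p by simp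
    have le: "norm (?f q) \<le> \<bar>K\<bar> * lev q ^ 2" if "q \<in> T" for q
    proof (cases "0 < lev q")
      case True
      then have "norm (?f q) \<le> K * lev q ^ 2" using K that by simp
      also have "\<dots> \<le> \<bar>K\<bar> * lev q ^ 2" by (intro mult_right_mono) auto
      finally show ?thesis .
    qed simp
    have "((\<lambda>q. \<bar>K\<bar> * lev q ^ 2) \<longlongrightarrow> \<bar>K\<bar> * lev p ^ 2) (at p within T \<inter> {p. 0 \<le> lev p})"
      by (intro tendsto_intros)
    then have "(?f \<longlongrightarrow> 0) (at p within T \<inter> {p. 0 \<le> lev p})"
      using z le by (intro Lim_null_comparison [of ?f "\<lambda>q. \<bar>K\<bar> * lev q ^ 2"]) (auto simp: eventually_at_filter)
    then show ?thesis using z by (simp add: continuous_within)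
  qed
  then show ?case by (simp add: continuous_on_eq_continuous_within)
next
  case (Suc k)
  obtain K g' where "\<forall>p\<in>T \<inter> {p. 0 < lev p}. norm (g p) \<le> K * lev p ^ 2"
    "\<forall>p\<in>T \<inter> {p. 0 < lev p}. (g has_derivative g' p) (at p)"
    "\<forall>w. flat_Ck (T \<inter> {p. 0 < lev p}) lev k (\<lambda>p. g' p w)"
    using Suc.prems unfolding flat_Ck.simps by blast
  then have K: "\<And>p. p \<in> T \<Longrightarrow> 0 < lev p \<Longrightarrow> norm (g p) \<le> K * lev p ^ 2" and
    g': "\<And>p. p \<in> T \<Longrightarrow> 0 < lev p \<Longrightarrow> (g has_derivative g' p) (at p)"
    "\<And>w. flat_Ck (T \<inter> {p. 0 < lev p}) lev k (\<lambda>p. g' p w)" by blast+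
  let ?f = "\<lambda>p. if 0 < lev p then g p else 0"
  have op: "open (T \<inter> {p :: real \<times> real \<times> real. 0 < lev p})"
    by (intro open_Int T open_Collect_less continuous_intros)
  show ?case
  proof (rule Ck_on_SucI)
    show "Ck_on k (T \<inter> {p. 0 \<le> lev p}) (\<lambda>p. (\<lambda>p w. if 0 < lev p then g' p w else 0) p w)" for w
      using Suc.IH [OF g'(2)] by simp
    fix p assume p: "p \<in> T \<inter> {p. 0 \<le> lev p}"
    show "(?f has_derivative (\<lambda>w. if 0 < lev p then g' p w else 0)) (at p within T \<inter> {p. 0 \<le> lev p})"
    proof (cases "0 < lev p")
      case True
      have "(?f has_derivative g' p) (at p)"
        by (rule has_derivative_cong_on_open [OF op, of p g]) (use True p g' in auto)
      then show ?thesis using True has_derivative_at_withinI by auto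
    next
      case False
      then have z: "lev p = 0" using p by simp
      have "(?f has_derivative (\<lambda>w. 0)) (at p within T \<inter> {p. 0 \<le> lev p})"
        unfolding has_derivative_within_alt
      proof (intro conjI allI impI)
        fix e :: real assume e: "0 < e"
        show "\<exists>d>0. \<forall>q\<in>T \<inter> {p. 0 \<le> lev p}. norm (q - p) < d \<longrightarrow> norm (?f q - ?f p - 0) \<le> e * norm (q - p)"
        proof (intro exI [of _ "e / (\<bar>K\<bar> + 1)"] conjI ballI impI)
          show "0 < e / (\<bar>K\<bar> + 1)" using e by simp
          fix q assume q: "q \<in> T \<inter> {p. 0 \<le> lev p}" "norm (q - p) < e / (\<bar>K\<bar> + 1)"
          have "lev q \<le> norm (q - p)"
          proof -
            have "lev (q - p) \<le> norm (q - p)" using abs_lev_le_norm [of "q - p"] by linarith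
            then show ?thesis using z by simp
          qed
          then have l2: "lev q ^ 2 \<le> norm (q - p) * norm (q - p)"
            using q by (simp add: power2_eq_square mult_mono)
          have "norm (?f q) \<le> \<bar>K\<bar> * lev q ^ 2"
          proof (cases "0 < lev q")
            case True
            then have "norm (?f q) \<le> K * lev q ^ 2" using K q by simp
            also have "\<dots> \<le> \<bar>K\<bar> * lev q ^ 2" by (intro mult_right_mono) auto
            finally show ?thesis .
          qed simp
          also have "\<dots> \<le> (\<bar>K\<bar> + 1) * (norm (q - p) * norm (q - p))"
            using l2 by (intro mult_mono) auto
          also have "\<dots> = ((\<bar>K\<bar> + 1) * norm (q - p)) * norm (q - p)" by simp
          also have "\<dots> \<le> e * norm (q - p)"
            using q(2) by (intro mult_right_mono) (auto simp: pos_less_divide_eq mult.commute less_imp_le)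
          finally show "norm (?f q - ?f p - 0) \<le> e * norm (q - p)" using z by simp
        qed
      qed simp
      then show ?thesis using False by simp
    qed
  qed
qed

context box_flow
begin

lemma rate_uniform:
  assumes "0 < e"
  shows "\<exists>T\<ge>0. \<forall>t\<ge>T. \<forall>p\<in>S. K * l t p ^ 3 < e"
proof -
  obtain T where T: "T \<ge> 0" "\<And>t p. t \<ge> T \<Longrightarrow> p \<in> S \<Longrightarrow> l t p < min 1 (e / (\<bar>K\<bar> + 1))"
    using l_uniform [of "min 1 (e / (\<bar>K\<bar> + 1))"] assms by auto
  have "K * l t p ^ 3 < e" if "t \<ge> T" "p \<in> S" for t p
  proof -
    have l: "0 < l t p" "l t p < 1" "l t p * (\<bar>K\<bar> + 1) < e"
      using T(2) [OF that] lev_pos [of t p] that T(1) by (auto simp: pos_less_divide_eq)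
    have "l t p ^ 3 \<le> l t p" using l power_decreasing [of 1 3 "l t p"] by simp
    then have "K * l t p ^ 3 \<le> (\<bar>K\<bar> + 1) * l t p" using l by (intro mult_mono) auto
    then show ?thesis using l(3) by (simp add: mult.commute)
  qed
  then show ?thesis using T(1) by blast
qed

lemma swapped_continuous:
  assumes "continuous_on ({0..} \<times> S) (\<lambda>(t, p). u t p)" "A \<subseteq> S"
  shows "continuous_on (A \<times> {0..T}) (\<lambda>(p, t). u t p)"
proof -
  have "continuous_on (A \<times> {0..T}) (\<lambda>z. (\<lambda>(t, p). u t p) (snd z, fst z))"
    using assms(2) by (intro continuous_on_compose2 [OF assms(1)] continuous_intros) auto
  then show ?thesis by (simp add: split_def)
qed

text \<open>The rate at t = 0, where the integral is empty, bounds G by a multiple of l^3 and hence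
  of l^2. Derivatives pass to the limit because the differentiated integrals converge uniformly on
  S, by \<open>rate_uniform\<close>.\<close>

lemma limit_flat:
  fixes u :: "real \<Rightarrow> real \<times> real \<times> real \<Rightarrow> 'b::euclidean_space"
  assumes "weighted_Ck S l 6 k u"
    and "\<exists>K. \<forall>p\<in>S. \<forall>t\<ge>0. norm (integral {0..t} (\<lambda>r. u r p) - G p) \<le> K * l t p ^ 3"
  shows "flat_Ck S lev k G"
  using assms
proof (induction k arbitrary: u G)
  have bound: "\<exists>K. \<forall>p\<in>S. norm (G p) \<le> K * lev p ^ 2"
    if G: "\<exists>K. \<forall>p\<in>S. \<forall>t\<ge>0. norm (integral {0..t} (\<lambda>r. u r p) - G p) \<le> K * l t p ^ 3"
    for u :: "real \<Rightarrow> real \<times> real \<times> real \<Rightarrow> 'b" and G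
  proof -
    obtain K where K: "\<And>p t. p \<in> S \<Longrightarrow> 0 \<le> t \<Longrightarrow> norm (integral {0..t} (\<lambda>r. u r p) - G p) \<le> K * l t p ^ 3"
      using G by (elim exE) blast
    have "norm (G p) \<le> (\<bar>K\<bar> * C) * lev p ^ 2" if p: "p \<in> S" for p
    proof -
      have lp: "0 < lev p" "lev p \<le> C" using lev_pos [of 0 p] l_le [of 0 p] p by (auto simp: \<xi>_0)
      have "norm (G p) \<le> K * lev p ^ 3" using K [OF p, of 0] p by (simp add: \<xi>_0)
      also have "\<dots> \<le> \<bar>K\<bar> * (C * lev p ^ 2)"
        using lp C by (intro mult_mono) (auto simp: eval_nat_numeral mult_right_mono)
      finally show ?thesis by simp
    qed
    then show ?thesis by blast
  qed
  {
    case (0 u G)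
    obtain K where K: "\<And>p t. p \<in> S \<Longrightarrow> 0 \<le> t \<Longrightarrow> norm (integral {0..t} (\<lambda>r. u r p) - G p) \<le> K * l t p ^ 3"
      using 0(2) by (elim exE) blast
    have "continuous_on S G"
    proof (rule uniform_limit_theorem)
      show "uniform_limit S (\<lambda>n p. integral {0..real n} (\<lambda>r. u r p)) G sequentially"
      proof (rule uniform_limitI)
        fix e :: real assume e0: "0 < e"
        obtain T where T: "T \<ge> 0" "\<And>t p. t \<ge> T \<Longrightarrow> p \<in> S \<Longrightarrow> K * l t p ^ 3 < e"
          using rate_uniform [OF e0, of K] by blast
        obtain N :: nat where N: "real N \<ge> T" using real_arch_simple by blast
        have "dist (integral {0..real n} (\<lambda>r. u r p)) (G p) < e" if "n \<ge> N" "p \<in> S" for n p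
        proof -
          have n: "real n \<ge> T" using that N by simp
          then show ?thesis using K [OF that(2), of "real n"] T(2) [OF n that(2)] by (simp add: dist_norm)
        qed
        then show "\<forall>\<^sub>F n in sequentially. \<forall>p\<in>S. dist (integral {0..real n} (\<lambda>r. u r p)) (G p) < e"
          unfolding eventually_sequentially by blast
      qed
      have "continuous_on ({0..} \<times> S) (\<lambda>(t, p). u t p)" using 0(1) by (simp add: weighted_bound_def)
      then have "continuous_on S (\<lambda>p. integral (cbox 0 (real n)) (\<lambda>r. u r p))" for n
        using swapped_continuous [of u S "real n"] by (intro integral_continuous_on_param) simp
      then show "\<forall>\<^sub>F n in sequentially. continuous_on S (\<lambda>p. integral {0..real n} (\<lambda>r. u r p))" by simp
    qed simp
    then show ?case using bound [OF 0(2)] by simp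
  next
    case (Suc k u G)
    obtain KG where KG: "\<And>p t. p \<in> S \<Longrightarrow> 0 \<le> t \<Longrightarrow> norm (integral {0..t} (\<lambda>r. u r p) - G p) \<le> KG * l t p ^ 3"
      using Suc.prems(2) by (elim exE) blast
    have ucont: "continuous_on ({0..} \<times> S) (\<lambda>(t, p). u t p)"
      using weighted_Ck_bound [OF Suc.prems(1)] by (simp add: weighted_bound_def)
    obtain u' where u': "\<And>t p. 0 \<le> t \<Longrightarrow> p \<in> S \<Longrightarrow> (u t has_derivative u' t p) (at p)"
      "\<And>w. weighted_Ck S l 6 k (\<lambda>t p. u' t p w)" by (rule weighted_Ck_SucE [OF Suc.prems(1)]) blast
    note u'b = weighted_Ck_bound [OF u'(2)]
    have u'cont: "continuous_on ({0..} \<times> S) (\<lambda>(t, p). u' t p w)" for w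
      using u'b [of w] by (simp add: weighted_bound_def)
    have "\<forall>w. \<exists>G'. \<exists>K\<ge>0. \<forall>p\<in>S. \<forall>t\<ge>0. norm (integral {0..t} (\<lambda>r. u' r p w) - G' p) \<le> K * l t p ^ 3"
      using limit_exists [OF u'b] by blast
    then obtain G1 K1 where K1: "\<And>w. K1 w \<ge> 0"
      "\<And>w p t. p \<in> S \<Longrightarrow> 0 \<le> t \<Longrightarrow> norm (integral {0..t} (\<lambda>r. u' r p w) - G1 w p) \<le> K1 w * l t p ^ 3"
      by metis
    \<comment> \<open>The limits \<open>G1 w\<close> come from a separate choice for each w.
      Rebuilding them from the basis directions makes the map linear in w and the rate uniform over
      vectors of bounded norm.\<close>
    define G' where "G' p w = (\<Sum>b\<in>Basis. (w \<bullet> b) *\<^sub>R G1 b p)" for p w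
    define K where "K = (\<Sum>b\<in>Basis. K1 b)"
    have rate: "norm (integral {0..t} (\<lambda>r. u' r p w) - G' p w) \<le> norm w * (K * l t p ^ 3)"
      if p: "p \<in> S" and t: "0 \<le> t" for p t w
    proof -
      have "u' r p w = (\<Sum>b\<in>Basis. (w \<bullet> b) *\<^sub>R u' r p b)" if "0 \<le> r" for r
      proof -
        have "linear (u' r p)" using u'(1) [OF that p] has_derivative_linear by blast
        then have "u' r p (\<Sum>b\<in>Basis. (w \<bullet> b) *\<^sub>R b) = (\<Sum>b\<in>Basis. (w \<bullet> b) *\<^sub>R u' r p b)"
          by (simp add: linear_sum linear_scale)
        then show ?thesis by (simp add: euclidean_representation)
      qed
      then have "integral {0..t} (\<lambda>r. u' r p w) = integral {0..t} (\<lambda>r. \<Sum>b\<in>Basis. (w \<bullet> b) *\<^sub>R u' r p b)"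
        by (intro integral_cong) auto
      also have "\<dots> = (\<Sum>b\<in>Basis. integral {0..t} (\<lambda>r. (w \<bullet> b) *\<^sub>R u' r p b))"
        by (intro integral_sum finite_Basis integrable_cmul u_integrable [OF u'b p]) simp
      also have "\<dots> = (\<Sum>b\<in>Basis. (w \<bullet> b) *\<^sub>R integral {0..t} (\<lambda>r. u' r p b))"
        by simp
      finally have "integral {0..t} (\<lambda>r. u' r p w) - G' p w =
          (\<Sum>b\<in>Basis. (w \<bullet> b) *\<^sub>R (integral {0..t} (\<lambda>r. u' r p b) - G1 b p))"
        by (simp add: G'_def sum_subtractf scaleR_diff_right)
      also have "norm \<dots> \<le> (\<Sum>b\<in>Basis. norm w * (K1 b * l t p ^ 3))"
      proof (rule sum_norm_le)
        fix b :: "real \<times> real \<times> real" assume "b \<in> Basis"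
        then show "norm ((w \<bullet> b) *\<^sub>R (integral {0..t} (\<lambda>r. u' r p b) - G1 b p)) \<le> norm w * (K1 b * l t p ^ 3)"
          using Basis_le_norm [of b w] K1(2) [OF p t, of b] by (simp add: mult_mono)
      qed
      finally show ?thesis by (simp add: K_def sum_distrib_left sum_distrib_right)
    qed
    have flat: "flat_Ck S lev k (\<lambda>p. G' p w)" for w
    proof (rule Suc.IH [OF u'(2)])
      show "\<exists>K. \<forall>p\<in>S. \<forall>t\<ge>0. norm (integral {0..t} (\<lambda>r. u' r p w) - G' p w) \<le> K * l t p ^ 3"
        using rate by (intro exI [of _ "norm w * K"]) (simp add: mult.assoc)
    qed
    have "(G has_derivative G' p) (at p)" if p: "p \<in> S" for p
    proof -
      obtain r where r: "0 < r" "ball p r \<subseteq> S" using S_open p open_contains_ball by blast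
      have lim: "(\<lambda>n. integral {0..real n} (\<lambda>r. u r q)) \<longlonglongrightarrow> G q" if q: "q \<in> S" for q
      proof (rule metric_LIMSEQ_I)
        fix e :: real assume e0: "0 < e"
        obtain T where T: "T \<ge> 0" "\<And>t p. t \<ge> T \<Longrightarrow> p \<in> S \<Longrightarrow> KG * l t p ^ 3 < e"
          using rate_uniform [OF e0, of KG] by blast
        obtain N :: nat where N: "real N \<ge> T" using real_arch_simple by blast
        have "dist (integral {0..real n} (\<lambda>r. u r q)) (G q) < e" if "n \<ge> N" for n
        proof -
          have n: "real n \<ge> T" using that N by simp
          then show ?thesis using KG [OF q, of "real n"] T(2) [OF n q] by (simp add: dist_norm)
        qed
        then show "\<exists>N. \<forall>n\<ge>N. dist (integral {0..real n} (\<lambda>r. u r q)) (G q) < e" by blast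
      qed
      have "\<exists>g. \<forall>x\<in>ball p r. (\<lambda>n. integral {0..real n} (\<lambda>r. u r x)) \<longlonglongrightarrow> g x \<and> (g has_derivative G' x) (at x within ball p r)"
      proof (rule has_derivative_sequence)
        show "((\<lambda>x. integral {0..real n} (\<lambda>r. u r x)) has_derivative (\<lambda>w. integral {0..real n} (\<lambda>r. u' r x w))) (at x within ball p r)"
          if x: "x \<in> ball p r" for n x
        proof (rule has_derivative_at_withinI, rule has_derivative_integral_param [where U = "ball p r"])
          show "((\<lambda>x. u t x) has_derivative u' t y) (at y)" if "y \<in> ball p r" "t \<in> {0..real n}" for y t
            using u'(1) [of t y] that r by auto
          show "continuous_on {0..real n} (\<lambda>t. u t y)" if "y \<in> ball p r" for y
          proof -
            have "continuous_on {0..real n} (\<lambda>t. (\<lambda>(t, p). u t p) (t, y))"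
              using that r by (intro continuous_on_compose2 [OF ucont] continuous_intros) auto
            then show ?thesis by simp
          qed
          show "continuous_on (ball p r \<times> {0..real n}) (\<lambda>(y, t). u' t y w)" for w
            by (rule swapped_continuous [OF u'cont r(2)])
        qed (use x in auto)
        fix e :: real assume e0: "0 < e"
        obtain T where T: "T \<ge> 0" "\<And>t p. t \<ge> T \<Longrightarrow> p \<in> S \<Longrightarrow> K * l t p ^ 3 < e"
          using rate_uniform [OF e0, of K] by blast
        obtain N :: nat where N: "real N \<ge> T" using real_arch_simple by blast
        have "norm (integral {0..real n} (\<lambda>r. u' r x h) - G' x h) \<le> e * norm h"
          if "n \<ge> N" "x \<in> ball p r" for n x h
        proof -
          have n: "real n \<ge> T" using that N by simp
          have x: "x \<in> S" using that r by auto
          have "norm (integral {0..real n} (\<lambda>r. u' r x h) - G' x h) \<le> norm h * (K * l (real n) x ^ 3)"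
            by (rule rate [OF x]) simp
          also have "\<dots> \<le> norm h * e" using T(2) [OF n x] by (intro mult_left_mono) auto
          finally show ?thesis by (simp add: mult.commute)
        qed
        then show "\<forall>\<^sub>F n in sequentially. \<forall>x\<in>ball p r. \<forall>h. norm (integral {0..real n} (\<lambda>r. u' r x h) - G' x h) \<le> e * norm h"
          unfolding eventually_sequentially by blast
      next
        show "(\<lambda>n. integral {0..real n} (\<lambda>r. u r p)) \<longlonglongrightarrow> G p" by (rule lim [OF p])
      qed (use r in auto)
      then obtain g where g: "\<And>x. x \<in> ball p r \<Longrightarrow> (\<lambda>n. integral {0..real n} (\<lambda>r. u r x)) \<longlonglongrightarrow> g x"
        "\<And>x. x \<in> ball p r \<Longrightarrow> (g has_derivative G' x) (at x within ball p r)" by blast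
      have pb: "p \<in> ball p r" using r by simp
      have eq: "g x = G x" if "x \<in> ball p r" for x
        using LIMSEQ_unique [OF g(1) [OF that] lim] that r by auto
      have "(g has_derivative G' p) (at p)" using g(2) [OF pb] at_within_open [OF pb] by simp
      from has_derivative_cong_on_open [OF open_ball pb eq this] show ?thesis .
    qed
    then show ?case using bound [OF Suc.prems(2)] flat by (simp only: flat_Ck.simps) blast
  }
qed

end

section \<open>Asymptotic energy\<close>

text \<open>Gronwall run backwards: exp (2 K s) times the square of norm (Y s w) cannot decrease, so
  a nonzero w is never sent to 0.\<close>

lemma (in flow_family) flow_derivative_inj:
  assumes p: "p \<in> S" and t: "0 \<le> t"
  shows "\<exists>D. (\<xi> t has_derivative D) (at p) \<and> inj D"
proof -
  interpret A: linear_family S "\<lambda>t p. F' (\<xi> t p)" by (rule flow_linear_family)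
  have "\<exists>Y. Y 0 = w \<and> ode_sol (\<lambda>t u. F' (\<xi> t p) u + 0) Y" for w
  proof (rule linear_ode_exists)
    show "linear (F' (\<xi> t p))" if "0 \<le> t" for t by (rule A.linear_A [OF that p])
    show "continuous_on {0..} (\<lambda>t. F' (\<xi> t p) v)" for v
    proof -
      have "continuous_on {0..} (\<lambda>t. (\<lambda>(t, p). F' (\<xi> t p) v) (t, p))"
        by (rule continuous_on_compose2 [OF A.cont_A continuous_on_Pair [OF continuous_on_id continuous_on_const]])
          (use p in auto)
      then show ?thesis by simp
    qed
  qed simp
  then obtain Y0 where Y0: "\<And>w. Y0 w 0 = w" "\<And>w. ode_sol (\<lambda>t u. F' (\<xi> t p) u + 0) (Y0 w)" by metis
  define Y where "Y t w = Y0 w t" for t w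
  have d: "(\<xi> t has_derivative Y t) (at p)"
    by (rule flow_derivative [OF _ _ p t]) (use Y0 in \<open>auto simp: Y_def\<close>)
  obtain K where K: "0 \<le> K" "\<And>s v. 0 \<le> s \<Longrightarrow> s \<le> t \<Longrightarrow> norm (F' (\<xi> s p) v) \<le> K * norm v"
    using A.operator_bounded [OF p, of t] by blast
  have "w = 0" if "Y t w = 0" for w
  proof -
    let ?g = "\<lambda>s. - (exp (2 * K * s) * (Y s w \<bullet> Y s w))"
    have "?g t \<le> ?g 0"
    proof (rule halfline_nonincreasing [of t ?g "\<lambda>s. - (exp (2 * K * s) * (2 * K * (Y s w \<bullet> Y s w) + 2 * (Y s w \<bullet> F' (\<xi> s p) (Y s w))))"])
      fix s :: real assume s: "0 \<le> s"
      have "((\<lambda>s. Y s w) has_vector_derivative F' (\<xi> s p) (Y s w)) (at s within {0..})"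
        using ode_solD [OF Y0(2) s, of w] by (simp add: Y_def)
      then have "((\<lambda>s. Y s w \<bullet> Y s w) has_real_derivative Y s w \<bullet> F' (\<xi> s p) (Y s w) + F' (\<xi> s p) (Y s w) \<bullet> Y s w) (at s within {0..})"
        unfolding has_real_derivative_iff_has_vector_derivative has_vector_derivative_def
        by (auto intro!: derivative_eq_intros simp: algebra_simps inner_simps)
      then show "(?g has_real_derivative - (exp (2 * K * s) * (2 * K * (Y s w \<bullet> Y s w) + 2 * (Y s w \<bullet> F' (\<xi> s p) (Y s w))))) (at s within {0..})"
        by (auto intro!: derivative_eq_intros simp: algebra_simps inner_commute)
    next
      fix s assume s: "0 < s" "s < t"
      have "\<bar>Y s w \<bullet> F' (\<xi> s p) (Y s w)\<bar> \<le> norm (Y s w) * norm (F' (\<xi> s p) (Y s w))"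
        by (rule Cauchy_Schwarz_ineq2)
      also have "\<dots> \<le> norm (Y s w) * (K * norm (Y s w))"
        using K(2) [of s] s by (intro mult_left_mono) auto
      also have "\<dots> = K * (Y s w \<bullet> Y s w)"
        by (simp add: power2_norm_eq_inner [symmetric] power2_eq_square)
      finally have "0 \<le> 2 * K * (Y s w \<bullet> Y s w) + 2 * (Y s w \<bullet> F' (\<xi> s p) (Y s w))" by linarith
      then show "- (exp (2 * K * s) * (2 * K * (Y s w \<bullet> Y s w) + 2 * (Y s w \<bullet> F' (\<xi> s p) (Y s w)))) \<le> 0"
        by simp
    qed (use t in auto)
    then have "w \<bullet> w \<le> 0" using that Y0(1) [of w] by (simp add: Y_def)
    then have "w \<bullet> w = 0" using inner_ge_zero [of w] by linarith
    then show ?thesis by simp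
  qed
  moreover have "linear (Y t)" using d has_derivative_linear by blast
  ultimately have "inj (Y t)" by (simp add: linear_injective_0)
  with d show ?thesis by blast
qed

lemma weighted_Ck_imp_Ck_on: "weighted_Ck S l a k g \<Longrightarrow> 0 \<le> t \<Longrightarrow> Ck_on k S (g t)"
proof (induction k arbitrary: g)
  case 0
  then have c: "continuous_on ({0..} \<times> S) (\<lambda>(t, p). g t p)" by (simp add: weighted_bound_def)
  have "continuous_on S (\<lambda>p. (\<lambda>(t, p). g t p) (t, p))"
    by (rule continuous_on_compose2 [OF c continuous_on_Pair [OF continuous_on_const continuous_on_id]])
      (use 0 in auto)
  then show ?case by simp
next
  case (Suc k)
  obtain g' where g': "\<And>t p. 0 \<le> t \<Longrightarrow> p \<in> S \<Longrightarrow> (g t has_derivative g' t p) (at p)"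
    "\<And>w. weighted_Ck S l a k (\<lambda>t p. g' t p w)" by (rule weighted_Ck_SucE [OF Suc.prems(1)]) blast
  show ?case
    by (rule Ck_on_SucI [OF has_derivative_at_withinI [OF g'(1) [OF Suc.prems(2)]] Suc.IH [OF g'(2) Suc.prems(2)]])
qed

section \<open>Solutions confined to a box\<close>

lemma ode_sol_shift:
  assumes "ode_sol (\<lambda>t. f) x" "0 \<le> T"
  shows "ode_sol (\<lambda>t. f) (\<lambda>t. x (T + t))"
  unfolding ode_sol_def
proof (intro allI impI)
  fix t :: real assume t: "0 \<le> t"
  have "((\<lambda>t. T + t) has_vector_derivative 1) (at t within {0..})" by (auto intro!: derivative_eq_intros)
  moreover have "(x has_vector_derivative f (x (T + t))) (at (T + t) within (\<lambda>t. T + t) ` {0..})"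
    by (rule has_vector_derivative_within_subset [OF ode_solD [OF assms(1)]]) (use assms(2) t in auto)
  ultimately show "((\<lambda>t. x (T + t)) has_vector_derivative f (x (T + t))) (at t within {0..})"
    using vector_derivative_diff_chain_within [of "\<lambda>t. T + t" 1 t "{0..}" x "\<lambda>h. h *\<^sub>R f (x (T + t))"]
    by (simp add: comp_def has_vector_derivative_def)
qed

text \<open>Composing with the nearest-point projection onto the convex box gives a globally
  Lipschitz field that agrees with \<open>fld\<close> on the box. Its solutions exist for all time
  and solve the true equation as long as they stay in the box.\<close>

definition ext_fld :: "real \<Rightarrow> real \<Rightarrow> real \<times> real \<times> real \<Rightarrow> real \<times> real \<times> real" where
  "ext_fld \<delta> C p = fld \<delta> (closest_point (Box C) p)"

lemma Box_nonempty: "1 \<le> C \<Longrightarrow> Box C \<noteq> {}"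
proof -
  assume "1 \<le> C"
  then have "1 / C \<le> 1" by simp
  with \<open>1 \<le> C\<close> have "(0, 0, 0) \<in> Box C" by (simp add: Box_def)
  then show ?thesis by blast
qed

lemma ext_fld_lipschitz:
  assumes C: "1 \<le> C"
  obtains L where "0 \<le> L" "\<And>p q. norm (ext_fld \<delta> C p - ext_fld \<delta> C q) \<le> L * norm (p - q)"
proof -
  have sub: "Box C \<subseteq> binet_dom" using Box_subset_binet_dom C by simp
  have d: "(fld \<delta> has_derivative fld' \<delta> u) (at u within Box C)" if "u \<in> Box C" for u
    using fld_has_derivative that sub has_derivative_at_withinI by blast
  have c: "continuous_on (Box C) (\<lambda>u. fld' \<delta> u v)" for v
    by (rule continuous_on_subset [OF smooth_on_imp_continuous_on [OF smooth_on_fld'] sub])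
  obtain L where L: "0 \<le> L" "\<And>u v. u \<in> Box C \<Longrightarrow> v \<in> Box C \<Longrightarrow> norm (fld \<delta> u - fld \<delta> v) \<le> L * norm (u - v)"
    using lipschitz_on_compact_convex [OF d c Box] by blast
  have "norm (ext_fld \<delta> C p - ext_fld \<delta> C q) \<le> L * norm (p - q)" for p q
  proof -
    have cl: "closed (Box C)" using Box(1) compact_imp_closed by blast
    have "norm (ext_fld \<delta> C p - ext_fld \<delta> C q) \<le> L * norm (closest_point (Box C) p - closest_point (Box C) q)"
      unfolding ext_fld_def using closest_point_in_set [OF cl Box_nonempty [OF C]] by (intro L(2))
    also have "\<dots> \<le> L * norm (p - q)"
      using closest_point_lipschitz [OF Box(2) cl Box_nonempty [OF C], of p q] L(1)
      by (intro mult_left_mono) (auto simp: dist_norm)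
    finally show ?thesis .
  qed
  then show thesis using L(1) that by blast
qed

lemma ext_sol_exists:
  assumes C: "1 \<le> C"
  shows "\<exists>\<xi>. \<xi> 0 = p \<and> ode_sol (\<lambda>t. ext_fld \<delta> C) \<xi>"
proof -
  obtain L where L: "0 \<le> L" "\<And>p q. norm (ext_fld \<delta> C p - ext_fld \<delta> C q) \<le> L * norm (p - q)"
    using ext_fld_lipschitz [OF C] by metis
  show ?thesis
  proof (rule picard_halfline)
    have "L-lipschitz_on UNIV (ext_fld \<delta> C)"
      using L by (intro lipschitz_onI) (auto simp: dist_norm)
    then have "continuous_on UNIV (ext_fld \<delta> C)" by (rule lipschitz_on_continuous_on)
    then have "continuous_on ({0..} \<times> UNIV) (\<lambda>z. ext_fld \<delta> C (snd z))"
      by (rule continuous_on_compose2) (auto intro: continuous_intros)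
    then show "continuous_on ({0..} \<times> UNIV) (\<lambda>(t :: real, x). ext_fld \<delta> C x)" by (simp add: split_def)
  qed (use L(2) in blast)
qed

lemma ext_sol_close:
  assumes C: "1 \<le> C"
  obtains L where "0 \<le> L" "\<And>\<xi> \<eta> t. ode_sol (\<lambda>t. ext_fld \<delta> C) \<xi> \<Longrightarrow> ode_sol (\<lambda>t. ext_fld \<delta> C) \<eta> \<Longrightarrow> 0 \<le> t \<Longrightarrow> t \<le> T \<Longrightarrow>
    norm (\<xi> t - \<eta> t) \<le> L * norm (\<xi> 0 - \<eta> 0)"
proof -
  obtain L where L: "0 \<le> L" "\<And>p q. norm (ext_fld \<delta> C p - ext_fld \<delta> C q) \<le> L * norm (p - q)"
    using ext_fld_lipschitz [OF C] by metis
  have "norm (\<xi> t - \<eta> t) \<le> sqrt (exp ((2 * L + 1) * T)) * norm (\<xi> 0 - \<eta> 0)"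
    if sol: "ode_sol (\<lambda>t. ext_fld \<delta> C) \<xi>" "ode_sol (\<lambda>t. ext_fld \<delta> C) \<eta>" and t: "0 \<le> t" "t \<le> T" for \<xi> \<eta> t
  proof -
    have "(norm (\<xi> t - \<eta> t))\<^sup>2 \<le> ((norm (\<xi> 0 - \<eta> 0))\<^sup>2 + 0\<^sup>2 * t) * exp ((2 * L + 1) * t)"
      by (rule gronwall_norm [OF ode_sol_diff [OF sol], of T]) (use L t in auto)
    also have "\<dots> \<le> (norm (\<xi> 0 - \<eta> 0))\<^sup>2 * exp ((2 * L + 1) * T)"
      using t L(1) by (auto intro!: mult_left_mono)
    also have "\<dots> = (sqrt (exp ((2 * L + 1) * T)) * norm (\<xi> 0 - \<eta> 0))\<^sup>2" by (simp add: power_mult_distrib)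
    finally show ?thesis by (rule power2_le_imp_le) simp
  qed
  then show thesis by (intro that [of "sqrt (exp ((2 * L + 1) * T))"]) auto
qed

lemma ext_sol_unique:
  assumes C: "1 \<le> C" and s: "ode_sol (\<lambda>t. ext_fld \<delta> C) \<xi>" "ode_sol (\<lambda>t. ext_fld \<delta> C) \<eta>" "\<xi> 0 = \<eta> 0" and t: "0 \<le> t"
  shows "\<xi> t = \<eta> t"
proof -
  obtain L where "\<And>\<xi> \<eta> s. ode_sol (\<lambda>t. ext_fld \<delta> C) \<xi> \<Longrightarrow> ode_sol (\<lambda>t. ext_fld \<delta> C) \<eta> \<Longrightarrow> 0 \<le> s \<Longrightarrow> s \<le> t \<Longrightarrow>
    norm (\<xi> s - \<eta> s) \<le> L * norm (\<xi> 0 - \<eta> 0)"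
    using ext_sol_close [OF C, of \<delta> t] by metis
  from this [OF s(1,2) t order_refl] show ?thesis using s(3) by simp
qed

lemma ext_fld_Box: "p \<in> Box C \<Longrightarrow> ext_fld \<delta> C p = fld \<delta> p"
  by (simp add: ext_fld_def closest_point_self)

lemma box_sol_iff_ext: "box_sol \<delta> C \<xi> \<longleftrightarrow> ode_sol (\<lambda>t. ext_fld \<delta> C) \<xi> \<and> (\<forall>t\<ge>0. \<xi> t \<in> Box C)"
  unfolding box_sol_def ode_sol_def by (auto simp: ext_fld_Box)

lemma box_sol_mono: "box_sol \<delta> C \<xi> \<Longrightarrow> 0 < C \<Longrightarrow> C \<le> D \<Longrightarrow> box_sol \<delta> D \<xi>"
  unfolding box_sol_def using Box_mono by blast

lemma box_sol_unique:
  assumes "box_sol \<delta> C \<xi>" "box_sol \<delta> D \<eta>" "1 \<le> C" "1 \<le> D" "\<xi> 0 = \<eta> 0" "0 \<le> t"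
  shows "\<xi> t = \<eta> t"
proof (rule ext_sol_unique [of "max C D"])
  show "ode_sol (\<lambda>t. ext_fld \<delta> (max C D)) \<xi>" "ode_sol (\<lambda>t. ext_fld \<delta> (max C D)) \<eta>"
    using box_sol_mono [OF assms(1), of "max C D"] box_sol_mono [OF assms(2), of "max C D"] assms(3,4)
    unfolding box_sol_iff_ext by auto
qed (use assms in auto)

lemma box_sol_shift: "box_sol \<delta> C \<xi> \<Longrightarrow> 0 \<le> T \<Longrightarrow> box_sol \<delta> C (\<lambda>t. \<xi> (T + t))"
  unfolding box_sol_def using ode_sol_shift by auto

text \<open>On the box - l' is at most c l with c = \<delta> C^3 C^2, so exp (c t) l is
  nondecreasing and l stays positive. Only a finite interval is assumed, because the lemma is used
  while confinement is still being proved.\<close>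

lemma lev_positive_interval:
  assumes d: "\<And>s. 0 \<le> s \<Longrightarrow> s \<le> t \<Longrightarrow> (\<xi> has_vector_derivative fld \<delta> (\<xi> s)) (at s within {0..})"
    and b: "\<And>s. 0 \<le> s \<Longrightarrow> s \<le> t \<Longrightarrow> \<xi> s \<in> Box C" and C: "1 \<le> C" and \<delta>: "\<delta> > 0"
    and pos: "0 < lev (\<xi> 0)" and t: "0 \<le> t"
  shows "0 < lev (\<xi> t)" "lev (\<xi> t) \<le> lev (\<xi> 0)"
proof -
  define c where "c = \<delta> * C ^ 3 * C ^ 2"
  have dl: "((\<lambda>t. lev (\<xi> t)) has_real_derivative - (\<delta> * lev (\<xi> s) ^ 4 * inverse (1 + fst (\<xi> s)) ^ 2)) (at s within {0..})"
    if "0 \<le> s" "s \<le> t" for s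
    using component_derivatives(3) [OF d [OF that]] unfolding fld_alt by simp
  have "lev (\<xi> t) \<le> lev (\<xi> 0)"
    by (rule halfline_nonincreasing [OF dl _ order_refl t order_refl]) (use \<delta> in auto)
  then show "lev (\<xi> t) \<le> lev (\<xi> 0)" .
  have "- (exp (c * t) * lev (\<xi> t)) \<le> - (exp (c * 0) * lev (\<xi> 0))"
  proof (rule halfline_nonincreasing [of t "\<lambda>s. - (exp (c * s) * lev (\<xi> s))"
        "\<lambda>s. - (exp (c * s) * (c * lev (\<xi> s) - \<delta> * lev (\<xi> s) ^ 4 * inverse (1 + fst (\<xi> s)) ^ 2))"])
    fix s :: real assume s: "0 \<le> s" "s \<le> t"
    show "((\<lambda>s. - (exp (c * s) * lev (\<xi> s))) has_real_derivative
      - (exp (c * s) * (c * lev (\<xi> s) - \<delta> * lev (\<xi> s) ^ 4 * inverse (1 + fst (\<xi> s)) ^ 2))) (at s within {0..})"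
      using dl [OF s] by (auto intro!: derivative_eq_intros simp: algebra_simps)
  next
    fix s :: real assume s: "0 < s" "s < t"
    note B = Box_D [OF b [of s] C]
    have "lev (\<xi> s) ^ 3 * inverse (1 + fst (\<xi> s)) ^ 2 \<le> C ^ 3 * C ^ 2"
      using B s C by (intro mult_mono power_mono) auto
    then have "\<delta> * lev (\<xi> s) * (lev (\<xi> s) ^ 3 * inverse (1 + fst (\<xi> s)) ^ 2) \<le> \<delta> * lev (\<xi> s) * (C ^ 3 * C ^ 2)"
      using B(5) s \<delta> by (intro mult_left_mono) auto
    then have "\<delta> * lev (\<xi> s) ^ 4 * inverse (1 + fst (\<xi> s)) ^ 2 \<le> c * lev (\<xi> s)"
      by (simp add: c_def eval_nat_numeral mult_ac)
    then show "- (exp (c * s) * (c * lev (\<xi> s) - \<delta> * lev (\<xi> s) ^ 4 * inverse (1 + fst (\<xi> s)) ^ 2)) \<le> 0" by simp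
  qed (use t in auto)
  then have "0 < exp (c * t) * lev (\<xi> t)" using pos by simp
  then show "0 < lev (\<xi> t)" by (simp add: zero_less_mult_iff)
qed

lemma box_sol_lev_pos:
  assumes "box_sol \<delta> C \<xi>" "1 \<le> C" "\<delta> > 0" "0 < lev (\<xi> 0)" "0 \<le> t"
  shows "0 < lev (\<xi> t)"
  by (rule lev_positive_interval [where \<xi> = \<xi>, OF _ _ assms(2-5)])
    (use ode_solD [OF box_solD(1) [OF assms(1)]] box_solD(2) [OF assms(1)] in auto)

text \<open>The box excludes collision and escape of the radius, and it makes the solution unique,
  so the existential quantifier leaves no ambiguity.\<close>

definition tends_to_energy :: "real \<Rightarrow> real \<times> real \<times> real \<Rightarrow> real \<Rightarrow> bool" where
  "tends_to_energy \<delta> p h \<longleftrightarrow> (\<exists>\<xi> C. 1 \<le> C \<and> \<xi> 0 = p \<and> box_sol \<delta> C \<xi> \<and> ((\<lambda>t. energy (\<xi> t)) \<longlongrightarrow> h) at_top)"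

lemma tends_to_energy_iff:
  assumes "box_sol \<delta> C \<xi>" "1 \<le> C" "\<xi> 0 = p"
  shows "tends_to_energy \<delta> p h \<longleftrightarrow> ((\<lambda>t. energy (\<xi> t)) \<longlongrightarrow> h) at_top"
proof
  assume "tends_to_energy \<delta> p h"
  then obtain \<eta> D where \<eta>: "1 \<le> D" "\<eta> 0 = p" "box_sol \<delta> D \<eta>" "((\<lambda>t. energy (\<eta> t)) \<longlongrightarrow> h) at_top"
    unfolding tends_to_energy_def by blast
  have "\<eta> t = \<xi> t" if "0 \<le> t" for t
    by (rule box_sol_unique [OF \<eta>(3) assms(1) \<eta>(1) assms(2) _ that]) (simp add: \<eta> assms)
  then have "\<forall>\<^sub>F t in at_top. energy (\<eta> t) = energy (\<xi> t)"
    unfolding eventually_at_top_linorder by (intro exI [of _ 0]) auto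
  from tendsto_cong [OF this] \<eta>(4) show "((\<lambda>t. energy (\<xi> t)) \<longlongrightarrow> h) at_top" by simp
qed (use assms tends_to_energy_def in blast)

lemma tends_to_energy_unique: "tends_to_energy \<delta> p h \<Longrightarrow> tends_to_energy \<delta> p h' \<Longrightarrow> h = h'"
proof -
  assume h: "tends_to_energy \<delta> p h" "tends_to_energy \<delta> p h'"
  then obtain \<xi> C where "1 \<le> C" "\<xi> 0 = p" "box_sol \<delta> C \<xi>" unfolding tends_to_energy_def by blast
  from tends_to_energy_iff [OF this(3,1,2)] h show ?thesis using tendsto_unique [OF trivial_limit_at_top_linorder] by blast
qed

lemma tends_to_energy_shift:
  assumes "box_sol \<delta> C \<xi>" "1 \<le> C" "0 \<le> T"
  shows "tends_to_energy \<delta> (\<xi> T) h \<longleftrightarrow> tends_to_energy \<delta> (\<xi> 0) h"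
proof -
  have "tends_to_energy \<delta> (\<xi> T) h \<longleftrightarrow> ((\<lambda>t. energy (\<xi> (T + t))) \<longlongrightarrow> h) at_top"
    by (rule tends_to_energy_iff [OF box_sol_shift [OF assms(1,3)] assms(2)]) simp
  also have "\<dots> \<longleftrightarrow> ((\<lambda>t. energy (\<xi> t)) \<longlongrightarrow> h) at_top"
  proof
    have f: "filterlim (\<lambda>t. c + t) at_top at_top" for c :: real
      by (rule filterlim_tendsto_add_at_top [OF tendsto_const filterlim_ident])
    show "((\<lambda>t. energy (\<xi> t)) \<longlongrightarrow> h) at_top" if "((\<lambda>t. energy (\<xi> (T + t))) \<longlongrightarrow> h) at_top"
      using filterlim_compose [OF that f, of "- T"] by simp
    show "((\<lambda>t. energy (\<xi> (T + t))) \<longlongrightarrow> h) at_top" if "((\<lambda>t. energy (\<xi> t)) \<longlongrightarrow> h) at_top"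
      by (rule filterlim_compose [OF that f])
  qed
  also have "\<dots> \<longleftrightarrow> tends_to_energy \<delta> (\<xi> 0) h" by (rule tends_to_energy_iff [OF assms(1,2) refl, symmetric])
  finally show ?thesis .
qed

section \<open>Confinement in a tube around the plane l = 0\<close>

lemma norm_plane: "(norm (plane p))\<^sup>2 = 2 * energy p"
  by (cases p) (simp add: norm_Pair energy_def)

lemma compact_tube: "compact {p. norm (plane p) \<le> \<rho> \<and> 0 \<le> lev p \<and> lev p \<le> b}"
proof -
  have "compact ((\<lambda>(z, l). (fst z, snd z, l)) ` (cball (0 :: real \<times> real) \<rho> \<times> {0..b :: real}))"
    by (intro compact_continuous_image compact_Times compact_cball compact_Icc)
      (auto simp: split_def intro!: continuous_intros)
  moreover have "(\<lambda>(z, l). (fst z, snd z, l)) ` (cball (0 :: real \<times> real) \<rho> \<times> {0..b}) = {p. norm (plane p) \<le> \<rho> \<and> 0 \<le> lev p \<and> lev p \<le> b}"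
    by force
  ultimately show ?thesis by simp
qed

lemma compact_bound:
  fixes f :: "'a::topological_space \<Rightarrow> real"
  assumes "compact K" "continuous_on K f"
  obtains B where "0 \<le> B" "\<And>x. x \<in> K \<Longrightarrow> \<bar>f x\<bar> \<le> B"
proof -
  have "bounded (f ` K)" by (intro compact_imp_bounded compact_continuous_image assms)
  then obtain B where "\<forall>y\<in>f ` K. norm y \<le> B" unfolding bounded_iff by blast
  then show thesis by (intro that [of "max 0 B"]) (auto simp: le_max_iff_disj)
qed

lemma has_derivative_along_curve:
  assumes "(V has_derivative D) (at (\<xi> s))" "(\<xi> has_vector_derivative v) (at s within S)"
  shows "((\<lambda>s. V (\<xi> s)) has_vector_derivative D v) (at s within S)"
  using vector_derivative_diff_chain_within [OF assms(2) has_derivative_at_withinI [OF assms(1)]] by (simp add: comp_def)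

lemma tube_subset_Box:
  assumes "\<rho> < 1" "C \<ge> 1 / (1 - \<rho>)" "C \<ge> 1" "norm (plane p) \<le> \<rho>" "0 \<le> lev p" "lev p \<le> C"
  shows "p \<in> Box C"
proof -
  have "\<bar>fst p\<bar> \<le> \<rho>" "\<bar>fst (snd p)\<bar> \<le> \<rho>"
    using norm_fst_le [of "fst p" "fst (snd p)"] norm_snd_le [of "fst (snd p)" "fst p"] assms(4) by auto
  moreover have "1 / C \<le> 1 - \<rho>" using assms(1-3) by (simp add: field_simps)
  ultimately show ?thesis using assms unfolding Box_def by (cases p) auto
qed

text \<open>The corrected energy V changes at rate l^6 f, which is at most Kf l^4 and hence
  dominated by - (Kf / c) l'. So V + (Kf / c) l never increases, and the energy can rise only by a
  multiple of the initial l, too little to reach radius \<rho>1.\<close>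

lemma tube_confined:
  assumes \<delta>: "\<delta> > 0" and \<rho>: "0 < \<rho>0" "\<rho>0 < \<rho>1" "\<rho>1 < 1" and C: "C \<ge> 1" "C \<ge> 1 / (1 - \<rho>1)"
  shows "\<exists>l1>0. l1 \<le> 1 \<and> (\<forall>p. norm (plane p) < \<rho>0 \<and> 0 < lev p \<and> lev p < l1 \<longrightarrow>
    (\<exists>\<xi>. \<xi> 0 = p \<and> box_sol \<delta> C \<xi> \<and> (\<forall>t\<ge>0. norm (plane (\<xi> t)) < \<rho>1 \<and> 0 < lev (\<xi> t))))"
proof -
  obtain e f where e: "smooth_on cylinder e" and f: "smooth_on disc f" and
    ef: "\<And>p. p \<in> cylinder \<Longrightarrow> \<exists>D. ((\<lambda>p. energy p + lev p ^ 3 * e p) has_derivative D) (at p) \<and>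
      D (fld \<delta> p) = lev p ^ (3 * 2) * f (plane p)"
    using normal_form [OF \<delta> order_refl] by blast
  define K where "K = {p. norm (plane p) \<le> \<rho>1 \<and> 0 \<le> lev p \<and> lev p \<le> 1}"
  have K: "compact K" unfolding K_def by (rule compact_tube)
  have K_cyl: "K \<subseteq> cylinder" using \<rho> by (auto simp: K_def mem_cylinder)
  have K_Box: "K \<subseteq> Box C" unfolding K_def using tube_subset_Box [OF \<rho>(3) C(2,1)] C(1) by force
  obtain Ke where Ke: "0 \<le> Ke" "\<And>p. p \<in> K \<Longrightarrow> \<bar>e p\<bar> \<le> Ke"
    by (rule compact_bound [OF K continuous_on_subset [OF smooth_on_imp_continuous_on [OF e] K_cyl]]) blast
  have "continuous_on (cball 0 \<rho>1) f"
    by (rule continuous_on_subset [OF smooth_on_imp_continuous_on [OF f]]) (use \<rho> in auto)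
  then obtain Kf where Kf: "0 \<le> Kf" "\<And>z. z \<in> cball 0 \<rho>1 \<Longrightarrow> \<bar>f z\<bar> \<le> Kf"
    by (rule compact_bound [OF compact_cball]) blast
  define c where "c = \<delta> / (C + 1) ^ 2"
  have c: "c > 0" using \<delta> C by (simp add: c_def)
  \<comment> \<open>2 * Ke pays for the correction l^3 e at both ends of the interval, Kf / c for
    the barrier term, and 1 for strictness. Then \<open>l1\<close> is chosen so that N * l1 fits
    between the two energy levels.\<close>
  define N where "N = 2 * Ke + Kf / c + 1"
  have N: "N > 0" using Ke Kf c by (simp add: N_def add_nonneg_pos)
  define l1 where "l1 = min 1 ((\<rho>1\<^sup>2 - \<rho>0\<^sup>2) / (2 * N))"
  have rr: "\<rho>0\<^sup>2 < \<rho>1\<^sup>2" using \<rho> by (intro power_strict_mono) auto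
  have l1: "0 < l1" "l1 \<le> 1" "N * l1 \<le> (\<rho>1\<^sup>2 - \<rho>0\<^sup>2) / 2"
  proof -
    show "0 < l1" "l1 \<le> 1" using rr N by (auto simp: l1_def)
    have "N * l1 \<le> N * ((\<rho>1\<^sup>2 - \<rho>0\<^sup>2) / (2 * N))" using N by (intro mult_left_mono) (auto simp: l1_def)
    then show "N * l1 \<le> (\<rho>1\<^sup>2 - \<rho>0\<^sup>2) / 2" using N by simp
  qed
  define V where "V p = energy p + lev p ^ 3 * e p" for p
  have "\<exists>\<xi>. \<xi> 0 = p \<and> box_sol \<delta> C \<xi> \<and> (\<forall>t\<ge>0. norm (plane (\<xi> t)) < \<rho>1 \<and> 0 < lev (\<xi> t))"
    if p: "norm (plane p) < \<rho>0" "0 < lev p" "lev p < l1" for p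
  proof -
    obtain \<xi> where \<xi>: "\<xi> 0 = p" "ode_sol (\<lambda>t. ext_fld \<delta> C) \<xi>" using ext_sol_exists [OF C(1)] by blast
    note cont = ode_sol_continuous_on [OF \<xi>(2)]
    define \<Omega> where "\<Omega> = {p. norm (plane p) < \<rho>1 \<and> 0 < lev p \<and> lev p < 1}"
    have \<Omega>K: "\<Omega> \<subseteq> K" by (auto simp: \<Omega>_def K_def)
    have open_\<Omega>: "open \<Omega>"
      unfolding \<Omega>_def by (intro open_Collect_conj open_Collect_less continuous_intros)
    have stay: "\<xi> t \<in> \<Omega>" if "0 \<le> t" for t
    proof (rule continuous_stays_in_open [OF cont open_\<Omega> _ _ that])
      show "\<xi> 0 \<in> \<Omega>" using p \<rho> l1 \<xi>(1) by (auto simp: \<Omega>_def)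
      fix t :: real assume t: "0 < t" and before: "\<And>s. 0 \<le> s \<Longrightarrow> s < t \<Longrightarrow> \<xi> s \<in> \<Omega>"
      \<comment> \<open>At the critical time itself only the closed conditions are known, by
        continuity. The energy estimate below turns them into strict ones again.\<close>
      have "\<xi> ` closure {0..<t} \<subseteq> K"
      proof (rule image_closure_subset)
        show "continuous_on (closure {0..<t}) \<xi>" using t by (intro continuous_on_subset [OF cont]) auto
        show "closed K" using K compact_imp_closed by blast
      qed (use before \<Omega>K in auto)
      then have inK: "\<xi> s \<in> K" if "0 \<le> s" "s \<le> t" for s using that t by auto
      have d: "(\<xi> has_vector_derivative fld \<delta> (\<xi> s)) (at s within {0..})" if "0 \<le> s" "s \<le> t" for s
        using ode_solD [OF \<xi>(2) that(1)] ext_fld_Box inK [OF that] K_Box by (metis subsetD)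
      have pos: "0 < lev (\<xi> t)" "lev (\<xi> t) \<le> lev (\<xi> 0)"
        using lev_positive_interval [of t \<xi> \<delta> C] d inK K_Box C \<delta> p \<xi>(1) t by (auto simp: subset_eq)
      have decr: "V (\<xi> t) + Kf / c * lev (\<xi> t) \<le> V (\<xi> 0) + Kf / c * lev (\<xi> 0)"
      proof (rule halfline_nonincreasing [of t "\<lambda>s. V (\<xi> s) + Kf / c * lev (\<xi> s)"
            "\<lambda>s. lev (\<xi> s) ^ (3 * 2) * f (plane (\<xi> s)) + Kf / c * (- (\<delta> * lev (\<xi> s) ^ 4 * inverse (1 + fst (\<xi> s)) ^ 2))"])
        fix s :: real assume s: "0 \<le> s" "s \<le> t"
        obtain D where D: "(V has_derivative D) (at (\<xi> s))" "D (fld \<delta> (\<xi> s)) = lev (\<xi> s) ^ (3 * 2) * f (plane (\<xi> s))"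
          using ef [of "\<xi> s"] inK [OF s] K_cyl unfolding V_def [abs_def] by blast
        have "((\<lambda>s. V (\<xi> s)) has_real_derivative lev (\<xi> s) ^ (3 * 2) * f (plane (\<xi> s))) (at s within {0..})"
          using has_derivative_along_curve [OF D(1) d [OF s]] D(2)
          by (simp add: has_real_derivative_iff_has_vector_derivative)
        moreover have "((\<lambda>t. lev (\<xi> t)) has_real_derivative - (\<delta> * lev (\<xi> s) ^ 4 * inverse (1 + fst (\<xi> s)) ^ 2)) (at s within {0..})"
          using component_derivatives(3) [OF d [OF s]] unfolding fld_alt by simp
        ultimately show "((\<lambda>s. V (\<xi> s) + Kf / c * lev (\<xi> s)) has_real_derivative
            lev (\<xi> s) ^ (3 * 2) * f (plane (\<xi> s)) + Kf / c * (- (\<delta> * lev (\<xi> s) ^ 4 * inverse (1 + fst (\<xi> s)) ^ 2))) (at s within {0..})"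
          by (intro DERIV_add DERIV_cmult)
      next
        fix s :: real assume s: "0 < s" "s < t"
        have sK: "\<xi> s \<in> K" using inK s by simp
        then have lb: "0 \<le> lev (\<xi> s)" "lev (\<xi> s) \<le> 1" and z: "plane (\<xi> s) \<in> cball 0 \<rho>1" by (auto simp: K_def)
        have "lev (\<xi> s) ^ (3 * 2) * f (plane (\<xi> s)) \<le> lev (\<xi> s) ^ (3 * 2) * Kf"
          using lb Kf(2) [OF z] by (intro mult_left_mono) auto
        also have "\<dots> \<le> lev (\<xi> s) ^ 4 * Kf"
          using lb Kf(1) power_decreasing [of 4 6 "lev (\<xi> s)"] by (intro mult_right_mono) auto
        also have "\<dots> = Kf / c * (\<delta> * lev (\<xi> s) ^ 4 * (1 / (C + 1) ^ 2))"
          using c \<delta> C unfolding c_def by (simp add: field_simps)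
        also have "\<dots> \<le> Kf / c * (\<delta> * lev (\<xi> s) ^ 4 * inverse (1 + fst (\<xi> s)) ^ 2)"
          using Kf(1) c \<delta> Box_D(3) [of "\<xi> s" C] sK K_Box C(1) by (intro mult_left_mono) auto
        finally show "lev (\<xi> s) ^ (3 * 2) * f (plane (\<xi> s)) + Kf / c * (- (\<delta> * lev (\<xi> s) ^ 4 * inverse (1 + fst (\<xi> s)) ^ 2)) \<le> 0"
          by simp
      qed (use t in auto)
      have nonneg: "0 \<le> Kf / c * lev (\<xi> t)" using Kf(1) c pos by simp
      have le1: "\<bar>lev (\<xi> s) ^ 3 * e (\<xi> s)\<bar> \<le> Ke * l1" if "s \<in> {0, t}" for s
      proof -
        have s: "\<xi> s \<in> K" using inK that t by auto
        have ls: "0 \<le> lev (\<xi> s)" "lev (\<xi> s) \<le> 1" using s by (auto simp: K_def)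
        have "lev (\<xi> s) \<le> l1" using that pos p \<xi>(1) by auto
        then have "lev (\<xi> s) ^ 3 \<le> l1" using power_decreasing [of 1 3 "lev (\<xi> s)"] ls by simp
        then have "\<bar>lev (\<xi> s)\<bar> ^ 3 * \<bar>e (\<xi> s)\<bar> \<le> l1 * Ke"
          using Ke(2) [OF s] ls l1 by (intro mult_mono) auto
        then show ?thesis by (simp add: abs_mult power_abs mult.commute)
      qed
      have le0: "Kf / c * lev (\<xi> 0) \<le> Kf / c * l1" using Kf(1) c p \<xi>(1) by (intro mult_left_mono) auto
      have "energy (\<xi> t) \<le> energy (\<xi> 0) + (2 * Ke + Kf / c) * l1"
      proof -
        have "(2 * Ke + Kf / c) * l1 = 2 * (Ke * l1) + Kf / c * l1" by (simp add: algebra_simps)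
        moreover have "\<bar>lev (\<xi> 0) ^ 3 * e (\<xi> 0)\<bar> \<le> Ke * l1" "\<bar>lev (\<xi> t) ^ 3 * e (\<xi> t)\<bar> \<le> Ke * l1" using le1 by auto
        ultimately show ?thesis using decr nonneg le0 unfolding V_def by linarith
      qed
      also have "\<dots> < energy (\<xi> 0) + N * l1" using l1 by (simp add: N_def algebra_simps)
      also have "\<dots> \<le> energy (\<xi> 0) + (\<rho>1\<^sup>2 - \<rho>0\<^sup>2) / 2" using l1(3) by simp
      finally have "2 * energy (\<xi> t) < 2 * energy (\<xi> 0) + \<rho>1\<^sup>2 - \<rho>0\<^sup>2" by (simp add: field_simps)
      moreover have "2 * energy (\<xi> 0) < \<rho>0\<^sup>2"
        unfolding norm_plane [symmetric] \<xi>(1) using p(1) by (intro power_strict_mono) auto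
      ultimately have "(norm (plane (\<xi> t)))\<^sup>2 < \<rho>1\<^sup>2" unfolding norm_plane by simp
      then have "norm (plane (\<xi> t)) < \<rho>1" using \<rho> by (intro power_less_imp_less_base [of _ 2 \<rho>1]) auto
      then show "\<xi> t \<in> \<Omega>" using pos p \<xi>(1) l1 by (auto simp: \<Omega>_def)
    qed
    then have "box_sol \<delta> C \<xi>" using \<xi>(2) \<Omega>K K_Box unfolding box_sol_iff_ext by blast
    then show ?thesis using \<xi>(1) stay unfolding \<Omega>_def by (intro exI [of _ \<xi>]) auto
  qed
  then show ?thesis using l1(1,2) by blast
qed

section \<open>Smoothness of the limit energy\<close>

definition limit_energy :: "real \<Rightarrow> real \<times> real \<times> real \<Rightarrow> real" where
  "limit_energy \<delta> p = (THE h. tends_to_energy \<delta> p h)"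

lemma limit_energy_eq: "tends_to_energy \<delta> p h \<Longrightarrow> limit_energy \<delta> p = h"
  unfolding limit_energy_def using tends_to_energy_unique by blast

lemma tends_to_energy_level_0:
  assumes "norm (plane p) < 1" "lev p = 0"
  shows "tends_to_energy \<delta> p (energy p)"
proof -
  define z where "z = plane p"
  define C where "C = 1 / (1 - norm z)"
  have z: "norm z < 1" using assms(1) by (simp add: z_def)
  have C: "1 \<le> C" using z by (simp add: C_def)
  define \<xi> where "\<xi> t = (fst (rot t z), snd (rot t z), 0 :: real)" for t
  have "ode_sol (\<lambda>t. fld \<delta>) \<xi>"
    unfolding ode_sol_def
  proof (intro allI impI)
    fix t :: real
    note r = has_vector_derivative_rot [of z t "{0..}"]
    have "(\<xi> has_vector_derivative (fst (rot' (rot t z)), snd (rot' (rot t z)), 0)) (at t within {0..})"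
      unfolding \<xi>_def [abs_def]
      by (intro has_vector_derivative_Pair has_vector_derivative_const
        bounded_linear.has_vector_derivative [OF bounded_linear_fst r] bounded_linear.has_vector_derivative [OF bounded_linear_snd r])
    then show "(\<xi> has_vector_derivative fld \<delta> (\<xi> t)) (at t within {0..})"
      by (simp add: fld_def \<xi>_def rot'_def)
  qed
  moreover have "\<xi> t \<in> Box C" for t
    by (rule tube_subset_Box [of "norm z"]) (use z C in \<open>auto simp: \<xi>_def C_def\<close>)
  ultimately have "box_sol \<delta> C \<xi>" by (simp add: box_sol_def)
  moreover have "\<xi> 0 = p" using assms(2) by (cases p) (simp add: \<xi>_def z_def)
  moreover have "energy (\<xi> t) = energy p" for t
  proof -
    have "2 * energy (\<xi> t) = 2 * energy p"
      unfolding norm_plane [symmetric] by (simp add: \<xi>_def z_def [symmetric])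
    then show ?thesis by simp
  qed
  ultimately show ?thesis unfolding tends_to_energy_def using C by (intro exI [of _ \<xi>] exI [of _ C]) simp
qed

text \<open>No lower bound on l, so that the set is open in the whole space; relative neighbourhoods
  of the boundary arise by intersecting it with \<open>upper\<close>.\<close>

definition cell :: "real \<Rightarrow> real \<Rightarrow> (real \<times> real \<times> real) set" where
  "cell \<rho> b = {p. norm (plane p) < \<rho> \<and> lev p < b}"

lemma open_cell: "open (cell \<rho> b)"
  unfolding cell_def by (intro open_Collect_conj open_Collect_less continuous_intros)

abbreviation upper :: "(real \<times> real \<times> real) set" where
  "upper \<equiv> {p. 0 \<le> lev p}"

text \<open>For each order k separately, the limit energy is V + G with a corrected energy V of
  order n and G the integral of its derivative along the solution. V, G and n depend on k, their sum
  does not, so smoothness of every order follows on one common set.\<close>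

theorem limit_energy_smooth:
  assumes \<delta>: "\<delta> > 0" and \<rho>: "0 < \<rho>0" "\<rho>0 < 1"
  shows "\<exists>l1>0. \<exists>C\<ge>1. smooth_on (cell \<rho>0 l1 \<inter> upper) (limit_energy \<delta>) \<and>
    (\<forall>p\<in>cell \<rho>0 l1 \<inter> upper. tends_to_energy \<delta> p (limit_energy \<delta> p)) \<and>
    (\<forall>p\<in>cell \<rho>0 l1. 0 < lev p \<longrightarrow> (\<exists>\<xi>. \<xi> 0 = p \<and> box_sol \<delta> C \<xi>))"
proof -
  define \<rho>1 where "\<rho>1 = (\<rho>0 + 1) / 2"
  have \<rho>1: "\<rho>0 < \<rho>1" "\<rho>1 < 1" using \<rho> by (auto simp: \<rho>1_def)
  define C where "C = max 1 (1 / (1 - \<rho>1))"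
  have C: "C \<ge> 1" "C \<ge> 1 / (1 - \<rho>1)" by (auto simp: C_def)
  obtain l1 where l1: "0 < l1" "l1 \<le> 1" and
    conf: "\<And>p. norm (plane p) < \<rho>0 \<Longrightarrow> 0 < lev p \<Longrightarrow> lev p < l1 \<Longrightarrow>
      \<exists>\<xi>. \<xi> 0 = p \<and> box_sol \<delta> C \<xi> \<and> (\<forall>t\<ge>0. norm (plane (\<xi> t)) < \<rho>1 \<and> 0 < lev (\<xi> t))"
    using tube_confined [OF \<delta> \<rho>(1) \<rho>1 C] by blast
  define S where "S = cell \<rho>0 l1 \<inter> {p. 0 < lev p}"
  have "\<forall>p. \<exists>\<xi>. p \<in> S \<longrightarrow> \<xi> 0 = p \<and> box_sol \<delta> C \<xi> \<and> (\<forall>t\<ge>0. norm (plane (\<xi> t)) < \<rho>1 \<and> 0 < lev (\<xi> t))"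
    using conf unfolding S_def cell_def by blast
  from choice [OF this] obtain X where X: "\<And>p. p \<in> S \<Longrightarrow> X p 0 = p" "\<And>p. p \<in> S \<Longrightarrow> box_sol \<delta> C (X p)"
    "\<And>p t. p \<in> S \<Longrightarrow> 0 \<le> t \<Longrightarrow> norm (plane (X p t)) < \<rho>1" "\<And>p t. p \<in> S \<Longrightarrow> 0 \<le> t \<Longrightarrow> 0 < lev (X p t)" by blast
  define \<xi> where "\<xi> t p = X p t" for t p
  have openS: "open S"
    unfolding S_def by (intro open_Int open_cell open_Collect_less continuous_intros)
  interpret box_flow \<delta> C S \<xi>
    by (rule box_flow.intro) (use \<delta> C openS X in \<open>auto simp: \<xi>_def\<close>)
  interpret w: weighted_family S l C by (rule weighted)
  define K where "K = {p. norm (plane p) \<le> \<rho>1 \<and> 0 \<le> lev p \<and> lev p \<le> C}"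
  have K: "compact K" unfolding K_def by (rule compact_tube)
  have K_cyl: "K \<subseteq> cylinder" using \<rho>1 by (auto simp: K_def mem_cylinder)
  have \<xi>K: "\<xi> t p \<in> K" if "0 \<le> t" "p \<in> S" for t p
    using X(3) [OF that(2,1)] lev_pos [OF that] l_le [OF that] by (simp add: K_def \<xi>_def)
  have main: "Ck_on k (cell \<rho>0 l1 \<inter> upper) (limit_energy \<delta>) \<and> (\<forall>p\<in>S. \<exists>h. tends_to_energy \<delta> p h)" for k
  proof -
    obtain a where a: "weighted_Ck S l a k \<xi>" using tempered [of k] unfolding tempered_Ck_def by blast
    define M where "M = max 0 (- a)"
    have M: "0 \<le> M" "- M \<le> a" by (auto simp: M_def)
    have w\<xi>: "weighted_Ck S l (- M) k \<xi>" by (rule w.weighted_Ck_mono [OF M(2) a])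
    have wl: "weighted_Ck S l (- M) k l"
    proof -
      have "weighted_Ck S l (- M + 0) k (\<lambda>t p. \<xi> t p \<bullet> (0, 0, 1))"
        by (rule w.weighted_Ck_bilinear [OF bounded_bilinear_inner w\<xi> w.weighted_Ck_const])
      moreover have "\<xi> t p \<bullet> (0, 0, 1) = l t p" for t p by (cases "\<xi> t p") simp
      ultimately show ?thesis by simp
    qed
    \<comment> \<open>Differentiating l^(3n) k times may cost k * (M + 1) and f along the flow k *
      M; exponent 6 must remain for the integral to converge. The leading 2 secures the start of
      \<open>normal_form\<close>.\<close>
    obtain n :: nat where n: "real n \<ge> 2 + (6 + real k * (M + 1) + real k * M)" using real_arch_simple by blast
    have n2: "n \<ge> 2"
    proof -
      have "0 \<le> real k * (M + 1)" "0 \<le> real k * M" using M by auto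
      then have "real n \<ge> 2" using n by linarith
      then show ?thesis by simp
    qed
    obtain e f where e: "smooth_on cylinder e" and f: "smooth_on disc f" and
      ef: "\<And>p. p \<in> cylinder \<Longrightarrow> \<exists>D. ((\<lambda>p. energy p + lev p ^ 3 * e p) has_derivative D) (at p) \<and>
        D (fld \<delta> p) = lev p ^ (3 * n) * f (plane p)"
      using normal_form [OF \<delta> n2] by blast
    define u where "u t p = l t p ^ (3 * n) * f (plane (\<xi> t p))" for t p
    have wu: "weighted_Ck S l 6 k u"
    proof -
      have "Ck_on k cylinder (\<lambda>p. f (plane p))"
        using smooth_on_plane_compose [OF f] by (simp add: smooth_on_def)
      then have "weighted_Ck S l (real k * (- M)) k (\<lambda>t p. (\<lambda>p. f (plane p)) (\<xi> t p))"
        by (intro w.weighted_Ck_compose [of cylinder K "- M" \<xi> k "\<lambda>p. f (plane p)"] open_cylinder K K_cyl \<xi>K w\<xi>)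
          (use M in simp_all)
      then have "weighted_Ck S l ((real (3 * n) - real k * (M + 1)) + real k * (- M)) k u"
        unfolding u_def [abs_def]
        by (rule w.weighted_Ck_bilinear [OF bounded_bilinear_mult lev_power_weighted [OF wl M(1)]])
      then show ?thesis
        by (rule w.weighted_Ck_mono [rotated]) (use n in \<open>simp add: algebra_simps\<close>)
    qed
    obtain G KG where G: "\<And>p t. p \<in> S \<Longrightarrow> 0 \<le> t \<Longrightarrow> norm (integral {0..t} (\<lambda>r. u r p) - G p) \<le> KG * l t p ^ 3"
      using limit_exists [OF weighted_Ck_bound [OF wu]] by blast
    have flat: "flat_Ck S lev k G" using limit_flat [OF wu] G by blast
    define V where "V p = energy p + lev p ^ 3 * e p" for p
    have limV: "tends_to_energy \<delta> p (V p + G p)" if p: "p \<in> S" for p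
    proof -
      have int: "integral {0..t} (\<lambda>r. u r p) = V (\<xi> t p) - V p" if t: "0 \<le> t" for t
      proof -
        have "((\<lambda>t. V (\<xi> t p)) has_vector_derivative u s p) (at s within {0..t})" if s: "s \<in> {0..t}" for s
        proof -
          have s0: "0 \<le> s" using s by simp
          obtain D where D: "(V has_derivative D) (at (\<xi> s p))" "D (fld \<delta> (\<xi> s p)) = u s p"
            using ef [of "\<xi> s p"] \<xi>K [OF s0 p] K_cyl unfolding V_def [abs_def] u_def by blast
          have "((\<lambda>t. \<xi> t p) has_vector_derivative fld \<delta> (\<xi> s p)) (at s within {0..t})"
            by (rule has_vector_derivative_within_subset [OF ode_solD [OF box_solD(1) [OF sol [OF p]] s0]]) auto
          from has_derivative_along_curve [OF D(1) this] D(2) show ?thesis by simp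
        qed
        then have "((\<lambda>r. u r p) has_integral V (\<xi> t p) - V (\<xi> 0 p)) {0..t}"
          using t by (intro fundamental_theorem_of_calculus) auto
        then show ?thesis using p by (simp add: integral_unique \<xi>_0)
      qed
      obtain Ke where Ke: "0 \<le> Ke" "\<And>p. p \<in> K \<Longrightarrow> \<bar>e p\<bar> \<le> Ke"
        by (rule compact_bound [OF K continuous_on_subset [OF smooth_on_imp_continuous_on [OF e] K_cyl]]) blast
      have "((\<lambda>t. (KG + Ke) * l t p ^ 3) \<longlongrightarrow> (KG + Ke) * 0 ^ 3) at_top"
        by (intro tendsto_intros l_tendsto_0 p)
      then have z: "((\<lambda>t. (KG + Ke) * l t p ^ 3) \<longlongrightarrow> 0) at_top" by simp
      have "norm (energy (\<xi> t p) - (V p + G p)) \<le> (KG + Ke) * l t p ^ 3" if t: "0 \<le> t" for t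
      proof -
        have "energy (\<xi> t p) - (V p + G p) = (integral {0..t} (\<lambda>r. u r p) - G p) + - (l t p ^ 3 * e (\<xi> t p))"
          unfolding int [OF t] V_def by simp
        also have "norm \<dots> \<le> KG * l t p ^ 3 + l t p ^ 3 * Ke"
        proof (rule norm_triangle_mono [OF G [OF p t]])
          show "norm (- (l t p ^ 3 * e (\<xi> t p))) \<le> l t p ^ 3 * Ke"
            using Ke(2) [OF \<xi>K [OF t p]] lev_pos [OF t p] by (simp add: abs_mult mult_left_mono)
        qed
        finally show ?thesis by (simp add: algebra_simps)
      qed
      then have "\<forall>\<^sub>F t in at_top. norm (energy (\<xi> t p) - (V p + G p)) \<le> (KG + Ke) * l t p ^ 3"
        unfolding eventually_at_top_linorder by blast
      from Lim_null_comparison [OF this z]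
      have "((\<lambda>t. energy (\<xi> t p)) \<longlongrightarrow> V p + G p) at_top" by (simp add: LIM_zero_iff)
      then show ?thesis
        using tends_to_energy_iff [OF sol [OF p] C(1) \<xi>_0 [OF p]] by blast
    qed
    \<comment> \<open>On the boundary the correction l^3 e vanishes and the energy is conserved, so
      the extension of G by 0 is the correct one.\<close>
    have eq: "V p + (if 0 < lev p then G p else 0) = limit_energy \<delta> p" if p: "p \<in> cell \<rho>0 l1 \<inter> upper" for p
    proof (cases "0 < lev p")
      case True
      then have "p \<in> S" using p by (simp add: S_def)
      from limit_energy_eq [OF limV [OF this]] True show ?thesis by simp
    next
      case False
      then have "lev p = 0" "norm (plane p) < 1" using p \<rho> by (auto simp: cell_def)
      from limit_energy_eq [OF tends_to_energy_level_0 [OF this(2,1)]] this(1) show ?thesis by (simp add: V_def)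
    qed
    have "Ck_on k (cell \<rho>0 l1 \<inter> upper) (\<lambda>p. V p + (if 0 < lev p then G p else 0))"
    proof (rule Ck_on_add)
      have "smooth_on cylinder V"
        unfolding V_def [abs_def] energy_def split_def by (intro smooth_intros e) auto
      then have "Ck_on k cylinder V" by (simp add: smooth_on_def)
      then show "Ck_on k (cell \<rho>0 l1 \<inter> upper) V"
        by (rule Ck_on_subset) (use \<rho> in \<open>auto simp: cell_def mem_cylinder\<close>)
      show "Ck_on k (cell \<rho>0 l1 \<inter> upper) (\<lambda>p. if 0 < lev p then G p else 0)"
        by (rule flat_Ck_extend [OF open_cell]) (use flat in \<open>simp add: S_def\<close>)
    qed
    moreover have "Ck_on k (cell \<rho>0 l1 \<inter> upper) (\<lambda>p. V p + (if 0 < lev p then G p else 0)) \<longleftrightarrow> Ck_on k (cell \<rho>0 l1 \<inter> upper) (limit_energy \<delta>)"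
      by (rule Ck_on_cong) (rule eq)
    ultimately have "Ck_on k (cell \<rho>0 l1 \<inter> upper) (limit_energy \<delta>)" by blast
    then show ?thesis using limV by blast
  qed
  have "tends_to_energy \<delta> p (limit_energy \<delta> p)" if p: "p \<in> cell \<rho>0 l1 \<inter> upper" for p
  proof (cases "0 < lev p")
    case True
    then have "p \<in> S" using p by (simp add: S_def)
    then obtain h where "tends_to_energy \<delta> p h" using main [of 0] by blast
    then show ?thesis using limit_energy_eq by blast
  next
    case False
    then have "lev p = 0" "norm (plane p) < 1" using p \<rho> by (auto simp: cell_def)
    from tends_to_energy_level_0 [OF this(2,1)] show ?thesis using limit_energy_eq by metis
  qed
  moreover have "\<exists>\<xi>. \<xi> 0 = p \<and> box_sol \<delta> C \<xi>" if "p \<in> cell \<rho>0 l1" "0 < lev p" for p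
  proof -
    have "p \<in> S" using that by (simp add: S_def)
    then show ?thesis using X(1,2) by blast
  qed
  moreover have "smooth_on (cell \<rho>0 l1 \<inter> upper) (limit_energy \<delta>)" using main by (simp add: smooth_on_def)
  ultimately show ?thesis using l1(1) C(1) by blast
qed

section \<open>Transport by the flow from points with l > 0\<close>

lemma near_Box:
  assumes q: "q \<in> Box C0" and C0: "1 \<le> C0" and m: "m \<le> lev q" and r: "norm (p - q) < min m (1 / (2 * C0))"
  shows "p \<in> Box (2 * C0)" "0 < lev p"
proof -
  have "\<bar>fst (p - q)\<bar> \<le> norm (p - q)" "\<bar>fst (snd (p - q))\<bar> \<le> norm (p - q)"
    using norm_fst_le [of "fst (p - q)" "snd (p - q)"] norm_snd_le [of "snd (p - q)" "fst (p - q)"]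
      norm_fst_le [of "fst (snd (p - q))" "snd (snd (p - q))"] unfolding prod.collapse by auto
  then have b: "\<bar>fst p - fst q\<bar> < 1 / (2 * C0)" "\<bar>fst (snd p) - fst (snd q)\<bar> < 1 / (2 * C0)"
    "\<bar>lev p - lev q\<bar> < 1 / (2 * C0)" "\<bar>lev p - lev q\<bar> < m"
    using r abs_lev_le_norm [of "p - q"] by auto
  have C: "1 / (2 * C0) \<le> 1" "1 / C0 = 2 * (1 / (2 * C0))" using C0 by (auto simp: field_simps)
  show "0 < lev p" using b(4) m by linarith
  have q': "1 / C0 - 1 \<le> fst q" "fst q \<le> C0" "- C0 \<le> fst (snd q)" "fst (snd q) \<le> C0" "lev q \<le> C0"
    using q by (auto simp: Box_def)
  have "1 / (2 * C0) - 1 \<le> fst p" "fst p \<le> 2 * C0" "- (2 * C0) \<le> fst (snd p)" "fst (snd p) \<le> 2 * C0" "lev p \<le> 2 * C0"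
    using b q' C C0 by linarith+
  then show "p \<in> Box (2 * C0)" using \<open>0 < lev p\<close> by (cases p) (auto simp: Box_def)
qed

text \<open>Away from l = 0 the time-T map carries a neighbourhood of the starting point into W,
  where solutions are known to exist for all time. It has injective derivative at the starting point
  and preserves the limit energy, so local statements in W can be pulled back.\<close>

theorem interior_flow:
  assumes \<delta>: "\<delta> > 0" and \<eta>: "box_sol \<delta> C0 \<eta>" "1 \<le> C0" "0 < lev (\<eta> 0)" and T: "0 \<le> T"
    and W: "open W" "\<eta> T \<in> W" and C1: "1 \<le> C1"
    and exist: "\<And>q. q \<in> W \<Longrightarrow> 0 < lev q \<Longrightarrow> \<exists>\<xi>. \<xi> 0 = q \<and> box_sol \<delta> C1 \<xi>"
  shows "\<exists>S \<phi> D. open S \<and> \<eta> 0 \<in> S \<and> smooth_on S \<phi> \<and> (\<phi> has_derivative D) (at (\<eta> 0)) \<and> inj D \<and>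
    (\<forall>p\<in>S. 0 < lev p \<and> \<phi> p \<in> W \<and> 0 < lev (\<phi> p) \<and> (\<forall>h. tends_to_energy \<delta> p h \<longleftrightarrow> tends_to_energy \<delta> (\<phi> p) h))"
proof -
  \<comment> \<open>2 * C0 covers perturbations of \<eta> up to time T, and C1 covers the
    continuation from points of W.\<close>
  define C where "C = max (2 * C0) C1"
  have C: "1 \<le> C" "2 * C0 \<le> C" "C1 \<le> C" "C0 \<le> C" using \<eta>(2) C1 by (auto simp: C_def)
  have "\<forall>p. \<exists>\<xi>. \<xi> 0 = p \<and> ode_sol (\<lambda>t. ext_fld \<delta> C) \<xi>" using ext_sol_exists [OF C(1)] by blast
  from choice [OF this] obtain X where X: "\<And>p. X p 0 = p" "\<And>p. ode_sol (\<lambda>t. ext_fld \<delta> C) (X p)" by blast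
  have \<eta>ext: "ode_sol (\<lambda>t. ext_fld \<delta> C) \<eta>"
    using box_sol_mono [OF \<eta>(1) _ C(4)] \<eta>(2) unfolding box_sol_iff_ext by simp
  obtain L where L: "0 \<le> L" "\<And>\<xi> \<zeta> t. ode_sol (\<lambda>t. ext_fld \<delta> C) \<xi> \<Longrightarrow> ode_sol (\<lambda>t. ext_fld \<delta> C) \<zeta> \<Longrightarrow> 0 \<le> t \<Longrightarrow> t \<le> T \<Longrightarrow>
    norm (\<xi> t - \<zeta> t) \<le> L * norm (\<xi> 0 - \<zeta> 0)"
    using ext_sol_close [OF C(1), of \<delta> T] by metis
  define m where "m = lev (\<eta> T)"
  have m: "0 < m" unfolding m_def by (rule box_sol_lev_pos [OF \<eta>(1,2) \<delta> \<eta>(3) T])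
  have m_le: "m \<le> lev (\<eta> t)" if "0 \<le> t" "t \<le> T" for t
    unfolding m_def by (rule lev_antimono [OF \<eta>(1) \<delta> that])
  obtain r0 where r0: "0 < r0" "ball (\<eta> T) r0 \<subseteq> W" using W open_contains_ball by blast
  \<comment> \<open>r0 keeps the end points in W, m keeps l positive, and 1 / (2 C0) keeps the
    perturbed path inside the doubled box.\<close>
  define r where "r = min r0 (min m (1 / (2 * C0)))"
  have r: "0 < r" using r0 m \<eta>(2) by (simp add: r_def)
  define S where "S = ball (\<eta> 0) (r / (L + 1))"
  have close: "norm (X p t - \<eta> t) < r" if p: "p \<in> S" and t: "0 \<le> t" "t \<le> T" for p t
  proof -
    have "norm (X p t - \<eta> t) \<le> L * norm (p - \<eta> 0)" using L(2) [OF X(2) \<eta>ext t, of p] by (simp add: X(1))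
    also have "\<dots> \<le> (L + 1) * norm (p - \<eta> 0)" by (intro mult_right_mono) auto
    also have "\<dots> < r"
      using p L(1) by (simp add: S_def dist_norm norm_minus_commute pos_less_divide_eq mult.commute)
    finally show ?thesis .
  qed
  have before: "X p t \<in> Box C" "0 < lev (X p t)" if p: "p \<in> S" and t: "0 \<le> t" "t \<le> T" for p t
    using near_Box [OF box_solD(2) [OF \<eta>(1) t(1)] \<eta>(2) m_le [OF t], of "X p t"] close [OF p t]
      Box_mono [of "2 * C0" C] C \<eta>(2) by (auto simp: r_def)
  have inW: "X p T \<in> W" if "p \<in> S" for p
    using close [OF that T order_refl] r0(2) by (auto simp: r_def dist_norm norm_minus_commute)
  have sol: "box_sol \<delta> C (X p)" if p: "p \<in> S" for p
    unfolding box_sol_iff_ext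
  proof (intro conjI X(2) allI impI)
    fix t :: real assume t: "0 \<le> t"
    show "X p t \<in> Box C"
    proof (cases "t \<le> T")
      case False
      obtain \<zeta> where \<zeta>: "\<zeta> 0 = X p T" "box_sol \<delta> C1 \<zeta>"
        using exist [OF inW [OF p] before(2) [OF p T order_refl]] by blast
      have \<zeta>C: "box_sol \<delta> C \<zeta>" using box_sol_mono [OF \<zeta>(2) _ C(3)] C1 by simp
      have "X p (T + (t - T)) = \<zeta> (t - T)"
        by (rule ext_sol_unique [OF C(1) ode_sol_shift [OF X(2) T]])
          (use \<zeta>C \<zeta>(1) False in \<open>auto simp: box_sol_iff_ext\<close>)
      then show ?thesis using box_solD(2) [OF \<zeta>C, of "t - T"] False by simp
    qed (use before p t in auto)
  qed
  have pos: "0 < lev (X p t)" if p: "p \<in> S" and t: "0 \<le> t" for p t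
    by (rule box_sol_lev_pos [OF sol [OF p] C(1) \<delta> _ t]) (use before(2) [OF p order_refl T] in simp)
  define \<xi> where "\<xi> t p = X p t" for t p
  interpret box_flow \<delta> C S \<xi>
    by (rule box_flow.intro) (use \<delta> C sol pos X(1) in \<open>auto simp: \<xi>_def S_def\<close>)
  have S0: "\<eta> 0 \<in> S" using r L(1) by (simp add: S_def)
  have smooth: "smooth_on S (\<xi> T)"
    unfolding smooth_on_def
  proof
    fix k
    obtain a where "weighted_Ck S l a k \<xi>" using tempered [of k] unfolding tempered_Ck_def by blast
    from weighted_Ck_imp_Ck_on [OF this T] show "Ck_on k S (\<xi> T)" .
  qed
  obtain D where D: "(\<xi> T has_derivative D) (at (\<eta> 0))" "inj D"
    using flow_family.flow_derivative_inj [OF flow S0 T] by blast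
  have as: "tends_to_energy \<delta> p h \<longleftrightarrow> tends_to_energy \<delta> (\<xi> T p) h" if "p \<in> S" for p h
    using tends_to_energy_shift [OF sol [OF that] C(1) T, of h] by (simp add: \<xi>_def X(1))
  show ?thesis
  proof (intro exI conjI ballI allI)
    show "open S" by (simp add: S_def)
    show "0 < lev p" if "p \<in> S" for p using pos [OF that order_refl] by (simp add: X(1))
    show "\<xi> T p \<in> W" "0 < lev (\<xi> T p)" if "p \<in> S" for p using inW pos [OF that T] that by (auto simp: \<xi>_def)
  qed (fact S0 smooth D as)+
qed

section \<open>An inverse function theorem up to the boundary\<close>

definition cross :: "real \<times> real \<times> real \<Rightarrow> real \<times> real \<times> real \<Rightarrow> real \<times> real \<times> real" where
  "cross a b = (fst (snd a) * lev b - lev a * fst (snd b), lev a * fst b - fst a * lev b, fst a * fst (snd b) - fst (snd a) * fst b)"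

definition det3 :: "(real \<times> real \<times> real) \<times> (real \<times> real \<times> real) \<times> (real \<times> real \<times> real) \<Rightarrow> real" where
  "det3 M = fst M \<bullet> cross (fst (snd M)) (snd (snd M))"

text \<open>The inverse of the matrix with columns M by Cramer's rule. The explicit rational formula
  makes its smooth dependence on M a matter of arithmetic.\<close>

definition cramer :: "(real \<times> real \<times> real) \<times> (real \<times> real \<times> real) \<times> (real \<times> real \<times> real) \<Rightarrow> real \<times> real \<times> real \<Rightarrow> real \<times> real \<times> real" where
  "cramer M w = inverse (det3 M) *\<^sub>R
     (cross (fst (snd M)) (snd (snd M)) \<bullet> w, cross (snd (snd M)) (fst M) \<bullet> w, cross (fst M) (fst (snd M)) \<bullet> w)"

definition columns :: "(real \<times> real \<times> real \<Rightarrow> real \<times> real \<times> real) \<Rightarrow> (real \<times> real \<times> real) \<times> (real \<times> real \<times> real) \<times> (real \<times> real \<times> real)" where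
  "columns A = (A (1, 0, 0), A (0, 1, 0), A (0, 0, 1))"

lemma linear_triple:
  assumes "linear A"
  shows "A v = fst v *\<^sub>R A (1, 0, 0) + fst (snd v) *\<^sub>R A (0, 1, 0) + lev v *\<^sub>R A (0, 0, 1)"
proof -
  have "v = fst v *\<^sub>R (1, 0, 0) + fst (snd v) *\<^sub>R (0, 1, 0) + lev v *\<^sub>R (0, 0, 1)" by (cases v) simp
  then have "A v = A (fst v *\<^sub>R (1, 0, 0) + fst (snd v) *\<^sub>R (0, 1, 0) + lev v *\<^sub>R (0, 0, 1))" by simp
  also have "\<dots> = fst v *\<^sub>R A (1, 0, 0) + fst (snd v) *\<^sub>R A (0, 1, 0) + lev v *\<^sub>R A (0, 0, 1)"
    using assms by (simp only: linear_add linear_scale)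
  finally show ?thesis .
qed

lemma linear_cramer: "linear (cramer M)"
  by (rule linearI) (auto simp: cramer_def inner_add_right algebra_simps)

lemma cramer_inverse:
  assumes A: "linear A" and d: "det3 (columns A) \<noteq> 0"
  shows "cramer (columns A) (A v) = v"
proof -
  obtain a1 a2 a3 where a: "A (1, 0, 0) = (a1, a2, a3)" by (cases "A (1, 0, 0)")
  obtain b1 b2 b3 where b: "A (0, 1, 0) = (b1, b2, b3)" by (cases "A (0, 1, 0)")
  obtain c1 c2 c3 where c: "A (0, 0, 1) = (c1, c2, c3)" by (cases "A (0, 0, 1)")
  obtain x y z where v: "v = (x, y, z)" by (cases v)
  define D where "D = det3 (columns A)"
  have D: "D = a1 * (b2 * c3 - b3 * c2) + a2 * (b3 * c1 - b1 * c3) + a3 * (b1 * c2 - b2 * c1)"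
    by (simp add: D_def det3_def columns_def cross_def a b c)
  have "(cross (A (0, 1, 0)) (A (0, 0, 1)) \<bullet> A v, cross (A (0, 0, 1)) (A (1, 0, 0)) \<bullet> A v, cross (A (1, 0, 0)) (A (0, 1, 0)) \<bullet> A v) = D *\<^sub>R v"
    unfolding linear_triple [OF A, of v] by (simp add: cross_def a b c v D algebra_simps)
  then show ?thesis using d by (simp add: cramer_def columns_def D_def)
qed

lemma det3_nonzero:
  assumes A: "linear A" and inj: "inj A"
  shows "det3 (columns A) \<noteq> 0"
proof
  assume d: "det3 (columns A) = 0"
  obtain a1 a2 a3 where a: "A (1, 0, 0) = (a1, a2, a3)" by (cases "A (1, 0, 0)")
  obtain b1 b2 b3 where b: "A (0, 1, 0) = (b1, b2, b3)" by (cases "A (0, 1, 0)")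
  obtain c1 c2 c3 where c: "A (0, 0, 1) = (c1, c2, c3)" by (cases "A (0, 0, 1)")
  have D: "a1 * (b2 * c3 - b3 * c2) + a2 * (b3 * c1 - b1 * c3) + a3 * (b1 * c2 - b2 * c1) = 0"
    using d by (simp add: det3_def columns_def cross_def a b c)
  have ker: "v = 0" if "A v = 0" for v
    using inj that linear_injective_0 [OF A] by blast
  have Av: "A (x, y, z) = (x * a1 + y * b1 + z * c1, x * a2 + y * b2 + z * c2, x * a3 + y * b3 + z * c3)" for x y z
    using linear_triple [OF A, of "(x, y, z)"] by (simp add: a b c)
  text \<open>The rows of the adjugate lie in the kernel, hence vanish; then the first two columns are parallel.\<close>
  have "A (b2 * c3 - b3 * c2, c2 * a3 - c3 * a2, a2 * b3 - a3 * b2) = 0"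
    "A (b3 * c1 - b1 * c3, c3 * a1 - c1 * a3, a3 * b1 - a1 * b3) = 0"
    "A (b1 * c2 - b2 * c1, c1 * a2 - c2 * a1, a1 * b2 - a2 * b1) = 0"
    unfolding Av using D by (auto simp: zero_prod_def algebra_simps)
  from this [THEN ker] have cr: "a2 * b3 = a3 * b2" "a3 * b1 = a1 * b3" "a1 * b2 = a2 * b1"
    by (auto simp: zero_prod_def)
  \<comment> \<open>For parallel columns a and b the vector (a . b, - a . a, 0) lies in the kernel,
    so the first column has to vanish.\<close>
  have "A (a1 * b1 + a2 * b2 + a3 * b3, - (a1 * a1 + a2 * a2 + a3 * a3), 0) = 0"
    unfolding Av zero_prod_def prod.inject using cr by algebra
  then have "a1 * a1 + a2 * a2 + a3 * a3 = 0" using ker by (force simp: zero_prod_def)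
  moreover have "0 \<le> a1 * a1" "0 \<le> a2 * a2" "0 \<le> a3 * a3" by simp_all
  ultimately have "a1 * a1 = 0" "a2 * a2 = 0" "a3 * a3 = 0" by linarith+
  then have "A (1, 0, 0) = 0" by (simp add: a zero_prod_def)
  from ker [OF this] show False by (simp add: zero_prod_def)
qed

lemma smooth_on_cramer: "smooth_on {M. det3 M \<noteq> 0} (\<lambda>M. cramer M w)"
proof -
  have c: "smooth_on T (\<lambda>x. cross (f x) (g x))" if "smooth_on T f" "smooth_on T g"
    for f g :: "(real \<times> real \<times> real) \<times> (real \<times> real \<times> real) \<times> (real \<times> real \<times> real) \<Rightarrow> real \<times> real \<times> real" and T
    unfolding cross_def by (intro smooth_intros that)
  have d: "smooth_on T det3" for T
    unfolding det3_def [abs_def] by (intro smooth_on_inner c smooth_intros)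
  show ?thesis
    unfolding cramer_def
    by (intro smooth_on_scaleR smooth_on_Pair smooth_on_inner smooth_on_inverse c d smooth_on_const smooth_on_fst smooth_on_snd smooth_on_id) auto
qed

lemma injective_near:
  fixes f' :: "'a::euclidean_space \<Rightarrow> 'a \<Rightarrow> 'b::euclidean_space"
  assumes lin: "\<And>x. x \<in> Q \<Longrightarrow> linear (f' x)" and cont: "\<And>w. continuous_on Q (\<lambda>x. f' x w)"
    and p: "p \<in> Q" "inj (f' p)"
  shows "\<exists>c>0. \<exists>r>0. (\<forall>w. 2 * c * norm w \<le> norm (f' p w)) \<and> (\<forall>x\<in>Q \<inter> ball p r. \<forall>w. norm (f' x w - f' p w) \<le> c * norm w)"
proof -
  obtain B where B: "0 < B" "\<And>w. B * norm w \<le> norm (f' p w)"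
    using linear_inj_bounded_below_pos [OF lin [OF p(1)] p(2)] by blast
  define c where "c = B / 2"
  have c: "0 < c" using B by (simp add: c_def)
  have "\<exists>r>0. \<forall>x\<in>Q. dist x p < r \<longrightarrow> dist (f' x b) (f' p b) < c / DIM('a)" for b
    using cont [of b] p(1) c unfolding continuous_on_iff by (simp add: divide_pos_pos)
  then obtain R where R: "\<And>b. 0 < R b" "\<And>b x. x \<in> Q \<Longrightarrow> dist x p < R b \<Longrightarrow> dist (f' x b) (f' p b) < c / DIM('a)" by metis
  define r where "r = Min (R ` Basis)"
  have r: "0 < r" "\<And>b. b \<in> Basis \<Longrightarrow> r \<le> R b" unfolding r_def using R(1) by auto
  have "norm (f' x w - f' p w) \<le> c * norm w" if x: "x \<in> Q \<inter> ball p r" for x w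
  proof -
    have "linear (\<lambda>w. f' x w - f' p w)" using x lin p(1) by (intro linear_compose_sub) auto
    then have "norm (f' x w - f' p w) \<le> (\<Sum>b\<in>Basis. norm (f' x b - f' p b)) * norm w" by (rule linear_norm_le_Basis)
    also have "\<dots> \<le> (\<Sum>b\<in>(Basis :: 'a set). c / DIM('a)) * norm w"
    proof (intro mult_right_mono sum_mono)
      fix b :: 'a assume "b \<in> Basis"
      then have "dist x p < R b" using x r(2) [of b] by (simp add: dist_commute)
      then show "norm (f' x b - f' p b) \<le> c / DIM('a)" using R(2) [of x b] x by (simp add: dist_norm less_imp_le)
    qed simp
    finally show ?thesis by simp
  qed
  moreover have "2 * c * norm w \<le> norm (f' p w)" for w using B(2) by (simp add: c_def)
  ultimately show ?thesis using c r(1) by blast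
qed

definition reflect :: "real \<times> real \<times> real \<Rightarrow> real \<times> real \<times> real" where
  "reflect p = (fst p, fst (snd p), - lev p)"

lemma reflect_reflect [simp]: "reflect (reflect p) = p" and lev_reflect [simp]: "lev (reflect p) = - lev p"
  by (simp_all add: reflect_def)

lemma continuous_on_reflect: "continuous_on S reflect"
  unfolding reflect_def [abs_def] by (intro continuous_intros)

text \<open>Reflecting in the hyperplane \<open>lev = 0\<close> reduces the boundary case to invariance of domain.\<close>

lemma upper_open_image:
  assumes S: "open S" and f: "continuous_on (S \<inter> upper) f" "inj_on f (S \<inter> upper)"
    and lev: "\<And>x. x \<in> S \<inter> upper \<Longrightarrow> 0 \<le> lev (f x)" "\<And>x. x \<in> S \<inter> upper \<Longrightarrow> lev (f x) = 0 \<longleftrightarrow> lev x = 0"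
  shows "\<exists>V. open V \<and> f ` (S \<inter> upper) = V \<inter> upper"
proof -
  \<comment> \<open>The part of S in \<open>upper\<close>, doubled across the hyperplane; F is the
    extension of f that commutes with the reflection. Both formulas agree on the hyperplane because
    f maps it into itself.\<close>
  define O' where "O' = {p. (if 0 \<le> lev p then p else reflect p) \<in> S}"
  define F where "F p = (if lev p \<le> 0 then reflect (f (reflect p)) else f p)" for p
  have "continuous_on UNIV (\<lambda>p :: real \<times> real \<times> real. (fst p, fst (snd p), \<bar>lev p\<bar>))"
    by (intro continuous_intros)
  then have "open ((\<lambda>p :: real \<times> real \<times> real. (fst p, fst (snd p), \<bar>lev p\<bar>)) -` S)" by (rule open_vimage [OF S])
  moreover have "(\<lambda>p :: real \<times> real \<times> real. (fst p, fst (snd p), \<bar>lev p\<bar>)) -` S = O'"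
    by (auto simp: O'_def reflect_def abs_if split: if_splits)
  ultimately have openO: "open O'" by simp
  have F_eq: "F p = f p" if "lev p = 0" "p \<in> S" for p
  proof -
    have r: "reflect q = q" if "lev q = 0" for q using that by (cases q) (simp add: reflect_def)
    have "lev (f p) = 0" using lev(2) [of p] that by simp
    then show ?thesis using that by (simp add: F_def r)
  qed
  have F_pos: "F p = f p" if "p \<in> O'" "0 \<le> lev p" for p
    using that F_eq [of p] by (cases "lev p = 0") (auto simp: F_def O'_def)
  have F_neg: "F p = reflect (f (reflect p))" if "lev p < 0" for p using that by (simp add: F_def)
  have neg_in: "reflect p \<in> S \<inter> upper" if "p \<in> O'" "lev p < 0" for p using that by (simp add: O'_def)
  have pos_in: "p \<in> S \<inter> upper" if "p \<in> O'" "0 \<le> lev p" for p using that by (simp add: O'_def)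
  have "continuous_on O' F"
    unfolding F_def [abs_def]
  proof (rule continuous_on_cases_le)
    have "reflect ` {x \<in> O'. lev x \<le> 0} \<subseteq> S \<inter> upper"
    proof (rule image_subsetI)
      fix p assume "p \<in> {x \<in> O'. lev x \<le> 0}"
      then have p: "p \<in> O'" "lev p \<le> 0" by auto
      show "reflect p \<in> S \<inter> upper"
      proof (cases "lev p = 0")
        case True
        then have "reflect p = p" by (cases p) (simp add: reflect_def)
        then show ?thesis using pos_in p True by simp
      qed (use neg_in p in auto)
    qed
    then show "continuous_on {x \<in> O'. lev x \<le> 0} (\<lambda>p. reflect (f (reflect p)))"
      by (intro continuous_on_compose2 [OF continuous_on_reflect [of UNIV]] continuous_on_compose2 [OF f(1) continuous_on_reflect]) auto
    show "continuous_on {x \<in> O'. 0 \<le> lev x} f"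
      by (rule continuous_on_subset [OF f(1)]) (use pos_in in auto)
    show "continuous_on O' lev" by (intro continuous_intros)
    show "reflect (f (reflect x)) = f x" if "x \<in> O'" "lev x = 0" for x
      using F_pos [of x] that by (simp add: F_def)
  qed
  moreover have lev_F: "0 \<le> lev (F p) \<longleftrightarrow> 0 \<le> lev p" if "p \<in> O'" for p
  proof (cases "0 \<le> lev p")
    case True
    then show ?thesis using F_pos [OF that True] lev(1) [OF pos_in [OF that True]] by simp
  next
    case False
    then have "0 \<le> lev (f (reflect p))" "lev (f (reflect p)) \<noteq> 0"
      using lev [OF neg_in [of p]] that by auto
    then show ?thesis using False F_neg [of p] by simp
  qed
  moreover have "inj_on F O'"
  proof (rule inj_onI)
    fix p q assume pq: "p \<in> O'" "q \<in> O'" "F p = F q"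
    then have same: "0 \<le> lev p \<longleftrightarrow> 0 \<le> lev q" using lev_F by metis
    show "p = q"
    proof (cases "0 \<le> lev p")
      case True
      then have q: "0 \<le> lev q" using same by simp
      have "f p = f q" using pq(3) F_pos [OF pq(1) True] F_pos [OF pq(2) q] by simp
      then show ?thesis using f(2) pos_in [OF pq(1) True] pos_in [OF pq(2) q] by (simp add: inj_on_def)
    next
      case False
      then have pn: "lev p < 0" and qn: "lev q < 0" using same by auto
      have "reflect (f (reflect p)) = reflect (f (reflect q))" using pq(3) F_neg [OF pn] F_neg [OF qn] by simp
      then have "f (reflect p) = f (reflect q)" by (metis reflect_reflect)
      then have "reflect p = reflect q" using f(2) neg_in [OF pq(1) pn] neg_in [OF pq(2) qn] by (simp add: inj_on_def)
      then show ?thesis by (metis reflect_reflect)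
    qed
  qed
  ultimately have "open (F ` O')" using invariance_of_domain openO by blast
  moreover have "f ` (S \<inter> upper) = F ` O' \<inter> upper"
  proof (intro equalityI subsetI)
    fix y assume "y \<in> f ` (S \<inter> upper)"
    then obtain x where x: "x \<in> S \<inter> upper" "y = f x" by blast
    then have xO: "x \<in> O'" by (simp add: O'_def)
    then show "y \<in> F ` O' \<inter> upper" using F_pos [OF xO] x lev(1) [OF x(1)] by (auto intro: rev_image_eqI)
  next
    fix y assume "y \<in> F ` O' \<inter> upper"
    then obtain x where x: "x \<in> O'" "y = F x" "0 \<le> lev y" by blast
    then have "0 \<le> lev x" using lev_F by simp
    then show "y \<in> f ` (S \<inter> upper)" using F_pos [OF x(1)] pos_in [OF x(1)] x(2) by blast
  qed
  ultimately show ?thesis by blast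
qed

text \<open>Near p the map differs from the injective linear map \<open>f' p\<close> by a term with
  Lipschitz constant c, while \<open>f' p\<close> expands by 2c. Hence f expands distances by c on a
  convex relative neighbourhood, which gives injectivity and a continuous inverse;
  \<open>upper_open_image\<close> makes the image relatively open.\<close>

theorem smooth_chart:
  fixes f :: "real \<times> real \<times> real \<Rightarrow> real \<times> real \<times> real"
  assumes S0: "open S0" and p: "p \<in> S0 \<inter> upper"
    and f': "\<And>x. x \<in> S0 \<inter> upper \<Longrightarrow> (f has_derivative f' x) (at x within S0 \<inter> upper)"
      "\<And>w. smooth_on (S0 \<inter> upper) (\<lambda>x. f' x w)"
    and inj: "inj (f' p)"
    and lev: "\<And>x. x \<in> S0 \<inter> upper \<Longrightarrow> 0 \<le> lev (f x)" "\<And>x. x \<in> S0 \<inter> upper \<Longrightarrow> lev (f x) = 0 \<longleftrightarrow> lev x = 0"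
  shows "\<exists>U V \<psi> \<psi>'. open U \<and> p \<in> U \<and> U \<subseteq> S0 \<and> open V \<and> homeomorphism (U \<inter> upper) (V \<inter> upper) f \<psi> \<and>
    smooth_on (V \<inter> upper) \<psi> \<and>
    (\<forall>y\<in>V \<inter> upper. (\<psi> has_derivative \<psi>' y) (at y within V \<inter> upper) \<and> inj (\<psi>' y)) \<and>
    (\<forall>x\<in>U \<inter> upper. inj (f' x))"
proof -
  have lin: "linear (f' x)" if "x \<in> S0 \<inter> upper" for x using f'(1) [OF that] has_derivative_linear by blast
  obtain c r1 where c: "0 < c" "0 < r1" "\<And>w. 2 * c * norm w \<le> norm (f' p w)"
    "\<And>x w. x \<in> (S0 \<inter> upper) \<inter> ball p r1 \<Longrightarrow> norm (f' x w - f' p w) \<le> c * norm w"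
    using injective_near [OF lin smooth_on_imp_continuous_on [OF f'(2)] p inj] by blast
  obtain r0 where r0: "0 < r0" "ball p r0 \<subseteq> S0" using S0 p open_contains_ball by blast
  define U where "U = ball p (min r0 r1)"
  have U: "open U" "p \<in> U" "U \<subseteq> S0" using r0 c by (auto simp: U_def)
  define Q where "Q = U \<inter> upper"
  have Q: "Q \<subseteq> (S0 \<inter> upper) \<inter> ball p r1" using U by (auto simp: Q_def U_def)
  have linQ: "linear (f' x)" if "x \<in> Q" for x using lin Q that by blast
  have upper_convex: "convex upper"
  proof -
    have "upper = {x. (0, 0, 1) \<bullet> x \<ge> 0}" by auto
    then show ?thesis using convex_halfspace_ge [of 0 "(0, 0, 1)"] by simp
  qed
  then have convQ: "convex Q" unfolding Q_def U_def by (intro convex_Int convex_ball)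
  have fQ: "(f has_derivative f' x) (at x within Q)" if "x \<in> Q" for x
    using has_derivative_subset [OF f'(1)] that Q by blast
  have lower: "c * norm w \<le> norm (f' x w)" if "x \<in> Q" for x w
  proof -
    have "norm (f' p w) \<le> norm (f' x w) + norm (f' x w - f' p w)"
      using norm_triangle_sub [of "f' p w" "f' x w"] by (simp add: norm_minus_commute)
    then show ?thesis using c(3) [of w] c(4) [of x w] that Q by (auto simp: subset_eq)
  qed
  have injx: "inj (f' x)" if x: "x \<in> Q" for x
  proof -
    have "w = 0" if "f' x w = 0" for w
      using lower [OF x, of w] that c(1) by (simp add: mult_le_0_iff)
    moreover have "linear (f' x)" using linQ x by blast
    ultimately show ?thesis using linear_injective_0 by blast
  qed
  have expand: "c * norm (x - y) \<le> norm (f x - f y)" if xy: "x \<in> Q" "y \<in> Q" for x y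
  proof -
    have "norm ((f x - f' p x) - (f y - f' p y)) \<le> c * norm (x - y)"
    proof (rule differentiable_bound [OF convQ, where f' = "\<lambda>z w. f' z w - f' p w"])
      fix z assume z: "z \<in> Q"
      show "((\<lambda>z. f z - f' p z) has_derivative (\<lambda>w. f' z w - f' p w)) (at z within Q)"
        by (intro has_derivative_diff fQ z linear_imp_has_derivative lin p)
      have "z \<in> (S0 \<inter> upper) \<inter> ball p r1" using z Q by blast
      from c(4) [OF this] show "onorm (\<lambda>w. f' z w - f' p w) \<le> c"
        by (intro onorm_bound less_imp_le [OF c(1)])
    qed (use xy in auto)
    moreover have "f' p (x - y) = f' p x - f' p y" using lin [OF p] by (rule linear_diff)
    then have "f x - f' p x - (f y - f' p y) = - (f' p (x - y) - (f x - f y))" by simp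
    ultimately have "norm (f' p (x - y) - (f x - f y)) \<le> c * norm (x - y)" by (metis norm_minus_cancel)
    moreover have "norm (f' p (x - y)) \<le> norm (f x - f y) + norm (f' p (x - y) - (f x - f y))"
      using norm_triangle_sub [of "f' p (x - y)" "f x - f y"] by simp
    ultimately show ?thesis using c(3) [of "x - y"] by linarith
  qed
  have contf: "continuous_on Q f" using fQ has_derivative_continuous_on by blast
  have injf: "inj_on f Q"
  proof (rule inj_onI)
    fix x y assume xy: "x \<in> Q" "y \<in> Q" "f x = f y"
    then have "c * norm (x - y) \<le> 0" using expand [OF xy(1,2)] by simp
    then show "x = y" using c(1) by (simp add: mult_le_0_iff)
  qed
  have levQ: "\<And>x. x \<in> U \<inter> upper \<Longrightarrow> 0 \<le> lev (f x)" "\<And>x. x \<in> U \<inter> upper \<Longrightarrow> lev (f x) = 0 \<longleftrightarrow> lev x = 0"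
    using lev U(3) by blast+
  obtain V where V: "open V" "f ` Q = V \<inter> upper"
    using upper_open_image [OF U(1) _ _ levQ] contf injf unfolding Q_def by blast
  define \<psi> where "\<psi> = the_inv_into Q f"
  have \<psi>f: "\<psi> (f x) = x" if "x \<in> Q" for x unfolding \<psi>_def by (rule the_inv_into_f_f [OF injf that])
  have \<psi>: "\<psi> y \<in> Q" "f (\<psi> y) = y" if "y \<in> V \<inter> upper" for y
    using that V(2) \<psi>f by (metis image_iff)+
  have cont\<psi>: "continuous_on (V \<inter> upper) \<psi>"
    unfolding continuous_on_iff
  proof (intro ballI allI impI)
    fix y e assume y: "y \<in> V \<inter> upper" and e: "0 < (e :: real)"
    show "\<exists>d>0. \<forall>y'\<in>V \<inter> upper. dist y' y < d \<longrightarrow> dist (\<psi> y') (\<psi> y) < e"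
    proof (intro exI [of _ "c * e"] conjI ballI impI)
      fix y' assume y': "y' \<in> V \<inter> upper" "dist y' y < c * e"
      have "c * norm (\<psi> y' - \<psi> y) \<le> norm (f (\<psi> y') - f (\<psi> y))" by (intro expand \<psi> y y')
      then have "c * norm (\<psi> y' - \<psi> y) < c * e" using \<psi>(2) y y' by (simp add: dist_norm)
      then show "dist (\<psi> y') (\<psi> y) < e" using c(1) by (simp add: dist_norm)
    qed (use c e in simp)
  qed
  have homeo: "homeomorphism Q (V \<inter> upper) f \<psi>"
    by (rule homeomorphismI [OF contf cont\<psi>]) (use \<psi>f \<psi> V(2) in blast)+
  define \<psi>' where "\<psi>' y = cramer (columns (f' (\<psi> y)))" for y
  have det: "det3 (columns (f' (\<psi> y))) \<noteq> 0" if "y \<in> V \<inter> upper" for y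
    by (rule det3_nonzero [OF linQ [OF \<psi>(1) [OF that]] injx [OF \<psi>(1) [OF that]]])
  have inv: "\<psi>' y (f' (\<psi> y) w) = w" if "y \<in> V \<inter> upper" for y w
    unfolding \<psi>'_def by (rule cramer_inverse [OF linQ [OF \<psi>(1) [OF that]] det [OF that]])
  have d\<psi>: "(\<psi> has_derivative \<psi>' y) (at y within V \<inter> upper)" if y: "y \<in> V \<inter> upper" for y
  proof -
    have "(\<psi> has_derivative \<psi>' y) (at (f (\<psi> y)) within f ` Q)"
    proof (rule has_derivative_inverse_within [OF fQ])
      show "continuous (at (f (\<psi> y)) within f ` Q) \<psi>"
        using cont\<psi> y by (simp add: V(2) \<psi>(2) continuous_on_eq_continuous_within)
      show "linear (\<psi>' y)" unfolding \<psi>'_def by (rule linear_cramer)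
      show "\<psi>' y \<circ> f' (\<psi> y) = id" using inv [OF y] by auto
    qed (use \<psi>(1) [OF y] \<psi>f in auto)
    then show ?thesis by (simp add: V(2) \<psi>(2) [OF y])
  qed
  have inj\<psi>': "inj (\<psi>' y)" if "y \<in> V \<inter> upper" for y
  proof -
    have "surj (\<psi>' y)" using inv [OF that] by (metis surjI)
    moreover have "linear (\<psi>' y)" unfolding \<psi>'_def by (rule linear_cramer)
    ultimately show ?thesis using linear_surj_imp_inj by blast
  qed
  \<comment> \<open>The derivative of \<psi> is a rational function of f' evaluated at \<psi>, so
    each order of smoothness of \<psi> yields the next.\<close>
  have "Ck_on k (V \<inter> upper) \<psi>" for k
  proof (induction k)
    case 0
    show ?case using cont\<psi> by simp
  next
    case (Suc k)
    show ?case
    proof (rule Ck_on_SucI [OF d\<psi>])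
      fix w
      have col: "Ck_on k (V \<inter> upper) (\<lambda>y. f' (\<psi> y) v)" for v
      proof (rule Ck_on_compose [OF Suc, of "S0 \<inter> upper" "\<lambda>x. f' x v"])
        show "Ck_on k (S0 \<inter> upper) (\<lambda>x. f' x v)" using f'(2) by (simp add: smooth_on_def)
        show "\<psi> ` (V \<inter> upper) \<subseteq> S0 \<inter> upper" using \<psi>(1) Q by blast
      qed
      have "Ck_on k (V \<inter> upper) (\<lambda>y. columns (f' (\<psi> y)))"
        unfolding columns_def by (intro Ck_on_Pair col)
      then show "Ck_on k (V \<inter> upper) (\<lambda>y. \<psi>' y w)"
        unfolding \<psi>'_def by (rule Ck_on_compose [where T = "{M. det3 M \<noteq> 0}"]) (use smooth_on_cramer det in \<open>auto simp: smooth_on_def\<close>)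
    qed
  qed
  then have "smooth_on (V \<inter> upper) \<psi>" by (simp add: smooth_on_def)
  moreover have "\<forall>y\<in>V \<inter> upper. (\<psi> has_derivative \<psi>' y) (at y within V \<inter> upper) \<and> inj (\<psi>' y)"
    using d\<psi> inj\<psi>' by blast
  ultimately show ?thesis using U V(1) homeo injx unfolding Q_def by blast
qed

section \<open>Local coordinates straightening the stable sets\<close>

lemma segment_in_open:
  fixes p w :: "'a::real_normed_vector"
  assumes "open S" "p \<in> S"
  shows "\<exists>e>0. \<forall>t. \<bar>t\<bar> < e \<longrightarrow> p + t *\<^sub>R w \<in> S"
proof -
  obtain r where r: "0 < r" "ball p r \<subseteq> S" using assms open_contains_ball by blast
  have "p + t *\<^sub>R w \<in> S" if "\<bar>t\<bar> < r / (norm w + 1)" for t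
  proof -
    have "\<bar>t\<bar> * norm w \<le> \<bar>t\<bar> * (norm w + 1)" by (intro mult_left_mono) auto
    also have "\<dots> < r" using that by (simp add: pos_less_divide_eq add_nonneg_pos)
    finally have "p + t *\<^sub>R w \<in> ball p r" by (simp add: dist_norm)
    then show ?thesis using r(2) by blast
  qed
  moreover have "0 < r / (norm w + 1)" using r(1) by (simp add: add_nonneg_pos)
  ultimately show ?thesis by blast
qed

lemma Basis_lev: "b \<in> Basis \<Longrightarrow> 0 \<le> lev b"
  by (auto simp: Basis_prod_def)

text \<open>Every basis vector has a nonnegative last component, so small positive steps along it
  stay in \<open>upper\<close> and determine the derivative even at boundary points.\<close>

lemma upper_derivative_unique:
  assumes "open S" "p \<in> S \<inter> upper"
    and "(f has_derivative f') (at p within S \<inter> upper)" "(f has_derivative f'') (at p within S \<inter> upper)"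
  shows "f' = f''"
proof (rule frechet_derivative_unique_within [OF assms(3,4)])
  fix b :: "real \<times> real \<times> real" and e :: real
  assume b: "b \<in> Basis" and e: "0 < e"
  obtain d where d: "0 < d" "\<And>t. \<bar>t\<bar> < d \<Longrightarrow> p + t *\<^sub>R b \<in> S" using segment_in_open [OF assms(1), of p b] assms(2) by blast
  define t where "t = min d e / 2"
  have "0 < \<bar>t\<bar>" "\<bar>t\<bar> < e" "p + t *\<^sub>R b \<in> S" using d e by (auto simp: t_def)
  moreover have "0 \<le> lev (p + t *\<^sub>R b)" using Basis_lev [OF b] assms(2) d(1) e by (simp add: t_def)
  ultimately show "\<exists>d. 0 < \<bar>d\<bar> \<and> \<bar>d\<bar> < e \<and> p + d *\<^sub>R b \<in> S \<inter> upper" by blast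
qed

lemma upper_closure_interior:
  assumes "open S"
  shows "S \<inter> upper \<subseteq> closure (interior (S \<inter> upper))"
proof
  fix p assume p: "p \<in> S \<inter> upper"
  have "open (S \<inter> {p :: real \<times> real \<times> real. 0 < lev p})" by (intro open_Int assms open_Collect_less continuous_intros)
  then have sub: "S \<inter> {p. 0 < lev p} \<subseteq> interior (S \<inter> upper)" by (rule interior_maximal [rotated]) auto
  show "p \<in> closure (interior (S \<inter> upper))"
    unfolding closure_approachable
  proof (intro allI impI)
    fix e :: real assume e: "0 < e"
    obtain d where d: "0 < d" "\<And>t. \<bar>t\<bar> < d \<Longrightarrow> p + t *\<^sub>R (0, 0, 1) \<in> S" using segment_in_open [OF assms(1), of p "(0, 0, 1)"] p by blast
    define t where "t = min d e / 2"
    have "p + t *\<^sub>R (0, 0, 1) \<in> S \<inter> {p. 0 < lev p}" using d e p by (auto simp: t_def)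
    moreover have "dist (p + t *\<^sub>R (0, 0, 1)) p < e" using d e by (simp add: dist_norm norm_Pair t_def)
    ultimately show "\<exists>y\<in>interior (S \<inter> upper). dist y p < e" using sub by blast
  qed
qed

text \<open>Directions parallel to the boundary can be followed both ways inside
  \<open>upper\<close>, so along them the one-sided derivative is an ordinary two-sided one.\<close>

lemma tangential_derivative:
  fixes f :: "real \<times> real \<times> real \<Rightarrow> 'b::real_normed_vector"
  assumes S: "open S" "p \<in> S \<inter> upper" and f: "(f has_derivative f') (at p within S \<inter> upper)" and w: "lev w = 0"
  shows "((\<lambda>t. f (p + t *\<^sub>R w)) has_vector_derivative f' w) (at 0)"
proof -
  obtain e where e: "0 < e" "\<And>t. \<bar>t\<bar> < e \<Longrightarrow> p + t *\<^sub>R w \<in> S" using segment_in_open [OF S(1), of p w] S(2) by blast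
  have "((\<lambda>t. p + t *\<^sub>R w) has_vector_derivative w) (at 0 within {-e<..<e})"
    by (auto intro!: derivative_eq_intros)
  moreover have "(\<lambda>t. p + t *\<^sub>R w) ` {-e<..<e} \<subseteq> S \<inter> upper"
  proof (rule image_subsetI)
    fix t assume "t \<in> {-e<..<e}"
    then show "p + t *\<^sub>R w \<in> S \<inter> upper" using e(2) [of t] w S(2) by auto
  qed
  then have "(f has_derivative f') (at (p + 0 *\<^sub>R w) within (\<lambda>t. p + t *\<^sub>R w) ` {-e<..<e})"
    using has_derivative_subset [OF f] by simp
  ultimately have "(f \<circ> (\<lambda>t. p + t *\<^sub>R w) has_vector_derivative f' w) (at 0 within {-e<..<e})"
    by (rule vector_derivative_diff_chain_within)
  moreover have "at (0 :: real) within {-e<..<e} = at 0" using e(1) by (intro at_within_open) auto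
  ultimately show ?thesis unfolding comp_def by (simp only:)
qed

text \<open>\<open>R\<close> relates points near \<open>p\<close> to their new coordinates.\<close>

definition straightens :: "(real \<times> real \<times> real \<Rightarrow> real \<times> real \<times> real \<Rightarrow> bool) \<Rightarrow> real \<times> real \<times> real \<Rightarrow> bool" where
  "straightens R p \<longleftrightarrow> (\<exists>S f D. open S \<and> p \<in> S \<and> smooth_on (S \<inter> upper) f \<and>
     (f has_derivative D) (at p within S \<inter> upper) \<and> inj D \<and>
     (\<forall>x\<in>S \<inter> upper. 0 \<le> lev (f x) \<and> (lev (f x) = 0 \<longleftrightarrow> lev x = 0) \<and> R x (f x)))"

lemma straightens_chart:
  assumes "straightens R p" "0 \<le> lev p"
  shows "\<exists>U f V \<psi> \<psi>'. open U \<and> p \<in> U \<and> open V \<and> homeomorphism (U \<inter> upper) (V \<inter> upper) f \<psi> \<and>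
    smooth_on (V \<inter> upper) \<psi> \<and> (\<forall>y\<in>V \<inter> upper. (\<psi> has_derivative \<psi>' y) (at y within V \<inter> upper) \<and> inj (\<psi>' y)) \<and>
    smooth_on (U \<inter> upper) f \<and> (\<forall>x\<in>U \<inter> upper. \<exists>D. (f has_derivative D) (at x within U \<inter> upper) \<and> inj D) \<and>
    (\<forall>x\<in>U \<inter> upper. 0 \<le> lev (f x) \<and> (lev (f x) = 0 \<longleftrightarrow> lev x = 0) \<and> R x (f x))"
proof -
  obtain S f D where S: "open S" "p \<in> S" and f: "smooth_on (S \<inter> upper) f"
    and D: "(f has_derivative D) (at p within S \<inter> upper)" "inj D"
    and R: "\<And>x. x \<in> S \<inter> upper \<Longrightarrow> 0 \<le> lev (f x) \<and> (lev (f x) = 0 \<longleftrightarrow> lev x = 0) \<and> R x (f x)"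
    using assms(1) unfolding straightens_def by blast
  have p: "p \<in> S \<inter> upper" using S(2) assms(2) by blast
  obtain f' where f': "\<And>x. x \<in> S \<inter> upper \<Longrightarrow> (f has_derivative f' x) (at x within S \<inter> upper)"
    "\<And>w. smooth_on (S \<inter> upper) (\<lambda>x. f' x w)"
    using smooth_onE [OF f upper_closure_interior [OF S(1)]] by blast
  have inj: "inj (f' p)" using upper_derivative_unique [OF S(1) p f'(1) [OF p] D(1)] D(2) by simp
  have "\<exists>U V \<psi> \<psi>'. open U \<and> p \<in> U \<and> U \<subseteq> S \<and> open V \<and> homeomorphism (U \<inter> upper) (V \<inter> upper) f \<psi> \<and>
    smooth_on (V \<inter> upper) \<psi> \<and>
    (\<forall>y\<in>V \<inter> upper. (\<psi> has_derivative \<psi>' y) (at y within V \<inter> upper) \<and> inj (\<psi>' y)) \<and>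
    (\<forall>x\<in>U \<inter> upper. inj (f' x))"
    by (rule smooth_chart [OF S(1) p f' inj]) (use R in blast)+
  then obtain U V \<psi> \<psi>' where U: "open U" "p \<in> U" "U \<subseteq> S" "open V" "homeomorphism (U \<inter> upper) (V \<inter> upper) f \<psi>"
    "smooth_on (V \<inter> upper) \<psi>"
    "\<forall>y\<in>V \<inter> upper. (\<psi> has_derivative \<psi>' y) (at y within V \<inter> upper) \<and> inj (\<psi>' y)"
    and injx: "\<forall>x\<in>U \<inter> upper. inj (f' x)" by blast
  have sub: "U \<inter> upper \<subseteq> S \<inter> upper" using U(3) by blast
  have "\<forall>x\<in>U \<inter> upper. \<exists>D. (f has_derivative D) (at x within U \<inter> upper) \<and> inj D"
    using has_derivative_subset [OF f'(1) sub] sub injx by blast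
  moreover have "smooth_on (U \<inter> upper) f" using smooth_on_subset [OF f sub] .
  moreover have "\<forall>x\<in>U \<inter> upper. 0 \<le> lev (f x) \<and> (lev (f x) = 0 \<longleftrightarrow> lev x = 0) \<and> R x (f x)"
    using R sub by blast
  ultimately show ?thesis using U(1,2,4-7) by blast
qed

text \<open>The solution keeps circling and need not converge, but compactness of the box yields a
  limit point of its values at integer times. It has l = 0 and energy h, and every neighbourhood of
  it is visited.\<close>

lemma box_sol_limit_point:
  assumes \<delta>: "\<delta> > 0" and \<xi>: "box_sol \<delta> C \<xi>" "1 \<le> C" and h: "((\<lambda>t. energy (\<xi> t)) \<longlongrightarrow> h) at_top"
  shows "\<exists>p. lev p = 0 \<and> energy p = h \<and> (\<forall>W. open W \<longrightarrow> p \<in> W \<longrightarrow> (\<exists>T\<ge>0. \<xi> T \<in> W))"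
proof -
  have "seq_compact (Box C)" using Box(1) compact_imp_seq_compact by blast
  then obtain p r where r: "strict_mono (r :: nat \<Rightarrow> nat)" and p: "((\<lambda>n. \<xi> (real n)) \<circ> r) \<longlonglongrightarrow> p"
    using box_solD(2) [OF \<xi>(1)] by (elim seq_compactE [where f = "\<lambda>n. \<xi> (real n)"]) auto
  have top: "filterlim (\<lambda>n. real (r n)) at_top sequentially"
    by (rule filterlim_compose [OF filterlim_real_sequentially filterlim_subseq [OF r]])
  have p: "(\<lambda>n. \<xi> (real (r n))) \<longlonglongrightarrow> p" using p by (simp add: o_def)
  have "(\<lambda>n. lev (\<xi> (real (r n)))) \<longlonglongrightarrow> lev p" by (intro tendsto_intros p)
  moreover have "(\<lambda>n. lev (\<xi> (real (r n)))) \<longlonglongrightarrow> 0"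
    by (rule filterlim_compose [OF lev_tendsto_0 [OF \<xi>(1) \<delta> \<xi>(2)] top])
  ultimately have "lev p = 0" by (rule LIMSEQ_unique)
  moreover have en: "energy q = ((fst q) ^ 2 + (fst (snd q)) ^ 2) / 2" for q by (cases q) (simp add: energy_def)
  have "(\<lambda>n. energy (\<xi> (real (r n)))) \<longlonglongrightarrow> energy p" unfolding en by (intro tendsto_intros p) simp
  then have "energy p = h" using filterlim_compose [OF h top] by (rule LIMSEQ_unique)
  moreover have "\<exists>T\<ge>0. \<xi> T \<in> W" if "open W" "p \<in> W" for W
  proof -
    have "eventually (\<lambda>n. \<xi> (real (r n)) \<in> W) sequentially" using p that by (rule topological_tendstoD)
    then obtain n where "\<xi> (real (r n)) \<in> W" using eventually_happens by force
    then show ?thesis by (intro exI [of _ "real (r n)"]) simp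
  qed
  ultimately show ?thesis by blast
qed

text \<open>The solution from P enters any neighbourhood of a limit point p on the boundary, where
  coordinates exist by \<open>base\<close>. Pulling them back by the flow gives coordinates at P;
  the assumption on R says that R sees a point only through its limit energy. The bound h < 1/2
  places p inside the disc, so solutions starting near it with l > 0 exist for all time.\<close>

lemma straightens_interior:
  assumes \<delta>: "\<delta> > 0" and P: "0 < lev P" "tends_to_energy \<delta> P h" "h < 1/2"
    and base: "\<And>p. lev p = 0 \<Longrightarrow> energy p = h \<Longrightarrow> straightens R p"
    and R: "\<And>p q y. (\<forall>h. tends_to_energy \<delta> p h \<longleftrightarrow> tends_to_energy \<delta> q h) \<Longrightarrow> R q y \<Longrightarrow> R p y"
  shows "straightens R P"
proof -
  obtain \<xi> C where \<xi>: "1 \<le> C" "\<xi> 0 = P" "box_sol \<delta> C \<xi>" "((\<lambda>t. energy (\<xi> t)) \<longlongrightarrow> h) at_top"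
    using P(2) unfolding tends_to_energy_def by blast
  from box_sol_limit_point [OF \<delta> \<xi>(3,1,4)] obtain p where p: "lev p = 0" "energy p = h"
    and near: "\<And>W. open W \<Longrightarrow> p \<in> W \<Longrightarrow> \<exists>T\<ge>0. \<xi> T \<in> W" by blast
  have p1: "norm (plane p) < 1"
  proof (rule power_less_imp_less_base)
    show "norm (plane p) ^ 2 < 1 ^ 2" using norm_plane [of p] p(2) P(3) by simp
  qed simp
  obtain U f where U: "open U" "p \<in> U" and f: "smooth_on (U \<inter> upper) f"
    "\<And>x. x \<in> U \<inter> upper \<Longrightarrow> \<exists>D. (f has_derivative D) (at x within U \<inter> upper) \<and> inj D"
    and Rf: "\<And>x. x \<in> U \<inter> upper \<Longrightarrow> 0 \<le> lev (f x) \<and> (lev (f x) = 0 \<longleftrightarrow> lev x = 0) \<and> R x (f x)"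
    using straightens_chart [OF base [OF p]] p(1) by fastforce
  define \<rho>0 where "\<rho>0 = (norm (plane p) + 1) / 2"
  have \<rho>0: "0 < \<rho>0" "\<rho>0 < 1" "norm (plane p) < \<rho>0" using p1 by (auto simp: \<rho>0_def add_nonneg_pos)
  from limit_energy_smooth [OF \<delta> \<rho>0(1,2)] obtain l1 C1 where l1: "0 < l1" and C1: "1 \<le> C1"
    and ex: "\<And>q. q \<in> cell \<rho>0 l1 \<Longrightarrow> 0 < lev q \<Longrightarrow> \<exists>\<xi>. \<xi> 0 = q \<and> box_sol \<delta> C1 \<xi>" by blast
  have pc: "p \<in> cell \<rho>0 l1" using \<rho>0(3) p(1) l1 by (simp add: cell_def)
  have oW: "open (U \<inter> cell \<rho>0 l1)" by (intro open_Int U open_cell)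
  obtain T where T: "0 \<le> T" "\<xi> T \<in> U \<inter> cell \<rho>0 l1" using near [OF oW] U pc by blast
  have "\<exists>S \<phi> D. open S \<and> \<xi> 0 \<in> S \<and> smooth_on S \<phi> \<and> (\<phi> has_derivative D) (at (\<xi> 0)) \<and> inj D \<and>
    (\<forall>p\<in>S. 0 < lev p \<and> \<phi> p \<in> U \<inter> cell \<rho>0 l1 \<and> 0 < lev (\<phi> p) \<and> (\<forall>h. tends_to_energy \<delta> p h \<longleftrightarrow> tends_to_energy \<delta> (\<phi> p) h))"
    by (rule interior_flow [OF \<delta> \<xi>(3,1) _ T(1) oW T(2) C1]) (use P(1) \<xi>(2) ex in auto)
  then obtain S \<phi> D where S: "open S" "P \<in> S" and \<phi>: "smooth_on S \<phi>" "(\<phi> has_derivative D) (at P)" "inj D"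
    and S\<phi>: "\<And>p. p \<in> S \<Longrightarrow> 0 < lev p \<and> \<phi> p \<in> U \<inter> cell \<rho>0 l1 \<and> 0 < lev (\<phi> p) \<and> (\<forall>h. tends_to_energy \<delta> p h \<longleftrightarrow> tends_to_energy \<delta> (\<phi> p) h)"
    unfolding \<xi>(2) by blast
  have Su: "S \<inter> upper = S" using S\<phi> less_imp_le by blast
  have sub: "\<phi> ` S \<subseteq> U \<inter> upper" using S\<phi> less_imp_le by blast
  have "\<phi> P \<in> U \<inter> upper" using sub S(2) by blast
  then obtain D2 where D2: "(f has_derivative D2) (at (\<phi> P) within U \<inter> upper)" "inj D2" using f(2) by blast
  have "((\<lambda>x. f (\<phi> x)) has_derivative (\<lambda>w. D2 (D w))) (at P within S)"
    by (rule has_derivative_in_compose [OF has_derivative_at_withinI [OF \<phi>(2)] has_derivative_subset [OF D2(1) sub]])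
  moreover have "inj (\<lambda>w. D2 (D w))" using inj_compose [OF D2(2) \<phi>(3)] by (simp add: o_def)
  moreover have "smooth_on S (\<lambda>x. f (\<phi> x))" by (rule smooth_on_compose [OF \<phi>(1) f(1) sub])
  moreover have "\<forall>x\<in>S. 0 \<le> lev (f (\<phi> x)) \<and> (lev (f (\<phi> x)) = 0 \<longleftrightarrow> lev x = 0) \<and> R x (f (\<phi> x))"
  proof
    fix x assume x: "x \<in> S"
    have "\<phi> x \<in> U \<inter> upper" using sub x by blast
    from Rf [OF this] S\<phi> [OF x] R [of x "\<phi> x"] show "0 \<le> lev (f (\<phi> x)) \<and> (lev (f (\<phi> x)) = 0 \<longleftrightarrow> lev x = 0) \<and> R x (f (\<phi> x))" by auto
  qed
  ultimately show ?thesis unfolding straightens_def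
    by (intro exI [of _ S] exI [of _ "\<lambda>x. f (\<phi> x)"] exI [of _ "\<lambda>w. D2 (D w)"]) (simp only: Su S simp_thms)
qed

section \<open>Coordinates near the periodic orbits and near the equilibrium\<close>

lemma limit_energy_level_0: "norm (plane p) < 1 \<Longrightarrow> lev p = 0 \<Longrightarrow> limit_energy \<delta> p = energy p"
  by (rule limit_energy_eq [OF tends_to_energy_level_0])

lemma limit_energy_nonneg: "tends_to_energy \<delta> p (limit_energy \<delta> p) \<Longrightarrow> 0 \<le> limit_energy \<delta> p"
proof -
  assume "tends_to_energy \<delta> p (limit_energy \<delta> p)"
  then obtain \<xi> :: "real \<Rightarrow> _" where \<xi>: "((\<lambda>t. energy (\<xi> t)) \<longlongrightarrow> limit_energy \<delta> p) at_top" unfolding tends_to_energy_def by blast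
  have "0 \<le> energy q" for q by (cases q) (simp add: energy_def)
  then have "\<forall>\<^sub>F t in at_top. 0 \<le> energy (\<xi> t)" by (intro always_eventually) blast
  then show ?thesis using \<xi> by (intro tendsto_lowerbound [where F = at_top]) auto
qed

lemma limit_energy_derivative_level_0:
  assumes S: "open S" "p \<in> S" "\<And>q. q \<in> S \<Longrightarrow> norm (plane q) < 1" and p: "lev p = 0"
    and E: "(limit_energy \<delta> has_derivative E') (at p within S \<inter> upper)" and w: "lev w = 0"
  shows "E' w = fst p * fst w + fst (snd p) * fst (snd w)"
proof -
  obtain e where e: "0 < e" "\<And>t. \<bar>t\<bar> < e \<Longrightarrow> p + t *\<^sub>R w \<in> S" using segment_in_open [OF S(1,2), of w] by blast
  have "((\<lambda>t. limit_energy \<delta> (p + t *\<^sub>R w)) has_real_derivative E' w) (at 0)"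
    unfolding has_real_derivative_iff_has_vector_derivative
    by (rule tangential_derivative [OF S(1) _ E w]) (use S(2) p in simp)
  then have "((\<lambda>t. energy (p + t *\<^sub>R w)) has_real_derivative E' w) (at 0)"
  proof (rule has_field_derivative_transform_within_open)
    show "limit_energy \<delta> (p + t *\<^sub>R w) = energy (p + t *\<^sub>R w)" if "t \<in> {-e<..<e}" for t
      by (rule limit_energy_level_0 [OF S(3) [OF e(2)]]) (use that p w in auto)
  qed (use e(1) in auto)
  moreover have "(\<lambda>t. energy (p + t *\<^sub>R w)) = (\<lambda>t. ((fst p + t * fst w) ^ 2 + (fst (snd p) + t * fst (snd w)) ^ 2) / 2)"
    by (cases p, cases w) (simp add: energy_def)
  moreover have "((\<lambda>t. ((fst p + t * fst w) ^ 2 + (fst (snd p) + t * fst (snd w)) ^ 2) / 2) has_real_derivative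
      fst p * fst w + fst (snd p) * fst (snd w)) (at 0)"
    by (auto intro!: derivative_eq_intros)
  ultimately show ?thesis using DERIV_unique by metis
qed

text \<open>The coordinates are the limit energy, a linear function increasing along the circle at
  p, and l. At l = 0 the first two derivatives are the radial and the tangential component of w,
  each times the radius of the circle, which is nonzero since the energy is positive.\<close>

lemma straightens_circle:
  assumes \<delta>: "\<delta> > 0" and p: "lev p = 0" "0 < energy p" "energy p < 1/2"
  shows "straightens (\<lambda>x y. \<forall>h. tends_to_energy \<delta> x h \<longleftrightarrow> fst y = h) p"
proof -
  have p1: "norm (plane p) < 1"
  proof (rule power_less_imp_less_base)
    show "norm (plane p) ^ 2 < 1 ^ 2" using norm_plane [of p] p(3) by simp
  qed simp
  define \<rho>0 where "\<rho>0 = (norm (plane p) + 1) / 2"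
  have \<rho>0: "0 < \<rho>0" "\<rho>0 < 1" "norm (plane p) < \<rho>0" using p1 by (auto simp: \<rho>0_def add_nonneg_pos)
  from limit_energy_smooth [OF \<delta> \<rho>0(1,2)] obtain l1 where l1: "0 < l1"
    and E: "smooth_on (cell \<rho>0 l1 \<inter> upper) (limit_energy \<delta>)"
    and as: "\<And>q. q \<in> cell \<rho>0 l1 \<inter> upper \<Longrightarrow> tends_to_energy \<delta> q (limit_energy \<delta> q)" by blast
  have pc: "p \<in> cell \<rho>0 l1" using \<rho>0(3) p(1) l1 by (simp add: cell_def)
  then have pcu: "p \<in> cell \<rho>0 l1 \<inter> upper" using p(1) by simp
  have c1: "norm (plane q) < 1" if "q \<in> cell \<rho>0 l1" for q using that \<rho>0(2) by (simp add: cell_def)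
  obtain E' where E': "\<And>x. x \<in> cell \<rho>0 l1 \<inter> upper \<Longrightarrow> (limit_energy \<delta> has_derivative E' x) (at x within cell \<rho>0 l1 \<inter> upper)"
    using smooth_onE [OF E upper_closure_interior [OF open_cell]] by blast
  define f where "f x = (limit_energy \<delta> x, fst p * fst (snd x) - fst (snd p) * fst x, lev x)" for x
  define D where "D w = (E' p w, fst p * fst (snd w) - fst (snd p) * fst w, lev w)" for w
  have "smooth_on (cell \<rho>0 l1 \<inter> upper) f"
    unfolding f_def [abs_def]
    by (intro smooth_on_Pair E smooth_on_diff smooth_on_mult smooth_on_const smooth_on_fst smooth_on_snd smooth_on_id)
  moreover have D: "(f has_derivative D) (at p within cell \<rho>0 l1 \<inter> upper)"
    unfolding f_def [abs_def] D_def [abs_def]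
    by (intro has_derivative_Pair E' [OF pcu] derivative_intros)
  moreover have "inj D"
  proof -
    have "w = 0" if w: "D w = 0" for w
    proof -
      have w': "E' p w = 0" "fst p * fst (snd w) = fst (snd p) * fst w" "lev w = 0" using w by (auto simp: D_def zero_prod_def)
      have "fst p * fst w + fst (snd p) * fst (snd w) = 0"
        using limit_energy_derivative_level_0 [OF open_cell pc c1 p(1) E' [OF pcu] w'(3)] w'(1) by simp
      moreover have "(2 * energy p) * fst w = fst p * (fst p * fst w + fst (snd p) * fst (snd w)) - fst (snd p) * (fst p * fst (snd w) - fst (snd p) * fst w)"
        "(2 * energy p) * fst (snd w) = fst (snd p) * (fst p * fst w + fst (snd p) * fst (snd w)) + fst p * (fst p * fst (snd w) - fst (snd p) * fst w)"
        by (cases p, simp add: energy_def algebra_simps power2_eq_square)+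
      ultimately have "fst w = 0" "fst (snd w) = 0" using w'(2) p(2) by auto
      then show ?thesis using w'(3) by (simp add: prod_eq_iff)
    qed
    then show ?thesis using linear_injective_0 [OF has_derivative_linear [OF D]] by blast
  qed
  moreover have "\<forall>x\<in>cell \<rho>0 l1 \<inter> upper. 0 \<le> lev (f x) \<and> (lev (f x) = 0 \<longleftrightarrow> lev x = 0) \<and> (\<forall>h. tends_to_energy \<delta> x h \<longleftrightarrow> fst (f x) = h)"
  proof
    fix x assume x: "x \<in> cell \<rho>0 l1 \<inter> upper"
    have "tends_to_energy \<delta> x h \<longleftrightarrow> limit_energy \<delta> x = h" for h
    proof
      show "tends_to_energy \<delta> x h" if "limit_energy \<delta> x = h" using as [OF x] that by simp
    qed (rule limit_energy_eq)
    then have "\<forall>h. tends_to_energy \<delta> x h \<longleftrightarrow> fst (f x) = h" by (simp only: f_def fst_conv simp_thms)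
    moreover have "lev (f x) = lev x" by (simp add: f_def)
    ultimately show "0 \<le> lev (f x) \<and> (lev (f x) = 0 \<longleftrightarrow> lev x = 0) \<and> (\<forall>h. tends_to_energy \<delta> x h \<longleftrightarrow> fst (f x) = h)"
      using x by simp
  qed
  ultimately show ?thesis unfolding straightens_def
    using open_cell [of \<rho>0 l1] pc by (intro exI [of _ "cell \<rho>0 l1"] exI [of _ f] exI [of _ D]) simp
qed

lemma limit_energy_constant_along_field:
  assumes \<delta>: "\<delta> > 0" and p: "0 < lev p" and \<xi>: "\<xi> 0 = p" "box_sol \<delta> C \<xi>" "1 \<le> C"
    and E: "(limit_energy \<delta> has_derivative E') (at p)"
  shows "E' (fld \<delta> p) = 0"
proof -
  have "(\<xi> has_vector_derivative fld \<delta> (\<xi> 0)) (at 0 within {0..})" by (rule ode_solD [OF box_solD(1) [OF \<xi>(2)]]) simp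
  then have "(limit_energy \<delta> \<circ> \<xi> has_vector_derivative E' (fld \<delta> p)) (at 0 within {0..})"
    using E unfolding \<xi>(1) by (intro vector_derivative_diff_chain_within) (auto simp: \<xi>(1) intro: has_derivative_at_withinI)
  moreover have "(limit_energy \<delta> \<circ> \<xi>) t = limit_energy \<delta> p" if "0 \<le> t" for t
    using tends_to_energy_shift [OF \<xi>(2,3) that] by (simp add: limit_energy_def \<xi>(1))
  then have "(limit_energy \<delta> \<circ> \<xi> has_vector_derivative 0) (at 0 within {0..})"
    by (intro has_vector_derivative_transform [OF _ _ has_vector_derivative_const [of "limit_energy \<delta> p"]]) auto
  ultimately show ?thesis
    by (rule vector_derivative_unique_within [rotated]) (simp add: at_within_Ici_at_right)
qed

text \<open>The level set 0 is degenerate, so the gradient of the limit energy in (x, y), together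
  with l, serves as coordinates; at the origin its derivative in the plane is the identity. Zeros of
  the limit energy are minima, hence critical in the plane. Conversely, the critical points form a
  curve down to the origin along which the limit energy is constant, so it is 0.\<close>

lemma straightens_origin:
  assumes \<delta>: "\<delta> > 0"
  shows "straightens (\<lambda>x y. tends_to_energy \<delta> x 0 \<longleftrightarrow> plane y = 0) 0"
proof -
  define \<rho>0 :: real where "\<rho>0 = 1 / 2"
  have \<rho>0: "0 < \<rho>0" "\<rho>0 < 1" by (auto simp: \<rho>0_def)
  from limit_energy_smooth [OF \<delta> \<rho>0] obtain l1 C where l1: "0 < l1" and C: "1 \<le> C"
    and E: "smooth_on (cell \<rho>0 l1 \<inter> upper) (limit_energy \<delta>)"
    and as: "\<And>q. q \<in> cell \<rho>0 l1 \<inter> upper \<Longrightarrow> tends_to_energy \<delta> q (limit_energy \<delta> q)"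
    and sol: "\<And>q. q \<in> cell \<rho>0 l1 \<Longrightarrow> 0 < lev q \<Longrightarrow> \<exists>\<xi>. \<xi> 0 = q \<and> box_sol \<delta> C \<xi>" by blast
  define Q where "Q = cell \<rho>0 l1 \<inter> upper"
  have zc: "0 \<in> cell \<rho>0 l1" using \<rho>0 l1 by (simp add: cell_def zero_prod_def)
  have zQ: "0 \<in> Q" using zc by (simp add: Q_def)
  have c1: "norm (plane q) < 1" if "q \<in> cell \<rho>0 l1" for q using that \<rho>0(2) by (simp add: cell_def)
  note clos = upper_closure_interior [OF open_cell [of \<rho>0 l1], folded Q_def]
  obtain E' where E': "\<And>x. x \<in> Q \<Longrightarrow> (limit_energy \<delta> has_derivative E' x) (at x within Q)"
    and smoothE': "\<And>w. smooth_on Q (\<lambda>x. E' x w)"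
    using smooth_onE [OF E [folded Q_def] clos] by blast
  define f where "f x = (E' x (1, 0, 0), E' x (0, 1, 0), lev x)" for x
  have levf: "lev (f x) = lev x" for x by (simp add: f_def)
  have smoothf: "smooth_on Q f"
    unfolding f_def [abs_def]
    by (intro smooth_on_Pair smoothE' smooth_on_snd smooth_on_id)
  have level0: "E' x w = fst x * fst w + fst (snd x) * fst (snd w)" if "x \<in> cell \<rho>0 l1" "lev x = 0" "lev w = 0" for x w
    by (rule limit_energy_derivative_level_0 [OF open_cell that(1) c1 that(2) _ that(3)]) (use E' [of x] that in \<open>auto simp: Q_def\<close>)
  have f0: "f x = x" if "x \<in> cell \<rho>0 l1" "lev x = 0" for x
    using level0 [OF that] that by (cases x) (simp add: f_def)
  obtain f' where f': "\<And>x. x \<in> Q \<Longrightarrow> (f has_derivative f' x) (at x within Q)"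
    and smoothf': "\<And>w. smooth_on Q (\<lambda>x. f' x w)"
    using smooth_onE [OF smoothf clos] by blast
  have f'0: "f' 0 w = w" if w: "lev w = 0" for w
  proof -
    obtain e where e: "0 < e" "\<And>t. \<bar>t\<bar> < e \<Longrightarrow> 0 + t *\<^sub>R w \<in> cell \<rho>0 l1" using segment_in_open [OF open_cell zc, of w] by blast
    have "((\<lambda>t. f (0 + t *\<^sub>R w)) has_vector_derivative f' 0 w) (at 0)"
      by (rule tangential_derivative [OF open_cell zQ [unfolded Q_def] f' [OF zQ, unfolded Q_def] w])
    then have "((\<lambda>t. t *\<^sub>R w) has_vector_derivative f' 0 w) (at 0)"
    proof (rule has_vector_derivative_transform_within_open)
      show "f (0 + t *\<^sub>R w) = t *\<^sub>R w" if "t \<in> {-e<..<e}" for t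
      proof -
        have "\<bar>t\<bar> < e" using that by auto
        from f0 [OF e(2) [OF this]] w show ?thesis by simp
      qed
    qed (use e(1) in auto)
    moreover have "((\<lambda>t. t *\<^sub>R w) has_vector_derivative w) (at 0)" by (auto intro!: derivative_eq_intros)
    ultimately show ?thesis by (rule vector_derivative_unique_at)
  qed
  have levf': "lev (f' 0 w) = lev w" for w
  proof -
    have "((\<lambda>x. lev (f x)) has_derivative (\<lambda>w. lev (f' 0 w))) (at 0 within cell \<rho>0 l1 \<inter> upper)"
      by (intro has_derivative_snd f' [OF zQ, unfolded Q_def])
    then have "(lev has_derivative (\<lambda>w. lev (f' 0 w))) (at 0 within cell \<rho>0 l1 \<inter> upper)" by (simp add: f_def)
    moreover have "(lev has_derivative lev) (at 0 within cell \<rho>0 l1 \<inter> upper)" by (intro derivative_intros)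
    ultimately have "(\<lambda>w. lev (f' 0 w)) = lev"
      by (rule upper_derivative_unique [OF open_cell zQ [unfolded Q_def]])
    then show ?thesis by metis
  qed
  have inj: "inj (f' 0)"
  proof -
    have "w = 0" if w: "f' 0 w = 0" for w
      using levf' [of w] f'0 [of w] w by (simp add: zero_prod_def)
    then show ?thesis using linear_injective_0 [OF has_derivative_linear [OF f' [OF zQ]]] by blast
  qed
  have "\<exists>U V \<psi> \<psi>'. open U \<and> 0 \<in> U \<and> U \<subseteq> cell \<rho>0 l1 \<and> open V \<and> homeomorphism (U \<inter> upper) (V \<inter> upper) f \<psi> \<and>
    smooth_on (V \<inter> upper) \<psi> \<and>
    (\<forall>y\<in>V \<inter> upper. (\<psi> has_derivative \<psi>' y) (at y within V \<inter> upper) \<and> inj (\<psi>' y)) \<and>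
    (\<forall>x\<in>U \<inter> upper. inj (f' x))"
    by (rule smooth_chart [OF open_cell]) (use zQ f' smoothf' inj in \<open>auto simp: Q_def f_def\<close>)
  then obtain U V \<psi> \<psi>' where U: "open U" "0 \<in> U" "U \<subseteq> cell \<rho>0 l1" and V: "open V"
    and homeo: "homeomorphism (U \<inter> upper) (V \<inter> upper) f \<psi>"
    and \<psi>': "\<And>y. y \<in> V \<inter> upper \<Longrightarrow> (\<psi> has_derivative \<psi>' y) (at y within V \<inter> upper)"
    by blast
  have f00: "f 0 = 0" by (rule f0 [OF zc]) simp
  have zV: "0 \<in> V"
  proof -
    have "f 0 \<in> V \<inter> upper" using homeomorphism_image1 [OF homeo] U(2) by auto
    then show ?thesis by (simp add: f00)
  qed
  obtain \<epsilon> where \<epsilon>: "0 < \<epsilon>" "ball 0 \<epsilon> \<subseteq> V" using V zV open_contains_ball by blast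
  have UQ: "U \<inter> upper \<subseteq> Q" using U(3) by (auto simp: Q_def)
  \<comment> \<open>Restricting to points whose image lies in a ball inside V keeps the segment from
    (0, 0, 0) to (0, 0, l) in V, so that its preimage under f is available as a curve.\<close>
  obtain A where A: "open A" "A \<inter> (U \<inter> upper) = f -` ball 0 \<epsilon> \<inter> (U \<inter> upper)"
    using continuous_on_open_invariant [of "U \<inter> upper" f] homeo unfolding homeomorphism_def by (metis open_ball)
  \<comment> \<open>The limit energy is constant along solutions and the field has a nonzero
    l-component for l > 0. With both planar derivatives zero, the derivative in l has to vanish
    too.\<close>
  have crit: "E' x w = 0" if x: "x \<in> Q" "0 < lev x" "plane (f x) = 0" for x w
  proof -
    have xc: "x \<in> cell \<rho>0 l1" using x(1) by (simp add: Q_def)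
    obtain \<xi> where \<xi>: "\<xi> 0 = x" "box_sol \<delta> C \<xi>" using sol [OF xc x(2)] by blast
    have "open (cell \<rho>0 l1 \<inter> {x. 0 < lev x})" by (intro open_Int open_cell open_Collect_less continuous_intros)
    moreover have "cell \<rho>0 l1 \<inter> {x. 0 < lev x} \<subseteq> Q" unfolding Q_def by auto
    moreover have "x \<in> cell \<rho>0 l1 \<inter> {x. 0 < lev x}" using xc x(2) by blast
    ultimately have "x \<in> interior Q" by (meson interior_maximal subsetD)
    from at_within_interior [OF this] have "(limit_energy \<delta> has_derivative E' x) (at x)" using E' [OF x(1)] by (simp only:)
    from limit_energy_constant_along_field [OF \<delta> x(2) \<xi> C this] have fld0: "E' x (fld \<delta> x) = 0" .
    have e: "E' x (1, 0, 0) = 0" "E' x (0, 1, 0) = 0" using x(3) by (auto simp: f_def zero_prod_def)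
    note tr = linear_triple [OF has_derivative_linear [OF E' [OF x(1)]]]
    have "lev (fld \<delta> x) * E' x (0, 0, 1) = 0" using tr [of "fld \<delta> x"] e fld0 by simp
    moreover have "lev (fld \<delta> x) \<noteq> 0"
    proof -
      have "\<bar>fst x\<bar> < 1" using c1 [OF xc] norm_fst_le [of "fst x" "fst (snd x)"] by simp
      then show ?thesis using \<delta> x(2) by (cases x) (simp add: fld_def)
    qed
    ultimately show ?thesis using tr [of w] e by simp
  qed
  have R: "tends_to_energy \<delta> x 0 \<longleftrightarrow> plane (f x) = 0" if x: "x \<in> (A \<inter> U) \<inter> upper" for x
  proof
    have xQ: "x \<in> cell \<rho>0 l1 \<inter> upper" using x U(3) by blast
    assume "tends_to_energy \<delta> x 0"
    then have min: "limit_energy \<delta> x = 0" by (rule limit_energy_eq)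
    \<comment> \<open>Limit energies are nonnegative, so the value 0 is a minimum along every line
      parallel to the boundary.\<close>
    have "E' x w = 0" if w: "lev w = 0" for w
    proof -
      obtain e where e: "0 < e" "\<And>t. \<bar>t\<bar> < e \<Longrightarrow> x + t *\<^sub>R w \<in> cell \<rho>0 l1" using segment_in_open [OF open_cell, of x \<rho>0 l1 w] xQ by blast
      have "((\<lambda>t. limit_energy \<delta> (x + t *\<^sub>R w)) has_real_derivative E' x w) (at 0)"
        unfolding has_real_derivative_iff_has_vector_derivative
        by (rule tangential_derivative [OF open_cell xQ _ w]) (use E' [of x] xQ in \<open>simp add: Q_def\<close>)
      then show ?thesis
      proof (rule DERIV_local_min [OF _ e(1)], intro allI impI)
        fix t :: real assume "\<bar>0 - t\<bar> < e"
        then have "x + t *\<^sub>R w \<in> cell \<rho>0 l1 \<inter> upper" using e(2) [of t] w xQ by simp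
        then show "limit_energy \<delta> (x + 0 *\<^sub>R w) \<le> limit_energy \<delta> (x + t *\<^sub>R w)" using limit_energy_nonneg [OF as] min by simp
      qed
    qed
    then show "plane (f x) = 0" by (simp add: f_def zero_prod_def)
  next
    have xQ: "x \<in> cell \<rho>0 l1 \<inter> upper" using x U(3) by blast
    assume pl: "plane (f x) = 0"
    define s where "s = lev x"
    have s: "0 \<le> s" using x by (simp add: s_def)
    have fx: "f x = (0, 0, s)" using pl by (simp add: f_def s_def zero_prod_def)
    have "f x \<in> ball 0 \<epsilon>" using A(2) x by blast
    then have s\<epsilon>: "s < \<epsilon>" using s by (simp add: fx norm_Pair)
    \<comment> \<open>The curve of critical points, parametrized by l, running from the origin to
      x.\<close>
    define c where "c \<sigma> = \<psi> (0, 0, \<sigma>)" for \<sigma> :: real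
    have inV: "(0, 0, \<sigma>) \<in> V \<inter> upper" if "\<sigma> \<in> {0..s}" for \<sigma> :: real
    proof -
      have "(0, 0, \<sigma>) \<in> ball (0 :: real \<times> real \<times> real) \<epsilon>" using that s\<epsilon> by (simp add: norm_Pair)
      then have "(0, 0, \<sigma>) \<in> V" using \<epsilon>(2) by blast
      then show ?thesis using that by simp
    qed
    have fc: "f (c \<sigma>) = (0, 0, \<sigma>)" "c \<sigma> \<in> Q" if "\<sigma> \<in> {0..s}" for \<sigma>
    proof -
      show "f (c \<sigma>) = (0, 0, \<sigma>)" unfolding c_def by (rule homeomorphism_apply2 [OF homeo inV [OF that]])
      have "\<psi> (0, 0, \<sigma>) \<in> U \<inter> upper" using homeomorphism_image2 [OF homeo] inV [OF that] by blast
      then show "c \<sigma> \<in> Q" using UQ unfolding c_def by blast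
    qed
    have cs: "c s = x" "c 0 = 0"
    proof -
      show "c s = x" unfolding c_def fx [symmetric] by (rule homeomorphism_apply1 [OF homeo]) (use x in blast)
      have "c 0 = \<psi> (f 0)" unfolding c_def f00 by (simp add: zero_prod_def)
      also have "\<dots> = 0" by (rule homeomorphism_apply1 [OF homeo]) (use U(2) in simp)
      finally show "c 0 = 0" .
    qed
    have g: "(limit_energy \<delta> \<circ> c has_vector_derivative E' (c \<sigma>) (\<psi>' (0, 0, \<sigma>) (0, 0, 1))) (at \<sigma> within {0..s})"
      if \<sigma>: "\<sigma> \<in> {0..s}" for \<sigma>
    proof -
      have "((\<lambda>\<sigma>. (0, 0, \<sigma>)) has_vector_derivative (0, 0, 1)) (at \<sigma> within {0..s})"
        by (intro has_vector_derivative_Pair has_vector_derivative_const has_vector_derivative_id)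
      moreover have "(\<psi> has_derivative \<psi>' (0, 0, \<sigma>)) (at (0, 0, \<sigma>) within (\<lambda>\<sigma>. (0, 0, \<sigma>)) ` {0..s})"
        by (rule has_derivative_subset [OF \<psi>' [OF inV [OF \<sigma>]]]) (rule image_subsetI, rule inV)
      ultimately have "(c has_vector_derivative \<psi>' (0, 0, \<sigma>) (0, 0, 1)) (at \<sigma> within {0..s})"
        using vector_derivative_diff_chain_within [of "\<lambda>\<sigma>. (0, 0, \<sigma>)" "(0, 0, 1)" \<sigma> "{0..s}" \<psi> "\<psi>' (0, 0, \<sigma>)"]
        by (simp add: c_def [abs_def] o_def)
      then show ?thesis
        by (rule vector_derivative_diff_chain_within)
          (rule has_derivative_subset [OF E' [OF fc(2) [OF \<sigma>]]], rule image_subsetI, rule fc(2))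
    qed
    have "(limit_energy \<delta> \<circ> c) s = (limit_energy \<delta> \<circ> c) 0"
    proof (cases "s = 0")
      case False
      show ?thesis
      proof (rule DERIV_isconst_end [where f = "limit_energy \<delta> \<circ> c"])
        show "0 < s" using s False by simp
        show "continuous_on {0..s} (limit_energy \<delta> \<circ> c)" using g by (rule continuous_on_vector_derivative)
        fix \<sigma> assume \<sigma>: "0 < \<sigma>" "\<sigma> < s"
        then have m: "\<sigma> \<in> {0..s}" by simp
        have "lev (f (c \<sigma>)) = \<sigma>" "plane (f (c \<sigma>)) = 0" by (simp_all add: fc(1) [OF m] zero_prod_def)
        then have "E' (c \<sigma>) w = 0" for w by (intro crit [OF fc(2) [OF m]]) (simp_all only: levf \<sigma>(1))
        then have "(limit_energy \<delta> \<circ> c has_vector_derivative 0) (at \<sigma> within {0..s})" using g [OF m] by simp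
        then show "DERIV (limit_energy \<delta> \<circ> c) \<sigma> :> 0"
          unfolding has_real_derivative_iff_has_vector_derivative at_within_Icc_at [OF \<sigma>] .
      qed
    qed simp
    then have "limit_energy \<delta> x = limit_energy \<delta> 0" by (simp add: cs)
    also have "\<dots> = 0" using limit_energy_level_0 [of 0 \<delta>] by (simp add: energy_def zero_prod_def)
    finally show "tends_to_energy \<delta> x 0" using as [OF xQ] by simp
  qed
  show ?thesis
    unfolding straightens_def
  proof (intro exI conjI)
    show "open (A \<inter> U)" using A(1) U(1) by blast
    show "0 \<in> A \<inter> U" using A(2) U(2) \<epsilon>(1) f00 by auto
    have sub: "(A \<inter> U) \<inter> upper \<subseteq> Q" using UQ by blast
    show "smooth_on ((A \<inter> U) \<inter> upper) f" by (rule smooth_on_subset [OF smoothf sub])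
    show "(f has_derivative f' 0) (at 0 within (A \<inter> U) \<inter> upper)" by (rule has_derivative_subset [OF f' [OF zQ] sub])
    show "\<forall>x\<in>(A \<inter> U) \<inter> upper. 0 \<le> lev (f x) \<and> (lev (f x) = 0 \<longleftrightarrow> lev x = 0) \<and> (tends_to_energy \<delta> x 0 \<longleftrightarrow> plane (f x) = 0)"
    proof
      fix x assume "x \<in> (A \<inter> U) \<inter> upper"
      from R [OF this] this show "0 \<le> lev (f x) \<and> (lev (f x) = 0 \<longleftrightarrow> lev x = 0) \<and> (tends_to_energy \<delta> x 0 \<longleftrightarrow> plane (f x) = 0)"
        by (auto simp: f_def)
    qed
  qed (rule inj)
qed

section \<open>The change of coordinates and time\<close>

text \<open>The new time is the inverse of the integral of g. The positive lower bound c makes that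
  integral unbounded, hence onto the half-line, and its inverse Lipschitz.\<close>

lemma positive_rate_clock:
  fixes g :: "real \<Rightarrow> real"
  assumes g: "continuous_on {0..} g" "\<And>t. 0 \<le> t \<Longrightarrow> c \<le> g t" and c: "0 < c"
  shows "\<exists>\<sigma>. \<sigma> 0 = 0 \<and> (\<forall>s\<ge>0. 0 \<le> \<sigma> s) \<and> filterlim \<sigma> at_top at_top \<and>
    (\<forall>s\<ge>0. (\<sigma> has_real_derivative 1 / g (\<sigma> s)) (at s within {0..}))"
proof -
  define \<tau> where "\<tau> t = integral {0..t} g" for t
  have d: "(\<tau> has_real_derivative g t) (at t within {0..})" if t: "0 \<le> t" for t
  proof -
    have "(\<tau> has_vector_derivative g t) (at t within {0..t + 1})"
      unfolding \<tau>_def by (rule integral_has_vector_derivative [OF continuous_on_subset [OF g(1)]]) (use t in auto)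
    then show ?thesis unfolding has_real_derivative_iff_has_vector_derivative
      by (rule has_vector_derivative_atLeast) (use t in auto)
  qed
  have grow: "c * (t - s) \<le> \<tau> t - \<tau> s" if st: "0 \<le> s" "s \<le> t" for s t
  proof -
    have "c * t - \<tau> t \<le> c * s - \<tau> s"
    proof (rule halfline_nonincreasing [where g = "\<lambda>t. c * t - \<tau> t" and g' = "\<lambda>t. c - g t" and T = t])
      show "((\<lambda>t. c * t - \<tau> t) has_real_derivative c - g u) (at u within {0..})" if "0 \<le> u" for u
        using d [OF that] by (auto intro!: derivative_eq_intros)
    qed (use st g(2) in auto)
    then show ?thesis by (simp add: algebra_simps)
  qed
  have \<tau>0: "\<tau> 0 = 0" by (simp add: \<tau>_def)
  have cont: "continuous_on {0..} \<tau>" using d DERIV_continuous_on by blast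
  have mono: "\<tau> s < \<tau> t" if "0 \<le> s" "s < t" for s t
  proof -
    have "0 < c * (t - s)" using that c by simp
    then show ?thesis using grow [of s t] that by linarith
  qed
  have \<tau>_nonneg: "0 \<le> \<tau> t" if t: "0 \<le> t" for t
  proof -
    have "0 \<le> c * t" using t c by simp
    then show ?thesis using grow [OF order_refl t] by (simp add: \<tau>0)
  qed
  have ex: "\<exists>t\<ge>0. \<tau> t = s" if s: "0 \<le> s" for s
  proof -
    have "\<tau> 0 \<le> s" "s \<le> \<tau> (s / c)" using grow [of 0 "s / c"] s c by (auto simp: \<tau>0)
    then have "\<exists>t\<ge>0. t \<le> s / c \<and> \<tau> t = s"
      by (rule IVT') (use s c in \<open>auto intro: continuous_on_subset [OF cont]\<close>)
    then show ?thesis by blast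
  qed
  define \<sigma> where "\<sigma> s = (SOME t. 0 \<le> t \<and> \<tau> t = s)" for s
  have \<sigma>: "0 \<le> \<sigma> s" "\<tau> (\<sigma> s) = s" if "0 \<le> s" for s
    using someI_ex [of "\<lambda>t. 0 \<le> t \<and> \<tau> t = s"] ex [OF that] unfolding \<sigma>_def by auto
  have \<sigma>\<tau>: "\<sigma> (\<tau> t) = t" if t: "0 \<le> t" for t
  proof -
    have "0 \<le> \<tau> t" by (rule \<tau>_nonneg [OF t])
    then show ?thesis using \<sigma> mono t by (metis less_irrefl linorder_neqE)
  qed
  have close: "\<bar>\<sigma> a - \<sigma> b\<bar> \<le> \<bar>a - b\<bar> / c" if "0 \<le> a" "0 \<le> b" for a b
    using grow [of "\<sigma> a" "\<sigma> b"] grow [of "\<sigma> b" "\<sigma> a"] \<sigma>[OF that(1)] \<sigma>[OF that(2)] c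
    by (auto simp: pos_le_divide_eq abs_if algebra_simps)
  have cont\<sigma>: "continuous_on {0..} \<sigma>"
    unfolding continuous_on_iff
  proof (intro ballI allI impI)
    fix x e :: real assume x: "x \<in> {0..}" and e: "0 < e"
    show "\<exists>d>0. \<forall>y\<in>{0..}. dist y x < d \<longrightarrow> dist (\<sigma> y) (\<sigma> x) < e"
    proof (intro exI [of _ "c * e"] conjI ballI impI)
      fix y assume y: "y \<in> {0..}" "dist y x < c * e"
      then have "\<bar>y - x\<bar> / c < e" using c by (simp add: dist_real_def pos_divide_less_eq mult.commute)
      then show "dist (\<sigma> y) (\<sigma> x) < e" using close [of y x] x y(1) by (simp add: dist_real_def)
    qed (use c e in simp)
  qed
  have im: "\<tau> ` {0..} = {0..}"
  proof
    show "\<tau> ` {0..} \<subseteq> {0..}" using \<tau>_nonneg by auto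
    show "{0..} \<subseteq> \<tau> ` {0..}" using ex by force
  qed
  have "(\<sigma> has_real_derivative 1 / g (\<sigma> s)) (at s within {0..})" if s: "0 \<le> s" for s
  proof -
    have gp: "0 < g (\<sigma> s)" using g(2) [OF \<sigma>(1) [OF s]] c by simp
    have "(\<sigma> has_derivative (\<lambda>h. h / g (\<sigma> s))) (at (\<tau> (\<sigma> s)) within \<tau> ` {0..})"
    proof (rule has_derivative_inverse_within)
      show "(\<tau> has_derivative (*) (g (\<sigma> s))) (at (\<sigma> s) within {0..})"
        using d [OF \<sigma>(1) [OF s]] by (simp add: has_field_derivative_def)
      show "continuous (at (\<tau> (\<sigma> s)) within \<tau> ` {0..}) \<sigma>"
        using cont\<sigma> s unfolding im \<sigma>(2) [OF s] continuous_on_eq_continuous_within by simp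
      show "linear (\<lambda>h. h / g (\<sigma> s))" by (rule linearI) (auto simp: add_divide_distrib)
      show "(\<lambda>h. h / g (\<sigma> s)) \<circ> (*) (g (\<sigma> s)) = id" using gp by auto
    qed (use \<sigma>(1) [OF s] \<sigma>\<tau> in auto)
    then show ?thesis unfolding im \<sigma>(2) [OF s] has_field_derivative_def
      by (rule has_derivative_eq_rhs) auto
  qed
  moreover have "filterlim \<sigma> at_top at_top"
    unfolding filterlim_at_top
  proof
    fix Z :: real
    have "Z \<le> \<sigma> s" if "max 0 (\<tau> (max 0 Z)) \<le> s" for s
    proof -
      have "\<not> \<sigma> s < max 0 Z"
        using mono [of "\<sigma> s" "max 0 Z"] \<sigma> [of s] that by auto
      then show ?thesis by simp
    qed
    then show "eventually (\<lambda>s. Z \<le> \<sigma> s) at_top" by (rule eventually_at_top_linorderI)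
  qed
  moreover have "\<sigma> 0 = 0" using \<sigma>\<tau> [of 0] by (simp add: \<tau>0)
  ultimately show ?thesis using \<sigma>(1) by blast
qed

lemma time_change:
  fixes X :: "real \<Rightarrow> 'a::euclidean_space"
  assumes X: "\<And>t. 0 \<le> t \<Longrightarrow> (X has_vector_derivative g t *\<^sub>R F (X t)) (at t within {0..})"
    and g: "continuous_on {0..} g" "\<And>t. 0 \<le> t \<Longrightarrow> c \<le> g t" and c: "0 < c"
  shows "\<exists>\<sigma>. \<sigma> 0 = 0 \<and> (\<forall>s\<ge>0. 0 \<le> \<sigma> s) \<and> filterlim \<sigma> at_top at_top \<and> ode_sol (\<lambda>t. F) (\<lambda>s. X (\<sigma> s))"
proof -
  obtain \<sigma> where \<sigma>: "\<sigma> 0 = 0" "\<And>s. 0 \<le> s \<Longrightarrow> 0 \<le> \<sigma> s" "filterlim \<sigma> at_top at_top"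
    and d: "\<And>s. 0 \<le> s \<Longrightarrow> (\<sigma> has_real_derivative 1 / g (\<sigma> s)) (at s within {0..})"
    using positive_rate_clock [OF g c] by blast
  have "ode_sol (\<lambda>t. F) (\<lambda>s. X (\<sigma> s))"
    unfolding ode_sol_def
  proof (intro allI impI)
    fix s :: real assume s: "0 \<le> s"
    have gp: "0 < g (\<sigma> s)" using g(2) [OF \<sigma>(2) [OF s]] c by simp
    have "(X has_vector_derivative g (\<sigma> s) *\<^sub>R F (X (\<sigma> s))) (at (\<sigma> s) within \<sigma> ` {0..})"
      by (rule has_vector_derivative_within_subset [OF X [OF \<sigma>(2) [OF s]]]) (use \<sigma>(2) in auto)
    then have "(X \<circ> \<sigma> has_vector_derivative (1 / g (\<sigma> s)) *\<^sub>R (g (\<sigma> s) *\<^sub>R F (X (\<sigma> s)))) (at s within {0..})"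
      using d [OF s] unfolding has_real_derivative_iff_has_vector_derivative by (intro vector_diff_chain_within)
    then show "((\<lambda>s. X (\<sigma> s)) has_vector_derivative F (X (\<sigma> s))) (at s within {0..})"
      using gp by (simp add: o_def)
  qed
  then show ?thesis using \<sigma> by blast
qed

section \<open>Correspondence with the original coordinates\<close>

definition binet :: "real \<times> real \<times> real \<Rightarrow> real \<times> real \<times> real" where
  "binet p = (1 / fst p - 1, - fst (snd p), lev p)"

definition binet_inv :: "real \<times> real \<times> real \<Rightarrow> real \<times> real \<times> real" where
  "binet_inv p = (1 / (1 + fst p), - fst (snd p), lev p)"

lemma binet_binet_inv [simp]: "binet (binet_inv p) = p"
  by (cases p) (simp add: binet_def binet_inv_def)

lemma binet_inv_binet [simp]: "binet_inv (binet p) = p"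
  by (cases p) (simp add: binet_def binet_inv_def)

lemma lev_binet [simp]: "lev (binet p) = lev p" "lev (binet_inv p) = lev p"
  by (simp_all add: binet_def binet_inv_def)

lemma phase_space_iff: "p \<in> phase_space \<longleftrightarrow> 0 < fst p \<and> 0 \<le> lev p"
  by (cases p) (simp add: phase_space_def)

lemma binet_phase_space: "p \<in> phase_space \<longleftrightarrow> binet p \<in> binet_dom \<and> 0 \<le> lev p"
  by (simp add: phase_space_iff binet_dom_def binet_def)

lemma continuous_on_binet: "continuous_on {p. 0 < fst p} binet"
  unfolding binet_def [abs_def] by (intro continuous_intros) auto

lemma continuous_on_binet_inv: "continuous_on binet_dom binet_inv"
  unfolding binet_inv_def [abs_def] by (intro continuous_intros) (auto simp: binet_dom_def)

lemma binet_pushforward: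
  assumes X: "(X has_vector_derivative kepler_drag \<delta> (X t)) (at t within T)" and r: "0 < fst (X t)"
  shows "((\<lambda>t. binet (X t)) has_vector_derivative (1 + fst (binet (X t))) ^ 2 *\<^sub>R fld \<delta> (binet (X t))) (at t within T)"
proof -
  obtain a v l where p: "X t = (a, v, l)" by (cases "X t")
  have a: "0 < a" using r p by simp
  have c: "((\<lambda>t. fst (X t)) has_real_derivative v + 2 * \<delta> * a * l ^ 3) (at t within T)"
    "((\<lambda>t. fst (snd (X t))) has_real_derivative - ((a - 1) / a ^ 3) - 2 * \<delta> * v * l ^ 3) (at t within T)"
    "((\<lambda>t. lev (X t)) has_real_derivative - \<delta> * l ^ 4) (at t within T)"
    using component_derivatives [OF X] by (simp_all add: p kepler_drag_def)
  have "((\<lambda>t. 1 / fst (X t) - 1) has_real_derivative - ((v + 2 * \<delta> * a * l ^ 3) / a\<^sup>2)) (at t within T)"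
    using c(1) a by (auto intro!: derivative_eq_intros simp: p power2_eq_square minus_divide_left)
  moreover have "((\<lambda>t. - fst (snd (X t))) has_real_derivative (a - 1) / a ^ 3 + 2 * \<delta> * v * l ^ 3) (at t within T)"
    using c(2) by (auto intro!: derivative_eq_intros)
  ultimately have "((\<lambda>t. binet (X t)) has_vector_derivative
      (- ((v + 2 * \<delta> * a * l ^ 3) / a\<^sup>2), (a - 1) / a ^ 3 + 2 * \<delta> * v * l ^ 3, - \<delta> * l ^ 4)) (at t within T)"
    unfolding binet_def has_real_derivative_iff_has_vector_derivative
    using c(3) [unfolded has_real_derivative_iff_has_vector_derivative]
    by (intro has_vector_derivative_Pair)
  moreover have "(- ((v + 2 * \<delta> * a * l ^ 3) / a\<^sup>2), (a - 1) / a ^ 3 + 2 * \<delta> * v * l ^ 3, - \<delta> * l ^ 4) =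
      (1 + fst (binet (X t))) ^ 2 *\<^sub>R fld \<delta> (binet (X t))"
    using a by (simp add: p binet_def fld_def field_simps power2_eq_square power3_eq_cube)
  ultimately show ?thesis by simp
qed

lemma binet_inv_pushforward:
  assumes \<xi>: "(\<xi> has_vector_derivative fld \<delta> (\<xi> t)) (at t within T)" and w: "\<xi> t \<in> binet_dom"
  shows "((\<lambda>t. binet_inv (\<xi> t)) has_vector_derivative inverse (1 + fst (\<xi> t)) ^ 2 *\<^sub>R kepler_drag \<delta> (binet_inv (\<xi> t))) (at t within T)"
proof -
  obtain x y l where p: "\<xi> t = (x, y, l)" by (cases "\<xi> t")
  have a: "0 < 1 + x" using w p by (simp add: binet_dom_def)
  have c: "((\<lambda>t. fst (\<xi> t)) has_real_derivative y - 2 * \<delta> * l ^ 3 / (1 + x)) (at t within T)"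
    "((\<lambda>t. fst (snd (\<xi> t))) has_real_derivative - x - 2 * \<delta> * y * l ^ 3 / (1 + x) ^ 2) (at t within T)"
    "((\<lambda>t. lev (\<xi> t)) has_real_derivative - \<delta> * l ^ 4 / (1 + x) ^ 2) (at t within T)"
    using component_derivatives [OF \<xi>] by (simp_all add: p fld_def)
  have "((\<lambda>t. 1 / (1 + fst (\<xi> t))) has_real_derivative - ((y - 2 * \<delta> * l ^ 3 / (1 + x)) / (1 + x)\<^sup>2)) (at t within T)"
    using c(1) a by (auto intro!: derivative_eq_intros simp: p power2_eq_square minus_divide_left)
  moreover have "((\<lambda>t. - fst (snd (\<xi> t))) has_real_derivative x + 2 * \<delta> * y * l ^ 3 / (1 + x) ^ 2) (at t within T)"
    using c(2) by (auto intro!: derivative_eq_intros)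
  ultimately have "((\<lambda>t. binet_inv (\<xi> t)) has_vector_derivative
      (- ((y - 2 * \<delta> * l ^ 3 / (1 + x)) / (1 + x)\<^sup>2), x + 2 * \<delta> * y * l ^ 3 / (1 + x) ^ 2, - \<delta> * l ^ 4 / (1 + x) ^ 2)) (at t within T)"
    unfolding binet_inv_def has_real_derivative_iff_has_vector_derivative
    using c(3) [unfolded has_real_derivative_iff_has_vector_derivative]
    by (intro has_vector_derivative_Pair)
  moreover have "(- ((y - 2 * \<delta> * l ^ 3 / (1 + x)) / (1 + x)\<^sup>2), x + 2 * \<delta> * y * l ^ 3 / (1 + x) ^ 2, - \<delta> * l ^ 4 / (1 + x) ^ 2) =
      inverse (1 + fst (\<xi> t)) ^ 2 *\<^sub>R kepler_drag \<delta> (binet_inv (\<xi> t))"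
  proof -
    define w where "w = 1 + x"
    have w: "0 < w" "x = w - 1" using a by (auto simp: w_def)
    show ?thesis unfolding p binet_inv_def kepler_drag_def w(2) using w(1)
      by (simp add: field_simps power2_eq_square power3_eq_cube)
  qed
  ultimately show ?thesis by simp
qed

lemma \<Gamma>\<^sub>1_iff: "p \<in> \<Gamma>\<^sub>1 h \<longleftrightarrow> 0 < fst p \<and> lev p = 0 \<and> energy (binet p) = h"
proof -
  have "(r - 1)\<^sup>2 / (2 * r\<^sup>2) = (1 / r - 1)\<^sup>2 / 2" if "0 < r" for r :: real
    using that by (simp add: power2_eq_square field_simps)
  then show ?thesis by (cases p) (auto simp: \<Gamma>\<^sub>1_def binet_def energy_def field_simps)
qed

text \<open>Lets the equilibrium be treated as the case h = 0, so that one criterion describes all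
  the stable sets.\<close>

lemma \<Gamma>\<^sub>1_0: "\<Gamma>\<^sub>1 0 = {q\<^sub>1}"
proof -
  have "p \<in> \<Gamma>\<^sub>1 0 \<longleftrightarrow> p = q\<^sub>1" for p
    by (cases p) (auto simp: \<Gamma>\<^sub>1_iff q\<^sub>1_def energy_def binet_def)
  then show ?thesis by blast
qed

lemma continuous_on_energy: "continuous_on S energy"
proof -
  have "continuous_on S (\<lambda>p. (fst p ^ 2 + fst (snd p) ^ 2) / 2)" by (intro continuous_intros) simp
  moreover have "(\<lambda>p. (fst p ^ 2 + fst (snd p) ^ 2) / 2) = energy" by (auto simp: energy_def)
  ultimately show ?thesis by (simp only:)
qed

text \<open>In the new coordinates this is the circle of radius sqrt (2 h). For h < 1/2 it lies
  inside the unit disc, at positive distance from x = - 1, where the coordinates break down.\<close>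

lemma \<Gamma>\<^sub>1_compact:
  assumes h: "0 \<le> h" "h < 1/2"
  shows "compact (\<Gamma>\<^sub>1 h)" "\<Gamma>\<^sub>1 h \<noteq> {}"
proof -
  define \<rho> where "\<rho> = sqrt (2 * h)"
  have \<rho>: "0 \<le> \<rho>" "\<rho> < 1" "\<rho>\<^sup>2 = 2 * h" using h by (auto simp: \<rho>_def)
  define K where "K = {p. norm (plane p) \<le> \<rho> \<and> 0 \<le> lev p \<and> lev p \<le> 0} \<inter> energy -` {h}"
  have "closed (energy -` {h})" by (rule continuous_closed_vimage) (use continuous_on_energy [of UNIV] in \<open>auto simp: continuous_on_eq_continuous_at\<close>)
  then have K: "compact K" unfolding K_def by (rule compact_Int_closed [OF compact_tube])
  have Kd: "K \<subseteq> binet_dom"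
  proof
    fix p assume "p \<in> K"
    then have "norm (plane p) < 1" using \<rho>(2) by (simp add: K_def)
    then have "\<bar>fst p\<bar> < 1" using norm_fst_le [of "fst p" "fst (snd p)"] by simp
    then show "p \<in> binet_dom" by (simp add: binet_dom_def)
  qed
  have "\<Gamma>\<^sub>1 h = binet_inv ` K"
  proof (intro equalityI subsetI)
    fix p assume p: "p \<in> \<Gamma>\<^sub>1 h"
    then have e: "energy (binet p) = h" "lev p = 0" by (auto simp: \<Gamma>\<^sub>1_iff)
    have "norm (plane (binet p)) \<le> \<rho>"
    proof (rule power2_le_imp_le)
      show "(norm (plane (binet p)))\<^sup>2 \<le> \<rho>\<^sup>2" using norm_plane [of "binet p"] e \<rho>(3) by simp
    qed (rule \<rho>(1))
    then have "binet p \<in> K" using e by (simp add: K_def)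
    then have "binet_inv (binet p) \<in> binet_inv ` K" by (rule imageI)
    then show "p \<in> binet_inv ` K" by simp
  next
    fix p assume "p \<in> binet_inv ` K"
    then obtain q where q: "q \<in> K" "p = binet_inv q" by blast
    then have "q \<in> binet_dom" using Kd by blast
    then show "p \<in> \<Gamma>\<^sub>1 h" using q by (simp add: \<Gamma>\<^sub>1_iff K_def) (simp add: binet_inv_def binet_dom_def)
  qed
  moreover have "compact (binet_inv ` K)" by (intro compact_continuous_image K continuous_on_subset [OF continuous_on_binet_inv Kd])
  moreover have "(\<rho>, 0, 0) \<in> K" using \<rho> by (simp add: K_def energy_def)
  ultimately show "compact (\<Gamma>\<^sub>1 h)" "\<Gamma>\<^sub>1 h \<noteq> {}" by auto
qed

section \<open>Stable sets as level sets of the limit energy\<close>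

lemma compact_subset_Box:
  assumes K: "compact K" "K \<subseteq> binet_dom" "K \<subseteq> upper"
  shows "\<exists>C\<ge>1. K \<subseteq> Box C"
proof -
  have c: "continuous_on K (\<lambda>p. inverse (1 + fst p))" using K(2) by (intro continuous_intros) (auto simp: binet_dom_def)
  obtain B1 where B1: "\<And>p. p \<in> K \<Longrightarrow> \<bar>fst p\<bar> \<le> B1" by (rule compact_bound [OF K(1), of fst]) (intro continuous_intros, blast)
  obtain B2 where B2: "\<And>p. p \<in> K \<Longrightarrow> \<bar>fst (snd p)\<bar> \<le> B2" by (rule compact_bound [OF K(1), of "\<lambda>p. fst (snd p)"]) (intro continuous_intros, blast)
  obtain B3 where B3: "\<And>p. p \<in> K \<Longrightarrow> \<bar>lev p\<bar> \<le> B3" by (rule compact_bound [OF K(1), of lev]) (intro continuous_intros, blast)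
  obtain B4 where B4: "\<And>p. p \<in> K \<Longrightarrow> \<bar>inverse (1 + fst p)\<bar> \<le> B4" by (rule compact_bound [OF K(1) c]) blast
  define C where "C = max 1 (max (max B1 B2) (max B3 B4))"
  have C: "1 \<le> C" "B1 \<le> C" "B2 \<le> C" "B3 \<le> C" "B4 \<le> C" by (auto simp: C_def)
  have "p \<in> Box C" if p: "p \<in> K" for p
  proof -
    have w: "0 < 1 + fst p" using K(2) p by (auto simp: binet_dom_def)
    have "inverse (1 + fst p) \<le> C" using B4 [OF p] C(5) by linarith
    then have "1 / C \<le> 1 + fst p" using w C(1) by (simp add: field_simps)
    moreover have "0 \<le> lev p" using K(3) p by blast
    ultimately show ?thesis using B1 [OF p] B2 [OF p] B3 [OF p] C by (cases p) (auto simp: Box_def)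
  qed
  then show ?thesis using C(1) by blast
qed

text \<open>On the compact set where g is at least e, f is nonzero and so has a positive minimum;
  once f is below it, g is below e. This translates between distance to the orbit and the pair of
  energy and level, in both directions.\<close>

lemma tendsto_zero_transfer:
  fixes f g :: "'a::topological_space \<Rightarrow> real"
  assumes K: "compact K" "continuous_on K f" "continuous_on K g" and x: "\<forall>\<^sub>F t in F. x t \<in> K"
    and nonneg: "\<And>q. q \<in> K \<Longrightarrow> 0 \<le> f q" "\<And>q. q \<in> K \<Longrightarrow> 0 \<le> g q"
    and zero: "\<And>q. q \<in> K \<Longrightarrow> f q = 0 \<Longrightarrow> g q = 0" and lim: "((\<lambda>t. f (x t)) \<longlongrightarrow> 0) F"
  shows "((\<lambda>t. g (x t)) \<longlongrightarrow> 0) F"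
proof (rule tendstoI)
  fix e :: real assume e: "0 < e"
  define K' where "K' = K \<inter> {q. e \<le> g q}"
  obtain m where m: "0 < m" "\<And>q. q \<in> K' \<Longrightarrow> m \<le> f q"
  proof (cases "K' = {}")
    case False
    obtain A where A: "closed A" "A \<inter> K = g -` {e..} \<inter> K"
      using K(3) unfolding continuous_on_closed_invariant by (metis closed_atLeast)
    have "K' = K \<inter> A" using A(2) by (auto simp: K'_def)
    then have "compact K'" using compact_Int_closed [OF K(1) A(1)] by simp
    moreover have "continuous_on K' f" using K(2) by (rule continuous_on_subset) (auto simp: K'_def)
    ultimately obtain q where q: "q \<in> K'" "\<And>y. y \<in> K' \<Longrightarrow> f q \<le> f y"
      using continuous_attains_inf [OF _ False] by blast
    have "f q \<noteq> 0" using q(1) zero [of q] e by (auto simp: K'_def)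
    then have "0 < f q" using nonneg(1) [of q] q(1) by (simp add: K'_def less_le)
    then show thesis using that q(2) by blast
  qed (use that [of 1] in auto)
  have "\<forall>\<^sub>F t in F. dist (f (x t)) 0 < m" using lim m(1) by (rule tendstoD)
  with x show "\<forall>\<^sub>F t in F. dist (g (x t)) 0 < e"
  proof eventually_elim
    case (elim t)
    show ?case
    proof (rule ccontr)
      assume "\<not> ?thesis"
      then have "x t \<in> K'" using nonneg(2) [OF elim(1)] elim(1) by (simp add: K'_def dist_real_def)
      from m(2) [OF this] show False using elim(2) by (simp add: dist_real_def)
    qed
  qed
qed

text \<open>Convergence of the distance traps the solution eventually in a compact subset of r > 0.
  Together with the initial arc this gives a box, and with it a rate of time change bounded away
  from 0.\<close>

lemma tends_to_energy_of_stable: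
  assumes h: "0 \<le> h" "h < 1/2" and p: "p \<in> stable_set \<delta> (\<Gamma>\<^sub>1 h)"
  shows "p \<in> phase_space" "tends_to_energy \<delta> (binet p) h"
proof -
  obtain X where X0: "X 0 = p" and X: "\<And>t. 0 \<le> t \<Longrightarrow> X t \<in> phase_space"
    "\<And>t. 0 \<le> t \<Longrightarrow> (X has_vector_derivative kepler_drag \<delta> (X t)) (at t within {0..})"
    and lim: "((\<lambda>t. infdist (X t) (\<Gamma>\<^sub>1 h)) \<longlongrightarrow> 0) at_top"
    using p unfolding stable_set_def by blast
  show "p \<in> phase_space" using X(1) [of 0] X0 by simp
  note G = \<Gamma>\<^sub>1_compact [OF h]
  have pos: "fst (X t) > 0" "0 \<le> lev (X t)" if "0 \<le> t" for t using X(1) [OF that] by (auto simp: phase_space_iff)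
  have cl: "closed {p :: real \<times> real \<times> real. fst p \<le> 0}" by (intro closed_Collect_le continuous_intros)
  have "\<Gamma>\<^sub>1 h \<inter> {p. fst p \<le> 0} = {}" by (auto simp: \<Gamma>\<^sub>1_iff)
  \<comment> \<open>The definition of the stable set measures distance in the whole space. A gap
    between the orbit and r \<le> 0 is needed before nearby points can be expressed in the new
    coordinates.\<close>
  from separate_compact_closed [OF G(1) cl this]
  obtain d where d: "0 < d" "\<And>x y. x \<in> \<Gamma>\<^sub>1 h \<Longrightarrow> fst y \<le> 0 \<Longrightarrow> d \<le> dist x y"
    unfolding Ball_def mem_Collect_eq by blast
  define K where "K = {x. infdist x (\<Gamma>\<^sub>1 h) \<le> d / 2}"
  have K: "compact K" unfolding K_def using d(1) by (intro compact_infdist_le G) simp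
  have Kp: "K \<subseteq> {x. 0 < fst x}"
  proof
    fix x assume x: "x \<in> K"
    obtain y where "y \<in> \<Gamma>\<^sub>1 h" "infdist x (\<Gamma>\<^sub>1 h) = dist x y"
      using infdist_attains_inf [OF compact_imp_closed [OF G(1)] G(2)] by blast
    then show "x \<in> {x. 0 < fst x}" using d(2) [of y x] x d(1) by (auto simp: K_def dist_commute not_le [symmetric])
  qed
  have evK: "\<forall>\<^sub>F t in at_top. X t \<in> K"
  proof -
    have "\<forall>\<^sub>F t in at_top. dist (infdist (X t) (\<Gamma>\<^sub>1 h)) 0 < d / 2" using lim d(1) by (intro tendstoD) auto
    then show ?thesis by eventually_elim (simp add: K_def dist_real_def)
  qed
  have contE: "continuous_on K (\<lambda>x. energy (binet x))"
    by (rule continuous_on_compose2 [OF continuous_on_energy [of UNIV] continuous_on_subset [OF continuous_on_binet Kp]]) simp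
  have "((\<lambda>t. \<bar>energy (binet (X t)) - h\<bar>) \<longlongrightarrow> 0) at_top"
  proof (rule tendsto_zero_transfer [OF K, where f = "\<lambda>x. infdist x (\<Gamma>\<^sub>1 h)" and x = X])
    show "\<bar>energy (binet x) - h\<bar> = 0" if "infdist x (\<Gamma>\<^sub>1 h) = 0" for x
    proof -
      have "x \<in> \<Gamma>\<^sub>1 h" using that in_closed_iff_infdist_zero [OF compact_imp_closed [OF G(1)] G(2)] by simp
      then show ?thesis by (simp add: \<Gamma>\<^sub>1_iff)
    qed
  qed (use evK lim in \<open>auto intro!: continuous_intros contE infdist_nonneg\<close>)
  then have limE: "((\<lambda>t. energy (binet (X t))) \<longlongrightarrow> h) at_top"
    using LIM_zero_cancel [of "\<lambda>t. energy (binet (X t))" h at_top] by (simp add: tendsto_rabs_zero_iff)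
  obtain T where T: "\<And>t. T \<le> t \<Longrightarrow> X t \<in> K" using evK unfolding eventually_at_top_linorder by blast
  have contX: "continuous_on {0..} X" by (rule continuous_on_vector_derivative) (use X(2) in auto)
  \<comment> \<open>The arc up to time T together with the neighbourhood K that contains everything
    later, moved to the new coordinates.\<close>
  define K2 where "K2 = binet ` ((X ` {0..max 0 T} \<union> K) \<inter> {x. 0 \<le> lev x})"
  have sub: "(X ` {0..max 0 T} \<union> K) \<inter> {x. 0 \<le> lev x} \<subseteq> {x. 0 < fst x}" using Kp pos(1) by auto
  have "closed {x :: real \<times> real \<times> real. 0 \<le> lev x}" by (intro closed_Collect_le continuous_intros)
  then have "compact ((X ` {0..max 0 T} \<union> K) \<inter> {x. 0 \<le> lev x})"
    by (intro compact_Int_closed compact_Un compact_continuous_image K compact_Icc continuous_on_subset [OF contX]) auto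
  then have "compact K2" unfolding K2_def
    by (intro compact_continuous_image continuous_on_subset [OF continuous_on_binet sub])
  moreover have "K2 \<subseteq> binet_dom" using sub by (auto simp: K2_def binet_dom_def binet_def)
  moreover have "K2 \<subseteq> upper" by (auto simp: K2_def)
  ultimately obtain C where C: "1 \<le> C" "K2 \<subseteq> Box C" using compact_subset_Box by blast
  have inBox: "binet (X t) \<in> Box C" if t: "0 \<le> t" for t
  proof -
    have "X t \<in> (X ` {0..max 0 T} \<union> K) \<inter> {x. 0 \<le> lev x}" using T [of t] pos(2) [OF t] t by (cases "T \<le> t") auto
    then have "binet (X t) \<in> K2" unfolding K2_def by (rule imageI)
    then show ?thesis using C(2) by blast
  qed
  have "\<exists>\<sigma>. \<sigma> 0 = 0 \<and> (\<forall>s\<ge>0. 0 \<le> \<sigma> s) \<and> filterlim \<sigma> at_top at_top \<and> ode_sol (\<lambda>t. fld \<delta>) (\<lambda>s. binet (X (\<sigma> s)))"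
  proof (rule time_change [where X = "\<lambda>t. binet (X t)" and g = "\<lambda>t. (1 + fst (binet (X t))) ^ 2"])
    show "((\<lambda>t. binet (X t)) has_vector_derivative (1 + fst (binet (X t))) ^ 2 *\<^sub>R fld \<delta> (binet (X t))) (at t within {0..})" if "0 \<le> t" for t
      by (rule binet_pushforward [OF X(2) [OF that] pos(1) [OF that]])
    have "X ` {0..} \<subseteq> {x. 0 < fst x}" by (rule image_subsetI) (simp add: pos(1))
    then have "continuous_on {0..} (\<lambda>t. binet (X t))"
      by (rule continuous_on_compose2 [OF continuous_on_binet contX])
    then show "continuous_on {0..} (\<lambda>t. (1 + fst (binet (X t))) ^ 2)" by (intro continuous_intros)
    show "(1 / C) ^ 2 \<le> (1 + fst (binet (X t))) ^ 2" if "0 \<le> t" for t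
      using inBox [OF that] C(1) by (intro power_mono) (auto simp: Box_def)
    show "0 < (1 / C) ^ 2" using C(1) by simp
  qed
  then obtain \<sigma> where \<sigma>: "\<sigma> 0 = 0" "\<And>s. 0 \<le> s \<Longrightarrow> 0 \<le> \<sigma> s" "filterlim \<sigma> at_top at_top"
    "ode_sol (\<lambda>t. fld \<delta>) (\<lambda>s. binet (X (\<sigma> s)))" by blast
  have "box_sol \<delta> C (\<lambda>s. binet (X (\<sigma> s)))" using \<sigma> inBox by (simp add: box_sol_def)
  moreover have "((\<lambda>s. energy (binet (X (\<sigma> s)))) \<longlongrightarrow> h) at_top" by (rule filterlim_compose [OF limE \<sigma>(3)])
  ultimately show "tends_to_energy \<delta> (binet p) h" unfolding tends_to_energy_def
    using C(1) \<sigma>(1) X0 by (intro exI [of _ "\<lambda>s. binet (X (\<sigma> s))"] exI [of _ C]) simp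
qed

lemma stable_of_tends_to_energy:
  assumes \<delta>: "\<delta> > 0" and h: "0 \<le> h" "h < 1/2" and a: "tends_to_energy \<delta> (binet p) h"
  shows "p \<in> stable_set \<delta> (\<Gamma>\<^sub>1 h)"
proof -
  obtain \<xi> C where \<xi>: "1 \<le> C" "\<xi> 0 = binet p" "box_sol \<delta> C \<xi>" and lim: "((\<lambda>t. energy (\<xi> t)) \<longlongrightarrow> h) at_top"
    using a unfolding tends_to_energy_def by blast
  note G = \<Gamma>\<^sub>1_compact [OF h]
  have binet_dom: "Box C \<subseteq> binet_dom" using Box_subset_binet_dom \<xi>(1) by simp
  have inBox: "\<xi> t \<in> Box C" if "0 \<le> t" for t by (rule box_solD(2) [OF \<xi>(3) that])
  have "\<exists>\<sigma>. \<sigma> 0 = 0 \<and> (\<forall>s\<ge>0. 0 \<le> \<sigma> s) \<and> filterlim \<sigma> at_top at_top \<and> ode_sol (\<lambda>t. kepler_drag \<delta>) (\<lambda>s. binet_inv (\<xi> (\<sigma> s)))"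
  proof (rule time_change [where X = "\<lambda>t. binet_inv (\<xi> t)" and g = "\<lambda>t. inverse (1 + fst (\<xi> t)) ^ 2"])
    show "((\<lambda>t. binet_inv (\<xi> t)) has_vector_derivative inverse (1 + fst (\<xi> t)) ^ 2 *\<^sub>R kepler_drag \<delta> (binet_inv (\<xi> t))) (at t within {0..})" if "0 \<le> t" for t
      by (rule binet_inv_pushforward [OF ode_solD [OF box_solD(1) [OF \<xi>(3)] that]]) (use binet_dom inBox [OF that] in blast)
    show "continuous_on {0..} (\<lambda>t. inverse (1 + fst (\<xi> t)) ^ 2)"
      using binet_dom inBox by (intro continuous_intros ode_sol_continuous_on [OF box_solD(1) [OF \<xi>(3)]]) (fastforce simp: binet_dom_def)
    show "1 / (C + 1) ^ 2 \<le> inverse (1 + fst (\<xi> t)) ^ 2" if "0 \<le> t" for t by (rule Box_D(3) [OF inBox [OF that] \<xi>(1)])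
    show "0 < 1 / (C + 1) ^ 2" using \<xi>(1) by simp
  qed
  then obtain \<sigma> where \<sigma>: "\<sigma> 0 = 0" "\<And>s. 0 \<le> s \<Longrightarrow> 0 \<le> \<sigma> s" "filterlim \<sigma> at_top at_top"
    "ode_sol (\<lambda>t. kepler_drag \<delta>) (\<lambda>s. binet_inv (\<xi> (\<sigma> s)))" by blast
  have "((\<lambda>t. infdist (binet_inv (\<xi> t)) (\<Gamma>\<^sub>1 h)) \<longlongrightarrow> 0) at_top"
  \<comment> \<open>Within the box this f vanishes only at points that correspond to the orbit:
    energy h on the plane l = 0.\<close>
  proof (rule tendsto_zero_transfer [OF Box(1) [of C], where f = "\<lambda>x. \<bar>energy x - h\<bar> + \<bar>lev x\<bar>" and x = \<xi>])
    show "continuous_on (Box C) (\<lambda>x. \<bar>energy x - h\<bar> + \<bar>lev x\<bar>)" by (intro continuous_intros continuous_on_energy)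
    show "continuous_on (Box C) (\<lambda>x. infdist (binet_inv x) (\<Gamma>\<^sub>1 h))"
      by (intro continuous_intros continuous_on_subset [OF continuous_on_binet_inv binet_dom])
    show "\<forall>\<^sub>F t in at_top. \<xi> t \<in> Box C" using inBox by (rule eventually_at_top_linorderI)
    show "infdist (binet_inv x) (\<Gamma>\<^sub>1 h) = 0" if "x \<in> Box C" "\<bar>energy x - h\<bar> + \<bar>lev x\<bar> = 0" for x
    proof -
      have "energy x = h" "lev x = 0" using that(2) by auto
      moreover have "0 < fst (binet_inv x)" using binet_dom that(1) by (auto simp: binet_inv_def binet_dom_def)
      ultimately have "binet_inv x \<in> \<Gamma>\<^sub>1 h" by (simp add: \<Gamma>\<^sub>1_iff)
      then show ?thesis by (rule infdist_zero)
    qed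
    have "((\<lambda>t. \<bar>energy (\<xi> t) - h\<bar> + \<bar>lev (\<xi> t)\<bar>) \<longlongrightarrow> \<bar>h - h\<bar> + \<bar>0\<bar>) at_top"
      by (intro tendsto_intros lim lev_tendsto_0 [OF \<xi>(3) \<delta> \<xi>(1)])
    then show "((\<lambda>t. \<bar>energy (\<xi> t) - h\<bar> + \<bar>lev (\<xi> t)\<bar>) \<longlongrightarrow> 0) at_top" by simp
  qed (auto intro: infdist_nonneg)
  then have "((\<lambda>s. infdist (binet_inv (\<xi> (\<sigma> s))) (\<Gamma>\<^sub>1 h)) \<longlongrightarrow> 0) at_top" by (rule filterlim_compose [OF _ \<sigma>(3)])
  moreover have "binet_inv (\<xi> (\<sigma> s)) \<in> phase_space" if "0 \<le> s" for s
    unfolding binet_phase_space using binet_dom inBox [OF \<sigma>(2) [OF that]] by (auto simp: Box_def)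
  ultimately show ?thesis unfolding stable_set_def
    using \<sigma>(1,4) \<xi>(2) by (intro CollectI exI [of _ "\<lambda>s. binet_inv (\<xi> (\<sigma> s))"]) (simp add: ode_sol_def)
qed

theorem stable_set_iff:
  assumes "\<delta> > 0" "0 \<le> h" "h < 1/2"
  shows "p \<in> stable_set \<delta> (\<Gamma>\<^sub>1 h) \<longleftrightarrow> p \<in> phase_space \<and> tends_to_energy \<delta> (binet p) h"
  using tends_to_energy_of_stable [OF assms(2,3)] stable_of_tends_to_energy [OF assms] by blast

section \<open>Smoothness of the stable manifolds\<close>

lemma box_sol_level_0:
  assumes \<delta>: "\<delta> > 0" and \<xi>: "box_sol \<delta> C \<xi>" "lev (\<xi> 0) = 0" and t: "0 \<le> t"
  shows "energy (\<xi> t) = energy (\<xi> 0)"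
proof -
  note o = box_solD(1) [OF \<xi>(1)]
  have l0: "lev (\<xi> s) = 0" if "0 \<le> s" for s
    using lev_antimono [OF \<xi>(1) \<delta> order_refl that] box_solD(2) [OF \<xi>(1) that] \<xi>(2) by (auto simp: Box_def)
  have en: "energy p = (fst p ^ 2 + fst (snd p) ^ 2) / 2" for p by (cases p) (simp add: energy_def)
  have d: "((\<lambda>t. energy (\<xi> t)) has_real_derivative 0) (at s within {0..})" if "0 \<le> s" for s
    unfolding en using component_derivatives(1,2) [OF ode_solD [OF o that]] l0 [OF that]
    by (auto intro!: derivative_eq_intros simp: fld_alt)
  have "energy (\<xi> t) \<le> energy (\<xi> 0)"
    by (rule halfline_nonincreasing [where g = "\<lambda>t. energy (\<xi> t)" and g' = "\<lambda>_. 0" and T = t]) (use d t in auto)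
  moreover have "- energy (\<xi> t) \<le> - energy (\<xi> 0)"
    by (rule halfline_nonincreasing [where g = "\<lambda>t. - energy (\<xi> t)" and g' = "\<lambda>_. 0" and T = t])
      (use DERIV_minus [OF d] t in auto)
  ultimately show ?thesis by simp
qed

lemma tends_to_energy_level_0D:
  assumes \<delta>: "\<delta> > 0" and p: "tends_to_energy \<delta> p h" "lev p = 0"
  shows "energy p = h"
proof -
  obtain \<xi> C where \<xi>: "\<xi> 0 = p" "box_sol \<delta> C \<xi>" and lim: "((\<lambda>t. energy (\<xi> t)) \<longlongrightarrow> h) at_top"
    using p(1) unfolding tends_to_energy_def by blast
  have "\<forall>\<^sub>F t in at_top. energy p = energy (\<xi> t)"
    by (rule eventually_at_top_linorderI [of 0]) (use box_sol_level_0 [OF \<delta> \<xi>(2)] \<xi>(1) p(2) in simp)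
  then have "((\<lambda>t. energy (\<xi> t)) \<longlongrightarrow> energy p) at_top" by (rule tendsto_eventually [THEN tendsto_cong [THEN iffD1, rotated], rotated]) simp
  then show ?thesis using lim tendsto_unique [OF trivial_limit_at_top_linorder] by blast
qed

lemma straightens_within:
  assumes "straightens R p" "open W" "p \<in> W"
  shows "straightens (\<lambda>x y. R x y \<and> x \<in> W) p"
proof -
  obtain S f D where S: "open S" "p \<in> S" and f: "smooth_on (S \<inter> upper) f" "(f has_derivative D) (at p within S \<inter> upper)" "inj D"
    and R: "\<forall>x\<in>S \<inter> upper. 0 \<le> lev (f x) \<and> (lev (f x) = 0 \<longleftrightarrow> lev x = 0) \<and> R x (f x)"
    using assms(1) unfolding straightens_def by blast
  have sub: "(S \<inter> W) \<inter> upper \<subseteq> S \<inter> upper" by blast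
  show ?thesis
    unfolding straightens_def
  proof (intro exI conjI)
    show "open (S \<inter> W)" "p \<in> S \<inter> W" using S assms by auto
    show "smooth_on ((S \<inter> W) \<inter> upper) f" by (rule smooth_on_subset [OF f(1) sub])
    show "(f has_derivative D) (at p within (S \<inter> W) \<inter> upper)" by (rule has_derivative_subset [OF f(2) sub])
    show "\<forall>x\<in>(S \<inter> W) \<inter> upper. 0 \<le> lev (f x) \<and> (lev (f x) = 0 \<longleftrightarrow> lev x = 0) \<and> R x (f x) \<and> x \<in> W" using R by blast
  qed (rule f(3))
qed

lemma smooth_on_binet_inv: "smooth_on binet_dom binet_inv"
  unfolding binet_inv_def [abs_def] by (intro smooth_intros) (auto simp: binet_dom_def)

lemma binet_inv_has_derivative:
  assumes "x \<in> binet_dom"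
  shows "\<exists>D. (binet_inv has_derivative D) (at x) \<and> inj D"
proof -
  have w: "0 < 1 + fst x" using assms by (simp add: binet_dom_def)
  define D where "D = (\<lambda>v :: real \<times> real \<times> real. (- (fst v / (1 + fst x)\<^sup>2), - fst (snd v), lev v))"
  have D: "(binet_inv has_derivative D) (at x)"
    unfolding binet_inv_def [abs_def] D_def
    using w by (intro has_derivative_Pair) (auto intro!: derivative_eq_intros simp: power2_eq_square)
  moreover have "inj D"
    unfolding D_def using w by (intro injI) (auto simp: prod_eq_iff)
  ultimately show ?thesis by blast
qed

text \<open>Common last step for curve and surfaces: in a straightening chart the stable set is the
  image of an affine slice j with continuous left inverse k. The parametrization is j followed by
  the inverse chart and the return to the original coordinates.\<close>

lemma slice_parametrization:
  fixes j :: "'a::euclidean_space \<Rightarrow> real \<times> real \<times> real"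
  assumes U: "U \<inter> upper \<subseteq> binet_dom" and homeo: "homeomorphism (U \<inter> upper) (V \<inter> upper) f \<psi>"
    and \<psi>: "smooth_on (V \<inter> upper) \<psi>"
      "\<And>y. y \<in> V \<inter> upper \<Longrightarrow> (\<psi> has_derivative \<psi>' y) (at y within V \<inter> upper) \<and> inj (\<psi>' y)"
    and lev: "\<And>x. x \<in> U \<inter> upper \<Longrightarrow> lev (f x) = 0 \<longleftrightarrow> lev x = 0"
    and b: "b \<in> Basis" "open N"
    and j: "smooth_on UNIV j" "\<And>x. (j has_derivative J) (at x)" "inj J" "\<And>x. lev (j x) = x \<bullet> b"
      "\<And>x. x \<in> N \<inter> halfspace b \<Longrightarrow> j x \<in> V"
    and k: "continuous_on UNIV k" "\<And>x. k (j x) = x"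
    and T: "T = {p \<in> phase_space. binet p \<in> U \<and> f (binet p) \<in> j ` (N \<inter> halfspace b)}"
  shows "smooth_parametrization phase_boundary T b N (\<lambda>x. binet_inv (\<psi> (j x)))"
  unfolding smooth_parametrization_def
proof (intro conjI ballI b)
  define Q where "Q = N \<inter> halfspace b"
  have jQ: "j x \<in> V \<inter> upper" if "x \<in> Q" for x
    using that j(4,5) [of x] by (simp add: Q_def halfspace_def)
  then have jim: "j ` Q \<subseteq> V \<inter> upper" by blast
  have \<psi>U: "\<psi> y \<in> U \<inter> upper" "f (\<psi> y) = y" if "y \<in> V \<inter> upper" for y
    using homeomorphism_image2 [OF homeo] homeomorphism_apply2 [OF homeo that] that by blast+
  have \<psi>binet_dom: "\<psi> ` (V \<inter> upper) \<subseteq> binet_dom" using \<psi>U(1) U by blast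
  have sj: "smooth_on Q j" using smooth_on_subset [OF j(1)] by blast
  have s1: "smooth_on Q (\<lambda>x. \<psi> (j x))" by (rule smooth_on_compose [OF sj \<psi>(1) jim])
  have im1: "(\<lambda>x. \<psi> (j x)) ` Q \<subseteq> binet_dom" using jim \<psi>binet_dom by blast
  have s2: "smooth_on Q (\<lambda>x. binet_inv (\<psi> (j x)))" by (rule smooth_on_compose [OF s1 smooth_on_binet_inv im1])
  then show "smooth_on (N \<inter> halfspace b) (\<lambda>x. binet_inv (\<psi> (j x)))" by (simp add: Q_def)
  show "\<exists>D. ((\<lambda>x. binet_inv (\<psi> (j x))) has_derivative D) (at x within N \<inter> halfspace b) \<and> inj D"
    if "x \<in> N \<inter> halfspace b" for x
  proof -
    have x: "x \<in> Q" using that by (simp add: Q_def)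
    have "\<psi> (j x) \<in> binet_dom" using im1 x by blast
    then obtain D where D: "(binet_inv has_derivative D) (at (\<psi> (j x)))" "inj D" using binet_inv_has_derivative by blast
    note p = \<psi>(2) [OF jQ [OF x]]
    have "((\<lambda>x. \<psi> (j x)) has_derivative (\<lambda>w. \<psi>' (j x) (J w))) (at x within Q)"
      by (rule has_derivative_in_compose [OF has_derivative_at_withinI [OF j(2)] has_derivative_subset [OF conjunct1 [OF p] jim]])
    then have "((\<lambda>x. binet_inv (\<psi> (j x))) has_derivative (\<lambda>w. D (\<psi>' (j x) (J w)))) (at x within Q)"
      by (rule has_derivative_compose [where f = "\<lambda>x. \<psi> (j x)" and g = binet_inv]) (rule D(1))
    moreover have "inj (\<lambda>w. D (\<psi>' (j x) (J w)))"
      using inj_compose [OF D(2) inj_compose [OF conjunct2 [OF p] j(3)]] by (simp add: o_def)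
    ultimately show ?thesis by (auto simp: Q_def)
  qed
  show "\<exists>\<psi>'. homeomorphism (N \<inter> halfspace b) T (\<lambda>x. binet_inv (\<psi> (j x))) \<psi>'"
  proof (intro exI [of _ "\<lambda>p. k (f (binet p))"] homeomorphismI)
    show "continuous_on (N \<inter> halfspace b) (\<lambda>x. binet_inv (\<psi> (j x)))" using smooth_on_imp_continuous_on [OF s2] by (simp add: Q_def)
    have "continuous_on T binet" by (rule continuous_on_subset [OF continuous_on_binet]) (auto simp: T phase_space_iff)
    moreover have "binet ` T \<subseteq> U \<inter> upper" by (rule image_subsetI) (simp add: T phase_space_iff)
    ultimately have "continuous_on T (\<lambda>p. f (binet p))"
      using continuous_on_compose2 [OF homeomorphism_cont1 [OF homeo]] by blast
    then show "continuous_on T (\<lambda>p. k (f (binet p)))" by (rule continuous_on_compose2 [OF k(1)]) simp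
    show "(\<lambda>x. binet_inv (\<psi> (j x))) ` (N \<inter> halfspace b) \<subseteq> T"
    proof (rule image_subsetI)
      fix x assume "x \<in> N \<inter> halfspace b"
      then have x: "x \<in> Q" by (simp add: Q_def)
      note u = \<psi>U [OF jQ [OF x]]
      have "\<psi> (j x) \<in> binet_dom" using u(1) U by blast
      then show "binet_inv (\<psi> (j x)) \<in> T"
        using u x unfolding T binet_phase_space mem_Collect_eq binet_binet_inv lev_binet Q_def by simp
    qed
    show "(\<lambda>p. k (f (binet p))) ` T \<subseteq> N \<inter> halfspace b" by (rule image_subsetI) (auto simp: T k(2))
    show "k (f (binet (binet_inv (\<psi> (j x))))) = x" if "x \<in> N \<inter> halfspace b" for x
      using \<psi>U(2) [OF jQ] that by (simp add: Q_def k(2))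
    show "binet_inv (\<psi> (j (k (f (binet p))))) = p" if pT: "p \<in> T" for p
    proof -
      obtain x where x: "f (binet p) = j x" using pT unfolding T by blast
      have "binet p \<in> U \<inter> upper" using pT by (simp add: T phase_space_iff)
      then have "\<psi> (f (binet p)) = binet p" by (rule homeomorphism_apply1 [OF homeo])
      then show ?thesis by (simp add: x k(2))
    qed
  qed
  show "binet_inv (\<psi> (j x)) \<in> phase_boundary \<longleftrightarrow> x \<bullet> b = 0" if "x \<in> N \<inter> halfspace b" for x
  proof -
    have x: "x \<in> Q" using that by (simp add: Q_def)
    note u = \<psi>U [OF jQ [OF x]]
    have "\<psi> (j x) \<in> binet_dom" using u(1) U by blast
    then have "0 < fst (binet_inv (\<psi> (j x)))" by (simp add: binet_inv_def binet_dom_def)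
    moreover have "p \<in> phase_boundary \<longleftrightarrow> 0 < fst p \<and> lev p = 0" for p by (cases p) (simp add: phase_boundary_def)
    ultimately show ?thesis using lev [OF u(1)] u(2) j(4) [of x] by simp
  qed
qed

lemma open_binet_vimage:
  assumes "open A"
  shows "open ({p. 0 < fst p} \<inter> binet -` A)"
  by (rule continuous_open_preimage [OF continuous_on_binet _ assms]) (intro open_Collect_less continuous_intros)

lemma smooth_family_imp_submanifold:
  fixes M :: "real \<Rightarrow> 'b::euclidean_space set"
  assumes "smooth_family TYPE('a::euclidean_space) B J M" "h \<in> J"
  shows "smooth_submanifold TYPE('a) B (M h)"
  unfolding smooth_submanifold_def
proof
  fix p assume "p \<in> M h"
  from assms(1) [unfolded smooth_family_def, THEN bspec, OF assms(2), THEN bspec, OF this]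
  obtain I U b V and \<Phi> :: "real \<times> 'a \<Rightarrow> 'b" where "h \<in> I" "open U" "p \<in> U"
    "\<forall>h\<in>I. smooth_parametrization B (M h \<inter> U) b V (\<lambda>x. \<Phi> (h, x))"
    by (elim exE conjE)
  then show "\<exists>U b V (\<phi> :: 'a \<Rightarrow> 'b). open U \<and> p \<in> U \<and> smooth_parametrization B (M h \<inter> U) b V \<phi>"
    by (intro exI [of _ U] exI [of _ b] exI [of _ V] exI [of _ "\<lambda>x. \<Phi> (h, x)"]) simp
qed

text \<open>Here the limit energy is itself a coordinate, so the stable sets for different h are
  parallel slices of one chart, and h enters as one of its smooth coordinates.\<close>

lemma stable_family:
  assumes \<delta>: "\<delta> > 0"
  shows "smooth_family TYPE(real \<times> real) phase_boundary {0<..<1/2} (\<lambda>h. stable_set \<delta> (\<Gamma>\<^sub>1 h))"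
  unfolding smooth_family_def
proof (intro ballI)
  fix h0 p assume h0: "h0 \<in> {0<..<1/2 :: real}" and p: "p \<in> stable_set \<delta> (\<Gamma>\<^sub>1 h0)"
  have M: "q \<in> stable_set \<delta> (\<Gamma>\<^sub>1 h) \<longleftrightarrow> q \<in> phase_space \<and> tends_to_energy \<delta> (binet q) h" if "h \<in> {0<..<1/2}" for h q
    by (rule stable_set_iff [OF \<delta>]) (use that in auto)
  have ps: "p \<in> phase_space" and as: "tends_to_energy \<delta> (binet p) h0" using p M [OF h0] by auto
  define R where "R x y \<longleftrightarrow> (\<forall>h. tends_to_energy \<delta> x h \<longleftrightarrow> fst y = h)" for x y :: "real \<times> real \<times> real"
  have "straightens R (binet p)"
  proof (cases "lev (binet p) = 0")
    case True
    have "energy (binet p) = h0" by (rule tends_to_energy_level_0D [OF \<delta> as True])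
    then show ?thesis using straightens_circle [OF \<delta> True] h0 by (simp add: R_def [abs_def])
  next
    case False
    show ?thesis
    proof (rule straightens_interior [OF \<delta> _ as])
      show "0 < lev (binet p)" using False ps by (simp add: phase_space_iff)
      show "straightens R q" if "lev q = 0" "energy q = h0" for q
        using straightens_circle [OF \<delta> that(1)] that(2) h0 by (simp add: R_def [abs_def])
      show "R x y" if "\<forall>h. tends_to_energy \<delta> x h \<longleftrightarrow> tends_to_energy \<delta> q h" "R q y" for x q y
        unfolding R_def by (simp add: that(1) that(2) [unfolded R_def])
    qed (use h0 in simp)
  qed
  then have "straightens (\<lambda>x y. R x y \<and> x \<in> binet_dom) (binet p)"
    by (rule straightens_within [OF _ open_binet_dom]) (use ps binet_phase_space in blast)
  moreover have "0 \<le> lev (binet p)" using ps by (simp add: phase_space_iff)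
  note straightens_chart [OF calculation this]
  then obtain U f V \<psi> \<psi>' where
    U: "open U" "binet p \<in> U" and V: "open V" and homeo: "homeomorphism (U \<inter> upper) (V \<inter> upper) f \<psi>"
    and \<psi>: "smooth_on (V \<inter> upper) \<psi>"
    and d\<psi>: "\<forall>y\<in>V \<inter> upper. (\<psi> has_derivative \<psi>' y) (at y within V \<inter> upper) \<and> inj (\<psi>' y)"
    and fU: "\<forall>x\<in>U \<inter> upper. 0 \<le> lev (f x) \<and> (lev (f x) = 0 \<longleftrightarrow> lev x = 0) \<and> R x (f x) \<and> x \<in> binet_dom"
    by (elim exE conjE)
  note f = fU [THEN bspec]
  have pU: "binet p \<in> U \<inter> upper" using U(2) ps by (simp add: phase_space_iff)
  have "f (binet p) \<in> V \<inter> upper" using homeomorphism_image1 [OF homeo] pU by blast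
  \<comment> \<open>A product neighbourhood allows the same parameter domain N for all h near
    \<open>h0\<close>.\<close>
  then obtain I0 N where N: "open I0" "open N" "f (binet p) \<in> I0 \<times> N" "I0 \<times> N \<subseteq> V"
    using open_prod_elim [OF V] by blast
  define I where "I = I0 \<inter> {0<..<1/2}"
  have fh: "fst (f (binet p)) = h0" using f [OF pU] as by (simp add: R_def)
  define b :: "real \<times> real" where "b = (0, 1)"
  have b: "b \<in> Basis" by (simp add: b_def Basis_prod_def)
  have hs: "x \<in> halfspace b \<longleftrightarrow> 0 \<le> snd x" for x by (cases x) (simp add: halfspace_def b_def)
  \<comment> \<open>Points of U whose coordinates leave the product must be excluded, since the
    parametrizations have to cover the whole stable set in the chosen neighbourhood.\<close>
  obtain A where A: "open A" "A \<inter> (U \<inter> upper) = f -` (I \<times> N) \<inter> (U \<inter> upper)"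
    using homeomorphism_cont1 [OF homeo] open_Times [of I N] N(1,2)
    unfolding continuous_on_open_invariant I_def by (meson open_Int open_greaterThanLessThan)
  define U' where "U' = {p. 0 < fst p} \<inter> binet -` (A \<inter> U)"
  define \<Phi> where "\<Phi> = (\<lambda>x. binet_inv (\<psi> x))"
  have IN: "I \<times> (N \<inter> halfspace b) \<subseteq> V \<inter> upper"
    using N(4) hs by (auto simp: I_def)
  have "smooth_on (I \<times> (N \<inter> halfspace b)) \<Phi>"
  proof -
    have s: "smooth_on (I \<times> (N \<inter> halfspace b)) \<psi>" by (rule smooth_on_subset [OF \<psi> IN])
    have "\<psi> ` (I \<times> (N \<inter> halfspace b)) \<subseteq> binet_dom"
    proof (rule image_subsetI)
      fix x assume "x \<in> I \<times> (N \<inter> halfspace b)"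
      then have "\<psi> x \<in> U \<inter> upper" using IN homeomorphism_image2 [OF homeo] by blast
      then show "\<psi> x \<in> binet_dom" using f by blast
    qed
    then show ?thesis unfolding \<Phi>_def by (rule smooth_on_compose [OF s smooth_on_binet_inv])
  qed
  moreover have "smooth_parametrization phase_boundary (stable_set \<delta> (\<Gamma>\<^sub>1 h) \<inter> U') b N (\<lambda>x. \<Phi> (h, x))" if h: "h \<in> I" for h
    unfolding \<Phi>_def
  proof (rule slice_parametrization [OF _ homeo \<psi> d\<psi> [THEN bspec] _ b N(2), where J = "\<lambda>x. (0, x)" and k = snd])
    show "U \<inter> upper \<subseteq> binet_dom" using f by blast
    show "lev (f x) = 0 \<longleftrightarrow> lev x = 0" if "x \<in> U \<inter> upper" for x using f [OF that] by blast
    show "smooth_on UNIV (\<lambda>x. (h, x))" by (intro smooth_intros)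
    show "((\<lambda>x. (h, x)) has_derivative (\<lambda>x. (0, x))) (at x)" for x by (intro has_derivative_Pair has_derivative_const has_derivative_ident)
    show "inj (\<lambda>x. (0 :: real, x :: real \<times> real))" by (rule injI) simp
    show "lev (h, x) = x \<bullet> b" for x by (cases x) (simp add: b_def)
    show "(h, x) \<in> V" if "x \<in> N \<inter> halfspace b" for x using IN h that by blast
    show "continuous_on UNIV snd" by (intro continuous_intros)
    have hJ: "h \<in> {0<..<1/2}" using h by (simp add: I_def)
    have "q \<in> stable_set \<delta> (\<Gamma>\<^sub>1 h) \<and> q \<in> U' \<longleftrightarrow> q \<in> phase_space \<and> binet q \<in> U \<and> f (binet q) \<in> (\<lambda>x. (h, x)) ` (N \<inter> halfspace b)" for q
    proof (cases "q \<in> phase_space \<and> binet q \<in> U")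
      case True
      then have qU: "binet q \<in> U \<inter> upper" by (simp add: phase_space_iff)
      have in_M: "q \<in> stable_set \<delta> (\<Gamma>\<^sub>1 h) \<longleftrightarrow> fst (f (binet q)) = h" using M [OF hJ] True f [OF qU] by (simp add: R_def)
      have "binet q \<in> A \<longleftrightarrow> f (binet q) \<in> I \<times> N" using A(2) qU by blast
      then have in_U': "q \<in> U' \<longleftrightarrow> f (binet q) \<in> I \<times> N" using True by (simp add: U'_def phase_space_iff)
      have "fst (f (binet q)) = h \<and> f (binet q) \<in> I \<times> N \<longleftrightarrow> f (binet q) \<in> (\<lambda>x. (h, x)) ` (N \<inter> halfspace b)"
        using f [OF qU] h hs by (cases "f (binet q)") auto
      then show ?thesis by (simp only: in_M in_U' True simp_thms)
    next
      case False
      then show ?thesis using M [OF hJ, of q] by (simp add: U'_def) blast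
    qed
    then show "stable_set \<delta> (\<Gamma>\<^sub>1 h) \<inter> U' = {q \<in> phase_space. binet q \<in> U \<and> f (binet q) \<in> (\<lambda>x. (h, x)) ` (N \<inter> halfspace b)}" by blast
  qed (assumption, rule snd_conv)
  moreover have "open I" "I \<subseteq> {0<..<1/2}" using N(1) by (auto simp: I_def)
  moreover have "h0 \<in> I" using N(3) h0 fh by (cases "f (binet p)") (simp add: I_def)
  moreover have "open U'" unfolding U'_def by (intro open_binet_vimage open_Int A U)
  moreover have "p \<in> U'"
  proof -
    have "f (binet p) \<in> I \<times> N" using N(3) \<open>h0 \<in> I\<close> fh by (cases "f (binet p)") simp
    then have "binet p \<in> A" using A(2) pU by blast
    then show ?thesis using U(2) ps by (simp add: U'_def phase_space_iff)
  qed
  ultimately show "\<exists>I U b V (\<Phi> :: real \<times> real \<times> real \<Rightarrow> real \<times> real \<times> real). open I \<and> h0 \<in> I \<and> I \<subseteq> {0<..<1/2} \<and> open U \<and> p \<in> U \<and>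
      smooth_on (I \<times> (V \<inter> halfspace b)) \<Phi> \<and>
      (\<forall>h\<in>I. smooth_parametrization phase_boundary (stable_set \<delta> (\<Gamma>\<^sub>1 h) \<inter> U) b V (\<lambda>x. \<Phi> (h, x)))"
    by (intro exI [of _ I] exI [of _ U'] exI [of _ b] exI [of _ N] exI [of _ \<Phi>]) simp
qed

text \<open>In the chart at the equilibrium, transported by the flow where l > 0, membership means
  that both planar coordinates vanish, so l alone parametrizes the stable set.\<close>

lemma stable_curve:
  assumes \<delta>: "\<delta> > 0"
  shows "smooth_submanifold TYPE(real) phase_boundary (stable_set \<delta> {q\<^sub>1})"
  unfolding smooth_submanifold_def
proof
  fix p assume p: "p \<in> stable_set \<delta> {q\<^sub>1}"
  have M: "q \<in> stable_set \<delta> {q\<^sub>1} \<longleftrightarrow> q \<in> phase_space \<and> tends_to_energy \<delta> (binet q) 0" for q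
    unfolding \<Gamma>\<^sub>1_0 [symmetric] by (rule stable_set_iff [OF \<delta>]) auto
  have ps: "p \<in> phase_space" and as: "tends_to_energy \<delta> (binet p) 0" using p M by auto
  define R where "R x y \<longleftrightarrow> (tends_to_energy \<delta> x 0 \<longleftrightarrow> plane y = 0)" for x y :: "real \<times> real \<times> real"
  have zero: "q = 0" if "lev q = 0" "energy q = 0" for q using that by (cases q) (simp add: energy_def zero_prod_def)
  have R0: "straightens R 0" using straightens_origin [OF \<delta>] by (simp add: R_def [abs_def])
  have "straightens R (binet p)"
  proof (cases "lev (binet p) = 0")
    case True
    then have "binet p = 0" using zero tends_to_energy_level_0D [OF \<delta> as] by blast
    then show ?thesis using R0 by simp
  next
    case False
    show ?thesis
    proof (rule straightens_interior [OF \<delta> _ as])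
      show "0 < lev (binet p)" using False ps by (simp add: phase_space_iff)
      show "straightens R q" if "lev q = 0" "energy q = 0" for q using zero [OF that] R0 by simp
      show "R x y" if "\<forall>h. tends_to_energy \<delta> x h \<longleftrightarrow> tends_to_energy \<delta> q h" "R q y" for x q y
        unfolding R_def by (simp add: that(1) that(2) [unfolded R_def])
    qed simp
  qed
  then have "straightens (\<lambda>x y. R x y \<and> x \<in> binet_dom) (binet p)"
    by (rule straightens_within [OF _ open_binet_dom]) (use ps binet_phase_space in blast)
  moreover have "0 \<le> lev (binet p)" using ps by (simp add: phase_space_iff)
  note straightens_chart [OF calculation this]
  then obtain U f V \<psi> \<psi>' where
    U: "open U" "binet p \<in> U" and V: "open V" and homeo: "homeomorphism (U \<inter> upper) (V \<inter> upper) f \<psi>"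
    and \<psi>: "smooth_on (V \<inter> upper) \<psi>"
    and d\<psi>: "\<forall>y\<in>V \<inter> upper. (\<psi> has_derivative \<psi>' y) (at y within V \<inter> upper) \<and> inj (\<psi>' y)"
    and fU: "\<forall>x\<in>U \<inter> upper. 0 \<le> lev (f x) \<and> (lev (f x) = 0 \<longleftrightarrow> lev x = 0) \<and> R x (f x) \<and> x \<in> binet_dom"
    by (elim exE conjE)
  note f = fU [THEN bspec]
  define N where "N = (\<lambda>l :: real. (0 :: real, 0 :: real, l)) -` V"
  have N: "open N" unfolding N_def by (rule open_vimage [OF V]) (intro continuous_intros)
  have b: "(1 :: real) \<in> Basis" by simp
  have hs: "l \<in> halfspace (1 :: real) \<longleftrightarrow> 0 \<le> l" for l by (simp add: halfspace_def)
  define U' where "U' = {p. 0 < fst p} \<inter> binet -` U"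
  have "smooth_parametrization phase_boundary (stable_set \<delta> {q\<^sub>1} \<inter> U') 1 N (\<lambda>l. binet_inv (\<psi> (0, 0, l)))"
  proof (rule slice_parametrization [OF _ homeo \<psi> d\<psi> [THEN bspec] _ b N, where J = "\<lambda>l. (0, 0, l)" and k = lev])
    show "U \<inter> upper \<subseteq> binet_dom" using f by blast
    show "lev (f x) = 0 \<longleftrightarrow> lev x = 0" if "x \<in> U \<inter> upper" for x using f [OF that] by blast
    show "smooth_on UNIV (\<lambda>l. (0, 0, l))" by (intro smooth_intros)
    show "((\<lambda>l. (0, 0, l)) has_derivative (\<lambda>l. (0, 0, l))) (at l)" for l :: real
      by (intro has_derivative_Pair has_derivative_const has_derivative_ident)
    show "inj (\<lambda>l. (0 :: real, 0 :: real, l :: real))" by (rule injI) simp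
    show "(0, 0, l) \<in> V" if "l \<in> N \<inter> halfspace 1" for l using that by (simp add: N_def)
    show "continuous_on UNIV lev" by (intro continuous_intros)
    have "q \<in> stable_set \<delta> {q\<^sub>1} \<and> q \<in> U' \<longleftrightarrow> q \<in> phase_space \<and> binet q \<in> U \<and> f (binet q) \<in> (\<lambda>l. (0, 0, l)) ` (N \<inter> halfspace 1)" for q
    proof (cases "q \<in> phase_space \<and> binet q \<in> U")
      case True
      then have qU: "binet q \<in> U \<inter> upper" by (simp add: phase_space_iff)
      have "f (binet q) \<in> V \<inter> upper" using homeomorphism_image1 [OF homeo] qU by blast
      then have "plane (f (binet q)) = 0 \<longleftrightarrow> f (binet q) \<in> (\<lambda>l. (0, 0, l)) ` (N \<inter> halfspace 1)"
        by (cases "f (binet q)") (auto simp: N_def hs zero_prod_def)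
      moreover have "q \<in> stable_set \<delta> {q\<^sub>1} \<longleftrightarrow> plane (f (binet q)) = 0" using M True f [OF qU] by (simp add: R_def)
      moreover have "q \<in> U'" using True by (simp add: U'_def phase_space_iff)
      ultimately show ?thesis using True by blast
    next
      case False
      then show ?thesis using M [of q] by (simp add: U'_def) blast
    qed
    then show "stable_set \<delta> {q\<^sub>1} \<inter> U' = {q \<in> phase_space. binet q \<in> U \<and> f (binet q) \<in> (\<lambda>l. (0, 0, l)) ` (N \<inter> halfspace 1)}" by blast
  qed simp_all
  moreover have "open U'" unfolding U'_def by (intro open_binet_vimage U)
  moreover have "p \<in> U'" using U(2) ps by (simp add: U'_def phase_space_iff)
  ultimately show "\<exists>U b V (\<phi> :: real \<Rightarrow> real \<times> real \<times> real). open U \<and> p \<in> U \<and>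
      smooth_parametrization phase_boundary (stable_set \<delta> {q\<^sub>1} \<inter> U) b V \<phi>"
    by (intro exI [of _ U'] exI [of _ 1] exI [of _ N] exI [of _ "\<lambda>l. binet_inv (\<psi> (0, 0, l))"]) simp
qed

theorem theorem2p8:
  fixes \<delta> :: real
  assumes "\<delta> > 0"
  shows "smooth_submanifold TYPE(real) phase_boundary (stable_set \<delta> {q\<^sub>1}) \<and>
         (\<forall>h\<in>{0<..<1/2}.
            smooth_submanifold TYPE(real \<times> real) phase_boundary (stable_set \<delta> (\<Gamma>\<^sub>1 h))) \<and>
         smooth_family TYPE(real \<times> real) phase_boundary {0<..<1/2} (\<lambda>h. stable_set \<delta> (\<Gamma>\<^sub>1 h))"
  using stable_curve [OF assms] stable_family [OF assms] smooth_family_imp_submanifold by blast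

end
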